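(* Let $b$ be a prime. Every regular polyhedron with $b$ vertices is flat and is (up to isomorphism) one of the following, each described by its automorphism group as a quotient of the string Coxeter group $[p,q]$ of its type: (1) $b=2$: the polyhedron of type $\{2,q\}$ with group $[2,q]$, for any $2\leq q\leq\infty$; (2) $b=3$: the polyhedron of type $\{3,4\}$ with group $[3,4]/\langle\langle(\rho_0\rho_1\rho_2)^3\rangle\rangle$ (the hemi-octahedron); (3) $b$ odd: the polyhedron of type $\{b,2\}$ with group $[b,2]$; (4) $b$ odd: the polyhedron of type $\{b,2b\}$ with group $[b,2b]$ subject to the extra relation $\sigma_2^{-1}\sigma_1=\sigma_1^{-1}\sigma_2^{-3}$. In particular, for each prime $b\geq 5$, there are, up to isomorphism, exactly two regular polyhedra with $b$ vertices.
   Context: An abstract regular polyhedron has flag-transitive automorphism group generated by distinguished involutions $\rho_0,\rho_1,\rho_2$ ($\rho_i$ changes only the rank-$i$ face of a base flag); it has type $\{p,q\}$ when $\rho_0\rho_1$ has order $p$ and $\rho_1\rho_2$ has order $q$, and then its automorphism group is a quotient of the string Coxeter group $[p,q]=\langle\rho_0,\rho_1,\rho_2\mid \rho_i^2=(\rho_0\rho_1)^p=(\rho_1\rho_2)^q=(\rho_0\rho_2)^2=1\rangle$. Here $\sigma_1=\rho_0\rho_1$ and $\sigma_2=\rho_1\rho_2$. Flat means every facet is incident to every vertex. *)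

theory Defs
  imports
    "HOL-Algebra.Bij"
    "HOL-Algebra.Generated_Groups"
    "HOL-Algebra.Multiplicative_Group"
    "HOL-Library.Extended_Nat"
    "HOL-Computational_Algebra.Primes"
begin

section \<open>Abstract regular polyhedra\<close>

text \<open>A poset is given by its reflexive order relation \<open>r\<close>; its faces are the elements of
  \<open>Field r\<close>, including the improper least and greatest faces.\<close>

definition flags :: "'a rel \<Rightarrow> 'a set set" where
  "flags r = {\<Phi> \<in> Chains r. \<forall>\<Psi> \<in> Chains r. \<Phi> \<subseteq> \<Psi> \<longrightarrow> \<Psi> = \<Phi>}"

text \<open>The rank of a face is its position in a flag, counted so that the least face has rank
  \<open>-1\<close>. When all flags have the same size, this does not depend on the flag.\<close>

definition faces_of_rank :: "'a rel \<Rightarrow> int \<Rightarrow> 'a set" where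
  "faces_of_rank r i =
     {x. \<exists>\<Phi> \<in> flags r. x \<in> \<Phi> \<and> int (card {y \<in> \<Phi>. (y, x) \<in> r}) = i + 2}"

definition adjacent_flags :: "'a rel \<Rightarrow> ('a set \<times> 'a set) set" where
  "adjacent_flags r =
     {(\<Phi>, \<Psi>). \<Phi> \<in> flags r \<and> \<Psi> \<in> flags r \<and> card (\<Phi> - \<Psi>) = 1 \<and> card (\<Psi> - \<Phi>) = 1}"

text \<open>The conditions are, in order: least and greatest faces, length of the flags, strong
  flag-connectivity, and the diamond condition.\<close>

definition abstract_polytope :: "nat \<Rightarrow> 'a rel \<Rightarrow> bool" where
  "abstract_polytope n r \<longleftrightarrow>
     Partial_order r \<and>
     (\<exists>x \<in> Field r. \<forall>y \<in> Field r. (x, y) \<in> r) \<and>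
     (\<exists>x \<in> Field r. \<forall>y \<in> Field r. (y, x) \<in> r) \<and>
     (\<forall>\<Phi> \<in> flags r. card \<Phi> = n + 2) \<and>
     (\<forall>\<Phi> \<in> flags r. \<forall>\<Psi> \<in> flags r.
        (\<Phi>, \<Psi>) \<in> {(A, B) \<in> adjacent_flags r. \<Phi> \<inter> \<Psi> \<subseteq> A \<and> \<Phi> \<inter> \<Psi> \<subseteq> B}\<^sup>*) \<and>
     (\<forall>i::int. 0 \<le> i \<and> i < int n \<longrightarrow>
        (\<forall>F \<in> faces_of_rank r (i - 1). \<forall>G \<in> faces_of_rank r (i + 1). (F, G) \<in> r \<longrightarrow>
           card {H \<in> faces_of_rank r i. (F, H) \<in> r \<and> (H, G) \<in> r} = 2))"

definition poset_iso :: "'a rel \<Rightarrow> 'b rel \<Rightarrow> bool" where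
  "poset_iso r s \<longleftrightarrow>
     (\<exists>f. bij_betw f (Field r) (Field s) \<and>
          (\<forall>x \<in> Field r. \<forall>y \<in> Field r. (x, y) \<in> r \<longleftrightarrow> (f x, f y) \<in> s))"

text \<open>Automorphisms compose as functions. Composing in the opposite order instead would give
  a group isomorphic to this one via inversion, which fixes the distinguished involutions; so
  presentations on these generators do not depend on the convention.\<close>

definition aut_group :: "'a rel \<Rightarrow> ('a \<Rightarrow> 'a) monoid" where
  "aut_group r = (BijGroup (Field r))
     \<lparr>carrier := {f \<in> Bij (Field r).
        \<forall>x \<in> Field r. \<forall>y \<in> Field r. (x, y) \<in> r \<longleftrightarrow> (f x, f y) \<in> r}\<rparr>"

definition regular_polyhedron :: "'a rel \<Rightarrow> bool" where
  "regular_polyhedron r \<longleftrightarrow>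
     abstract_polytope 3 r \<and>
     (\<forall>\<Phi> \<in> flags r. \<forall>\<Psi> \<in> flags r. \<exists>f \<in> carrier (aut_group r). f ` \<Phi> = \<Psi>)"

definition vertices :: "'a rel \<Rightarrow> 'a set" where
  "vertices r = faces_of_rank r 0"

definition facets :: "'a rel \<Rightarrow> 'a set" where
  "facets r = faces_of_rank r 2"

definition flat :: "'a rel \<Rightarrow> bool" where
  "flat r \<longleftrightarrow> (\<forall>F \<in> facets r. \<forall>v \<in> vertices r. (v, F) \<in> r)"

text \<open>\<open>f\<close> is the automorphism changing exactly the rank-\<open>i\<close> face of the base flag \<open>\<Phi>\<close>.\<close>

definition distinguished :: "'a rel \<Rightarrow> 'a set \<Rightarrow> nat \<Rightarrow> ('a \<Rightarrow> 'a) \<Rightarrow> bool" where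
  "distinguished r \<Phi> i f \<longleftrightarrow>
     f \<in> carrier (aut_group r) \<and> (\<forall>x \<in> \<Phi>. f x \<noteq> x \<longleftrightarrow> x \<in> faces_of_rank r (int i))"

text \<open>\<^term>\<open>group.ord\<close> returns \<open>0\<close> for elements of infinite order.\<close>

definition extended_ord :: "('b, 'c) monoid_scheme \<Rightarrow> 'b \<Rightarrow> enat" where
  "extended_ord G x = (if group.ord G x = 0 then \<infinity> else enat (group.ord G x))"

text \<open>A regular polyhedron of type \<open>{p, q}\<close> whose automorphism group is \<open>G\<close>, with
  \<open>g 0, g 1, g 2\<close> corresponding to the distinguished involutions. Which base flag is used is
  immaterial, since the automorphism group is transitive on flags.\<close>

definition polyhedron_with_group ::
    "'a rel \<Rightarrow> enat \<Rightarrow> enat \<Rightarrow> ('b, 'c) monoid_scheme \<Rightarrow> (nat \<Rightarrow> 'b) \<Rightarrow> bool" where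
  "polyhedron_with_group r p q G g \<longleftrightarrow>
     regular_polyhedron r \<and>
     (\<exists>\<Phi> \<in> flags r. \<exists>\<rho>. (\<forall>i < 3. distinguished r \<Phi> i (\<rho> i)) \<and>
        extended_ord (aut_group r) (\<rho> 0 \<otimes>\<^bsub>aut_group r\<^esub> \<rho> 1) = p \<and>
        extended_ord (aut_group r) (\<rho> 1 \<otimes>\<^bsub>aut_group r\<^esub> \<rho> 2) = q \<and>
        (\<exists>h \<in> iso G (aut_group r). \<forall>i < 3. h (g i) = \<rho> i))"


section \<open>Free groups and presentations\<close>

text \<open>In a word, \<open>(x, True)\<close> stands for the generator \<open>x\<close> and \<open>(x, False)\<close> for its inverse.\<close>

definition word_cancel :: "'g set \<Rightarrow> ('g \<times> bool) list rel" where
  "word_cancel X = {(u @ [(x, e), (x, \<not> e)] @ v, u @ v) | u v x e.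
     x \<in> X \<and> u \<in> lists (X \<times> UNIV) \<and> v \<in> lists (X \<times> UNIV)}"

definition word_equiv :: "'g set \<Rightarrow> ('g \<times> bool) list rel" where
  "word_equiv X = {(u, v). u \<in> lists (X \<times> UNIV) \<and> v \<in> lists (X \<times> UNIV) \<and>
     (u, v) \<in> (word_cancel X \<union> (word_cancel X)\<inverse>)\<^sup>*}"

definition free_group :: "'g set \<Rightarrow> ('g \<times> bool) list set monoid" where
  "free_group X =
     \<lparr>carrier = lists (X \<times> UNIV) // word_equiv X,
      monoid.mult = (\<lambda>A B. \<Union>u \<in> A. \<Union>v \<in> B. word_equiv X `` {u @ v}),
      one = word_equiv X `` {[]}\<rparr>"

definition free_gen :: "'g set \<Rightarrow> 'g \<Rightarrow> ('g \<times> bool) list set" where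
  "free_gen X x = word_equiv X `` {[(x, True)]}"

definition normal_closure :: "('b, 'c) monoid_scheme \<Rightarrow> 'b set \<Rightarrow> 'b set" where
  "normal_closure G S =
     generate G {x \<otimes>\<^bsub>G\<^esub> s \<otimes>\<^bsub>G\<^esub> inv\<^bsub>G\<^esub> x | x s. x \<in> carrier G \<and> s \<in> S}"


section \<open>String Coxeter groups and their quotients\<close>

text \<open>An infinite \<open>p\<close> or \<open>q\<close> contributes no relator.\<close>

definition coxeter_relators :: "enat \<Rightarrow> enat \<Rightarrow> (nat \<times> bool) list set set" where
  "coxeter_relators p q =
     (let F = free_group {..<3}; r = free_gen {..<3} in
        {r i [^]\<^bsub>F\<^esub> (2::nat) | i. i < 3} \<union>
        {(r 0 \<otimes>\<^bsub>F\<^esub> r 1) [^]\<^bsub>F\<^esub> m | m::nat. p = enat m} \<union>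
        {(r 1 \<otimes>\<^bsub>F\<^esub> r 2) [^]\<^bsub>F\<^esub> m | m::nat. q = enat m} \<union>
        {(r 0 \<otimes>\<^bsub>F\<^esub> r 2) [^]\<^bsub>F\<^esub> (2::nat)})"

definition coxeter_group :: "enat \<Rightarrow> enat \<Rightarrow> (nat \<times> bool) list set set monoid" where
  "coxeter_group p q =
     free_group {..<3} Mod normal_closure (free_group {..<3}) (coxeter_relators p q)"

definition coxeter_gen :: "enat \<Rightarrow> enat \<Rightarrow> nat \<Rightarrow> (nat \<times> bool) list set set" where
  "coxeter_gen p q i =
     normal_closure (free_group {..<3}) (coxeter_relators p q)
       #>\<^bsub>free_group {..<3}\<^esub> free_gen {..<3} i"

text \<open>\<open>[p, q] / \<langle>\<langle>S\<rangle>\<rangle>\<close> and the images of the generators in it.\<close>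

definition coxeter_quotient ::
    "enat \<Rightarrow> enat \<Rightarrow> (nat \<times> bool) list set set set \<Rightarrow> (nat \<times> bool) list set set set monoid" where
  "coxeter_quotient p q S = coxeter_group p q Mod normal_closure (coxeter_group p q) S"

definition coxeter_quotient_gen ::
    "enat \<Rightarrow> enat \<Rightarrow> (nat \<times> bool) list set set set \<Rightarrow> nat \<Rightarrow> (nat \<times> bool) list set set set" where
  "coxeter_quotient_gen p q S i =
     normal_closure (coxeter_group p q) S #>\<^bsub>coxeter_group p q\<^esub> coxeter_gen p q i"


section \<open>The polyhedra of the classification\<close>

definition is_hosohedron :: "enat \<Rightarrow> 'a rel \<Rightarrow> bool" where
  "is_hosohedron q r \<longleftrightarrow> polyhedron_with_group r 2 q (coxeter_group 2 q) (coxeter_gen 2 q)"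

definition hemi_octahedron_relator :: "(nat \<times> bool) list set set" where
  "hemi_octahedron_relator =
     (let G = coxeter_group 3 4; \<rho> = coxeter_gen 3 4 in
        (\<rho> 0 \<otimes>\<^bsub>G\<^esub> \<rho> 1 \<otimes>\<^bsub>G\<^esub> \<rho> 2) [^]\<^bsub>G\<^esub> (3::nat))"

definition is_hemi_octahedron :: "'a rel \<Rightarrow> bool" where
  "is_hemi_octahedron r \<longleftrightarrow>
     polyhedron_with_group r 3 4
       (coxeter_quotient 3 4 {hemi_octahedron_relator})
       (coxeter_quotient_gen 3 4 {hemi_octahedron_relator})"

definition is_dihedron :: "nat \<Rightarrow> 'a rel \<Rightarrow> bool" where
  "is_dihedron b r \<longleftrightarrow>
     polyhedron_with_group r (enat b) 2 (coxeter_group (enat b) 2) (coxeter_gen (enat b) 2)"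

text \<open>The relator of the relation \<open>\<sigma>\<^sub>2\<^sup>-\<^sup>1 \<sigma>\<^sub>1 = \<sigma>\<^sub>1\<^sup>-\<^sup>1 \<sigma>\<^sub>2\<^sup>-\<^sup>3\<close>, left side times inverse of right side.\<close>

definition flat_b_2b_relator :: "nat \<Rightarrow> (nat \<times> bool) list set set" where
  "flat_b_2b_relator b =
     (let G = coxeter_group (enat b) (enat (2 * b)); \<rho> = coxeter_gen (enat b) (enat (2 * b));
          \<sigma>1 = \<rho> 0 \<otimes>\<^bsub>G\<^esub> \<rho> 1; \<sigma>2 = \<rho> 1 \<otimes>\<^bsub>G\<^esub> \<rho> 2
      in (inv\<^bsub>G\<^esub> \<sigma>2 \<otimes>\<^bsub>G\<^esub> \<sigma>1) \<otimes>\<^bsub>G\<^esub> inv\<^bsub>G\<^esub> (inv\<^bsub>G\<^esub> \<sigma>1 \<otimes>\<^bsub>G\<^esub> \<sigma>2 [^]\<^bsub>G\<^esub> (-3::int)))"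

definition is_flat_b_2b :: "nat \<Rightarrow> 'a rel \<Rightarrow> bool" where
  "is_flat_b_2b b r \<longleftrightarrow>
     polyhedron_with_group r (enat b) (enat (2 * b))
       (coxeter_quotient (enat b) (enat (2 * b)) {flat_b_2b_relator b})
       (coxeter_quotient_gen (enat b) (enat (2 * b)) {flat_b_2b_relator b})"

end

theory Submission
  imports Defs "HOL-Combinatorics.Permutations" "HOL-Algebra.Sylow" "HOL-Library.Countable_Set"
begin

text \<open>Let \<open>b\<close> be odd. The automorphism group acts transitively on the \<open>b\<close> vertices, and the group
  \<open>H\<close> induced by the stabiliser of the base vertex is generated by the two involutions \<open>\<rho>\<^sub>1, \<rho>\<^sub>2\<close>.
  Counting the common neighbours of adjacent vertices bounds the order of \<open>H\<close> by \<open>2 (b - 1)\<close>.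
  For an element \<open>\<tau>\<close> of order \<open>b\<close>, the orbits of \<open>\<tau>\<close> on the cosets modulo \<open>\<langle>\<tau>\<rangle>\<close> give
  \<open>|H| \<equiv> d\<close> modulo \<open>b\<close>, where \<open>d\<close> divides \<open>|H|\<close> and counts the elements of \<open>H\<close> normalising
  \<open>\<langle>\<tau>\<rangle>\<close>; so \<open>d = |H|\<close> or \<open>d = 1\<close>. If \<open>d = 1\<close>, the conjugates of the powers of \<open>\<tau>\<close> exhaust the
  complement of every stabiliser, so \<open>H\<close> is trivial. Thus \<open>H\<close> normalises \<open>\<langle>\<tau>\<rangle>\<close>, and this
  forces \<open>\<rho>\<^sub>2\<close> to fix every vertex.

  The automorphisms fixing all vertices are then the elements \<open>w\<^sup>j\<close> and \<open>w\<^sup>j \<rho>\<^sub>2\<close> with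
  \<open>w = (\<rho>\<^sub>1 \<rho>\<^sub>2)\<^sup>2\<close>, and conjugating \<open>w\<close> by \<open>\<rho>\<^sub>0\<close> leaves only the listed relations. Each of
  them puts \<open>\<rho>\<^sub>0 (\<rho>\<^sub>1 \<rho>\<^sub>2 \<rho>\<^sub>1) \<rho>\<^sub>0\<close> into \<open>\<langle>\<rho>\<^sub>2, \<rho>\<^sub>1 \<rho>\<^sub>2 \<rho>\<^sub>1\<rangle>\<close>, which makes the group the product of
  \<open>\<langle>\<rho>\<^sub>1, \<rho>\<^sub>2\<rangle>\<close> and \<open>\<langle>\<rho>\<^sub>0, \<rho>\<^sub>1\<rangle>\<close>; this gives flatness, and shows that no further relations hold.
  Conversely, a regular polyhedron is recovered from its group with the distinguished
  generators, and each of the groups is realised by functions on integers and finite sets,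
  whose cosets form the polyhedron.\<close>

section \<open>Free groups and string Coxeter groups\<close>

text \<open>The bound \<open>2 * (b - 1)\<close> matters because it lies below \<open>2 * b\<close>:
  it leaves room for only one orbit of length \<open>b\<close> outside the normaliser. The obstacle
  is that \<open>H\<close> need not act faithfully on the neighbours of the base vertex. If there
  are \<open>m\<close> of them, the rotation generating \<open>H\<close> together with
  \<open>\<rho>\<^sub>2\<close> may have order \<open>2 * m\<close> instead of \<open>m\<close>, and
  then the obvious estimate \<open>m \<le> b - 1\<close> is too weak. In that exceptional case two
  adjacent vertices have at most one common neighbour, which yields \<open>2 * m < b\<close>. The
  vertex action loses information, since \<open>\<rho>\<^sub>2\<close> turns out to be trivial
  there. The order of \<open>\<rho>\<^sub>0 \<rho>\<^sub>1\<close> survives, because a nontrivial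
  power of it moves the base vertex; the order of \<open>\<rho>\<^sub>1 \<rho>\<^sub>2\<close> must
  come from \<open>w\<close>. For the same reason the realisations act on a second summand beside
  the vertices. Their cosets are numbered, so that every example is a relation on \<open>nat\<close>
  whatever its generators act on.\<close>

abbreviation words :: "'g set \<Rightarrow> ('g \<times> bool) list set" where
  "words X \<equiv> lists (X \<times> UNIV)"

lemma word_cancel_words: "(u, v) \<in> word_cancel X \<Longrightarrow> u \<in> words X \<and> v \<in> words X"
  by (auto simp: word_cancel_def)

lemma word_cancel_context:
  assumes "(u, v) \<in> word_cancel X" "a \<in> words X" "b \<in> words X"
  shows "(a @ u @ b, a @ v @ b) \<in> word_cancel X"
proof -
  obtain u' v' x e where *: "u = u' @ [(x, e), (x, \<not> e)] @ v'" "v = u' @ v'"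
    "x \<in> X" "u' \<in> words X" "v' \<in> words X"
    using assms(1) unfolding word_cancel_def by blast
  have "a @ u @ b = (a @ u') @ [(x, e), (x, \<not> e)] @ (v' @ b)" "a @ v @ b = (a @ u') @ (v' @ b)"
    using * by auto
  moreover have "a @ u' \<in> words X" "v' @ b \<in> words X"
    using * assms by auto
  ultimately show ?thesis
    unfolding word_cancel_def using *(3) by blast
qed

lemma word_equivI: "(u, v) \<in> word_cancel X \<Longrightarrow> (u, v) \<in> word_equiv X"
  unfolding word_equiv_def using word_cancel_words by blast

lemma equiv_word_equiv: "equiv (words X) (word_equiv X)"
proof (rule equivI)
  show "refl_on (words X) (word_equiv X)"
    by (auto simp: refl_on_def word_equiv_def)
  have "sym ((word_cancel X \<union> (word_cancel X)\<inverse>)\<^sup>*)"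
    by (intro sym_rtrancl sym_Un_converse)
  then show "sym (word_equiv X)"
    unfolding word_equiv_def sym_def by blast
  show "trans (word_equiv X)"
    unfolding word_equiv_def trans_def by (blast intro: rtrancl_trans)
  show "word_equiv X \<subseteq> words X \<times> words X"
    by (auto simp: word_equiv_def)
qed

lemma word_equiv_context:
  assumes "(u, v) \<in> word_equiv X" "a \<in> words X" "b \<in> words X"
  shows "(a @ u @ b, a @ v @ b) \<in> word_equiv X"
proof -
  have "(u, v) \<in> (word_cancel X \<union> (word_cancel X)\<inverse>)\<^sup>*" "u \<in> words X"
    using assms by (auto simp: word_equiv_def)
  then show ?thesis
  proof (induction rule: rtrancl_induct)
    case base
    then show ?case
      using assms by (auto simp: word_equiv_def)
  next
    case (step y z)
    have "(a @ y @ b, a @ z @ b) \<in> word_equiv X"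
      using step(2) word_cancel_context[OF _ assms(2,3)]
      by (metis UnE converse_iff equivE equiv_word_equiv symD word_equivI)
    then show ?case
      using step equiv_word_equiv[of X] by (meson equivE transE)
  qed
qed

lemma word_equiv_append:
  assumes "(u, v) \<in> word_equiv X" "(u', v') \<in> word_equiv X"
  shows "(u @ u', v @ v') \<in> word_equiv X"
proof -
  have W: "u \<in> words X" "v \<in> words X" "u' \<in> words X" "v' \<in> words X"
    using assms by (auto simp: word_equiv_def)
  have "(u @ u', v @ u') \<in> word_equiv X"
    using word_equiv_context[OF assms(1), of "[]" u'] W by simp
  moreover have "(v @ u', v @ v') \<in> word_equiv X"
    using word_equiv_context[OF assms(2), of v "[]"] W by simp
  ultimately show ?thesis
    using equiv_word_equiv[of X] by (meson equivE transE)
qed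

abbreviation word_class :: "'g set \<Rightarrow> ('g \<times> bool) list \<Rightarrow> ('g \<times> bool) list set" where
  "word_class X u \<equiv> word_equiv X `` {u}"

lemma carrier_free_group: "carrier (free_group X) = word_class X ` words X"
  by (auto simp: free_group_def quotient_def)

lemma mult_free_group:
  assumes "u \<in> words X" "v \<in> words X"
  shows "word_class X u \<otimes>\<^bsub>free_group X\<^esub> word_class X v = word_class X (u @ v)"
proof -
  have "congruent2 (word_equiv X) (word_equiv X) (\<lambda>u v. word_class X (u @ v))"
    by (rule congruent2I'[where ?r1.0 = "word_equiv X" and ?r2.0 = "word_equiv X"])
       (metis equiv_class_eq equiv_word_equiv word_equiv_append)
  from UN_equiv_class2[OF equiv_word_equiv equiv_word_equiv this assms]
  show ?thesis by (simp add: free_group_def)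
qed

lemma one_free_group: "\<one>\<^bsub>free_group X\<^esub> = word_class X []"
  by (simp add: free_group_def)

lemma word_class_cancel:
  assumes "x \<in> X" "v \<in> words X"
  shows "word_class X ((x, e) # (x, \<not> e) # v) = word_class X v"
proof -
  have "((x, e) # (x, \<not> e) # v, v) \<in> word_cancel X"
    unfolding word_cancel_def using assms
    by (intro CollectI exI[of _ "[]"] exI[of _ v] exI[of _ x] exI[of _ e]) auto
  then show ?thesis
    by (meson equiv_class_eq equiv_word_equiv word_equivI)
qed

text \<open>The inverse word is reversed with all exponents flipped, so the innermost pair cancels
  first; hence the induction peels off the head of \<open>u\<close>.\<close>

lemma word_class_left_inverse:
  assumes "u \<in> words X"
  shows "word_class X (rev (map (map_prod id Not) u) @ u) = word_class X []"
  using assms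
proof (induction u)
  case Nil
  then show ?case by simp
next
  case (Cons y u)
  obtain x e where y: "y = (x, e)" by (cases y)
  have W: "rev (map (map_prod id Not) u) \<in> words X" "u \<in> words X" "x \<in> X"
    using Cons y by (force simp: lists_eq_set)+
  have W': "(x, \<not> e) # (x, e) # u \<in> words X" using W by simp
  have "word_class X (rev (map (map_prod id Not) (y # u)) @ y # u)
      = word_class X (rev (map (map_prod id Not) u) @ ((x, \<not> e) # (x, e) # u))"
    by (simp add: y)
  also have "\<dots> = word_class X (rev (map (map_prod id Not) u))
      \<otimes>\<^bsub>free_group X\<^esub> word_class X ((x, \<not> e) # (x, \<not> \<not> e) # u)"
    using mult_free_group[OF W(1) W'] by simp
  also have "\<dots> = word_class X (rev (map (map_prod id Not) u) @ u)"
    using word_class_cancel[OF W(3,2), of "\<not> e"] mult_free_group[OF W(1,2)] by simp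
  also have "\<dots> = word_class X []" by (rule Cons.IH)
  finally show ?case .
qed

lemma group_free_group: "group (free_group X)"
proof (rule groupI)
  fix A B C assume "A \<in> carrier (free_group X)" "B \<in> carrier (free_group X)" "C \<in> carrier (free_group X)"
  then obtain u v w where "u \<in> words X" "v \<in> words X" "w \<in> words X"
    "A = word_class X u" "B = word_class X v" "C = word_class X w"
    by (auto simp: carrier_free_group)
  then show "A \<otimes>\<^bsub>free_group X\<^esub> B \<otimes>\<^bsub>free_group X\<^esub> C = A \<otimes>\<^bsub>free_group X\<^esub> (B \<otimes>\<^bsub>free_group X\<^esub> C)"
    by (simp add: mult_free_group)
next
  fix A assume "A \<in> carrier (free_group X)"
  then obtain u where u: "u \<in> words X" "A = word_class X u"
    by (auto simp: carrier_free_group)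
  then have "rev (map (map_prod id Not) u) \<in> words X"
    by (force simp: lists_eq_set)
  then show "\<exists>B\<in>carrier (free_group X). B \<otimes>\<^bsub>free_group X\<^esub> A = \<one>\<^bsub>free_group X\<^esub>"
    using word_class_left_inverse[OF u(1)] u
    by (intro bexI[of _ "word_class X (rev (map (map_prod id Not) u))"])
       (simp_all add: carrier_free_group mult_free_group one_free_group)
next
  fix A B assume "A \<in> carrier (free_group X)" "B \<in> carrier (free_group X)"
  then obtain u v where "u \<in> words X" "v \<in> words X" "A = word_class X u" "B = word_class X v"
    by (auto simp: carrier_free_group)
  then show "A \<otimes>\<^bsub>free_group X\<^esub> B \<in> carrier (free_group X)"
    by (simp add: carrier_free_group mult_free_group)
next
  fix A assume "A \<in> carrier (free_group X)"
  then obtain u where "u \<in> words X" "A = word_class X u"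
    by (auto simp: carrier_free_group)
  then show "\<one>\<^bsub>free_group X\<^esub> \<otimes>\<^bsub>free_group X\<^esub> A = A"
    by (simp add: one_free_group mult_free_group)
qed (simp add: carrier_free_group one_free_group)

lemma free_gen_closed: "x \<in> X \<Longrightarrow> free_gen X x \<in> carrier (free_group X)"
  by (auto simp: free_gen_def carrier_free_group)

lemma inv_free_gen:
  assumes "x \<in> X"
  shows "inv\<^bsub>free_group X\<^esub> free_gen X x = word_class X [(x, False)]"
proof (rule group.inv_equality[OF group_free_group])
  show "word_class X [(x, False)] \<otimes>\<^bsub>free_group X\<^esub> free_gen X x = \<one>\<^bsub>free_group X\<^esub>"
    using assms mult_free_group[of "[(x, False)]" X "[(x, True)]"] word_class_cancel[of x X "[]" False]
    by (simp add: free_gen_def one_free_group)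
qed (use assms in \<open>auto simp: free_gen_def carrier_free_group\<close>)

lemma generate_free_gen: "generate (free_group X) (free_gen X ` X) = carrier (free_group X)"
proof
  show "generate (free_group X) (free_gen X ` X) \<subseteq> carrier (free_group X)"
    by (intro group.generate_incl[OF group_free_group]) (auto intro: free_gen_closed)
  have "word_class X u \<in> generate (free_group X) (free_gen X ` X)" if "u \<in> words X" for u
    using that
  proof (induction u)
    case Nil
    then show ?case
      by (metis generate.one one_free_group)
  next
    case (Cons y u)
    obtain x e where y: "y = (x, e)" by (cases y)
    then have x: "x \<in> X" and u: "u \<in> words X" using Cons by auto
    have "word_class X [(x, e)] \<in> generate (free_group X) (free_gen X ` X)"
      using generate.incl[of "free_gen X x" "free_gen X ` X" "free_group X"]
        generate.inv[of "free_gen X x" "free_gen X ` X" "free_group X"] x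
      by (cases e) (simp_all add: inv_free_gen, simp add: free_gen_def)
    then have "word_class X [(x, e)] \<otimes>\<^bsub>free_group X\<^esub> word_class X u
        \<in> generate (free_group X) (free_gen X ` X)"
      using Cons u by (intro generate.eng) auto
    then show ?case
      using mult_free_group[of "[(x, e)]" X u] x u y by simp
  qed
  then show "carrier (free_group X) \<subseteq> generate (free_group X) (free_gen X ` X)"
    by (auto simp: carrier_free_group)
qed

text \<open>A word is evaluated letter by letter; a cancelling pair evaluates to the identity, so
  the value is constant on each class.\<close>

lemma free_group_universal:
  fixes H (structure)
  assumes "group H" and \<rho>: "\<And>x. x \<in> X \<Longrightarrow> \<rho> x \<in> carrier H"
  obtains h where "h \<in> hom (free_group X) H" "\<And>x. x \<in> X \<Longrightarrow> h (free_gen X x) = \<rho> x"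
proof -
  interpret group H by fact
  define letter where "letter = (\<lambda>(x, e). if e then \<rho> x else inv (\<rho> x))"
  define ev where "ev u = foldr (\<lambda>y a. letter y \<otimes> a) u \<one>" for u
  have letter: "letter y \<in> carrier H" if "y \<in> X \<times> UNIV" for y
    using that \<rho> by (auto simp: letter_def)
  have ev_closed: "ev u \<in> carrier H" if "u \<in> words X" for u
    using that by (induction u) (auto simp: ev_def letter)
  have ev_append: "ev (u @ v) = ev u \<otimes> ev v" if "u \<in> words X" "v \<in> words X" for u v
    using that
  proof (induction u)
    case (Cons y u)
    then show ?case
      using ev_closed[of u] ev_closed[of v] letter[of y] by (auto simp: ev_def m_assoc)
  qed (use ev_closed[of v] in \<open>auto simp: ev_def\<close>)
  have cancel: "ev u = ev v" if "(u, v) \<in> word_cancel X" for u v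
  proof -
    obtain u' v' x e where *: "u = u' @ [(x, e), (x, \<not> e)] @ v'" "v = u' @ v'"
      "x \<in> X" "u' \<in> words X" "v' \<in> words X"
      using \<open>(u, v) \<in> word_cancel X\<close> unfolding word_cancel_def by blast
    have "ev [(x, e), (x, \<not> e)] = \<one>"
      using \<rho>[OF *(3)] by (auto simp: ev_def letter_def)
    then show ?thesis
      using * ev_closed by (simp add: ev_append del: append_Cons append_Nil)
  qed
  have ev_equiv: "ev u = ev v" if "(u, v) \<in> word_equiv X" for u v
  proof -
    have "(u, v) \<in> (word_cancel X \<union> (word_cancel X)\<inverse>)\<^sup>*"
      using that by (simp add: word_equiv_def)
    then show ?thesis
      by (induction rule: rtrancl_induct) (auto dest: cancel)
  qed
  \<comment> \<open>The image of a class under \<open>ev\<close> is a singleton, so its value is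
    read off without choosing a representative.\<close>
  define h where "h A = the_elem (ev ` A)" for A
  have h: "h (word_class X u) = ev u" if "u \<in> words X" for u
    unfolding h_def
  proof (rule the_elem_image_unique)
    show "word_class X u \<noteq> {}"
      using equiv_class_self[OF equiv_word_equiv that] by blast
    show "ev v = ev u" if "v \<in> word_class X u" for v
      using ev_equiv[of u v] that by simp
  qed
  show thesis
  proof
    show "h \<in> hom (free_group X) H"
    proof (rule homI)
      fix A assume "A \<in> carrier (free_group X)"
      then obtain u where "u \<in> words X" "A = word_class X u"
        by (auto simp: carrier_free_group)
      then show "h A \<in> carrier H"
        by (simp only: h ev_closed)
      fix B assume "B \<in> carrier (free_group X)"
      then obtain v where "v \<in> words X" "B = word_class X v"
        by (auto simp: carrier_free_group)
      with \<open>u \<in> words X\<close> \<open>A = word_class X u\<close>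
      show "h (A \<otimes>\<^bsub>free_group X\<^esub> B) = h A \<otimes> h B"
        by (simp only: h mult_free_group ev_append append_in_lists_conv simp_thms)
    qed
    show "h (free_gen X x) = \<rho> x" if "x \<in> X" for x
      using that \<rho> by (simp add: free_gen_def h ev_def letter_def)
  qed
qed

section \<open>Normal closures and quotients by them\<close>

context group
begin

abbreviation conjugates :: "'a set \<Rightarrow> 'a set" where
  "conjugates S \<equiv> {x \<otimes> s \<otimes> inv x | x s. x \<in> carrier G \<and> s \<in> S}"

lemma normal_normal_closure:
  assumes "S \<subseteq> carrier G"
  shows "normal_closure G S \<lhd> G"
  unfolding normal_closure_def
proof (rule normal_generateI)
  show "conjugates S \<subseteq> carrier G" using assms by auto
next
  fix h g assume "h \<in> conjugates S" and g: "g \<in> carrier G"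
  then obtain x s where xs: "x \<in> carrier G" "s \<in> S" "h = x \<otimes> s \<otimes> inv x" by blast
  then have "g \<otimes> h \<otimes> inv g = (g \<otimes> x) \<otimes> s \<otimes> inv (g \<otimes> x)"
    using assms g by (auto simp: m_assoc inv_mult_group)
  then show "g \<otimes> h \<otimes> inv g \<in> conjugates S"
    using xs g by blast
qed

lemma normal_closure_incl:
  assumes "S \<subseteq> carrier G"
  shows "S \<subseteq> normal_closure G S"
proof
  fix s assume s: "s \<in> S"
  then have "s = \<one> \<otimes> s \<otimes> inv \<one>" using assms by auto
  then show "s \<in> normal_closure G S"
    unfolding normal_closure_def using s by (intro generate.incl) blast
qed

lemma normal_closure_subset:
  assumes "N \<lhd> G" "S \<subseteq> N"
  shows "normal_closure G S \<subseteq> N"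
  unfolding normal_closure_def
proof (rule generate_subgroup_incl)
  show "subgroup N G" using assms by (simp add: normal_def)
  show "conjugates S \<subseteq> N" using assms normal.inv_op_closed2 by fastforce
qed

lemma quotient_rel:
  assumes "S \<subseteq> carrier G" "s \<in> S"
  shows "normal_closure G S #> s = \<one>\<^bsub>G Mod normal_closure G S\<^esub>"
proof -
  interpret N: normal "normal_closure G S" G
    by (rule normal_normal_closure[OF assms(1)])
  show ?thesis
    using normal_closure_incl[OF assms(1)] assms(2)
    by (metis FactGroup_def N.rcos_const monoid.simps(2) subsetD is_group)
qed

lemma quotient_universal:
  fixes H (structure)
  assumes "S \<subseteq> carrier G" "group H" "h \<in> hom G H" "\<And>s. s \<in> S \<Longrightarrow> h s = \<one>\<^bsub>H\<^esub>"
  obtains k where "k \<in> hom (G Mod normal_closure G S) H"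
    "\<And>x. x \<in> carrier G \<Longrightarrow> k (normal_closure G S #>\<^bsub>G\<^esub> x) = h x"
proof -
  interpret h: group_hom G H h
    using assms by (simp add: group_hom_def group_hom_axioms_def)
  have "normal_closure G S \<subseteq> kernel G H h"
    using assms by (intro normal_closure_subset h.normal_kernel) (auto simp: kernel_def)
  then show thesis
    using h.FactGroup_universal_kernel[OF normal_normal_closure[OF assms(1)]] that by blast
qed

lemma quotient_generate:
  assumes "N \<lhd> G" "generate G S = carrier G" "S \<subseteq> carrier G"
  shows "generate (G Mod N) ((\<lambda>x. N #> x) ` S) = carrier (G Mod N)"
proof -
  interpret N: normal N G by fact
  interpret q: group_hom G "G Mod N" "\<lambda>x. N #> x"
    using N.r_coset_hom_Mod N.factorgroup_is_group
    by (simp add: group_hom_def group_hom_axioms_def)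
  show ?thesis
    using q.generate_img[OF assms(3)] assms(2) by (auto simp: FactGroup_def RCOSETS_def)
qed

end

lemma (in group) group_hom_quotient:
  assumes "S \<subseteq> carrier G"
  shows "group_hom G (G Mod normal_closure G S) (\<lambda>x. normal_closure G S #> x)"
proof -
  interpret N: normal "normal_closure G S" G
    by (rule normal_normal_closure[OF assms(1)])
  show ?thesis
    using N.r_coset_hom_Mod N.factorgroup_is_group
    by (simp add: group_hom_def group_hom_axioms_def)
qed

section \<open>String Coxeter groups and their universal property\<close>

text \<open>Only relations are demanded, not exact orders, so the presented groups, their quotients
  and the automorphism group of a polyhedron are all instances. The relator of \<open>g 0\<close>
  and \<open>g 2\<close> appears as commutation.\<close>

definition coxeter_system :: "('b, 'c) monoid_scheme \<Rightarrow> (nat \<Rightarrow> 'b) \<Rightarrow> enat \<Rightarrow> enat \<Rightarrow> bool" where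
  "coxeter_system G g p q \<longleftrightarrow> group G \<and> (\<forall>i<3. g i \<in> carrier G \<and> g i \<otimes>\<^bsub>G\<^esub> g i = \<one>\<^bsub>G\<^esub>) \<and>
     (\<forall>m. p = enat m \<longrightarrow> (g 0 \<otimes>\<^bsub>G\<^esub> g 1) [^]\<^bsub>G\<^esub> m = \<one>\<^bsub>G\<^esub>) \<and>
     (\<forall>m. q = enat m \<longrightarrow> (g 1 \<otimes>\<^bsub>G\<^esub> g 2) [^]\<^bsub>G\<^esub> m = \<one>\<^bsub>G\<^esub>) \<and>
     g 0 \<otimes>\<^bsub>G\<^esub> g 2 = g 2 \<otimes>\<^bsub>G\<^esub> g 0 \<and>
     generate G (g ` {..<3}) = carrier G"

lemma coxeter_systemI:
  assumes "group G" "\<And>i. i < 3 \<Longrightarrow> g i \<in> carrier G" "\<And>i. i < 3 \<Longrightarrow> g i \<otimes>\<^bsub>G\<^esub> g i = \<one>\<^bsub>G\<^esub>"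
    "\<And>m. p = enat m \<Longrightarrow> (g 0 \<otimes>\<^bsub>G\<^esub> g 1) [^]\<^bsub>G\<^esub> m = \<one>\<^bsub>G\<^esub>"
    "\<And>m. q = enat m \<Longrightarrow> (g 1 \<otimes>\<^bsub>G\<^esub> g 2) [^]\<^bsub>G\<^esub> m = \<one>\<^bsub>G\<^esub>"
    "g 0 \<otimes>\<^bsub>G\<^esub> g 2 = g 2 \<otimes>\<^bsub>G\<^esub> g 0" "generate G (g ` {..<3}) = carrier G"
  shows "coxeter_system G g p q"
  unfolding coxeter_system_def using assms by (intro conjI allI impI)

lemma coxeter_systemD:
  assumes "coxeter_system G g p q"
  shows "group G" "i < 3 \<Longrightarrow> g i \<in> carrier G" "i < 3 \<Longrightarrow> g i \<otimes>\<^bsub>G\<^esub> g i = \<one>\<^bsub>G\<^esub>"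
    "p = enat m \<Longrightarrow> (g 0 \<otimes>\<^bsub>G\<^esub> g 1) [^]\<^bsub>G\<^esub> m = \<one>\<^bsub>G\<^esub>"
    "q = enat m \<Longrightarrow> (g 1 \<otimes>\<^bsub>G\<^esub> g 2) [^]\<^bsub>G\<^esub> m = \<one>\<^bsub>G\<^esub>"
    "g 0 \<otimes>\<^bsub>G\<^esub> g 2 = g 2 \<otimes>\<^bsub>G\<^esub> g 0" "generate G (g ` {..<3}) = carrier G"
  using assms unfolding coxeter_system_def by blast+

lemma coxeter_relators_closed: "coxeter_relators p q \<subseteq> carrier (free_group {..<3})"
proof -
  interpret group "free_group {..<3::nat}" by (rule group_free_group)
  have "free_gen {..<3} i \<in> carrier (free_group {..<3})" if "i < 3" for i :: nat
    using that by (intro free_gen_closed) auto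
  from this[of 0] this[of 1] this[of 2] this show ?thesis
    by (auto simp: coxeter_relators_def Let_def)
qed

lemma (in group) involutions_commute:
  assumes "x \<in> carrier G" "y \<in> carrier G" "x \<otimes> x = \<one>" "y \<otimes> y = \<one>"
  shows "(x \<otimes> y) [^] (2::nat) = \<one> \<longleftrightarrow> x \<otimes> y = y \<otimes> x"
proof -
  have "inv x = x" "inv y = y" using assms inv_equality by auto
  then have "inv (x \<otimes> y) = y \<otimes> x" using assms by (simp add: inv_mult_group)
  moreover have "(x \<otimes> y) [^] (2::nat) = (x \<otimes> y) \<otimes> (x \<otimes> y)"
    using assms by (simp add: numeral_2_eq_2)
  moreover have "(x \<otimes> y) \<otimes> (x \<otimes> y) = \<one> \<longleftrightarrow> inv (x \<otimes> y) = x \<otimes> y"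
    using assms by (metis inv_equality l_inv m_closed)
  ultimately show ?thesis by metis
qed

lemma coxeter_system_coxeter_group: "coxeter_system (coxeter_group p q) (coxeter_gen p q) p q"
proof -
  define F where "F = free_group {..<3::nat}"
  define f where "f = free_gen {..<3::nat}"
  define S where "S = coxeter_relators p q"
  interpret F: group F unfolding F_def by (rule group_free_group)
  have S: "S \<subseteq> carrier F" unfolding S_def F_def by (rule coxeter_relators_closed)
  have f: "f i \<in> carrier F" if "i < 3" for i
    using that unfolding F_def f_def by (intro free_gen_closed) auto
  define \<pi> where "\<pi> = (\<lambda>x. normal_closure F S #>\<^bsub>F\<^esub> x)"
  have G: "coxeter_group p q = F Mod normal_closure F S"
    by (simp add: coxeter_group_def F_def S_def)
  interpret \<pi>: group_hom F "coxeter_group p q" \<pi>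
    unfolding \<pi>_def G by (rule F.group_hom_quotient[OF S])
  have g: "coxeter_gen p q = (\<lambda>i. \<pi> (f i))"
    by (simp add: fun_eq_iff coxeter_gen_def \<pi>_def F_def S_def f_def)
  have rel: "\<pi> s = \<one>\<^bsub>coxeter_group p q\<^esub>" if "s \<in> S" for s
    using F.quotient_rel[OF S that] by (simp add: \<pi>_def G)
  have f3: "f 0 \<in> carrier F" "f 1 \<in> carrier F" "f 2 \<in> carrier F"
    using f by auto
  have r0: "f i [^]\<^bsub>F\<^esub> (2::nat) \<in> S" if "i < 3" for i
    using that by (auto simp: S_def coxeter_relators_def F_def f_def Let_def)
  have r1: "(f 0 \<otimes>\<^bsub>F\<^esub> f 1) [^]\<^bsub>F\<^esub> m \<in> S" if "p = enat m" for m
    using that by (auto simp: S_def coxeter_relators_def F_def f_def Let_def)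
  have r2: "(f 1 \<otimes>\<^bsub>F\<^esub> f 2) [^]\<^bsub>F\<^esub> m \<in> S" if "q = enat m" for m
    using that by (auto simp: S_def coxeter_relators_def F_def f_def Let_def)
  have r3: "(f 0 \<otimes>\<^bsub>F\<^esub> f 2) [^]\<^bsub>F\<^esub> (2::nat) \<in> S"
    by (auto simp: S_def coxeter_relators_def F_def f_def Let_def)
  have sq: "\<pi> (f i) \<otimes>\<^bsub>coxeter_group p q\<^esub> \<pi> (f i) = \<one>\<^bsub>coxeter_group p q\<^esub>" if "i < 3" for i
    using rel[OF r0[OF that]] f[OF that] by (simp add: numeral_2_eq_2)
  have gen: "generate F (f ` {..<3}) = carrier F"
    unfolding F_def f_def by (rule generate_free_gen)
  have "generate (coxeter_group p q) (\<pi> ` f ` {..<3}) = carrier (coxeter_group p q)"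
    unfolding \<pi>_def G using f by (intro F.quotient_generate F.normal_normal_closure S gen) auto
  moreover have "\<pi> (f 0) \<otimes>\<^bsub>coxeter_group p q\<^esub> \<pi> (f 2) = \<pi> (f 2) \<otimes>\<^bsub>coxeter_group p q\<^esub> \<pi> (f 0)"
    using f3 sq[of 0] sq[of 2] rel[OF r3] \<pi>.H.involutions_commute[of "\<pi> (f 0)" "\<pi> (f 2)"]
    by (simp add: \<pi>.hom_nat_pow)
  moreover have "(\<pi> (f 0) \<otimes>\<^bsub>coxeter_group p q\<^esub> \<pi> (f 1)) [^]\<^bsub>coxeter_group p q\<^esub> m = \<one>\<^bsub>coxeter_group p q\<^esub>"
    if "p = enat m" for m
    using rel[OF r1[OF that]] f3 by (simp add: \<pi>.hom_nat_pow del: One_nat_def)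
  moreover have "(\<pi> (f 1) \<otimes>\<^bsub>coxeter_group p q\<^esub> \<pi> (f 2)) [^]\<^bsub>coxeter_group p q\<^esub> m = \<one>\<^bsub>coxeter_group p q\<^esub>"
    if "q = enat m" for m
    using rel[OF r2[OF that]] f3 by (simp add: \<pi>.hom_nat_pow del: One_nat_def)
  ultimately show ?thesis
    using f sq \<pi>.H.is_group unfolding g
    by (intro coxeter_systemI) (simp_all add: image_image del: One_nat_def)
qed

lemma coxeter_group_universal:
  fixes H :: "('b, 'c) monoid_scheme"
  assumes "coxeter_system H \<rho> p q"
  obtains h where "h \<in> hom (coxeter_group p q) H" "\<And>i. i < 3 \<Longrightarrow> h (coxeter_gen p q i) = \<rho> i"
proof -
  define F where "F = free_group {..<3::nat}"
  define f where "f = free_gen {..<3::nat}"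
  define S where "S = coxeter_relators p q"
  interpret F: group F unfolding F_def by (rule group_free_group)
  interpret H: group H by (rule coxeter_systemD(1)[OF assms])
  have S: "S \<subseteq> carrier F" unfolding S_def F_def by (rule coxeter_relators_closed)
  have f: "f i \<in> carrier F" if "i < 3" for i
    using that unfolding F_def f_def by (intro free_gen_closed) auto
  have f3: "f 0 \<in> carrier F" "f (Suc 0) \<in> carrier F" "f 2 \<in> carrier F"
    using f by auto
  have \<rho>: "\<rho> i \<in> carrier H" "\<rho> i \<otimes>\<^bsub>H\<^esub> \<rho> i = \<one>\<^bsub>H\<^esub>" if "i < 3" for i
    using coxeter_systemD(2,3)[OF assms that] by auto
  obtain k where k: "k \<in> hom F H" "\<And>i. i < 3 \<Longrightarrow> k (f i) = \<rho> i"
    using free_group_universal[OF H.is_group, of "{..<3}" \<rho>] \<rho> unfolding F_def f_def by auto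
  interpret k: group_hom F H k
    using k by (simp add: group_hom_def group_hom_axioms_def F.is_group H.is_group)
  have "k s = \<one>\<^bsub>H\<^esub>" if "s \<in> S" for s
  proof -
    have *: "s \<in> {f i [^]\<^bsub>F\<^esub> (2::nat) | i. i < 3} \<union>
        {(f 0 \<otimes>\<^bsub>F\<^esub> f 1) [^]\<^bsub>F\<^esub> m | m::nat. p = enat m} \<union>
        {(f 1 \<otimes>\<^bsub>F\<^esub> f 2) [^]\<^bsub>F\<^esub> m | m::nat. q = enat m} \<union>
        {(f 0 \<otimes>\<^bsub>F\<^esub> f 2) [^]\<^bsub>F\<^esub> (2::nat)}"
      using that by (simp add: S_def coxeter_relators_def F_def f_def Let_def)
    have "(\<rho> 0 \<otimes>\<^bsub>H\<^esub> \<rho> 2) [^]\<^bsub>H\<^esub> (2::nat) = \<one>\<^bsub>H\<^esub>"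
      using H.involutions_commute[of "\<rho> 0" "\<rho> 2"] \<rho>[of 0] \<rho>[of 2] coxeter_systemD(6)[OF assms] by simp
    moreover have "k (f i [^]\<^bsub>F\<^esub> (2::nat)) = \<one>\<^bsub>H\<^esub>" if "i < 3" for i
      using f[OF that] \<rho>[OF that] k(2)[OF that] by (simp add: numeral_2_eq_2)
    moreover have "k ((f i \<otimes>\<^bsub>F\<^esub> f j) [^]\<^bsub>F\<^esub> m) = (\<rho> i \<otimes>\<^bsub>H\<^esub> \<rho> j) [^]\<^bsub>H\<^esub> m"
      if "i < 3" "j < 3" for i j and m :: nat
      using k.hom_nat_pow[of "f i \<otimes>\<^bsub>F\<^esub> f j" m] k.hom_mult[of "f i" "f j"] f that k(2) by simp
    ultimately show ?thesis
      using * coxeter_systemD(4)[OF assms] coxeter_systemD(5)[OF assms]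
      by (elim UnE) (auto simp del: One_nat_def)
  qed
  then obtain h where h: "h \<in> hom (F Mod normal_closure F S) H"
      "\<And>x. x \<in> carrier F \<Longrightarrow> h (normal_closure F S #>\<^bsub>F\<^esub> x) = k x"
    using F.quotient_universal[OF S H.is_group k(1)] by blast
  show thesis
    by (rule that[of h]) (use h k f in \<open>auto simp: coxeter_group_def coxeter_gen_def F_def f_def S_def\<close>)
qed

lemma coxeter_system_coxeter_quotient:
  assumes "S \<subseteq> carrier (coxeter_group p q)"
  shows "coxeter_system (coxeter_quotient p q S) (coxeter_quotient_gen p q S) p q"
    and "group_hom (coxeter_group p q) (coxeter_quotient p q S)
      (\<lambda>x. normal_closure (coxeter_group p q) S #>\<^bsub>coxeter_group p q\<^esub> x)"
    and "s \<in> S \<Longrightarrow> normal_closure (coxeter_group p q) S #>\<^bsub>coxeter_group p q\<^esub> s = \<one>\<^bsub>coxeter_quotient p q S\<^esub>"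
proof -
  let ?G = "coxeter_group p q" and ?g = "coxeter_gen p q"
  have cs: "coxeter_system ?G ?g p q" by (rule coxeter_system_coxeter_group)
  interpret G: group ?G by (rule coxeter_systemD(1)[OF cs])
  define \<pi> where "\<pi> = (\<lambda>x. normal_closure ?G S #>\<^bsub>?G\<^esub> x)"
  have hom: "group_hom ?G (coxeter_quotient p q S) \<pi>"
    unfolding coxeter_quotient_def \<pi>_def by (rule G.group_hom_quotient[OF assms])
  then show "group_hom ?G (coxeter_quotient p q S) (\<lambda>x. normal_closure ?G S #>\<^bsub>?G\<^esub> x)"
    unfolding \<pi>_def .
  interpret \<pi>: group_hom ?G "coxeter_quotient p q S" \<pi>
    by (rule hom)
  show "normal_closure (coxeter_group p q) S #>\<^bsub>coxeter_group p q\<^esub> s = \<one>\<^bsub>coxeter_quotient p q S\<^esub>" if "s \<in> S"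
    unfolding coxeter_quotient_def by (rule G.quotient_rel[OF assms that])
  have g: "coxeter_quotient_gen p q S = (\<lambda>i. \<pi> (?g i))"
    by (simp add: fun_eq_iff coxeter_quotient_gen_def \<pi>_def)
  have gc: "?g i \<in> carrier ?G" "?g i \<otimes>\<^bsub>?G\<^esub> ?g i = \<one>\<^bsub>?G\<^esub>" if "i < 3" for i
    using coxeter_systemD(2,3)[OF cs that] by auto
  have gc3: "?g 0 \<in> carrier ?G" "?g 1 \<in> carrier ?G" "?g 2 \<in> carrier ?G"
    using gc by auto
  have "generate (coxeter_quotient p q S) (\<pi> ` ?g ` {..<3}) = carrier (coxeter_quotient p q S)"
    unfolding \<pi>_def coxeter_quotient_def
    using gc by (intro G.quotient_generate G.normal_normal_closure assms coxeter_systemD(7)[OF cs]) auto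
  moreover have "\<pi> (?g i) \<otimes>\<^bsub>coxeter_quotient p q S\<^esub> \<pi> (?g i) = \<one>\<^bsub>coxeter_quotient p q S\<^esub>" if "i < 3" for i
    using gc[OF that] by (metis \<pi>.hom_mult \<pi>.hom_one)
  moreover have "(\<pi> (?g 0) \<otimes>\<^bsub>coxeter_quotient p q S\<^esub> \<pi> (?g 1)) [^]\<^bsub>coxeter_quotient p q S\<^esub> m = \<one>\<^bsub>coxeter_quotient p q S\<^esub>"
    if "p = enat m" for m
  proof -
    have "(?g 0 \<otimes>\<^bsub>?G\<^esub> ?g 1) [^]\<^bsub>?G\<^esub> m = \<one>\<^bsub>?G\<^esub>"
      by (rule coxeter_systemD(4)[OF cs that])
    then show ?thesis
      using gc3 \<pi>.hom_nat_pow[of "?g 0 \<otimes>\<^bsub>?G\<^esub> ?g 1" m] by (simp del: One_nat_def)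
  qed
  moreover have "(\<pi> (?g 1) \<otimes>\<^bsub>coxeter_quotient p q S\<^esub> \<pi> (?g 2)) [^]\<^bsub>coxeter_quotient p q S\<^esub> m = \<one>\<^bsub>coxeter_quotient p q S\<^esub>"
    if "q = enat m" for m
  proof -
    have "(?g 1 \<otimes>\<^bsub>?G\<^esub> ?g 2) [^]\<^bsub>?G\<^esub> m = \<one>\<^bsub>?G\<^esub>"
      by (rule coxeter_systemD(5)[OF cs that])
    then show ?thesis
      using gc3 \<pi>.hom_nat_pow[of "?g 1 \<otimes>\<^bsub>?G\<^esub> ?g 2" m] by (simp del: One_nat_def)
  qed
  moreover have "\<pi> (?g 0) \<otimes>\<^bsub>coxeter_quotient p q S\<^esub> \<pi> (?g 2) = \<pi> (?g 2) \<otimes>\<^bsub>coxeter_quotient p q S\<^esub> \<pi> (?g 0)"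
  proof -
    have "?g 0 \<otimes>\<^bsub>?G\<^esub> ?g 2 = ?g 2 \<otimes>\<^bsub>?G\<^esub> ?g 0"
      by (rule coxeter_systemD(6)[OF cs])
    then show ?thesis
      using gc3 \<pi>.hom_mult by metis
  qed
  ultimately show "coxeter_system (coxeter_quotient p q S) (coxeter_quotient_gen p q S) p q"
    using gc \<pi>.H.is_group unfolding g
    by (intro coxeter_systemI) (simp_all add: image_image del: One_nat_def)
qed

text \<open>The last premise ranges over homomorphisms because the relators in \<open>S\<close> are
  elements of \<open>coxeter_group p q\<close>, which have a value in \<open>H\<close> only once
  such a homomorphism is given.\<close>

lemma coxeter_quotient_universal:
  fixes H :: "('b, 'c) monoid_scheme"
  assumes "coxeter_system H \<rho> p q" "S \<subseteq> carrier (coxeter_group p q)"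
    and "\<And>h s. h \<in> hom (coxeter_group p q) H \<Longrightarrow> (\<And>i. i < 3 \<Longrightarrow> h (coxeter_gen p q i) = \<rho> i) \<Longrightarrow>
           s \<in> S \<Longrightarrow> h s = \<one>\<^bsub>H\<^esub>"
  obtains h where "h \<in> hom (coxeter_quotient p q S) H"
    "\<And>i. i < 3 \<Longrightarrow> h (coxeter_quotient_gen p q S i) = \<rho> i"
proof -
  interpret G: group "coxeter_group p q"
    by (rule coxeter_systemD(1)[OF coxeter_system_coxeter_group])
  have H: "group H" by (rule coxeter_systemD(1)[OF assms(1)])
  obtain k where k: "k \<in> hom (coxeter_group p q) H" "\<And>i. i < 3 \<Longrightarrow> k (coxeter_gen p q i) = \<rho> i"
    using coxeter_group_universal[OF assms(1)] by blast
  obtain h where h: "h \<in> hom (coxeter_quotient p q S) H"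
      "\<And>x. x \<in> carrier (coxeter_group p q) \<Longrightarrow>
        h (normal_closure (coxeter_group p q) S #>\<^bsub>coxeter_group p q\<^esub> x) = k x"
    using G.quotient_universal[OF assms(2) H k(1) assms(3)[OF k]] unfolding coxeter_quotient_def
    by blast
  show thesis
    by (rule that[of h])
       (use h k coxeter_systemD(2)[OF coxeter_system_coxeter_group] in \<open>auto simp: coxeter_quotient_gen_def\<close>)
qed

section \<open>Groups of functions generated by involutions\<close>

text \<open>Inverses need no clause: when the generators are involutions, the span is already a
  group.\<close>

inductive_set involution_span :: "('a \<Rightarrow> 'a) set \<Rightarrow> ('a \<Rightarrow> 'a) set" for S where
  id: "id \<in> involution_span S"
| step: "s \<in> S \<Longrightarrow> f \<in> involution_span S \<Longrightarrow> s \<circ> f \<in> involution_span S"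

abbreviation finv :: "('a \<Rightarrow> 'b) \<Rightarrow> 'b \<Rightarrow> 'a" where
  "finv \<equiv> inv_into UNIV"

lemma involution_span_incl: "s \<in> S \<Longrightarrow> s \<in> involution_span S"
  using involution_span.step[OF _ involution_span.id] by fastforce

lemma involution_span_comp:
  "f \<in> involution_span S \<Longrightarrow> g \<in> involution_span S \<Longrightarrow> f \<circ> g \<in> involution_span S"
  by (induction rule: involution_span.induct) (auto simp: comp_assoc intro: involution_span.step)

lemma involution_span_funpow: "f \<in> involution_span S \<Longrightarrow> f ^^ n \<in> involution_span S"
  by (induction n) (auto intro: involution_span.id involution_span_comp)

lemma involution_span_mono: "f \<in> involution_span S \<Longrightarrow> S \<subseteq> T \<Longrightarrow> f \<in> involution_span T"
  by (induction rule: involution_span.induct) (auto intro: involution_span.intros)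

lemma involution_span_inverse:
  assumes "f \<in> involution_span S" "\<And>s. s \<in> S \<Longrightarrow> s \<circ> s = id"
  shows "\<exists>g \<in> involution_span S. f \<circ> g = id \<and> g \<circ> f = id"
  using assms(1)
proof (induction rule: involution_span.induct)
  case id
  show ?case by (rule bexI[OF _ involution_span.id]) simp
next
  case (step s f)
  then obtain g where g: "g \<in> involution_span S" "f \<circ> g = id" "g \<circ> f = id" by blast
  have "(s \<circ> f) \<circ> (g \<circ> s) = s \<circ> (f \<circ> g) \<circ> s" "(g \<circ> s) \<circ> (s \<circ> f) = g \<circ> (s \<circ> s) \<circ> f"
    by (simp_all add: comp_assoc)
  then have "(s \<circ> f) \<circ> (g \<circ> s) = id" "(g \<circ> s) \<circ> (s \<circ> f) = id"
    using g assms(2)[OF step(1)] by simp_all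
  then show ?case
    using g(1) step(1) by (blast intro: involution_span_comp involution_span_incl)
qed

lemma involution_span_bij:
  assumes "f \<in> involution_span S" "\<And>s. s \<in> S \<Longrightarrow> s \<circ> s = id"
  shows "bij f" "finv f \<in> involution_span S"
proof -
  obtain g where g: "g \<in> involution_span S" "f \<circ> g = id" "g \<circ> f = id"
    using involution_span_inverse[OF assms] by blast
  then show "bij f" using o_bij by blast
  show "finv f \<in> involution_span S" using g inv_unique_comp by metis
qed

lemma double_eq_of_dvd:
  fixes j m :: nat
  assumes "m dvd j + j" "j < m" "j \<noteq> 0"
  shows "j + j = m"
proof -
  obtain k where k: "j + j = m * k" using assms(1) by (auto simp: dvd_def)
  then have "m * k < m * 2" "m * k \<noteq> 0" using assms by linarith+
  then have "k < 2" "k \<noteq> 0" using mult_less_cancel1 by auto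
  then have "k = 1" by simp
  then show ?thesis using k by simp
qed

lemma funpow_conj: "g \<circ> f = f' \<circ> g \<Longrightarrow> g \<circ> f ^^ i = f' ^^ i \<circ> g"
proof (induction i)
  case (Suc i)
  then show ?case by (metis comp_assoc funpow.simps(2))
qed simp

lemma funpow_period:
  fixes f :: "'a \<Rightarrow> 'a"
  assumes "f ^^ n = id" "n > 0"
  obtains m where "m > 0" "\<And>i. (f ^^ i) v = v \<longleftrightarrow> m dvd i"
proof -
  define m where "m = (LEAST m. m > 0 \<and> (f ^^ m) v = v)"
  have m: "m > 0 \<and> (f ^^ m) v = v"
    unfolding m_def by (rule LeastI[of _ n]) (use assms in auto)
  have mult: "(f ^^ (k * m)) v = v" for k
    by (induction k) (use m in \<open>auto simp: funpow_add\<close>)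
  have "(f ^^ i) v = v \<longleftrightarrow> m dvd i" for i
  proof
    assume "(f ^^ i) v = v"
    moreover have "(f ^^ i) v = (f ^^ (i mod m)) ((f ^^ (i div m * m)) v)"
      by (metis comp_apply funpow_add mod_div_mult_eq)
    ultimately have "(f ^^ (i mod m)) v = v" using mult by simp
    then have "\<not> i mod m > 0"
      using not_less_Least[of "i mod m" "\<lambda>m. m > 0 \<and> (f ^^ m) v = v"] m
      by (auto simp: m_def[symmetric])
    then show "m dvd i" by auto
  next
    assume "m dvd i"
    then show "(f ^^ i) v = v" using mult by (metis dvd_def mult.commute)
  qed
  then show thesis using that m by blast
qed

lemma funpow_eq_iff_mod:
  fixes f :: "'a \<Rightarrow> 'a"
  assumes "bij f" "\<And>i. (f ^^ i) v = v \<longleftrightarrow> m dvd i"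
  shows "(f ^^ i) v = (f ^^ j) v \<longleftrightarrow> i mod m = j mod m"
proof (induction i j rule: linorder_wlog)
  case (le i j)
  have "(f ^^ j) v = (f ^^ i) ((f ^^ (j - i)) v)"
    using le by (metis comp_apply funpow_add le_add_diff_inverse)
  moreover have "inj (f ^^ i)" using assms(1) by (simp add: bij_is_inj inj_fn)
  ultimately have "(f ^^ i) v = (f ^^ j) v \<longleftrightarrow> m dvd (j - i)"
    using assms(2) by (metis injD)
  then show ?case using le mod_eq_dvd_iff_nat by metis
qed auto


section \<open>Prime degree permutation groups with dihedral point stabilisers\<close>

text \<open>The permutation group induced on the vertices. Its elements are functions on the whole
  type that fix everything outside \<open>V\<close>, so equality of functions is equality of
  permutations. What remains of the polyhedron is the premise \<open>stabilizer\<close>.\<close>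

locale prime_degree_action =
  fixes V :: "'v set" and u0 :: 'v and r0 r1 r2 :: "'v \<Rightarrow> 'v" and b :: nat
  assumes involution: "r0 \<circ> r0 = id" "r1 \<circ> r1 = id" "r2 \<circ> r2 = id"
    and commute: "r0 \<circ> r2 = r2 \<circ> r0"
    and support: "v \<notin> V \<Longrightarrow> r0 v = v" "v \<notin> V \<Longrightarrow> r1 v = v" "v \<notin> V \<Longrightarrow> r2 v = v"
    and card_V: "card V = b" and prime: "prime b" and odd: "odd b" and u0: "u0 \<in> V"
    and fixed: "r1 u0 = u0" "r2 u0 = u0"
    and transitive: "v \<in> V \<Longrightarrow> \<exists>g \<in> involution_span {r0, r1, r2}. g u0 = v"
    and stabilizer: "g \<in> involution_span {r0, r1, r2} \<Longrightarrow> g u0 = u0 \<Longrightarrow> g \<in> involution_span {r1, r2}"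
begin

definition G where "G = involution_span {r0, r1, r2}"
definition H where "H = {g \<in> G. g u0 = u0}"
definition u1 where "u1 = r0 u0"
definition c where "c = r1 \<circ> r2"

lemma finite_V: "finite V"
  using card_V prime card.infinite[of V] not_prime_0 by metis

lemma b_gt_2: "b > 2"
proof -
  have "b \<noteq> 2" using odd by auto
  then show ?thesis using prime_gt_1_nat[OF prime] by simp
qed

lemma gens_in_G: "r0 \<in> G" "r1 \<in> G" "r2 \<in> G" "id \<in> G"
  by (auto simp: G_def intro: involution_span_incl involution_span.id)

lemma comp_G: "f \<in> G \<Longrightarrow> g \<in> G \<Longrightarrow> f \<circ> g \<in> G"
  unfolding G_def by (rule involution_span_comp)

lemma funpow_G: "f \<in> G \<Longrightarrow> f ^^ n \<in> G"
  unfolding G_def by (rule involution_span_funpow)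

lemma bij_G: "f \<in> G \<Longrightarrow> bij f" and inv_G: "f \<in> G \<Longrightarrow> finv f \<in> G"
  unfolding G_def using involution_span_bij involution by blast+

lemma inv_comp_G: "f \<in> G \<Longrightarrow> finv f \<circ> f = id" "f \<in> G \<Longrightarrow> f \<circ> finv f = id"
  using bij_G by (auto simp: bij_def surj_iff inj_iff)

lemma inv_apply: "f \<in> G \<Longrightarrow> finv f (f x) = x" "f \<in> G \<Longrightarrow> f (finv f x) = x"
  using bij_G by (simp_all add: bij_is_inj bij_is_surj surj_f_inv_f)

lemma inv_comp_left: "f \<in> G \<Longrightarrow> f \<circ> x = y \<Longrightarrow> x = finv f \<circ> y"
  by (simp add: fun_eq_iff) (metis inv_apply(1))

lemma involution_apply [simp]: "r0 (r0 x) = x" "r1 (r1 x) = x" "r2 (r2 x) = x"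
  using involution by (simp_all add: fun_eq_iff)

lemma permutes_G: "f \<in> G \<Longrightarrow> f permutes V"
proof -
  assume f: "f \<in> G"
  have "f v = v" if "v \<notin> V" for v
    using f that unfolding G_def by (induction rule: involution_span.induct) (auto simp: support id_def)
  then show ?thesis using bij_G[OF f] unfolding permutes_def bij_iff by blast
qed

lemma G_in_V: "f \<in> G \<Longrightarrow> f v \<in> V \<longleftrightarrow> v \<in> V"
  using permutes_G permutes_in_image by metis

lemma finite_G: "finite G"
  by (rule finite_subset[OF _ finite_permutations[OF finite_V]]) (use permutes_G in blast)

lemma ex_pow_id: "f \<in> G \<Longrightarrow> \<exists>n>0. f ^^ n = id"
proof -
  assume f: "f \<in> G"
  have "\<not> inj (\<lambda>n. f ^^ n)"
  proof
    assume "inj (\<lambda>n. f ^^ n)"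
    moreover have "range (\<lambda>n. f ^^ n) \<subseteq> G" by (auto intro: funpow_G[OF f])
    ultimately show False
      using finite_imageD[of "\<lambda>n. f ^^ n" UNIV] finite_subset[OF _ finite_G] infinite_UNIV_nat by blast
  qed
  then obtain k l where "f ^^ k = f ^^ l" "k \<noteq> l" unfolding inj_def by blast
  then obtain i j where ij: "f ^^ i = f ^^ j" "i < j" by (metis linorder_neqE_nat)
  have "f ^^ i \<circ> f ^^ (j - i) = f ^^ i"
    using ij funpow_add[of i "j - i" f] by simp
  then have "f ^^ (j - i) = finv (f ^^ i) \<circ> f ^^ i"
    by (rule inv_comp_left[OF funpow_G[OF f]])
  then have "f ^^ (j - i) = id"
    using inv_comp_G(1)[OF funpow_G[OF f, of i]] by simp
  then show ?thesis using ij by (intro exI[of _ "j - i"]) auto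
qed

lemma H_subset: "h \<in> H \<Longrightarrow> h \<in> G" and H_fix: "h \<in> H \<Longrightarrow> h u0 = u0"
  by (auto simp: H_def)

lemma gens_in_H: "r1 \<in> H" "r2 \<in> H" "id \<in> H"
  using gens_in_G fixed by (auto simp: H_def)

lemma comp_H: "f \<in> H \<Longrightarrow> g \<in> H \<Longrightarrow> f \<circ> g \<in> H"
  by (auto simp: H_def comp_G)

lemma funpow_H: "f \<in> H \<Longrightarrow> f ^^ n \<in> H"
  by (induction n) (auto simp: gens_in_H comp_H)

lemma inv_H: "f \<in> H \<Longrightarrow> finv f \<in> H"
  using inv_comp_G(1)[of f] by (auto simp: H_def inv_G fun_eq_iff) metis

lemma eq_id: "f \<in> G \<Longrightarrow> (\<And>v. v \<in> V \<Longrightarrow> f v = v) \<Longrightarrow> f = id"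
  using permutes_G by (auto simp: fun_eq_iff permutes_def)

lemma c_in_H: "c \<in> H"
  unfolding c_def by (intro comp_H gens_in_H)

lemma r1_eq: "r1 = c \<circ> r2"
  by (simp add: c_def comp_assoc involution)

lemma inverts_c: "r2 \<circ> c = finv c \<circ> r2" "r1 \<circ> c = finv c \<circ> r1"
proof -
  have "c \<circ> (r2 \<circ> c) = r2" "c \<circ> (r1 \<circ> c) = r1"
    by (simp_all add: c_def fun_eq_iff)
  then show "r2 \<circ> c = finv c \<circ> r2" "r1 \<circ> c = finv c \<circ> r1"
    using inv_comp_left[OF H_subset[OF c_in_H]] by blast+
qed

text \<open>Finite order makes the inverse a natural power, so normal forms and closure arguments
  can stay with \<open>funpow\<close>.\<close>

lemma inv_pow: "f \<in> G \<Longrightarrow> \<exists>n. finv f = f ^^ n"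
proof -
  assume f: "f \<in> G"
  obtain n where "n > 0" "f ^^ n = id" using ex_pow_id[OF f] by blast
  then have "f \<circ> f ^^ (n - 1) = id" by (cases n) auto
  then have "f ^^ (n - 1) = finv f \<circ> id" by (rule inv_comp_left[OF f])
  then show ?thesis by (intro exI[of _ "n - 1"]) simp
qed

text \<open>The dihedral normal form: \<open>r2\<close> passes powers of \<open>c\<close> by
  inverting them, and \<open>r1\<close> is traded for \<open>c \<circ> r2\<close>.\<close>

lemma H_cases: "h \<in> H \<Longrightarrow> \<exists>i. h = c ^^ i \<or> h = c ^^ i \<circ> r2"
proof -
  obtain n where n: "finv c = c ^^ n" using inv_pow[OF H_subset[OF c_in_H]] by blast
  have r2c: "r2 \<circ> c ^^ i = c ^^ (n * i) \<circ> r2" for i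
    using funpow_conj[OF inverts_c(1), of i] n by (simp add: funpow_mult)
  assume "h \<in> H"
  then have "h \<in> involution_span {r1, r2}" using stabilizer by (auto simp: H_def G_def)
  then show ?thesis
  proof (induction rule: involution_span.induct)
    case id
    show ?case by (rule exI[of _ 0]) (simp add: id_def)
  next
    case (step s h)
    have r2_h: "\<exists>i. r2 \<circ> h = c ^^ i \<or> r2 \<circ> h = c ^^ i \<circ> r2"
    proof -
      from step(3) obtain i where "h = c ^^ i \<or> h = c ^^ i \<circ> r2" by blast
      then have "r2 \<circ> h = r2 \<circ> c ^^ i \<or> r2 \<circ> h = (r2 \<circ> c ^^ i) \<circ> r2" by auto
      then have "r2 \<circ> h = c ^^ (n * i) \<circ> r2 \<or> r2 \<circ> h = c ^^ (n * i)"
        unfolding r2c by (auto simp: comp_assoc involution)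
      then show ?thesis by blast
    qed
    from step(1) consider "s = r2" | "s \<circ> h = c \<circ> (r2 \<circ> h)" using r1_eq by (metis comp_assoc empty_iff insert_iff)
    then show ?case
    proof cases
      case 2
      obtain i where "r2 \<circ> h = c ^^ i \<or> r2 \<circ> h = c ^^ i \<circ> r2" using r2_h by blast
      then have "s \<circ> h = c ^^ Suc i \<or> s \<circ> h = c ^^ Suc i \<circ> r2" using 2 by (auto simp: comp_assoc)
      then show ?thesis by blast
    qed (use r2_h in \<open>simp only:\<close>)
  qed
qed

lemma u1: "u1 \<in> V" "u1 \<noteq> u0" "r2 u1 = u1" "r0 u1 = u0"
proof -
  show "u1 \<in> V" unfolding u1_def using G_in_V gens_in_G u0 by blast
  show "r0 u1 = u0" unfolding u1_def by simp
  show "r2 u1 = u1" unfolding u1_def using commute fixed by (metis comp_apply)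
  show "u1 \<noteq> u0"
  proof
    assume u: "u1 = u0"
    have "g u0 = u0" if "g \<in> involution_span {r0, r1, r2}" for g
      using that by (induction rule: involution_span.induct) (use u fixed in \<open>auto simp: u1_def\<close>)
    then have "V = {u0}" using transitive u0 by fastforce
    then show False using card_V b_gt_2 by simp
  qed
qed

text \<open>The length of the orbit of \<open>u1\<close> under \<open>c\<close>, which is the number
  of neighbours of \<open>u0\<close>. Accordingly the powers of \<open>s\<close> are the rotations
  in \<open>H\<close> that fix \<open>u1\<close>.\<close>

definition m where "m = (SOME m. m > 0 \<and> (\<forall>i. (c ^^ i) u1 = u1 \<longleftrightarrow> m dvd i))"
definition s where "s = c ^^ m"

lemma m: "m > 0" "(c ^^ i) u1 = u1 \<longleftrightarrow> m dvd i"
proof -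
  obtain n where "n > 0" "c ^^ n = id" using ex_pow_id H_subset[OF c_in_H] by blast
  then have "\<exists>m. m > 0 \<and> (\<forall>i. (c ^^ i) u1 = u1 \<longleftrightarrow> m dvd i)"
    using funpow_period[where f = c and n = n and v = u1] by metis
  then have "m > 0 \<and> (\<forall>i. (c ^^ i) u1 = u1 \<longleftrightarrow> m dvd i)"
    unfolding m_def by (rule someI_ex)
  then show "m > 0" "(c ^^ i) u1 = u1 \<longleftrightarrow> m dvd i" by auto
qed

lemma bij_c: "bij c" using bij_G H_subset c_in_H by blast

lemma c_pow_u1_eq_iff: "(c ^^ i) u1 = (c ^^ j) u1 \<longleftrightarrow> i mod m = j mod m"
  using funpow_eq_iff_mod[OF bij_c m(2)] .

lemma s_in_H: "s \<in> H" and s_u1: "s u1 = u1" and s_c: "s \<circ> c = c \<circ> s"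
  unfolding s_def using funpow_H[OF c_in_H] m by (auto simp: funpow_swap1 fun_eq_iff)

lemma pair_stabilizer:
  assumes "g \<in> G" "g u0 = u0" "g u1 = u1"
  obtains j where "g = s ^^ j \<or> g = s ^^ j \<circ> r2"
proof -
  obtain i where i: "g = c ^^ i \<or> g = c ^^ i \<circ> r2"
    using H_cases assms by (auto simp: H_def)
  then have "(c ^^ i) u1 = u1" using assms u1 by auto
  then obtain j where "i = m * j" using m by (auto simp: dvd_def)
  then have "c ^^ i = s ^^ j" by (simp add: s_def funpow_mult mult.commute)
  then show thesis using that i by metis
qed

lemma inverts_s: "r2 \<circ> s ^^ i = finv s ^^ i \<circ> r2" "r1 \<circ> s ^^ i = finv s ^^ i \<circ> r1"
proof -
  have "finv s = finv c ^^ m" unfolding s_def using bij_c inv_fn by metis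
  then show "r2 \<circ> s ^^ i = finv s ^^ i \<circ> r2" "r1 \<circ> s ^^ i = finv s ^^ i \<circ> r1"
    using funpow_conj[OF funpow_conj[OF inverts_c(1)]] funpow_conj[OF funpow_conj[OF inverts_c(2)]]
    by (simp_all add: s_def)
qed

text \<open>\<open>r1\<close> and \<open>r2\<close> invert \<open>s\<close>, so the premise makes
  its cyclic group normal. A normal subgroup of a transitive group that fixes one point fixes every
  point.\<close>

lemma s_normal_imp_id:
  assumes "r0 \<circ> s \<circ> r0 = s ^^ j"
  shows "s = id"
proof -
  obtain n where inv_s: "finv s = s ^^ n" using inv_pow[OF H_subset[OF s_in_H]] by blast
  have r0: "r0 \<circ> s = s ^^ j \<circ> r0"
    unfolding assms[symmetric] by (simp add: fun_eq_iff)
  have *: "\<exists>k. f \<circ> s ^^ i = s ^^ k \<circ> f" if "f \<in> {r0, r1, r2}" for f i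
    using that funpow_conj[OF r0, of i] inverts_s[of i] inv_s by (auto simp: funpow_mult)
  have "\<exists>k. g \<circ> s = s ^^ k \<circ> g" if "g \<in> G" for g
    using that unfolding G_def
  proof (induction rule: involution_span.induct)
    case id
    show ?case by (rule exI[of _ 1]) simp
  next
    case (step f g)
    then obtain k where "g \<circ> s = s ^^ k \<circ> g" by blast
    moreover obtain l where "f \<circ> s ^^ k = s ^^ l \<circ> f" using *[OF step(1)] by blast
    ultimately have "(f \<circ> g) \<circ> s = s ^^ l \<circ> (f \<circ> g)"
      by (simp add: fun_eq_iff)
    then show ?case by blast
  qed
  then have conj: "\<exists>k. finv g \<circ> s = s ^^ k \<circ> finv g" if "g \<in> G" for g using inv_G that by blast
  show ?thesis
  proof (rule eq_id)
    show "s \<in> G" by (rule H_subset[OF s_in_H])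
    fix v assume "v \<in> V"
    then obtain g where g: "g \<in> G" "g u0 = v" using transitive G_def by blast
    then obtain k where "finv g \<circ> s = s ^^ k \<circ> finv g" using conj by blast
    then have "g (finv g (s v)) = g ((s ^^ k) (finv g v))" by (simp add: fun_eq_iff)
    moreover have "finv g v = u0" using g inv_apply by metis
    ultimately have "s v = g ((s ^^ k) u0)" using inv_apply[OF g(1)] by simp
    then show "s v = v" using H_fix[OF funpow_H[OF s_in_H]] g by simp
  qed
qed

text \<open>\<open>r0\<close> swaps \<open>u0\<close> and \<open>u1\<close>, so it conjugates
  \<open>s\<close> into the stabiliser of that pair. Either the cyclic group of \<open>s\<close> is
  normalised, or the conjugate is a reflection \<open>s ^^ j \<circ> r2\<close>; then
  \<open>s\<close> is an involution too, and only the parity of \<open>j\<close> counts.\<close>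

lemma s_cases: "s = id \<or> (s \<circ> s = id \<and> r0 \<circ> s \<circ> r0 = s \<circ> r2)"
proof -
  have "r0 \<circ> s \<circ> r0 \<in> G" using gens_in_G comp_G H_subset[OF s_in_H] by blast
  moreover have "(r0 \<circ> s \<circ> r0) u0 = u0" "(r0 \<circ> s \<circ> r0) u1 = u1"
    using u1 s_u1 H_fix[OF s_in_H] by (auto simp: u1_def)
  ultimately obtain j where "r0 \<circ> s \<circ> r0 = s ^^ j \<or> r0 \<circ> s \<circ> r0 = s ^^ j \<circ> r2"
    using pair_stabilizer by blast
  then show ?thesis
  proof
    assume "r0 \<circ> s \<circ> r0 = s ^^ j"
    then show ?thesis using s_normal_imp_id by blast
  next
    assume j: "r0 \<circ> s \<circ> r0 = s ^^ j \<circ> r2"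
    have cancel: "(s ^^ j) ((finv s ^^ j) x) = x" for x
      using inv_apply(2)[OF funpow_G[OF H_subset[OF s_in_H]]] inv_fn[OF bij_G[OF H_subset[OF s_in_H]]]
      by simp
    have r2s: "r2 ((s ^^ j) x) = (finv s ^^ j) (r2 x)" for x
      using inverts_s(1) by (simp add: fun_eq_iff)
    have r0s: "r0 (s (r0 x)) = (s ^^ j) (r2 x)" for x
      using j by (simp add: fun_eq_iff)
    have "r0 (s (s (r0 x))) = x" for x
    proof -
      have "r0 (s (s (r0 x))) = r0 (s (r0 (r0 (s (r0 x)))))" by simp
      also have "\<dots> = (s ^^ j) (r2 ((s ^^ j) (r2 x)))" by (simp only: r0s)
      also have "\<dots> = x" by (simp add: r2s cancel)
      finally show ?thesis .
    qed
    from this[of "r0 _"] have "r0 (s (s x)) = r0 x" for x by simp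
    then have "s (s x) = x" for x using involution_apply(1) by metis
    then have ss: "s \<circ> s = id" by (simp add: fun_eq_iff)
    have "s ^^ j = id \<or> s ^^ j = s"
    proof (induction j)
      case (Suc j)
      then show ?case using ss by (metis comp_id funpow.simps(2))
    qed simp
    then consider "r0 \<circ> s \<circ> r0 = r2" | "r0 \<circ> s \<circ> r0 = s \<circ> r2" using j by auto
    then show ?thesis
    proof cases
      \<comment> \<open>Here \<open>r0\<close> conjugates \<open>s\<close> to \<open>r2\<close>,
        with which it commutes; so \<open>s = r2\<close>, and \<open>s\<close> is its own
        conjugate.\<close>
      case 1
      then have "(r0 \<circ> s \<circ> r0) (r0 x) = r2 (r0 x)" for x by simp
      then have "r0 (s x) = r2 (r0 x)" for x by simp
      then have "r0 (s x) = r0 (r2 x)" for x using commute by (metis comp_apply)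
      then have "r0 (r0 (s x)) = r0 (r0 (r2 x))" for x by (simp only:)
      then have "s x = r2 x" for x by (simp only: involution_apply)
      then have "s = r2" by (simp add: fun_eq_iff)
      then have "r0 \<circ> s \<circ> r0 = s ^^ 1" using 1 by simp
      then show ?thesis using s_normal_imp_id by blast
    qed (use ss in simp)
  qed
qed

subsection \<open>Neighbours of a vertex\<close>

text \<open>The graph on \<open>V\<close> whose edges are the images of the pair \<open>u0\<close>,
  \<open>u1\<close>; it is symmetric because \<open>r0\<close> swaps them.\<close>

definition nb where "nb v = {g u1 | g. g \<in> G \<and> g u0 = v}"

lemma nb_u0: "nb u0 = (\<lambda>i. (c ^^ i) u1) ` {..<m}"
proof
  show "nb u0 \<subseteq> (\<lambda>i. (c ^^ i) u1) ` {..<m}"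
  proof
    fix w assume "w \<in> nb u0"
    then obtain g where "g \<in> H" "w = g u1" by (auto simp: nb_def H_def)
    then obtain i where "w = (c ^^ i) u1" using H_cases[of g] u1 by auto
    then have "w = (c ^^ (i mod m)) u1" using c_pow_u1_eq_iff by auto
    then show "w \<in> (\<lambda>i. (c ^^ i) u1) ` {..<m}" using m(1) by auto
  qed
  show "(\<lambda>i. (c ^^ i) u1) ` {..<m} \<subseteq> nb u0"
    using funpow_H[OF c_in_H] by (auto simp: nb_def H_def)
qed

lemma nb_image: "g \<in> G \<Longrightarrow> nb (g v) = g ` nb v"
proof (intro equalityI subsetI)
  assume g: "g \<in> G"
  fix w
  show "w \<in> g ` nb v" if w: "w \<in> nb (g v)"
  proof -
    obtain f where f: "f \<in> G" "f u0 = g v" "w = f u1" using w by (auto simp: nb_def)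
    have "finv g \<circ> f \<in> G" "(finv g \<circ> f) u0 = v" "w = g ((finv g \<circ> f) u1)"
      using f g comp_G inv_G inv_comp_G[OF g] by (auto simp: fun_eq_iff)
    then show ?thesis unfolding nb_def by blast
  qed
  show "w \<in> nb (g v)" if w: "w \<in> g ` nb v"
  proof -
    obtain f where "f \<in> G" "f u0 = v" "w = g (f u1)" using w by (auto simp: nb_def)
    then have "g \<circ> f \<in> G" "(g \<circ> f) u0 = g v" "w = (g \<circ> f) u1" using g comp_G by auto
    then show ?thesis unfolding nb_def by blast
  qed
qed

lemma nb_sym: "w \<in> nb v \<Longrightarrow> v \<in> nb w"
proof -
  assume "w \<in> nb v"
  then obtain g where "g \<in> G" "g u0 = v" "w = g u1" by (auto simp: nb_def)
  then have "g \<circ> r0 \<in> G" "(g \<circ> r0) u0 = w" "v = (g \<circ> r0) u1"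
    using comp_G gens_in_G u1 by (auto simp: u1_def[symmetric])
  then show ?thesis unfolding nb_def by blast
qed

lemma nb_irrefl: "v \<notin> nb v"
proof
  assume "v \<in> nb v"
  then obtain g where g: "g \<in> G" "g u0 = v" "v = g u1" unfolding nb_def by blast
  then have "g u1 = g u0" by simp
  then show False using bij_is_inj[OF bij_G[OF g(1)]] u1(2) by (simp add: inj_eq)
qed

lemma nb_in_V: "v \<in> V \<Longrightarrow> nb v \<subseteq> V"
  unfolding nb_def using G_in_V u1 by auto

lemma card_nb: "v \<in> V \<Longrightarrow> card (nb v) = m"
proof -
  assume "v \<in> V"
  then obtain g where g: "g \<in> G" "g u0 = v" using transitive G_def by blast
  have "card (nb u0) = m"
    unfolding nb_u0 using c_pow_u1_eq_iff by (subst card_image) (simp_all add: inj_on_def)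
  then show ?thesis
    using nb_image[OF g(1), of u0] g(2) card_image[OF inj_on_subset[OF bij_is_inj[OF bij_G[OF g(1)]]], of "nb u0"]
    by simp
qed

lemma nb_pair:
  assumes "w \<in> nb v"
  obtains g where "g \<in> G" "v = g u0" "w = g u1" "nb v \<inter> nb w = g ` (nb u0 \<inter> nb u1)"
proof -
  obtain g where g: "g \<in> G" "g u0 = v" "w = g u1" using assms by (auto simp: nb_def)
  then have "nb v = g ` nb u0" "nb w = g ` nb u1" using nb_image by auto
  then have "nb v \<inter> nb w = g ` (nb u0 \<inter> nb u1)"
    using bij_G[OF g(1)] by (simp add: bij_is_inj image_Int)
  then show thesis using that g by blast
qed

lemma s_fixes_nb: "w \<in> nb u0 \<Longrightarrow> s w = w"
proof -
  assume "w \<in> nb u0"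
  then obtain i where w: "w = (c ^^ i) u1" unfolding nb_u0 by auto
  have "c ^^ i \<circ> s = s \<circ> c ^^ i" using funpow_conj[OF s_c, of i] by simp
  then show ?thesis using w s_u1 by (metis comp_apply)
qed

text \<open>For a common neighbour \<open>y\<close>, \<open>r0 y\<close> is a neighbour of
  \<open>u0\<close> and hence fixed by \<open>s\<close>, so the conjugate
  \<open>s \<circ> r2\<close> fixes \<open>y\<close>. As \<open>s\<close> also fixes the neighbour
  \<open>r2 y\<close>, \<open>r2\<close> fixes \<open>y\<close>. On the cycle of neighbours,
  \<open>r2\<close> is a reflection through \<open>u1\<close>, and its only other possible fixed
  point is the antipode.\<close>

lemma common_nb_unique:
  assumes "r0 \<circ> s \<circ> r0 = s \<circ> r2" "y \<in> nb u0 \<inter> nb u1"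
  shows "y = (c ^^ (m div 2)) u1"
proof -
  obtain j where j: "j < m" "y = (c ^^ j) u1" using assms(2) nb_u0 by auto
  have "nb u1 = r0 ` nb u0" unfolding u1_def using nb_image gens_in_G by blast
  then obtain z where z: "z \<in> nb u0" "y = r0 z" using assms(2) by auto
  have "r0 y = z" using z by simp
  then have "(r0 \<circ> s \<circ> r0) y = y" using s_fixes_nb[OF z(1)] z by simp
  then have sy: "s (r2 y) = y" using assms(1) by simp
  have "r2 y \<in> r2 ` nb u0" using assms(2) by blast
  then have "r2 y \<in> nb u0" using nb_image[OF gens_in_G(3), of u0] fixed by simp
  then have r2y: "r2 y = y" using sy s_fixes_nb by simp
  have "r2 \<circ> c ^^ j = finv c ^^ j \<circ> r2" by (rule funpow_conj[OF inverts_c(1)])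
  then have "r2 y = (finv c ^^ j) u1" using j u1 by (metis comp_apply)
  then have "(c ^^ j) ((finv c ^^ j) u1) = (c ^^ j) ((c ^^ j) u1)" using r2y j by simp
  moreover have "(c ^^ j) ((finv c ^^ j) u1) = u1"
    using inv_apply(2)[OF funpow_G[OF H_subset[OF c_in_H]]] inv_fn[OF bij_c] by simp
  ultimately have "(c ^^ (j + j)) u1 = u1" by (simp add: funpow_add)
  then have dvd: "m dvd j + j" using m by simp
  have "y \<noteq> u1" using assms(2) nb_irrefl by blast
  then have "j \<noteq> 0" using j by (metis funpow_0)
  then have "j + j = m" using double_eq_of_dvd dvd j(1) by blast
  then have "m div 2 = j" by auto
  then show ?thesis using j by simp
qed

text \<open>If \<open>2 * m\<close> exceeded \<open>b\<close>, inclusion-exclusion with at most one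
  common neighbour would make the neighbourhoods of adjacent vertices cover \<open>V\<close>. Then
  some vertex is adjacent to all others, hence so is \<open>u0\<close> because all neighbourhoods
  have \<open>m\<close> elements, and \<open>s\<close> fixes every vertex.\<close>

lemma two_m_le: 
  assumes "s \<noteq> id"
  shows "2 * m \<le> b"
proof (rule ccontr)
  assume "\<not> 2 * m \<le> b"
  have conj: "r0 \<circ> s \<circ> r0 = s \<circ> r2" using s_cases assms by blast
  define y where "y = (c ^^ (m div 2)) u1"
  have le1: "card (nb v \<inter> nb w) \<le> 1" if vw: "w \<in> nb v" for v w
  proof -
    obtain g where g: "nb v \<inter> nb w = g ` (nb u0 \<inter> nb u1)" using nb_pair[OF vw] by blast
    have "g ` (nb u0 \<inter> nb u1) \<subseteq> {g y}" using common_nb_unique[OF conj] y_def by auto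
    then have "card (g ` (nb u0 \<inter> nb u1)) \<le> card {g y}" by (rule card_mono[rotated]) simp
    then show ?thesis using g by simp
  qed
  have un: "nb v \<union> nb w = V" "nb v \<inter> nb w \<noteq> {}" if "v \<in> V" "w \<in> nb v" for v w
  proof -
    have w: "w \<in> V" using that nb_in_V by blast
    have sub: "nb v \<subseteq> V" "nb w \<subseteq> V" using nb_in_V that w by auto
    then have fin: "finite (nb v)" "finite (nb w)" using finite_V finite_subset by auto
    have sum: "card (nb v \<union> nb w) + card (nb v \<inter> nb w) = 2 * m"
      using card_Un_Int[OF fin] card_nb that w by simp
    have "card (nb v \<union> nb w) \<ge> b"
      using sum le1[OF that(2)] \<open>\<not> 2 * m \<le> b\<close> by linarith
    then show "nb v \<union> nb w = V"
      using card_seteq[OF finite_V, of "nb v \<union> nb w"] sub card_V by auto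
    then have "card (nb v \<inter> nb w) > 0"
      using sum card_V \<open>\<not> 2 * m \<le> b\<close> by simp
    then show "nb v \<inter> nb w \<noteq> {}" by auto
  qed
  have "u1 \<in> nb u0" unfolding nb_def using gens_in_G(4) by (intro CollectI exI[of _ id]) simp
  then have y: "y \<in> nb u0" "y \<in> nb u1" using un(2)[OF u0] common_nb_unique[OF conj] y_def by auto
  then have yV: "y \<in> V" using nb_in_V u0 by blast
  \<comment> \<open>By the covering property, a vertex outside \<open>nb y\<close> is a neighbour of
    both \<open>u0\<close> and \<open>u1\<close>, hence equals \<open>y\<close>.\<close>
  have "nb y = V - {y}"
  proof
    show "nb y \<subseteq> V - {y}" using nb_in_V[OF yV] nb_irrefl by blast
    show "V - {y} \<subseteq> nb y"
    proof
      fix w assume w: "w \<in> V - {y}"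
      show "w \<in> nb y"
      proof (rule ccontr)
        assume "w \<notin> nb y"
        then have "w \<in> nb u0 \<inter> nb u1"
          using w un(1)[OF yV nb_sym[OF y(1)]] un(1)[OF yV nb_sym[OF y(2)]] by blast
        then show False using common_nb_unique[OF conj] w y_def by blast
      qed
    qed
  qed
  then have "card (nb u0) = card (V - {u0})"
    using card_nb[OF u0] card_nb[OF yV] yV u0 finite_V by simp
  then have "nb u0 = V - {u0}"
    using nb_in_V[OF u0] nb_irrefl[of u0] finite_V by (intro card_seteq) auto
  then have "s = id"
    using s_fixes_nb H_fix[OF s_in_H] by (intro eq_id H_subset[OF s_in_H]) blast
  then show False using assms by simp
qed

lemma card_H_le: "card H \<le> 2 * (b - 1)"
proof -
  have m_le: "m \<le> b - 1"
    using card_nb[OF u0] card_mono[of "V - {u0}" "nb u0"] nb_in_V[OF u0] nb_irrefl[of u0]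
      finite_V card_V u0 by auto
  \<comment> \<open>\<open>k\<close> is a period of \<open>c\<close>, because
    \<open>c ^^ m = s\<close> is trivial or an involution.\<close>
  define k where "k = (if s = id then m else 2 * m)"
  have k: "c ^^ k = id"
    using s_cases by (auto simp: k_def s_def mult_2 funpow_add)
  have k_pos: "k > 0" using m by (simp add: k_def)
  have mod: "c ^^ i = c ^^ (i mod k)" for i
    using k by (metis comp_id funpow_add funpow_mult id_funpow mod_div_mult_eq mult.commute)
  define F where "F = (\<lambda>(i, e). c ^^ i \<circ> (if e then r2 else id))"
  have "H \<subseteq> F ` ({..<k} \<times> UNIV)"
  proof
    fix h assume "h \<in> H"
    then obtain i where "h = c ^^ i \<or> h = c ^^ i \<circ> r2" using H_cases by blast
    then have "h = c ^^ (i mod k) \<or> h = c ^^ (i mod k) \<circ> r2" using mod by metis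
    then have "h = F (i mod k, False) \<or> h = F (i mod k, True)" by (simp add: F_def)
    then show "h \<in> F ` ({..<k} \<times> UNIV)" using k_pos by auto
  qed
  then have "card H \<le> card ({..<k} \<times> (UNIV :: bool set))"
    by (intro surj_card_le) auto
  then have "card H \<le> 2 * k" by (simp add: card_cartesian_product)
  moreover have "k \<le> b - 1"
  proof (cases "s = id")
    case False
    \<comment> \<open>The parity of \<open>b\<close> improves \<open>2 * m \<le> b\<close> to the
      strict inequality required.\<close>
    have "2 * m \<noteq> b" using odd by auto
    then show ?thesis using two_m_le[OF False] False by (simp add: k_def)
  qed (use m_le in \<open>simp add: k_def\<close>)
  ultimately show ?thesis by linarith
qed

subsection \<open>A regular normal subgroup\<close>

abbreviation fun_monoid :: "('v \<Rightarrow> 'v) set \<Rightarrow> ('v \<Rightarrow> 'v) monoid" where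
  "fun_monoid A \<equiv> \<lparr>carrier = A, monoid.mult = (\<circ>), one = id\<rparr>"

lemma group_fun_monoid:
  assumes "A \<subseteq> G" "id \<in> A" "\<And>f g. f \<in> A \<Longrightarrow> g \<in> A \<Longrightarrow> f \<circ> g \<in> A"
  shows "group (fun_monoid A)"
proof (rule groupI)
  fix f assume "f \<in> carrier (fun_monoid A)"
  then have f: "f \<in> A" "f \<in> G" using assms by auto
  obtain n where n: "finv f = f ^^ n" using inv_pow[OF f(2)] by blast
  have "f ^^ k \<in> A" for k by (induction k) (use assms f in \<open>simp_all only: funpow.simps\<close>)
  then show "\<exists>g\<in>carrier (fun_monoid A). g \<otimes>\<^bsub>fun_monoid A\<^esub> f = \<one>\<^bsub>fun_monoid A\<^esub>"
    using n inv_comp_G(1)[OF f(2)] by (intro bexI[of _ "finv f"]) auto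
qed (use assms in \<open>auto simp: comp_assoc\<close>)

lemma card_dvd_card:
  assumes "A \<subseteq> B" "B \<subseteq> G" "id \<in> A"
    and "\<And>f g. f \<in> A \<Longrightarrow> g \<in> A \<Longrightarrow> f \<circ> g \<in> A" "\<And>f g. f \<in> B \<Longrightarrow> g \<in> B \<Longrightarrow> f \<circ> g \<in> B"
  shows "card A dvd card B"
proof -
  interpret B: group "fun_monoid B" using assms by (intro group_fun_monoid) auto
  have "group (fun_monoid A)" using assms by (intro group_fun_monoid) auto
  then have "subgroup A (fun_monoid B)"
    using assms(1,3,4) B.group_incl_imp_subgroup[of A] by simp
  then show ?thesis
    using B.lagrange[of A] by (simp add: order_def dvd_def) (metis mult.commute)
qed

lemma card_G: "card G = b * card H"
proof -
  have "\<exists>t. \<forall>v\<in>V. t v \<in> G \<and> t v u0 = v"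
    using transitive unfolding G_def by (intro bchoice) blast
  then obtain t where t: "\<And>v. v \<in> V \<Longrightarrow> t v \<in> G" "\<And>v. v \<in> V \<Longrightarrow> t v u0 = v" by blast
  have "bij_betw (\<lambda>(v, h). t v \<circ> h) (V \<times> H) G"
  proof (rule bij_betwI')
    fix x y assume xy: "x \<in> V \<times> H" "y \<in> V \<times> H"
    obtain v h w k where [simp]: "x = (v, h)" "y = (w, k)" by (cases x; cases y)
    have mem: "v \<in> V" "w \<in> V" "h \<in> H" "k \<in> H" using xy by auto
    show "((\<lambda>(v, h). t v \<circ> h) x = (\<lambda>(v, h). t v \<circ> h) y) = (x = y)"
    proof
      assume "(\<lambda>(v, h). t v \<circ> h) x = (\<lambda>(v, h). t v \<circ> h) y"
      then have eq: "t v \<circ> h = t w \<circ> k" by simp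
      then have "(t v \<circ> h) u0 = (t w \<circ> k) u0" by simp
      then have "v = w"
        using H_fix[OF mem(3)] H_fix[OF mem(4)] t(2)[OF mem(1)] t(2)[OF mem(2)] by simp
      then show "x = y"
        using eq inv_comp_left[OF t(1)[OF mem(1)] eq] inv_comp_left[OF t(1)[OF mem(1)] refl, of k] by simp
    qed simp
  next
    fix x assume "x \<in> V \<times> H"
    then show "(\<lambda>(v, h). t v \<circ> h) x \<in> G" using t H_subset by (auto intro: comp_G)
  next
    fix g assume g: "g \<in> G"
    then have v: "g u0 \<in> V" using G_in_V u0 by blast
    have "finv (t (g u0)) \<circ> g \<in> H"
      using comp_G[OF inv_G[OF t(1)[OF v]] g] inv_apply(1)[OF t(1)[OF v], of u0] t(2)[OF v]
      by (simp add: H_def)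
    moreover have "g = t (g u0) \<circ> (finv (t (g u0)) \<circ> g)"
      using inv_apply(2)[OF t(1)[OF v]] by (simp add: fun_eq_iff)
    ultimately show "\<exists>x\<in>V \<times> H. g = (\<lambda>(v, h). t v \<circ> h) x"
      using v by (intro bexI[of _ "(g u0, finv (t (g u0)) \<circ> g)"]) auto
  qed
  then show ?thesis using bij_betw_same_card card_V by (metis card_cartesian_product)
qed

lemma finite_H: "finite H" using finite_subset[OF _ finite_G] H_subset by blast

definition tau where "tau = (SOME f. f \<in> G \<and> f ^^ b = id \<and> f \<noteq> id)"

lemma tau: "tau \<in> G" "tau ^^ b = id" "tau \<noteq> id"
proof -
  interpret G: group "fun_monoid G" using group_fun_monoid gens_in_G comp_G by blast
  \<comment> \<open>The exponent \<open>1\<close> is enough whether or not \<open>b\<close> also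
    divides \<open>card H\<close>: the Sylow theorem yields a subgroup of order exactly
    \<open>b\<close>.\<close>
  obtain P where P: "subgroup P (fun_monoid G)" "card P = b ^ 1"
    using sylow_thm[OF prime G.is_group, of 1 "card H"] card_G finite_G by (auto simp: order_def)
  then have "P \<noteq> {id}" using b_gt_2 by auto
  moreover have "id \<in> P" using subgroup.one_closed[OF P(1)] by simp
  ultimately obtain f where f: "f \<in> P" "f \<noteq> id" by blast
  interpret P: group "fun_monoid G\<lparr>carrier := P\<rparr>" using G.subgroup_imp_group[OF P(1)] .
  have pow: "f [^]\<^bsub>fun_monoid G\<lparr>carrier := P\<rparr>\<^esub> n = f ^^ n" for n :: nat
    by (induction n) (simp_all add: funpow_swap1 fun_eq_iff)
  have "f ^^ b = id"
    using P.pow_order_eq_1[of f] f P(2) pow by (simp add: order_def)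
  moreover have "f \<in> G" using subgroup.subset[OF P(1)] f by auto
  ultimately have "\<exists>f. f \<in> G \<and> f ^^ b = id \<and> f \<noteq> id" using f by blast
  then have "tau \<in> G \<and> tau ^^ b = id \<and> tau \<noteq> id" unfolding tau_def by (rule someI_ex)
  then show "tau \<in> G" "tau ^^ b = id" "tau \<noteq> id" by auto
qed

text \<open>Some point is moved by \<open>tau\<close>; its orbit length divides the prime
  \<open>b\<close>, so it is \<open>b\<close>, and the orbit is all of \<open>V\<close>.\<close>

lemma tau_regular:
  assumes "v \<in> V"
  shows "(tau ^^ i) v = v \<longleftrightarrow> b dvd i"
proof -
  obtain w where w: "w \<in> V" "tau w \<noteq> w" using eq_id tau by blast
  obtain p where p: "p > 0" "\<And>i. (tau ^^ i) w = w \<longleftrightarrow> p dvd i"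
    using funpow_period[where f = tau and v = w] tau b_gt_2 by (metis gr_implies_not0 neq0_conv)
  have "p dvd b" using p(2)[of b] tau by simp
  moreover have "p \<noteq> 1" using p(2)[of 1] w by auto
  ultimately have "p = b" using prime by (auto simp: prime_nat_iff)
  then have eq: "(tau ^^ i) w = (tau ^^ j) w \<longleftrightarrow> i mod b = j mod b" for i j
    using funpow_eq_iff_mod[OF bij_G[OF tau(1)] p(2)] by simp
  have "card ((\<lambda>i. (tau ^^ i) w) ` {..<b}) = b"
    using eq by (subst card_image) (simp_all add: inj_on_def)
  moreover have "(\<lambda>i. (tau ^^ i) w) ` {..<b} \<subseteq> V"
    using G_in_V[OF funpow_G[OF tau(1)]] w by auto
  ultimately have "(\<lambda>i. (tau ^^ i) w) ` {..<b} = V"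
    using card_V finite_V card_subset_eq by metis
  then obtain k where k: "v = (tau ^^ k) w" using assms by blast
  then have "(tau ^^ i) v = v \<longleftrightarrow> (i + k) mod b = k mod b"
    using eq[of "i + k" k] by (simp add: funpow_add)
  also have "\<dots> \<longleftrightarrow> b dvd i"
    using mod_eq_dvd_iff_nat[of k "i + k" b] by simp
  finally show ?thesis .
qed

lemma tau_eq_iff: "v \<in> V \<Longrightarrow> (tau ^^ i) v = (tau ^^ j) v \<longleftrightarrow> i mod b = j mod b"
  using funpow_eq_iff_mod[OF bij_G[OF tau(1)]] tau_regular by blast

lemma tau_transitive:
  assumes "v \<in> V" "w \<in> V"
  obtains i where "i < b" "(tau ^^ i) v = w"
proof -
  have "card ((\<lambda>i. (tau ^^ i) v) ` {..<b}) = b"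
    using tau_eq_iff[OF assms(1)] by (subst card_image) (simp_all add: inj_on_def)
  moreover have "(\<lambda>i. (tau ^^ i) v) ` {..<b} \<subseteq> V"
    using G_in_V[OF funpow_G[OF tau(1)]] assms by auto
  ultimately have "(\<lambda>i. (tau ^^ i) v) ` {..<b} = V"
    using card_V finite_V card_subset_eq by metis
  then show thesis using assms that by blast
qed

lemma tau_mod: "tau ^^ (i mod b) = tau ^^ i"
proof -
  have "tau ^^ i = tau ^^ (i mod b) \<circ> (tau ^^ b) ^^ (i div b)"
    by (metis funpow_add funpow_mult mod_mult_div_eq)
  then show ?thesis using tau by simp
qed

text \<open>\<open>i * (b - 1)\<close> is a natural exponent for the inverse of
  \<open>tau ^^ i\<close>.\<close>

lemma tau_cancel: "tau ^^ (i * (b - 1)) \<circ> tau ^^ i = id"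
proof -
  have "i * (b - 1) + i = b * i" using b_gt_2 by (cases b) auto
  then show ?thesis using tau(2) by (metis funpow_add funpow_mult id_funpow)
qed

lemma tau_cancel': "tau ^^ i \<circ> tau ^^ (i * (b - 1)) = id"
  using tau_cancel by (metis add.commute funpow_add)

section \<open>The normaliser of the translations inside the point stabiliser\<close>

definition D where "D = {h \<in> H. \<exists>l. h \<circ> tau = tau ^^ l \<circ> h}"

lemma tau_pow_generates:
  assumes "\<not> b dvd i"
  obtains x where "(tau ^^ i) ^^ x = tau"
proof -
  have "gcd i b = 1"
    using prime_imp_coprime[OF prime assms] by (simp add: coprime_iff_gcd_eq_1 gcd.commute)
  moreover have "i \<noteq> 0" using assms by (metis dvd_0_right)
  ultimately obtain x y where "i * x = b * y + 1" using bezout_nat[of i b] by auto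
  then have "(i * x) mod b = 1" using b_gt_2 mod_mult_self4[of b y 1] by simp
  then have "tau ^^ (i * x) = tau" using tau_mod[of "i * x"] by simp
  then have "(tau ^^ i) ^^ x = tau" by (simp add: funpow_mult)
  then show thesis using that by blast
qed

text \<open>One nontrivial power is enough, since it generates a group of prime order and so gives
  back \<open>tau\<close>.\<close>

lemma D_I:
  assumes "h \<in> H" "h \<circ> tau ^^ i = tau ^^ j \<circ> h" "\<not> b dvd i"
  shows "h \<in> D"
proof -
  obtain x where "(tau ^^ i) ^^ x = tau" using tau_pow_generates[OF assms(3)] by blast
  then have "h \<circ> tau = tau ^^ (j * x) \<circ> h"
    using funpow_conj[OF assms(2), of x] by (simp add: funpow_mult)
  then show ?thesis using assms(1) unfolding D_def by blast
qed

lemma D_subset: "D \<subseteq> H" and id_in_D: "id \<in> D" and finite_D: "finite D"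
  using gens_in_H finite_subset[OF _ finite_H] by (auto simp: D_def intro: exI[of _ 1])

lemma comp_D: "f \<in> D \<Longrightarrow> g \<in> D \<Longrightarrow> f \<circ> g \<in> D"
proof -
  assume "f \<in> D" "g \<in> D"
  then obtain k l where kl: "f \<circ> tau = tau ^^ k \<circ> f" "g \<circ> tau = tau ^^ l \<circ> g" "f \<in> H" "g \<in> H"
    by (auto simp: D_def)
  have "(f \<circ> g) \<circ> tau = (f \<circ> tau ^^ l) \<circ> g" using kl(2) by (simp add: comp_assoc)
  also have "f \<circ> tau ^^ l = (tau ^^ k) ^^ l \<circ> f" by (rule funpow_conj[OF kl(1)])
  finally have "(f \<circ> g) \<circ> tau = tau ^^ (k * l) \<circ> (f \<circ> g)" by (simp only: comp_assoc funpow_mult)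
  then show ?thesis using kl comp_H unfolding D_def by blast
qed

lemma card_D_dvd: "card D dvd card H"
  using D_subset id_in_D comp_D comp_H H_subset by (intro card_dvd_card) auto

lemma translate_unique:
  assumes "tau ^^ i \<circ> f \<in> H" "tau ^^ j \<circ> f \<in> H"
  shows "tau ^^ i \<circ> f = tau ^^ j \<circ> f"
proof -
  have "(tau ^^ i) (f u0) = u0" "(tau ^^ j) (f u0) = u0" using assms H_fix by fastforce+
  moreover from this have "f u0 \<in> V" using G_in_V[OF funpow_G[OF tau(1), of i], of "f u0"] u0 by simp
  ultimately have "i mod b = j mod b" using tau_eq_iff by metis
  then show ?thesis using tau_mod by metis
qed

text \<open>By regularity every coset of the translations contains exactly one element fixing
  \<open>u0\<close>. \<open>shift h j\<close> is the one in the coset of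
  \<open>h \<circ> tau ^^ j\<close>: right multiplication by \<open>tau ^^ j\<close>, transported
  from the cosets to \<open>H\<close>.\<close>

definition shift where "shift h j = tau ^^ (SOME i. (tau ^^ i) (h ((tau ^^ j) u0)) = u0) \<circ> (h \<circ> tau ^^ j)"

lemma shift_in_H:
  assumes "h \<in> H"
  shows "shift h j \<in> H"
proof -
  have g: "h \<circ> tau ^^ j \<in> G" using assms H_subset comp_G funpow_G tau by blast
  then have "h ((tau ^^ j) u0) \<in> V" using G_in_V u0 by fastforce
  then obtain i where "(tau ^^ i) (h ((tau ^^ j) u0)) = u0" using tau_transitive u0 by blast
  then have "(tau ^^ (SOME i. (tau ^^ i) (h ((tau ^^ j) u0)) = u0)) (h ((tau ^^ j) u0)) = u0"
    by (rule someI)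
  then show ?thesis using g comp_G funpow_G[OF tau(1)] by (simp add: H_def shift_def)
qed

lemma shift_eq:
  assumes "h \<in> H" "x \<in> H" "x = tau ^^ i \<circ> (h \<circ> tau ^^ j)"
  shows "x = shift h j"
  using translate_unique[of i "h \<circ> tau ^^ j"] shift_in_H[OF assms(1), of j] assms(2,3)
  unfolding shift_def by blast

text \<open>Orbits of the transported action that meet are equal; cancelling translations on both
  sides solves for \<open>k\<close>.\<close>

lemma shift_shift:
  assumes "h \<in> H" "k \<in> H" "shift h i = shift k j"
  shows "k \<in> shift h ` {..<b}"
proof -
  obtain i' j' where eq: "tau ^^ i' \<circ> (h \<circ> tau ^^ i) = tau ^^ j' \<circ> (k \<circ> tau ^^ j)"
    using assms(3) unfolding shift_def by blast
  have "k = (tau ^^ (j' * (b - 1)) \<circ> tau ^^ j') \<circ> (k \<circ> (tau ^^ j \<circ> tau ^^ (j * (b - 1))))"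
    by (simp only: tau_cancel tau_cancel' id_comp comp_id)
  also have "\<dots> = tau ^^ (j' * (b - 1)) \<circ> (tau ^^ j' \<circ> (k \<circ> tau ^^ j)) \<circ> tau ^^ (j * (b - 1))"
    by (simp only: comp_assoc)
  also have "\<dots> = (tau ^^ (j' * (b - 1)) \<circ> tau ^^ i') \<circ> (h \<circ> (tau ^^ i \<circ> tau ^^ (j * (b - 1))))"
    unfolding eq[symmetric] by (simp only: comp_assoc)
  also have "\<dots> = tau ^^ (j' * (b - 1) + i') \<circ> (h \<circ> tau ^^ ((i + j * (b - 1)) mod b))"
    by (simp only: funpow_add tau_mod)
  finally have "k = shift h ((i + j * (b - 1)) mod b)"
    using shift_eq[OF assms(1,2)] by blast
  then show ?thesis using b_gt_2 by auto
qed

lemma shift_not_in_D: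
  assumes "h \<in> H" "h \<notin> D"
  shows "shift h j \<notin> D"
proof
  assume "shift h j \<in> D"
  then obtain i l where "tau ^^ i \<circ> (h \<circ> tau ^^ j) \<circ> tau = tau ^^ l \<circ> (tau ^^ i \<circ> (h \<circ> tau ^^ j))"
    unfolding shift_def D_def by blast
  then have "(tau ^^ i \<circ> (h \<circ> tau ^^ j) \<circ> tau) \<circ> tau ^^ (j * (b - 1))
      = tau ^^ l \<circ> (tau ^^ i \<circ> (h \<circ> tau ^^ j)) \<circ> tau ^^ (j * (b - 1))" by simp
  moreover have "tau ^^ j \<circ> tau \<circ> tau ^^ (j * (b - 1)) = tau \<circ> (tau ^^ j \<circ> tau ^^ (j * (b - 1)))"
    by (simp add: fun_eq_iff funpow_swap1)
  ultimately have "tau ^^ i \<circ> (h \<circ> tau) = tau ^^ l \<circ> (tau ^^ i \<circ> h)"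
    by (simp only: comp_assoc tau_cancel' comp_id)
  then have "(tau ^^ (i * (b - 1)) \<circ> tau ^^ i) \<circ> (h \<circ> tau) = (tau ^^ (i * (b - 1)) \<circ> tau ^^ (l + i)) \<circ> h"
    by (simp only: comp_assoc funpow_add)
  then have "h \<circ> tau = tau ^^ (i * (b - 1) + (l + i)) \<circ> h"
    by (simp only: tau_cancel id_comp funpow_add)
  then show False using assms unfolding D_def by blast
qed

text \<open>If the orbit of \<open>h\<close> closed up early, \<open>h\<close> would conjugate a
  nontrivial \<open>tau ^^ (j - i)\<close> into the translations and therefore lie in
  \<open>D\<close>.\<close>

lemma inj_on_shift:
  assumes "h \<in> H" "h \<notin> D"
  shows "inj_on (shift h) {..<b}"
proof (rule linorder_inj_onI)
  fix i j assume ij: "i < j" "i \<in> {..<b}" "j \<in> {..<b}"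
  show "shift h i \<noteq> shift h j"
  proof
    assume "shift h i = shift h j"
    then obtain k l where eq: "tau ^^ k \<circ> (h \<circ> tau ^^ i) = tau ^^ l \<circ> (h \<circ> tau ^^ j)"
      unfolding shift_def by blast
    have "tau ^^ j = tau ^^ (j - i) \<circ> tau ^^ i" using ij funpow_add[of "j - i" i tau] by simp
    then have diff: "tau ^^ j \<circ> tau ^^ (i * (b - 1)) = tau ^^ (j - i)"
      by (simp only: comp_assoc tau_cancel' comp_id)
    have "tau ^^ k \<circ> (h \<circ> (tau ^^ i \<circ> tau ^^ (i * (b - 1))))
        = (tau ^^ k \<circ> (h \<circ> tau ^^ i)) \<circ> tau ^^ (i * (b - 1))" by (simp only: comp_assoc)
    also have "\<dots> = tau ^^ l \<circ> (h \<circ> (tau ^^ j \<circ> tau ^^ (i * (b - 1))))"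
      unfolding eq by (simp only: comp_assoc)
    finally have "tau ^^ k \<circ> h = tau ^^ l \<circ> (h \<circ> tau ^^ (j - i))"
      by (simp only: tau_cancel' comp_id diff)
    then have "(tau ^^ (l * (b - 1)) \<circ> tau ^^ k) \<circ> h = (tau ^^ (l * (b - 1)) \<circ> tau ^^ l) \<circ> (h \<circ> tau ^^ (j - i))"
      by (simp only: comp_assoc)
    then have "h \<circ> tau ^^ (j - i) = tau ^^ (l * (b - 1) + k) \<circ> h"
      by (simp only: tau_cancel id_comp funpow_add)
    moreover have "\<not> b dvd j - i" using ij by (auto dest: dvd_imp_le)
    ultimately show False using D_I assms by blast
  qed
qed auto

text \<open>Orbits outside \<open>D\<close> have length \<open>b\<close>, and
  \<open>card_H_le\<close> leaves room for only one: \<open>card H = card D + b\<close>. By Lagrange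
  \<open>card D\<close> then divides \<open>b\<close>, and \<open>card D = b\<close> would give
  \<open>card H = 2 * b\<close>.\<close>

lemma D_trivial:
  assumes "h \<in> H" "h \<notin> D"
  shows "D = {id}"
proof -
  have card_orbit: "card (shift k ` {..<b}) = b" "shift k ` {..<b} \<subseteq> H - D" if "k \<in> H" "k \<notin> D" for k
    using card_image[OF inj_on_shift[OF that]] shift_in_H shift_not_in_D that by auto
  have "H - D \<subseteq> shift h ` {..<b}"
  proof
    fix k assume k: "k \<in> H - D"
    show "k \<in> shift h ` {..<b}"
    proof (rule ccontr)
      assume "k \<notin> shift h ` {..<b}"
      then have "shift h ` {..<b} \<inter> shift k ` {..<b} = {}"
        using shift_shift[OF assms(1)] k by blast
      then have "card (shift h ` {..<b} \<union> shift k ` {..<b}) = 2 * b"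
        using card_orbit k assms by (subst card_Un_disjoint) auto
      moreover have "shift h ` {..<b} \<union> shift k ` {..<b} \<subseteq> H" using card_orbit k assms by blast
      ultimately have "2 * b \<le> card H" using card_mono[OF finite_H] by metis
      then show False using card_H_le b_gt_2 by simp
    qed
  qed
  then have "H - D = shift h ` {..<b}" using card_orbit assms by blast
  then have "card (H - D) = b" using card_orbit assms by simp
  then have sum: "card H = card D + b"
    using card_Diff_subset[OF finite_D D_subset] card_mono[OF finite_H D_subset] by simp
  then have "card D dvd b" using card_D_dvd by (metis dvd_add_right_iff dvd_refl)
  then have "card D = 1 \<or> card D = b" using prime by (auto simp: prime_nat_iff)
  then have "card D = 1" using sum card_H_le b_gt_2 by auto
  then show ?thesis using id_in_D by (auto simp: card_1_singleton_iff)
qed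

text \<open>If only the identity of the stabiliser \<^term>\<open>H\<close> normalises the translations, their conjugates
  are so many fixed-point-free elements that every other element lies in every vertex stabiliser.\<close>

lemma normalises_translations: "h \<in> H \<Longrightarrow> h \<in> D"
proof (rule ccontr)
  assume "h \<in> H" "h \<notin> D"
  then have D: "D = {id}" by (rule D_trivial)
  define cj where "cj = (\<lambda>(h :: 'v \<Rightarrow> 'v, i). h \<circ> tau ^^ i \<circ> finv h)"
  define X where "X = cj ` (H \<times> {1..<b})"
  have X_G: "X \<subseteq> G"
    unfolding X_def cj_def using H_subset comp_G inv_G funpow_G tau by auto
  have no_fix: "x v \<noteq> v" if x: "x \<in> X" and v: "v \<in> V" for x v
  proof
    assume "x v = v"
    obtain h i where hi: "h \<in> H" "i \<in> {1..<b}" "x = h \<circ> tau ^^ i \<circ> finv h"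
      using x unfolding X_def cj_def by auto
    then have "h ((tau ^^ i) (finv h v)) = v" using \<open>x v = v\<close> by simp
    then have "(tau ^^ i) (finv h v) = finv h v"
      using inv_apply[OF H_subset[OF hi(1)]] by metis
    moreover have "finv h v \<in> V" using G_in_V[OF inv_G[OF H_subset[OF hi(1)]]] v by simp
    ultimately have "b dvd i" using tau_regular by blast
    then show False using hi by (auto dest: dvd_imp_le)
  qed
  \<comment> \<open>A coincidence makes \<open>finv k \<circ> h\<close> carry a power of
    \<open>tau\<close> to a power of \<open>tau\<close>, so it lies in \<open>D\<close>, which is
    trivial here.\<close>
  have "inj_on cj (H \<times> {1..<b})"
  proof (rule inj_onI)
    fix x y assume xy: "x \<in> H \<times> {1..<b}" "y \<in> H \<times> {1..<b}" "cj x = cj y"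
    obtain h i k j where [simp]: "x = (h, i)" "y = (k, j)" by (cases x; cases y)
    have mem: "h \<in> H" "k \<in> H" "i \<in> {1..<b}" "j \<in> {1..<b}" using xy by auto
    have eq: "h ((tau ^^ i) (finv h v)) = k ((tau ^^ j) (finv k v))" for v
      using xy(3) by (simp add: cj_def fun_eq_iff)
    have "finv k \<circ> h \<circ> tau ^^ i = tau ^^ j \<circ> (finv k \<circ> h)"
    proof
      fix v
      have "h ((tau ^^ i) v) = k ((tau ^^ j) (finv k (h v)))"
        using eq[of "h v"] inv_apply[OF H_subset[OF mem(1)]] by simp
      then show "(finv k \<circ> h \<circ> tau ^^ i) v = (tau ^^ j \<circ> (finv k \<circ> h)) v"
        using inv_apply[OF H_subset[OF mem(2)]] by simp
    qed
    moreover have "\<not> b dvd i" using mem by (auto dest: dvd_imp_le)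
    ultimately have "finv k \<circ> h \<in> D" using D_I comp_H inv_H mem by blast
    then have kh: "finv k \<circ> h = id" using D by blast
    then have "k (finv k (h v)) = k v" for v by (simp add: fun_eq_iff)
    then have hk: "h = k" using inv_apply[OF H_subset[OF mem(2)]] by (simp add: fun_eq_iff)
    then have "(tau ^^ i) v = (tau ^^ j) v" for v
      using eq[of "h v"] inv_apply[OF H_subset[OF mem(2)]] bij_is_inj[OF bij_G[OF H_subset[OF mem(2)]]]
      by (simp add: inj_eq)
    then have "i mod b = j mod b" using tau_eq_iff[OF u0] by blast
    then show "x = y" using hk mem by simp
  qed
  then have "card X = card H * (b - 1)"
    unfolding X_def by (simp add: card_image card_cartesian_product)
  then have card_GX: "card (G - X) = card H"
    using card_Diff_subset[OF finite_subset[OF X_G finite_G] X_G] card_G b_gt_2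
    by (cases b) (auto simp: algebra_simps)
  \<comment> \<open>The stabiliser of \<open>v\<close> avoids \<open>X\<close> and, being conjugate
    to \<open>H\<close>, is as large as what \<open>X\<close> leaves over.\<close>
  have stab: "{g \<in> G. g v = v} = G - X" if v: "v \<in> V" for v
  proof (rule card_seteq)
    show "finite (G - X)" using finite_G by simp
    show "{g \<in> G. g v = v} \<subseteq> G - X" using no_fix v by blast
    obtain g where g: "g \<in> G" "g u0 = v" using transitive[OF v] unfolding G_def by blast
    have "inj_on (\<lambda>h. g \<circ> h \<circ> finv g) H"
    proof (rule inj_onI)
      fix x y assume "g \<circ> x \<circ> finv g = g \<circ> y \<circ> finv g"
      then have "g (x (finv g (g v))) = g (y (finv g (g v)))" for v by (metis comp_apply)
      then have "x v = y v" for v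
        using inv_apply[OF g(1)] by metis
      then show "x = y" by blast
    qed
    moreover have "(\<lambda>h. g \<circ> h \<circ> finv g) ` H \<subseteq> {g \<in> G. g v = v}"
    proof
      fix x assume "x \<in> (\<lambda>h. g \<circ> h \<circ> finv g) ` H"
      then obtain h where h: "h \<in> H" "x = g \<circ> h \<circ> finv g" by blast
      have "finv g v = u0" using g inv_apply by metis
      then have "x v = v" using h H_fix[OF h(1)] g by simp
      then show "x \<in> {g \<in> G. g v = v}" using h comp_G inv_G g(1) H_subset by simp
    qed
    moreover have "finite {g \<in> G. g v = v}" using finite_G by simp
    ultimately show "card (G - X) \<le> card {g \<in> G. g v = v}"
      unfolding card_GX by (rule card_inj_on_le)
  qed
  have "g = id" if "g \<in> H" for g
  proof (rule eq_id[OF H_subset[OF that]])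
    fix v assume "v \<in> V"
    have "g \<in> G - X" using stab[OF u0] that by (auto simp: H_def)
    then show "g v = v" using stab[OF \<open>v \<in> V\<close>] by blast
  qed
  then show False using \<open>h \<in> H\<close> \<open>h \<notin> D\<close> id_in_D by blast
qed

lemma u1_translate: obtains j where "u1 = (tau ^^ j) u0" "0 < j" "j < b"
proof -
  obtain j where "j < b" "(tau ^^ j) u0 = u1" using tau_transitive u0 u1 by blast
  moreover from this have "j \<noteq> 0" using u1 by (metis funpow_0)
  ultimately show thesis using that[of j] by simp
qed

text \<open>A permutation commuting with a transitive group is determined by a single value.\<close>

lemma centralises_imp_id:
  assumes "h \<in> H" "h \<circ> tau = tau \<circ> h"
  shows "h = id"
proof (rule eq_id[OF H_subset[OF assms(1)]])
  fix v assume "v \<in> V"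
  then obtain i where "v = (tau ^^ i) u0" using tau_transitive u0 by metis
  moreover have "h \<circ> tau ^^ i = tau ^^ i \<circ> h" by (rule funpow_conj[OF assms(2)])
  ultimately show "h v = v" using H_fix[OF assms(1)] by (metis comp_apply)
qed

text \<open>\<open>r2\<close> fixes both \<open>u0\<close> and \<open>u1 = (tau ^^ j) u0\<close>, so
  the translation into which it conjugates \<open>tau ^^ j\<close> agrees with
  \<open>tau ^^ j\<close> at \<open>u0\<close>, hence everywhere. Thus \<open>r2\<close> centralises
  the translations.\<close>

theorem r2_trivial: "r2 = id"
proof -
  obtain j where j: "u1 = (tau ^^ j) u0" "0 < j" "j < b" by (rule u1_translate)
  obtain l where l: "r2 \<circ> tau = tau ^^ l \<circ> r2"
    using normalises_translations[OF gens_in_H(2)] unfolding D_def by blast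
  have r2_pow: "r2 \<circ> tau ^^ j = tau ^^ (l * j) \<circ> r2"
    using funpow_conj[OF l, of j] by (simp add: funpow_mult)
  then have "r2 ((tau ^^ j) u0) = (tau ^^ (l * j)) u0"
    using fixed by (metis comp_apply)
  then have "(tau ^^ (l * j)) u0 = (tau ^^ j) u0" using u1 j by simp
  then have "(l * j) mod b = j mod b" using tau_eq_iff[OF u0] by simp
  then have "r2 \<circ> tau ^^ j = tau ^^ j \<circ> r2" using r2_pow tau_mod by metis
  moreover have "\<not> b dvd j" using j by (auto dest: dvd_imp_le)
  then obtain x where "(tau ^^ j) ^^ x = tau" by (rule tau_pow_generates)
  ultimately have "r2 \<circ> tau = tau \<circ> r2" using funpow_conj by metis
  then show ?thesis using centralises_imp_id gens_in_H by blast
qed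

text \<open>With \<open>r2\<close> trivial, \<open>H\<close> is \<open>{id, r1}\<close>. Correcting
  \<open>r0\<close> by a translation lands in \<open>H\<close>, and not at the identity: a
  nontrivial translation has odd order, while \<open>r0\<close> is an involution. So
  \<open>r0 \<circ> r1\<close> is itself a translation.\<close>

theorem r0_r1_cycle: "((r0 \<circ> r1) ^^ i) u0 = u0 \<longleftrightarrow> b dvd i"
proof -
  obtain j where j: "u1 = (tau ^^ j) u0" "0 < j" "j < b" by (rule u1_translate)
  have not_dvd: "\<not> b dvd j" using j by (auto dest: dvd_imp_le)
  have H: "h = id \<or> h = r1" if "h \<in> H" for h
  proof -
    have "h \<in> involution_span {r1, r2}" using that stabilizer by (auto simp: H_def G_def)
    then show ?thesis
      by (induction rule: involution_span.induct) (use involution r2_trivial in auto)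
  qed
  define f where "f = tau ^^ (j * (b - 1)) \<circ> r0"
  have "f u0 = (tau ^^ (j * (b - 1)) \<circ> tau ^^ j) u0"
    using j by (simp add: f_def u1_def)
  then have "f u0 = u0" unfolding tau_cancel by simp
  then have "f \<in> H" using comp_G[OF funpow_G[OF tau(1)] gens_in_G(1)] by (simp add: H_def f_def)
  then have "f = id \<or> f = r1" by (rule H)
  moreover have r0: "r0 = tau ^^ j \<circ> f"
    unfolding f_def comp_assoc[symmetric] tau_cancel' by simp
  moreover have "r0 \<noteq> tau ^^ j"
  proof
    assume "r0 = tau ^^ j"
    then have "tau ^^ (j + j) = id" using involution(1) by (simp add: funpow_add)
    then have "b dvd 2 * j" using tau_regular[OF u0, of "j + j"] by (simp add: mult_2)
    then have "b dvd 2" using prime not_dvd prime_dvd_mult_iff by blast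
    then show False using b_gt_2 by (auto dest: dvd_imp_le)
  qed
  ultimately have "r0 = tau ^^ j \<circ> r1" by auto
  then have "r0 \<circ> r1 = (tau ^^ j \<circ> r1) \<circ> r1" by (rule arg_cong[where f = "\<lambda>f. f \<circ> r1"])
  also have "\<dots> = tau ^^ j \<circ> (r1 \<circ> r1)" by (rule comp_assoc)
  finally have "r0 \<circ> r1 = tau ^^ j" using involution(2) by simp
  then have "((r0 \<circ> r1) ^^ i) u0 = u0 \<longleftrightarrow> b dvd j * i"
    using tau_regular[OF u0] by (simp add: funpow_mult)
  also have "\<dots> \<longleftrightarrow> b dvd i" using prime not_dvd prime_dvd_mult_iff by blast
  finally show ?thesis .
qed

end

section \<open>Regular polyhedra and their automorphism groups\<close>

text \<open>Ranks are shifted so that the least face has level \<open>0\<close> and the greatest one level \<open>4\<close>.\<close>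

definition level :: "'a rel \<Rightarrow> 'a \<Rightarrow> nat" where
  "level r x = card {y \<in> (SOME \<Phi>. \<Phi> \<in> flags r \<and> x \<in> \<Phi>). (y, x) \<in> r \<and> y \<noteq> x}"

locale polyhedron =
  fixes r :: "'a rel"
  assumes polytope: "abstract_polytope 3 r"
begin

lemma refl: "x \<in> Field r \<Longrightarrow> (x, x) \<in> r"
  and trans: "(x, y) \<in> r \<Longrightarrow> (y, z) \<in> r \<Longrightarrow> (x, z) \<in> r"
  and antisym: "(x, y) \<in> r \<Longrightarrow> (y, x) \<in> r \<Longrightarrow> x = y"
  using polytope
  by (auto simp: abstract_polytope_def partial_order_on_def preorder_on_def refl_on_def
      dest: transD antisymD)

lemma chain_Field: "C \<in> Chains r \<Longrightarrow> C \<subseteq> Field r"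
  by (auto simp: Chains_def Field_def)

lemma chain_compare: "C \<in> Chains r \<Longrightarrow> x \<in> C \<Longrightarrow> y \<in> C \<Longrightarrow> (x, y) \<in> r \<or> (y, x) \<in> r"
  by (auto simp: Chains_def)

lemma flag_chain: "\<Phi> \<in> flags r \<Longrightarrow> \<Phi> \<in> Chains r"
  and flag_maximal: "\<Phi> \<in> flags r \<Longrightarrow> \<Psi> \<in> Chains r \<Longrightarrow> \<Phi> \<subseteq> \<Psi> \<Longrightarrow> \<Psi> = \<Phi>"
  by (auto simp: flags_def)

lemma card_flag: "\<Phi> \<in> flags r \<Longrightarrow> card \<Phi> = 5"
  using polytope by (auto simp: abstract_polytope_def)

lemma finite_flag: "\<Phi> \<in> flags r \<Longrightarrow> finite \<Phi>"
  using card_flag card.infinite by fastforce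

lemma flag_Field: "\<Phi> \<in> flags r \<Longrightarrow> x \<in> \<Phi> \<Longrightarrow> x \<in> Field r"
  using flag_chain chain_Field by blast

text \<open>Zorn is used because the axioms bound the size of maximal chains only; that every chain
  extends to one has to be shown first.\<close>

lemma chain_in_flag:
  assumes "C \<in> Chains r"
  obtains \<Phi> where "\<Phi> \<in> flags r" "C \<subseteq> \<Phi>"
proof -
  let ?A = "{D \<in> Chains r. C \<subseteq> D}"
  have "\<exists>M\<in>?A. \<forall>X\<in>?A. M \<subseteq> X \<longrightarrow> X = M"
  proof (rule subset_Zorn_nonempty)
    show "?A \<noteq> {}" using assms by blast
    fix \<C> assume \<C>: "\<C> \<noteq> {}" "subset.chain ?A \<C>"
    have "\<Union>\<C> \<in> Chains r"
      unfolding Chains_def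
    proof (intro CollectI ballI)
      fix x y assume "x \<in> \<Union>\<C>" "y \<in> \<Union>\<C>"
      then obtain X Y where XY: "X \<in> \<C>" "Y \<in> \<C>" "x \<in> X" "y \<in> Y" by blast
      then have "X \<subseteq> Y \<or> Y \<subseteq> X" "X \<in> Chains r" "Y \<in> Chains r"
        using \<C>(2) by (auto simp: subset_chain_def)
      then show "(x, y) \<in> r \<or> (y, x) \<in> r" using XY chain_compare by blast
    qed
    moreover have "C \<subseteq> \<Union>\<C>" using \<C> unfolding subset_chain_def by blast
    ultimately show "\<Union>\<C> \<in> ?A" by blast
  qed
  then obtain M where M: "M \<in> ?A" "\<forall>X\<in>?A. M \<subseteq> X \<longrightarrow> X = M" ..
  then have "M \<in> flags r" by (auto simp: flags_def)
  then show thesis using that M by simp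
qed

lemma chain_insert:
  assumes "C \<in> Chains r" "x \<in> Field r" "\<And>y. y \<in> C \<Longrightarrow> (x, y) \<in> r \<or> (y, x) \<in> r"
  shows "insert x C \<in> Chains r"
  using assms refl by (auto simp: Chains_def)

lemma flag_insert:
  assumes "\<Phi> \<in> flags r" "x \<in> Field r" "\<And>y. y \<in> \<Phi> \<Longrightarrow> (x, y) \<in> r \<or> (y, x) \<in> r"
  shows "x \<in> \<Phi>"
  using flag_maximal[OF assms(1) chain_insert[OF flag_chain[OF assms(1)] assms(2,3)]] by blast

lemma chain_card_5:
  assumes "C \<in> Chains r" "card C = 5"
  shows "C \<in> flags r"
proof -
  obtain \<Phi> where \<Phi>: "\<Phi> \<in> flags r" "C \<subseteq> \<Phi>" by (rule chain_in_flag[OF assms(1)])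
  then have "C = \<Phi>" using assms(2) card_flag finite_flag card_subset_eq by metis
  then show ?thesis using \<Phi> by simp
qed

lemma face_in_flag:
  assumes "x \<in> Field r"
  obtains \<Phi> where "\<Phi> \<in> flags r" "x \<in> \<Phi>"
proof -
  have "{x} \<in> Chains r" using refl[OF assms] by (simp add: Chains_def)
  then show thesis using chain_in_flag that by blast
qed

lemma pair_in_flag:
  assumes "(x, y) \<in> r"
  obtains \<Phi> where "\<Phi> \<in> flags r" "x \<in> \<Phi>" "y \<in> \<Phi>"
proof -
  have "x \<in> Field r" "y \<in> Field r" using assms by (auto simp: Field_def)
  then have "{x, y} \<in> Chains r" using refl assms by (auto simp: Chains_def)
  then show thesis using chain_in_flag that by (metis insert_subset)
qed

text \<open>The part of one flag below \<open>x\<close> and the part of another flag above \<open>x\<close> form a flag.\<close>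

lemma level_eq:
  assumes "\<Phi> \<in> flags r" "x \<in> \<Phi>"
  shows "level r x = card {y \<in> \<Phi>. (y, x) \<in> r \<and> y \<noteq> x}"
proof -
  define \<Psi> where "\<Psi> = (SOME \<Phi>. \<Phi> \<in> flags r \<and> x \<in> \<Phi>)"
  have \<Psi>: "\<Psi> \<in> flags r" "x \<in> \<Psi>"
    using someI[of "\<lambda>\<Phi>. \<Phi> \<in> flags r \<and> x \<in> \<Phi>", OF conjI[OF assms]] by (simp_all add: \<Psi>_def)
  define A A' B where "A = {y \<in> \<Phi>. (y, x) \<in> r \<and> y \<noteq> x}"
    and "A' = {y \<in> \<Psi>. (y, x) \<in> r \<and> y \<noteq> x}" and "B = {y \<in> \<Psi>. (x, y) \<in> r}"
  have fin: "finite A" "finite A'" "finite B"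
    using finite_flag[OF assms(1)] finite_flag[OF \<Psi>(1)] by (simp_all add: A_def A'_def B_def)
  have disj: "A \<inter> B = {}" "A' \<inter> B = {}"
    using antisym by (auto simp: A_def A'_def B_def)
  have cmp: "(y, x) \<in> r \<or> (x, y) \<in> r" if "y \<in> \<Phi> \<or> y \<in> \<Psi>" for y
    using that chain_compare[OF flag_chain] assms \<Psi> by metis
  have x: "x \<in> Field r" by (rule flag_Field[OF assms])
  have \<Psi>_eq: "A' \<union> B = \<Psi>" using cmp refl[OF x] by (auto simp: A'_def B_def)
  have "A \<union> B \<in> Chains r"
    unfolding Chains_def
  proof (intro CollectI ballI)
    fix y z assume "y \<in> A \<union> B" "z \<in> A \<union> B"
    then show "(y, z) \<in> r \<or> (z, y) \<in> r"
      using chain_compare[OF flag_chain[OF assms(1)], of y z] chain_compare[OF flag_chain[OF \<Psi>(1)], of y z]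
        trans[of y x z] trans[of z x y]
      by (auto simp: A_def B_def)
  qed
  moreover have "D = A \<union> B" if D: "D \<in> Chains r" "A \<union> B \<subseteq> D" for D
  proof
    show "D \<subseteq> A \<union> B"
    proof
      fix z assume z: "z \<in> D"
      have zF: "z \<in> Field r" using z D chain_Field by blast
      have "x \<in> B" using \<Psi> refl[OF x] by (simp add: B_def)
      then have zx: "(z, x) \<in> r \<or> (x, z) \<in> r" using chain_compare D z by blast
      show "z \<in> A \<union> B"
      proof (cases "(x, z) \<in> r")
        case True
        have "(z, y) \<in> r \<or> (y, z) \<in> r" if "y \<in> \<Psi>" for y
        proof (cases "y \<in> B")
          case True
          then show ?thesis using chain_compare D z by blast
        next
          case False
          then have "(y, x) \<in> r" using cmp that by (auto simp: B_def)
          then show ?thesis using True trans by blast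
        qed
        then have "z \<in> \<Psi>" by (rule flag_insert[OF \<Psi>(1) zF])
        then show ?thesis using True by (simp add: B_def)
      next
        case False
        then have zx: "(z, x) \<in> r" "z \<noteq> x" using zx refl[OF x] by auto
        have "(z, y) \<in> r \<or> (y, z) \<in> r" if "y \<in> \<Phi>" for y
        proof (cases "y \<in> A")
          case True
          then show ?thesis using chain_compare D z by blast
        next
          case False
          then have "(x, y) \<in> r" using cmp that refl[OF x] by (auto simp: A_def)
          then show ?thesis using zx trans by blast
        qed
        then have "z \<in> \<Phi>" by (rule flag_insert[OF assms(1) zF])
        then show ?thesis using zx by (simp add: A_def)
      qed
    qed
  qed (use D in blast)
  ultimately have "A \<union> B \<in> flags r" unfolding flags_def by blast
  then have "card (A \<union> B) = card (A' \<union> B)" using card_flag \<Psi> \<Psi>_eq by simp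
  then have "card A = card A'" using fin disj by (simp add: card_Un_disjoint)
  then show ?thesis unfolding level_def A_def A'_def \<Psi>_def by (rule sym)
qed

lemma level_strict_mono:
  assumes "(x, y) \<in> r" "x \<noteq> y"
  shows "level r x < level r y"
proof -
  obtain \<Phi> where \<Phi>: "\<Phi> \<in> flags r" "x \<in> \<Phi>" "y \<in> \<Phi>" by (rule pair_in_flag[OF assms(1)])
  have "{z \<in> \<Phi>. (z, x) \<in> r \<and> z \<noteq> x} \<subset> {z \<in> \<Phi>. (z, y) \<in> r \<and> z \<noteq> y}"
    using assms \<Phi> trans antisym by blast
  then have "card {z \<in> \<Phi>. (z, x) \<in> r \<and> z \<noteq> x} < card {z \<in> \<Phi>. (z, y) \<in> r \<and> z \<noteq> y}"
    using finite_flag[OF \<Phi>(1)] by (intro psubset_card_mono) simp_all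
  then show ?thesis
    using level_eq[OF \<Phi>(1,2)] level_eq[OF \<Phi>(1,3)] by simp
qed

lemma level_mono: "(x, y) \<in> r \<Longrightarrow> level r x \<le> level r y"
  using level_strict_mono[of x y] by (cases "x = y") auto

lemma level_less_5:
  assumes "x \<in> Field r"
  shows "level r x < 5"
proof -
  obtain \<Phi> where \<Phi>: "\<Phi> \<in> flags r" "x \<in> \<Phi>" by (rule face_in_flag[OF assms])
  have "{z \<in> \<Phi>. (z, x) \<in> r \<and> z \<noteq> x} \<subset> \<Phi>" using \<Phi> by blast
  then have "card {z \<in> \<Phi>. (z, x) \<in> r \<and> z \<noteq> x} < card \<Phi>"
    by (rule psubset_card_mono[OF finite_flag[OF \<Phi>(1)]])
  then show ?thesis using level_eq[OF \<Phi>] card_flag[OF \<Phi>(1)] by simp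
qed

lemma flag_inj_level:
  assumes "\<Phi> \<in> flags r" "x \<in> \<Phi>" "y \<in> \<Phi>" "level r x = level r y"
  shows "x = y"
  using chain_compare[OF flag_chain[OF assms(1)] assms(2,3)]
    level_strict_mono[of x y] level_strict_mono[of y x] assms(4) by fastforce

lemma level_image_flag: 
  assumes "\<Phi> \<in> flags r"
  shows "level r ` \<Phi> = {..<5}"
proof (rule card_subset_eq)
  show "level r ` \<Phi> \<subseteq> {..<5}" using level_less_5 flag_Field[OF assms] by auto
  have "inj_on (level r) \<Phi>" using flag_inj_level[OF assms] by (auto simp: inj_on_def)
  then show "card (level r ` \<Phi>) = card {..<5::nat}" using card_flag[OF assms] by (simp add: card_image)
qed simp

section \<open>The faces of a flag, indexed by level\<close>

definition face_at :: "'a set \<Rightarrow> nat \<Rightarrow> 'a" where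
  "face_at \<Phi> i = (THE x. x \<in> \<Phi> \<and> level r x = i)"

lemma face_at:
  assumes "\<Phi> \<in> flags r" "i < 5"
  shows "face_at \<Phi> i \<in> \<Phi>" "level r (face_at \<Phi> i) = i"
proof -
  have "\<exists>!x. x \<in> \<Phi> \<and> level r x = i"
  proof -
    have "i \<in> level r ` \<Phi>" using level_image_flag[OF assms(1)] assms(2) by simp
    then show ?thesis using flag_inj_level[OF assms(1)] by blast
  qed
  then have "face_at \<Phi> i \<in> \<Phi> \<and> level r (face_at \<Phi> i) = i" unfolding face_at_def by (rule theI')
  then show "face_at \<Phi> i \<in> \<Phi>" "level r (face_at \<Phi> i) = i" by auto
qed

lemma face_at_level: "\<Phi> \<in> flags r \<Longrightarrow> x \<in> \<Phi> \<Longrightarrow> face_at \<Phi> (level r x) = x"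
  by (rule flag_inj_level) (use face_at level_less_5 flag_Field in blast)+

lemma face_at_le:
  assumes "\<Phi> \<in> flags r" "i \<le> j" "j < 5"
  shows "(face_at \<Phi> i, face_at \<Phi> j) \<in> r"
proof (cases "i = j")
  case True
  then show ?thesis using refl flag_Field face_at(1)[OF assms(1,3)] assms(1) by simp
next
  case False
  then have "\<not> level r (face_at \<Phi> j) \<le> level r (face_at \<Phi> i)" using assms face_at by auto
  then have "(face_at \<Phi> j, face_at \<Phi> i) \<notin> r" using level_mono by blast
  moreover have "i < 5" using assms by simp
  ultimately show ?thesis
    using chain_compare[OF flag_chain[OF assms(1)] face_at(1)[OF assms(1)] face_at(1)[OF assms(1,3)]] by blast
qed

lemma flag_eq_faces: "\<Phi> \<in> flags r \<Longrightarrow> \<Phi> = face_at \<Phi> ` {..<5}"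
proof (intro equalityI subsetI)
  fix x assume "\<Phi> \<in> flags r" "x \<in> \<Phi>"
  then show "x \<in> face_at \<Phi> ` {..<5}"
    using face_at_level[of \<Phi> x] level_less_5[of x] flag_Field[of \<Phi> x]
    by (intro image_eqI[of _ _ "level r x"]) auto
qed (use face_at in auto)

lemma flag_eqI:
  assumes "\<Phi> \<in> flags r" "\<Psi> \<in> flags r" "\<And>i. i < 5 \<Longrightarrow> face_at \<Phi> i = face_at \<Psi> i"
  shows "\<Phi> = \<Psi>"
proof -
  have "face_at \<Phi> ` {..<5} = face_at \<Psi> ` {..<5}" using assms(3) by (intro image_cong) auto
  then show ?thesis using flag_eq_faces[OF assms(1)] flag_eq_faces[OF assms(2)] by simp
qed

text \<open>The count in \<open>faces_of_rank\<close> includes the face itself and ranks start at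
  \<open>-1\<close>, while \<open>level\<close> counts strictly smaller faces; hence the offset
  \<open>i + 1\<close>.\<close>

lemma faces_of_rank_eq: "faces_of_rank r i = {x \<in> Field r. int (level r x) = i + 1}"
proof -
  have iff: "int (card {y \<in> \<Phi>. (y, x) \<in> r}) = i + 2 \<longleftrightarrow> int (level r x) = i + 1"
    if "\<Phi> \<in> flags r" "x \<in> \<Phi>" for \<Phi> x
  proof -
    have "{y \<in> \<Phi>. (y, x) \<in> r} = insert x {y \<in> \<Phi>. (y, x) \<in> r \<and> y \<noteq> x}"
      using that refl flag_Field by blast
    then have "card {y \<in> \<Phi>. (y, x) \<in> r} = Suc (level r x)"
      using level_eq[OF that] finite_flag[OF that(1)] by simp
    then show ?thesis by auto
  qed
  show ?thesis
    unfolding faces_of_rank_def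
  proof (intro equalityI subsetI)
    fix x assume "x \<in> {x. \<exists>\<Phi>\<in>flags r. x \<in> \<Phi> \<and> int (card {y \<in> \<Phi>. (y, x) \<in> r}) = i + 2}"
    then show "x \<in> {x \<in> Field r. int (level r x) = i + 1}" using iff flag_Field by blast
  next
    fix x assume x: "x \<in> {x \<in> Field r. int (level r x) = i + 1}"
    then obtain \<Phi> where \<Phi>: "\<Phi> \<in> flags r" "x \<in> \<Phi>" using face_in_flag by blast
    then have "int (card {y \<in> \<Phi>. (y, x) \<in> r}) = i + 2" using x iff by blast
    then show "x \<in> {x. \<exists>\<Phi>\<in>flags r. x \<in> \<Phi> \<and> int (card {y \<in> \<Phi>. (y, x) \<in> r}) = i + 2}"
      using \<Phi> by blast
  qed
qed

lemma vertices_eq: "vertices r = {x \<in> Field r. level r x = 1}"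
  and facets_eq: "facets r = {x \<in> Field r. level r x = 3}"
  by (auto simp: vertices_def facets_def faces_of_rank_eq)

lemma diamond:
  assumes "k \<in> {1, 2, 3}" "(x, y) \<in> r" "level r x = k - 1" "level r y = k + 1"
  shows "card {z. level r z = k \<and> (x, z) \<in> r \<and> (z, y) \<in> r} = 2"
proof -
  have xy: "x \<in> Field r" "y \<in> Field r" using assms by (auto simp: Field_def)
  have "{z. level r z = k \<and> (x, z) \<in> r \<and> (z, y) \<in> r}
      = {z \<in> faces_of_rank r (int k - 1). (x, z) \<in> r \<and> (z, y) \<in> r}"
    by (auto simp: faces_of_rank_eq Field_def)
  moreover have "x \<in> faces_of_rank r (int k - 1 - 1)" "y \<in> faces_of_rank r (int k - 1 + 1)"
    using assms xy by (auto simp: faces_of_rank_eq)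
  moreover have "0 \<le> int k - 1 \<and> int k - 1 < int 3" using assms by auto
  moreover have "\<forall>i::int. 0 \<le> i \<and> i < int 3 \<longrightarrow>
      (\<forall>F \<in> faces_of_rank r (i - 1). \<forall>G \<in> faces_of_rank r (i + 1). (F, G) \<in> r \<longrightarrow>
         card {H \<in> faces_of_rank r i. (F, H) \<in> r \<and> (H, G) \<in> r} = 2)"
    using polytope unfolding abstract_polytope_def by blast
  ultimately show ?thesis using assms(2) by simp
qed

lemma extreme_faces:
  assumes "\<Phi> \<in> flags r" "\<Psi> \<in> flags r" "i \<in> {0, 4}"
  shows "face_at \<Phi> i = face_at \<Psi> i"
proof -
  obtain bot top where bt: "bot \<in> Field r" "\<And>y. y \<in> Field r \<Longrightarrow> (bot, y) \<in> r"
      "top \<in> Field r" "\<And>y. y \<in> Field r \<Longrightarrow> (y, top) \<in> r"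
    using polytope unfolding abstract_polytope_def by metis
  have "face_at \<Theta> 0 = bot" "face_at \<Theta> 4 = top" if \<Theta>: "\<Theta> \<in> flags r" for \<Theta>
  proof -
    have f: "face_at \<Theta> 0 \<in> Field r" "face_at \<Theta> 4 \<in> Field r"
      using face_at[OF \<Theta>] flag_Field[OF \<Theta>] by auto
    show "face_at \<Theta> 0 = bot"
      using bt(2)[OF f(1)] level_strict_mono[of bot "face_at \<Theta> 0"] face_at(2)[OF \<Theta>, of 0] by fastforce
    show "face_at \<Theta> 4 = top"
      using bt(4)[OF f(2)] level_strict_mono[of "face_at \<Theta> 4" top] level_less_5[OF bt(3)]
        face_at(2)[OF \<Theta>, of 4] by fastforce
  qed
  then show ?thesis using assms by auto
qed

lemma strongly_flag_connected:
  assumes "\<Phi> \<in> flags r" "\<Psi> \<in> flags r"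
  shows "(\<Phi>, \<Psi>) \<in> {(A, B) \<in> adjacent_flags r. \<Phi> \<inter> \<Psi> \<subseteq> A \<and> \<Phi> \<inter> \<Psi> \<subseteq> B}\<^sup>*"
proof -
  have "\<forall>\<Phi> \<in> flags r. \<forall>\<Psi> \<in> flags r.
      (\<Phi>, \<Psi>) \<in> {(A, B) \<in> adjacent_flags r. \<Phi> \<inter> \<Psi> \<subseteq> A \<and> \<Phi> \<inter> \<Psi> \<subseteq> B}\<^sup>*"
    using polytope unfolding abstract_polytope_def by (elim conjE) assumption
  from bspec[OF bspec[OF this assms(1)] assms(2)] show ?thesis .
qed

subsection \<open>Automorphisms\<close>

abbreviation "\<Gamma> \<equiv> aut_group r"

lemma aut_carrier: "\<gamma> \<in> carrier \<Gamma> \<longleftrightarrow> \<gamma> \<in> Bij (Field r) \<and>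
    (\<forall>x \<in> Field r. \<forall>y \<in> Field r. (x, y) \<in> r \<longleftrightarrow> (\<gamma> x, \<gamma> y) \<in> r)"
  by (simp add: aut_group_def)

lemma Bij_Field: "\<gamma> \<in> Bij (Field r) \<Longrightarrow> x \<in> Field r \<Longrightarrow> \<gamma> x \<in> Field r"
  by (auto simp: Bij_def bij_betw_def)

lemma group_aut: "group \<Gamma>"
proof -
  interpret B: group "BijGroup (Field r)" by (rule group_BijGroup)
  have "subgroup (carrier \<Gamma>) (BijGroup (Field r))"
  proof (rule B.subgroupI)
    show "carrier \<Gamma> \<subseteq> carrier (BijGroup (Field r))" by (auto simp: aut_carrier BijGroup_def)
    show "carrier \<Gamma> \<noteq> {}" using id_Bij[of "Field r"] aut_carrier[of "\<lambda>x\<in>Field r. x"] by auto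
  next
    fix \<gamma> assume \<gamma>: "\<gamma> \<in> carrier \<Gamma>"
    then have bij: "\<gamma> \<in> Bij (Field r)" by (simp add: aut_carrier)
    have inv: "inv\<^bsub>BijGroup (Field r)\<^esub> \<gamma> = (\<lambda>x\<in>Field r. inv_into (Field r) \<gamma> x)"
      using inv_BijGroup[OF bij] by simp
    have "(x, y) \<in> r \<longleftrightarrow> (inv_into (Field r) \<gamma> x, inv_into (Field r) \<gamma> y) \<in> r"
      if "x \<in> Field r" "y \<in> Field r" for x y
    proof -
      have "\<gamma> ` Field r = Field r" using bij by (auto simp: Bij_def bij_betw_def)
      then have "inv_into (Field r) \<gamma> x \<in> Field r" "inv_into (Field r) \<gamma> y \<in> Field r"
        "\<gamma> (inv_into (Field r) \<gamma> x) = x" "\<gamma> (inv_into (Field r) \<gamma> y) = y"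
        using that by (auto intro: inv_into_into f_inv_into_f)
      then show ?thesis using \<gamma> unfolding aut_carrier by metis
    qed
    then show "inv\<^bsub>BijGroup (Field r)\<^esub> \<gamma> \<in> carrier \<Gamma>"
      unfolding inv using restrict_inv_into_Bij[OF bij] by (simp add: aut_carrier)
  next
    fix \<gamma> \<delta> assume *: "\<gamma> \<in> carrier \<Gamma>" "\<delta> \<in> carrier \<Gamma>"
    then have bij: "\<gamma> \<in> Bij (Field r)" "\<delta> \<in> Bij (Field r)" by (auto simp: aut_carrier)
    have "(x, y) \<in> r \<longleftrightarrow> (compose (Field r) \<gamma> \<delta> x, compose (Field r) \<gamma> \<delta> y) \<in> r"
      if "x \<in> Field r" "y \<in> Field r" for x y
    proof -
      have "(x, y) \<in> r \<longleftrightarrow> (\<delta> x, \<delta> y) \<in> r" using * that unfolding aut_carrier by blast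
      also have "\<dots> \<longleftrightarrow> (\<gamma> (\<delta> x), \<gamma> (\<delta> y)) \<in> r"
        using * that Bij_Field[OF bij(2)] unfolding aut_carrier by blast
      finally show ?thesis using that by (simp add: compose_def)
    qed
    then have "compose (Field r) \<gamma> \<delta> \<in> carrier \<Gamma>"
      unfolding aut_carrier using compose_Bij[OF bij] by blast
    then show "\<gamma> \<otimes>\<^bsub>BijGroup (Field r)\<^esub> \<delta> \<in> carrier \<Gamma>"
      using bij by (simp add: BijGroup_def)
  qed
  then have "group ((BijGroup (Field r)) \<lparr>carrier := carrier \<Gamma>\<rparr>)" by (rule B.subgroup_imp_group)
  then show ?thesis by (simp add: aut_group_def)
qed

sublocale \<Gamma>: group \<Gamma> by (rule group_aut)

lemma aut_Field: "\<gamma> \<in> carrier \<Gamma> \<Longrightarrow> x \<in> Field r \<Longrightarrow> \<gamma> x \<in> Field r"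
  using Bij_Field aut_carrier by blast

lemma aut_le_iff: "\<gamma> \<in> carrier \<Gamma> \<Longrightarrow> x \<in> Field r \<Longrightarrow> y \<in> Field r \<Longrightarrow> (\<gamma> x, \<gamma> y) \<in> r \<longleftrightarrow> (x, y) \<in> r"
  using aut_carrier by blast

lemma mult_apply: "\<gamma> \<in> carrier \<Gamma> \<Longrightarrow> \<delta> \<in> carrier \<Gamma> \<Longrightarrow> x \<in> Field r \<Longrightarrow> (\<gamma> \<otimes>\<^bsub>\<Gamma>\<^esub> \<delta>) x = \<gamma> (\<delta> x)"
  by (simp add: aut_group_def BijGroup_def compose_def)

lemma one_apply: "x \<in> Field r \<Longrightarrow> \<one>\<^bsub>\<Gamma>\<^esub> x = x"
  by (simp add: aut_group_def BijGroup_def)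

lemma inv_apply: "\<gamma> \<in> carrier \<Gamma> \<Longrightarrow> x \<in> Field r \<Longrightarrow> (inv\<^bsub>\<Gamma>\<^esub> \<gamma>) (\<gamma> x) = x"
  "\<gamma> \<in> carrier \<Gamma> \<Longrightarrow> x \<in> Field r \<Longrightarrow> \<gamma> ((inv\<^bsub>\<Gamma>\<^esub> \<gamma>) x) = x"
  using mult_apply[of "inv\<^bsub>\<Gamma>\<^esub> \<gamma>" \<gamma> x] mult_apply[of \<gamma> "inv\<^bsub>\<Gamma>\<^esub> \<gamma>" x] one_apply[of x] by simp_all

lemma aut_eqI:
  assumes "\<gamma> \<in> carrier \<Gamma>" "\<delta> \<in> carrier \<Gamma>" "\<And>x. x \<in> Field r \<Longrightarrow> \<gamma> x = \<delta> x"
  shows "\<gamma> = \<delta>"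
  using assms by (intro extensionalityI[of \<gamma> "Field r" \<delta>]) (auto simp: aut_carrier Bij_def)

lemma aut_flag:
  assumes "\<gamma> \<in> carrier \<Gamma>" "\<Phi> \<in> flags r"
  shows "\<gamma> ` \<Phi> \<in> flags r"
proof (rule chain_card_5)
  have F: "\<Phi> \<subseteq> Field r" using flag_Field[OF assms(2)] by blast
  have "(\<gamma> x, \<gamma> y) \<in> r \<or> (\<gamma> y, \<gamma> x) \<in> r" if "x \<in> \<Phi>" "y \<in> \<Phi>" for x y
    using chain_compare[OF flag_chain[OF assms(2)] that] aut_le_iff[OF assms(1)] F that by blast
  then show "\<gamma> ` \<Phi> \<in> Chains r"
    by (auto simp: Chains_def)
  have "inj_on \<gamma> \<Phi>"
    using inv_apply(1)[OF assms(1)] F by (metis inj_on_inverseI subsetD)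
  then show "card (\<gamma> ` \<Phi>) = 5" using card_flag[OF assms(2)] by (simp add: card_image)
qed

lemma aut_level:
  assumes "\<gamma> \<in> carrier \<Gamma>" "x \<in> Field r"
  shows "level r (\<gamma> x) = level r x"
proof -
  obtain \<Phi> where \<Phi>: "\<Phi> \<in> flags r" "x \<in> \<Phi>" by (rule face_in_flag[OF assms(2)])
  have F: "\<Phi> \<subseteq> Field r" using flag_Field[OF \<Phi>(1)] by blast
  have inj: "inj_on \<gamma> \<Phi>"
    using inv_apply(1)[OF assms(1)] F by (metis inj_on_inverseI subsetD)
  have "{y \<in> \<gamma> ` \<Phi>. (y, \<gamma> x) \<in> r \<and> y \<noteq> \<gamma> x} = \<gamma> ` {y \<in> \<Phi>. (y, x) \<in> r \<and> y \<noteq> x}"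
    using aut_le_iff[OF assms(1)] F \<Phi>(2) inj by (auto simp: inj_on_def)
  then have "card {y \<in> \<gamma> ` \<Phi>. (y, \<gamma> x) \<in> r \<and> y \<noteq> \<gamma> x} = card {y \<in> \<Phi>. (y, x) \<in> r \<and> y \<noteq> x}"
    using inj by (simp add: card_image inj_on_subset)
  then show ?thesis
    using level_eq[OF \<Phi>] level_eq[OF aut_flag[OF assms(1) \<Phi>(1)], of "\<gamma> x"] \<Phi>(2) by simp
qed

lemma face_at_aut:
  assumes "\<gamma> \<in> carrier \<Gamma>" "\<Phi> \<in> flags r" "i < 5"
  shows "face_at (\<gamma> ` \<Phi>) i = \<gamma> (face_at \<Phi> i)"
proof -
  have "\<gamma> (face_at \<Phi> i) \<in> \<gamma> ` \<Phi>" "level r (\<gamma> (face_at \<Phi> i)) = i"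
    using face_at[OF assms(2,3)] aut_level[OF assms(1)] flag_Field[OF assms(2)] by auto
  then show ?thesis using face_at_level[OF aut_flag[OF assms(1,2)]] by metis
qed

end

locale regular_polyhedron_base = polyhedron +
  fixes \<Phi> :: "'a set" and \<rho> :: "nat \<Rightarrow> 'a \<Rightarrow> 'a"
  assumes regular: "regular_polyhedron r" and base_flag: "\<Phi> \<in> flags r"
    and distinguished: "i < 3 \<Longrightarrow> distinguished r \<Phi> i (\<rho> i)"
begin

abbreviation b where "b \<equiv> face_at \<Phi>"

lemma b_Field: "i < 5 \<Longrightarrow> b i \<in> Field r" and b_level: "i < 5 \<Longrightarrow> level r (b i) = i"
  using face_at[OF base_flag] flag_Field[OF base_flag] by auto

lemma aut_b_level: "\<gamma> \<in> carrier \<Gamma> \<Longrightarrow> i < 5 \<Longrightarrow> level r (\<gamma> (b i)) = i"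
  using aut_level b_Field b_level by simp

lemma aut_b_inj: "\<gamma> \<in> carrier \<Gamma> \<Longrightarrow> \<delta> \<in> carrier \<Gamma> \<Longrightarrow> i < 5 \<Longrightarrow> j < 5 \<Longrightarrow> \<gamma> (b i) = \<delta> (b j) \<Longrightarrow> i = j"
  using aut_b_level by metis

lemma \<rho>_closed: "i < 3 \<Longrightarrow> \<rho> i \<in> carrier \<Gamma>"
  using distinguished by (simp add: distinguished_def)

lemma \<rho>_moves: "i < 3 \<Longrightarrow> j < 5 \<Longrightarrow> \<rho> i (b j) \<noteq> b j \<longleftrightarrow> j = Suc i"
  using distinguished[of i] face_at[OF base_flag, of j] b_Field[of j]
  by (auto simp: distinguished_def faces_of_rank_eq)

lemma extremes_fixed: "\<gamma> \<in> carrier \<Gamma> \<Longrightarrow> i \<in> {0, 4} \<Longrightarrow> \<gamma> (b i) = b i"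
  using extreme_faces[OF aut_flag[OF _ base_flag] base_flag] face_at_aut[OF _ base_flag] by fastforce

definition between :: "nat \<Rightarrow> 'a set" where
  "between k = {z. level r z = k \<and> (b (k - 1), z) \<in> r \<and> (z, b (k + 1)) \<in> r}"

lemma between_Field: "z \<in> between k \<Longrightarrow> z \<in> Field r"
  by (auto simp: between_def Field_def)

lemma b_between: "k \<in> {1, 2, 3} \<Longrightarrow> b k \<in> between k"
  using face_at_le[OF base_flag, of "k - 1" k] face_at_le[OF base_flag, of k "k + 1"] b_level[of k]
  by (auto simp: between_def)

lemma aut_between:
  assumes "k \<in> {1, 2, 3}" "\<gamma> \<in> carrier \<Gamma>" "\<gamma> (b (k - 1)) = b (k - 1)" "\<gamma> (b (k + 1)) = b (k + 1)"
    and z: "z \<in> between k"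
  shows "\<gamma> z \<in> between k"
proof -
  have F: "z \<in> Field r" "b (k - 1) \<in> Field r" "b (k + 1) \<in> Field r"
    using between_Field[OF z] b_Field assms(1) by auto
  have "(\<gamma> (b (k - 1)), \<gamma> z) \<in> r" "(\<gamma> z, \<gamma> (b (k + 1))) \<in> r"
    using aut_le_iff[OF assms(2)] F z by (simp_all add: between_def)
  then show ?thesis
    using aut_level[OF assms(2) F(1)] z assms(3,4) by (simp add: between_def)
qed

lemma \<rho>_between: "k \<in> {1, 2, 3} \<Longrightarrow> \<rho> (k - 1) (b k) \<in> between k"
proof (rule aut_between[of k "\<rho> (k - 1)" "b k"])
  assume k: "k \<in> {1, 2, 3}"
  show "\<rho> (k - 1) (b (k - 1)) = b (k - 1)" "\<rho> (k - 1) (b (k + 1)) = b (k + 1)"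
    using \<rho>_moves[of "k - 1" "k - 1"] \<rho>_moves[of "k - 1" "k + 1"] k by auto
qed (use b_between \<rho>_closed in auto)

lemma between_cases:
  assumes k: "k \<in> {1, 2, 3}"
  shows "between k = {b k, \<rho> (k - 1) (b k)}"
proof -
  have "card (between k) = 2"
    unfolding between_def
    by (rule diamond[OF k]) (use face_at_le[OF base_flag, of "k - 1" "k + 1"] b_level k in auto)
  moreover have "card {b k, \<rho> (k - 1) (b k)} = 2"
    using \<rho>_moves[of "k - 1" k] k by auto
  moreover have "{b k, \<rho> (k - 1) (b k)} \<subseteq> between k"
    using b_between[OF k] \<rho>_between[OF k] by simp
  moreover have "finite (between k)" using calculation(1) card.infinite by fastforce
  ultimately show ?thesis using card_subset_eq by metis
qed

text \<open>Rigidity spreads along adjacent flags: the next flag has one new face \<open>z\<close>,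
  the diamond condition leaves two values for \<open>\<gamma> z\<close>, and the other value is the
  image of an already fixed face.\<close>

lemma aut_fix_flag:
  assumes \<gamma>: "\<gamma> \<in> carrier \<Gamma>" and fixed: "\<And>i. i < 5 \<Longrightarrow> \<gamma> (b i) = b i"
  shows "\<gamma> = \<one>\<^bsub>\<Gamma>\<^esub>"
proof -
  have *: "\<forall>x\<in>\<Psi>. \<gamma> x = x" if "(\<Phi>, \<Psi>) \<in> (adjacent_flags r)\<^sup>*" for \<Psi>
    using that
  proof (induction rule: rtrancl_induct)
    case base
    show ?case
    proof
      fix x assume x: "x \<in> \<Phi>"
      then have "b (level r x) = x" "level r x < 5"
        using face_at_level[OF base_flag] level_less_5 flag_Field[OF base_flag] by auto
      then show "\<gamma> x = x" using fixed by metis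
    qed
  next
    case (step \<Psi> \<Theta>)
    have fl: "\<Psi> \<in> flags r" "\<Theta> \<in> flags r" and card1: "card (\<Theta> - \<Psi>) = 1"
      using step(2) by (simp_all add: adjacent_flags_def)
    obtain z where z: "\<Theta> - \<Psi> = {z}" using card_1_singletonE[OF card1] .
    then have zF: "z \<in> \<Theta>" "z \<in> Field r" using flag_Field[OF fl(2)] by auto
    have "\<gamma> ` \<Theta> \<in> flags r" by (rule aut_flag[OF \<gamma> fl(2)])
    define k where "k = level r z"
    have k: "k < 5" "face_at \<Theta> k = z"
      using level_less_5[OF zF(2)] face_at_level[OF fl(2) zF(1)] by (auto simp: k_def)
    have others: "face_at \<Theta> i \<in> \<Psi>" "face_at \<Theta> i = face_at \<Psi> i" "\<gamma> (face_at \<Theta> i) = face_at \<Theta> i"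
      if "i < 5" "i \<noteq> k" for i
    proof -
      have "face_at \<Theta> i \<in> \<Theta>" "face_at \<Theta> i \<noteq> z"
        using face_at[OF fl(2) that(1)] that(2) k_def by auto
      then show "face_at \<Theta> i \<in> \<Psi>" using z by blast
      then show "face_at \<Theta> i = face_at \<Psi> i" "\<gamma> (face_at \<Theta> i) = face_at \<Theta> i"
        using face_at_level[OF fl(1), of "face_at \<Theta> i"] face_at(2)[OF fl(2) that(1)] step.IH by auto
    qed
    have k123: "k \<in> {1, 2, 3}"
    proof (rule ccontr)
      assume "k \<notin> {1, 2, 3}"
      then have "k \<in> {0, 4}" using k(1) by auto
      then have "z = face_at \<Psi> k" using extreme_faces[OF fl] k by metis
      then show False using z face_at[OF fl(1) k(1)] by auto
    qed
    define A where "A = {y. level r y = k \<and> (face_at \<Theta> (k - 1), y) \<in> r \<and> (y, face_at \<Theta> (k + 1)) \<in> r}"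
    have nbs: "face_at \<Theta> (k - 1) = face_at \<Psi> (k - 1)" "\<gamma> (face_at \<Theta> (k - 1)) = face_at \<Theta> (k - 1)"
      "face_at \<Theta> (k + 1) = face_at \<Psi> (k + 1)" "\<gamma> (face_at \<Theta> (k + 1)) = face_at \<Theta> (k + 1)"
      using others[of "k - 1"] others[of "k + 1"] k123 by auto
    have zA: "z \<in> A"
      unfolding A_def using face_at_le[OF fl(2), of "k - 1" k] face_at_le[OF fl(2), of k "k + 1"] k k_def k123
      by auto
    have yA: "face_at \<Psi> k \<in> A"
      unfolding A_def nbs using face_at_le[OF fl(1), of "k - 1" k] face_at_le[OF fl(1), of k "k + 1"]
        face_at(2)[OF fl(1) k(1)] k123 by auto
    have F: "face_at \<Theta> (k - 1) \<in> Field r" "face_at \<Theta> (k + 1) \<in> Field r"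
      using face_at(1)[OF fl(2)] flag_Field[OF fl(2)] k123 by auto
    have "(\<gamma> (face_at \<Theta> (k - 1)), \<gamma> z) \<in> r" "(\<gamma> z, \<gamma> (face_at \<Theta> (k + 1))) \<in> r"
      using aut_le_iff[OF \<gamma>] F zF zA by (auto simp: A_def)
    then have \<gamma>zA: "\<gamma> z \<in> A" using aut_level[OF \<gamma> zF(2)] nbs by (simp add: A_def k_def)
    have "card A = 2"
      unfolding A_def
      by (rule diamond[OF k123]) (use face_at_le[OF fl(2), of "k - 1" "k + 1"] face_at[OF fl(2)] k123 in auto)
    moreover have ne: "z \<noteq> face_at \<Psi> k" using z face_at(1)[OF fl(1) k(1)] by blast
    ultimately have "A = {z, face_at \<Psi> k}"
      using zA yA by (intro card_subset_eq[symmetric]) (auto simp: card_eq_0_iff intro: card_ge_0_finite)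
    moreover have "\<gamma> z \<noteq> face_at \<Psi> k"
    proof
      assume "\<gamma> z = face_at \<Psi> k"
      moreover have "\<gamma> (face_at \<Psi> k) = face_at \<Psi> k" using step.IH face_at(1)[OF fl(1) k(1)] by blast
      ultimately have "z = face_at \<Psi> k"
        using inv_apply(1)[OF \<gamma>] zF flag_Field[OF fl(1) face_at(1)[OF fl(1) k(1)]] by metis
      then show False using ne by simp
    qed
    ultimately have "\<gamma> z = z" using \<gamma>zA by blast
    show ?case
    proof
      fix x assume "x \<in> \<Theta>"
      show "\<gamma> x = x"
      proof (cases "x = z")
        case False
        then have "x \<in> \<Psi>" using \<open>x \<in> \<Theta>\<close> z by blast
        then show ?thesis using step.IH by blast
      qed (use \<open>\<gamma> z = z\<close> in simp)
    qed
  qed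
  show ?thesis
  proof (rule aut_eqI[OF \<gamma> \<Gamma>.one_closed])
    fix x assume x: "x \<in> Field r"
    obtain \<Psi> where \<Psi>: "\<Psi> \<in> flags r" "x \<in> \<Psi>" by (rule face_in_flag[OF x])
    have "(\<Phi>, \<Psi>) \<in> {(A, B) \<in> adjacent_flags r. \<Phi> \<inter> \<Psi> \<subseteq> A \<and> \<Phi> \<inter> \<Psi> \<subseteq> B}\<^sup>*"
      by (rule strongly_flag_connected[OF base_flag \<Psi>(1)])
    then have "(\<Phi>, \<Psi>) \<in> (adjacent_flags r)\<^sup>*"
      by (rule rtrancl_mono[THEN subsetD, rotated]) auto
    then show "\<gamma> x = \<one>\<^bsub>\<Gamma>\<^esub> x" using * \<Psi>(2) one_apply[OF x] by simp
  qed
qed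

lemma aut_eq_on_base:
  assumes "\<gamma> \<in> carrier \<Gamma>" "\<delta> \<in> carrier \<Gamma>" "\<And>i. i \<in> {1, 2, 3} \<Longrightarrow> \<gamma> (b i) = \<delta> (b i)"
  shows "\<gamma> = \<delta>"
proof -
  have "(inv\<^bsub>\<Gamma>\<^esub> \<delta> \<otimes>\<^bsub>\<Gamma>\<^esub> \<gamma>) (b i) = b i" if "i < 5" for i
  proof (cases "i \<in> {1, 2, 3}")
    case True
    then show ?thesis
      using assms b_Field[OF that] inv_apply(1)[OF assms(2)] mult_apply[of "inv\<^bsub>\<Gamma>\<^esub> \<delta>" \<gamma> "b i"] by simp
  next
    case False
    then have "i \<in> {0, 4}" using that by auto
    then show ?thesis using extremes_fixed[OF _ \<open>i \<in> {0, 4}\<close>] assms by simp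
  qed
  then have "inv\<^bsub>\<Gamma>\<^esub> \<delta> \<otimes>\<^bsub>\<Gamma>\<^esub> \<gamma> = \<one>\<^bsub>\<Gamma>\<^esub>"
    using assms by (intro aut_fix_flag) auto
  then show ?thesis using assms(1,2) by (metis \<Gamma>.inv_closed \<Gamma>.inv_equality \<Gamma>.inv_inv)
qed

lemma \<rho>_b: "i < 3 \<Longrightarrow> j < 5 \<Longrightarrow> j \<noteq> Suc i \<Longrightarrow> \<rho> i (b j) = b j"
  using \<rho>_moves by blast

text \<open>\<open>\<rho> i\<close> permutes the two faces of the diamond at level
  \<open>Suc i\<close> and moves the base face, so it swaps them; its square fixes the base
  flag.\<close>

lemma \<rho>_involution: "i < 3 \<Longrightarrow> \<rho> i \<otimes>\<^bsub>\<Gamma>\<^esub> \<rho> i = \<one>\<^bsub>\<Gamma>\<^esub>"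
proof (rule aut_eq_on_base)
  assume i: "i < 3"
  fix j :: nat assume j: "j \<in> {1, 2, 3}"
  have c: "\<rho> i \<in> carrier \<Gamma>" using \<rho>_closed[OF i] .
  have "\<rho> i (\<rho> i (b j)) = b j"
  proof (cases "j = Suc i")
    case True
    have z: "\<rho> i (b j) \<in> between j" using \<rho>_between[OF j] True by simp
    moreover have "\<rho> i (\<rho> i (b j)) \<in> between j"
      by (rule aut_between[OF j c _ _ z]) (use \<rho>_b[OF i] j True in auto)
    moreover have "\<rho> i (\<rho> i (b j)) \<noteq> \<rho> i (b j)"
    proof
      assume eq: "\<rho> i (\<rho> i (b j)) = \<rho> i (b j)"
      have F: "b j \<in> Field r" using b_Field[of j] j by auto
      have "\<rho> i (b j) = b j"
        using inv_apply(1)[OF c F] inv_apply(1)[OF c aut_Field[OF c F]] eq by simp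
      then show False using \<rho>_moves[OF i, of j] True i by simp
    qed
    ultimately show ?thesis using between_cases[OF j] True by simp
  qed (use \<rho>_b[OF i, of j] j in auto)
  then show "(\<rho> i \<otimes>\<^bsub>\<Gamma>\<^esub> \<rho> i) (b j) = \<one>\<^bsub>\<Gamma>\<^esub> (b j)"
    using mult_apply[OF c c] b_Field[of j] one_apply j by auto
qed (use \<rho>_closed in auto)

lemma \<rho>_neq_one: "i < 3 \<Longrightarrow> \<rho> i \<noteq> \<one>\<^bsub>\<Gamma>\<^esub>"
  using \<rho>_moves[of i "Suc i"] one_apply[OF b_Field, of "Suc i"] by auto

lemma \<rho>_commute: "\<rho> 0 \<otimes>\<^bsub>\<Gamma>\<^esub> \<rho> 2 = \<rho> 2 \<otimes>\<^bsub>\<Gamma>\<^esub> \<rho> 0"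
proof (rule aut_eq_on_base)
  have c: "\<rho> 0 \<in> carrier \<Gamma>" "\<rho> 2 \<in> carrier \<Gamma>" using \<rho>_closed by auto
  then show "\<rho> 0 \<otimes>\<^bsub>\<Gamma>\<^esub> \<rho> 2 \<in> carrier \<Gamma>" "\<rho> 2 \<otimes>\<^bsub>\<Gamma>\<^esub> \<rho> 0 \<in> carrier \<Gamma>" by auto
  \<comment> \<open>An automorphism fixing the ends and one middle face of a diamond fixes the other
    middle face. This is applied to \<open>\<rho> 2\<close> at the vertex and to
    \<open>\<rho> 0\<close> at the facet.\<close>
  have swap: "\<rho> (k - 1) (b k) = \<gamma> (\<rho> (k - 1) (b k))"
    if k: "k \<in> {1, 2, 3}" and \<gamma>: "\<gamma> \<in> carrier \<Gamma>" "\<gamma> (b (k - 1)) = b (k - 1)" "\<gamma> (b (k + 1)) = b (k + 1)"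
      "\<gamma> (b k) = b k" for k \<gamma>
  proof -
    have z: "\<rho> (k - 1) (b k) \<in> between k" by (rule \<rho>_between[OF k])
    have "\<gamma> (\<rho> (k - 1) (b k)) \<in> between k" by (rule aut_between[OF k \<gamma>(1,2,3) z])
    moreover have "\<gamma> (\<rho> (k - 1) (b k)) \<noteq> b k"
    proof
      assume "\<gamma> (\<rho> (k - 1) (b k)) = b k"
      then have "\<rho> (k - 1) (b k) = b k"
        using \<gamma> inv_apply(1)[OF \<gamma>(1)] between_Field[OF z] between_Field[OF b_between[OF k]] by metis
      then show False using \<rho>_moves[of "k - 1" k] k by auto
    qed
    ultimately show ?thesis using between_cases[OF k] by auto
  qed
  fix j :: nat assume j: "j \<in> {1, 2, 3}"
  have "\<rho> 0 (b 1) = \<rho> 2 (\<rho> 0 (b 1))" using swap[of 1 "\<rho> 2"] \<rho>_b[of 2] c by simp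
  moreover have "\<rho> 2 (b 3) = \<rho> 0 (\<rho> 2 (b 3))" using swap[of 3 "\<rho> 0"] \<rho>_b[of 0] c by simp
  ultimately have "\<rho> 0 (\<rho> 2 (b j)) = \<rho> 2 (\<rho> 0 (b j))"
    using j \<rho>_b[of 0 2] \<rho>_b[of 0 3] \<rho>_b[of 2 1] \<rho>_b[of 2 2] by auto
  then show "(\<rho> 0 \<otimes>\<^bsub>\<Gamma>\<^esub> \<rho> 2) (b j) = (\<rho> 2 \<otimes>\<^bsub>\<Gamma>\<^esub> \<rho> 0) (b j)"
    using mult_apply c b_Field[of j] j by auto
qed

section \<open>Generators of the automorphism group and of the face stabilisers\<close>

lemma adjacent_to_base:
  assumes "\<Theta> \<in> flags r" "card (\<Theta> - \<Phi>) = 1"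
  obtains j where "j < 3" "\<Theta> = \<rho> j ` \<Phi>" "b (Suc j) \<notin> \<Theta>"
proof -
  obtain z where z: "\<Theta> - \<Phi> = {z}" using assms(2) by (auto simp: card_1_singleton_iff)
  then have zF: "z \<in> \<Theta>" "z \<in> Field r" using flag_Field[OF assms(1)] by auto
  define k where "k = level r z"
  have k: "k < 5" "face_at \<Theta> k = z"
    using level_less_5[OF zF(2)] face_at_level[OF assms(1) zF(1)] by (auto simp: k_def)
  have others: "face_at \<Theta> i = b i" if "i < 5" "i \<noteq> k" for i
  proof -
    have "face_at \<Theta> i \<in> \<Theta>" "face_at \<Theta> i \<noteq> z"
      using face_at[OF assms(1) that(1)] that(2) k_def by auto
    then have "face_at \<Theta> i \<in> \<Phi>" using z by blast
    then show ?thesis using face_at_level[OF base_flag] face_at(2)[OF assms(1) that(1)] by metis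
  qed
  have zb: "z \<noteq> b k" using z face_at(1)[OF base_flag k(1)] by blast
  have k123: "k \<in> {1, 2, 3}"
  proof (rule ccontr)
    assume "k \<notin> {1, 2, 3}"
    then have "k \<in> {0, 4}" using k(1) by auto
    then show False using extreme_faces[OF assms(1) base_flag] k zb by metis
  qed
  have "(face_at \<Theta> (k - 1), z) \<in> r" "(z, face_at \<Theta> (k + 1)) \<in> r"
    using face_at_le[OF assms(1), of "k - 1" k] face_at_le[OF assms(1), of k "k + 1"] k k123 by auto
  moreover have "face_at \<Theta> (k - 1) = b (k - 1)" "face_at \<Theta> (k + 1) = b (k + 1)"
    using others[of "k - 1"] others[of "k + 1"] k123 by auto
  ultimately have "z \<in> between k" by (simp add: between_def k_def)
  then have z_eq: "z = \<rho> (k - 1) (b k)" using between_cases[OF k123] zb by blast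
  have k1: "k - 1 < 3" "Suc (k - 1) = k" using k123 by auto
  have "\<Theta> = \<rho> (k - 1) ` \<Phi>"
  proof (rule flag_eqI[OF assms(1) aut_flag[OF \<rho>_closed[OF k1(1)] base_flag]])
    fix i :: nat assume i: "i < 5"
    have "face_at (\<rho> (k - 1) ` \<Phi>) i = \<rho> (k - 1) (b i)"
      by (rule face_at_aut[OF \<rho>_closed[OF k1(1)] base_flag i])
    then show "face_at \<Theta> i = face_at (\<rho> (k - 1) ` \<Phi>) i"
      using others[OF i] k(2) z_eq \<rho>_b[OF k1(1) i] k1(2) by (cases "i = k") auto
  qed
  moreover have "b k \<notin> \<Theta>" using face_at_level[OF assms(1), of "b k"] b_level[OF k(1)] k(2) zb by auto
  ultimately show thesis using that[of "k - 1"] k1 by simp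
qed

lemma aut_image_diff:
  assumes "\<gamma> \<in> carrier \<Gamma>" "A \<subseteq> Field r" "B \<subseteq> Field r"
  shows "\<gamma> ` A - \<gamma> ` B = \<gamma> ` (A - B)" "card (\<gamma> ` A) = card A"
proof -
  have "inj_on \<gamma> (Field r)" using inv_apply(1)[OF assms(1)] by (metis inj_on_inverseI)
  then show "\<gamma> ` A - \<gamma> ` B = \<gamma> ` (A - B)" "card (\<gamma> ` A) = card A"
    using assms inj_on_image_set_diff[of \<gamma> "Field r" A B] card_image[of \<gamma> A] inj_on_subset[of \<gamma> "Field r" A]
    by blast+
qed

lemma mult_image:
  assumes "\<gamma> \<in> carrier \<Gamma>" "\<delta> \<in> carrier \<Gamma>" "A \<subseteq> Field r"
  shows "(\<gamma> \<otimes>\<^bsub>\<Gamma>\<^esub> \<delta>) ` A = \<gamma> ` (\<delta> ` A)"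
proof -
  have "(\<gamma> \<otimes>\<^bsub>\<Gamma>\<^esub> \<delta>) x = \<gamma> (\<delta> x)" if "x \<in> A" for x using mult_apply assms that by blast
  then show ?thesis by (simp add: image_image)
qed

lemma same_flag_eq:
  assumes "\<gamma> \<in> carrier \<Gamma>" "\<delta> \<in> carrier \<Gamma>" "\<gamma> ` \<Phi> = \<delta> ` \<Phi>"
  shows "\<gamma> = \<delta>"
proof (rule aut_eq_on_base[OF assms(1,2)])
  fix i :: nat assume "i \<in> {1, 2, 3}"
  then have i: "i < 5" by auto
  show "\<gamma> (b i) = \<delta> (b i)"
    using face_at_aut[OF assms(1) base_flag i] face_at_aut[OF assms(2) base_flag i] assms(3) by simp
qed

definition moved :: "('a \<Rightarrow> 'a) \<Rightarrow> nat set" where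
  "moved \<gamma> = {j. j < 3 \<and> \<gamma> (b (Suc j)) \<noteq> b (Suc j)}"

text \<open>Strong flag-connectivity joins the base flag to its image through flags containing all
  shared faces. Pulled back by \<open>\<delta>\<close>, each step is a \<open>\<rho> j\<close>; no
  shared face is ever exchanged, so \<open>j\<close> is a rank moved by \<open>\<gamma>\<close>.
  Generation of the group and of all face stabilisers follows at once.\<close>

lemma generated_by_moved:
  assumes \<gamma>: "\<gamma> \<in> carrier \<Gamma>"
  shows "\<gamma> \<in> generate \<Gamma> (\<rho> ` moved \<gamma>)"
proof -
  have \<Phi>F: "\<Phi> \<subseteq> Field r" using flag_Field[OF base_flag] by blast
  have gen_carrier: "\<rho> ` moved \<gamma> \<subseteq> carrier \<Gamma>" using \<rho>_closed by (auto simp: moved_def)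
  have "(\<Phi>, \<gamma> ` \<Phi>) \<in> {(A, B) \<in> adjacent_flags r. \<Phi> \<inter> \<gamma> ` \<Phi> \<subseteq> A \<and> \<Phi> \<inter> \<gamma> ` \<Phi> \<subseteq> B}\<^sup>*"
    by (rule strongly_flag_connected[OF base_flag aut_flag[OF \<gamma> base_flag]])
  then have "\<exists>\<delta> \<in> generate \<Gamma> (\<rho> ` moved \<gamma>). \<gamma> ` \<Phi> = \<delta> ` \<Phi>"
  proof (induction rule: rtrancl_induct)
    case base
    have "\<one>\<^bsub>\<Gamma>\<^esub> ` \<Phi> = \<Phi>" using one_apply \<Phi>F by force
    then show ?case using generate.one by metis
  next
    case (step \<Psi> \<Theta>)
    then obtain \<delta> where \<delta>: "\<delta> \<in> generate \<Gamma> (\<rho> ` moved \<gamma>)" "\<Psi> = \<delta> ` \<Phi>" by blast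
    have \<delta>c: "\<delta> \<in> carrier \<Gamma>" using \<Gamma>.generate_in_carrier[OF gen_carrier \<delta>(1)] .
    then have inv\<delta>: "inv\<^bsub>\<Gamma>\<^esub> \<delta> \<in> carrier \<Gamma>" by simp
    have adj: "\<Theta> \<in> flags r" "card (\<Theta> - \<Psi>) = 1" "\<Phi> \<inter> \<gamma> ` \<Phi> \<subseteq> \<Psi>" "\<Phi> \<inter> \<gamma> ` \<Phi> \<subseteq> \<Theta>"
      using step(2) by (auto simp: adjacent_flags_def)
    have \<Theta>F: "\<Theta> \<subseteq> Field r" using flag_Field[OF adj(1)] by blast
    have \<Psi>F: "\<Psi> \<subseteq> Field r" using flag_Field[OF aut_flag[OF \<delta>c base_flag]] \<delta>(2) by blast
    have pull_back: "(inv\<^bsub>\<Gamma>\<^esub> \<delta>) ` \<Psi> = \<Phi>" "\<delta> ` (inv\<^bsub>\<Gamma>\<^esub> \<delta>) ` \<Theta> = \<Theta>"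
      unfolding \<delta>(2) using inv_apply[OF \<delta>c] \<Phi>F \<Theta>F by (force simp: image_image)+
    have "(inv\<^bsub>\<Gamma>\<^esub> \<delta>) ` \<Theta> - \<Phi> = (inv\<^bsub>\<Gamma>\<^esub> \<delta>) ` (\<Theta> - \<Psi>)"
      using aut_image_diff(1)[OF inv\<delta> \<Theta>F \<Psi>F] unfolding pull_back(1) .
    then have "card ((inv\<^bsub>\<Gamma>\<^esub> \<delta>) ` \<Theta> - \<Phi>) = 1"
      using aut_image_diff(2)[OF inv\<delta>, of "\<Theta> - \<Psi>" "{}"] adj(2) \<Theta>F by auto
    then obtain j where j: "j < 3" "(inv\<^bsub>\<Gamma>\<^esub> \<delta>) ` \<Theta> = \<rho> j ` \<Phi>" "b (Suc j) \<notin> (inv\<^bsub>\<Gamma>\<^esub> \<delta>) ` \<Theta>"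
      using adjacent_to_base[OF aut_flag[OF inv\<delta> adj(1)]] by blast
    have "j \<in> moved \<gamma>"
    proof (rule ccontr)
      assume "j \<notin> moved \<gamma>"
      then have "\<gamma> (b (Suc j)) = b (Suc j)" using j(1) by (simp add: moved_def)
      then have mem: "b (Suc j) \<in> \<Phi> \<inter> \<gamma> ` \<Phi>" using face_at(1)[OF base_flag, of "Suc j"] j(1) by (auto intro: rev_image_eqI)
      then have "b (Suc j) \<in> \<delta> ` \<Phi>" "b (Suc j) \<in> \<Theta>" using adj(3,4) \<delta>(2) by auto
      then obtain x where x: "x \<in> \<Phi>" "b (Suc j) = \<delta> x" by blast
      have "level r (\<delta> x) = level r x" using aut_level[OF \<delta>c] x(1) \<Phi>F by blast
      then have "level r x = Suc j" using b_level[of "Suc j"] j(1) x(2) by simp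
      then have "x = b (Suc j)" using face_at_level[OF base_flag x(1)] by simp
      then have "(inv\<^bsub>\<Gamma>\<^esub> \<delta>) (b (Suc j)) = b (Suc j)"
        using inv_apply(1)[OF \<delta>c, of x] x \<Phi>F by auto
      then show False using j(3) \<open>b (Suc j) \<in> \<Theta>\<close> by (metis imageI)
    qed
    then have "\<delta> \<otimes>\<^bsub>\<Gamma>\<^esub> \<rho> j \<in> generate \<Gamma> (\<rho> ` moved \<gamma>)"
      using generate.eng[OF \<delta>(1) generate.incl] by blast
    moreover have "\<Theta> = (\<delta> \<otimes>\<^bsub>\<Gamma>\<^esub> \<rho> j) ` \<Phi>"
      using mult_image[OF \<delta>c \<rho>_closed[OF j(1)] \<Phi>F] j(2) pull_back(2) by simp
    ultimately show ?case by blast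
  qed
  then obtain \<delta> where \<delta>: "\<delta> \<in> generate \<Gamma> (\<rho> ` moved \<gamma>)" "\<gamma> ` \<Phi> = \<delta> ` \<Phi>" by blast
  then show ?thesis
    using same_flag_eq[OF \<gamma> \<Gamma>.generate_in_carrier[OF gen_carrier \<delta>(1)] \<delta>(2)] by simp
qed

lemma stabilizer_generated:
  assumes "\<gamma> \<in> carrier \<Gamma>" "\<And>j. j \<in> J \<Longrightarrow> \<gamma> (b (Suc j)) = b (Suc j)"
  shows "\<gamma> \<in> generate \<Gamma> (\<rho> ` ({..<3} - J))"
  using generated_by_moved[OF assms(1)] \<Gamma>.mono_generate[of "\<rho> ` moved \<gamma>" "\<rho> ` ({..<3} - J)"] assms(2)
  by (fastforce simp: moved_def)

lemma generate_fixes: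
  assumes "\<gamma> \<in> generate \<Gamma> (\<rho> ` J)" "J \<subseteq> {..<3}" "i < 5" "\<And>j. j \<in> J \<Longrightarrow> i \<noteq> Suc j"
  shows "\<gamma> \<in> carrier \<Gamma> \<and> \<gamma> (b i) = b i"
  using assms(1)
proof (induction rule: generate.induct)
  case (inv h)
  then have "h \<in> carrier \<Gamma>" "h (b i) = b i" using assms \<rho>_closed \<rho>_b by auto
  then show ?case using inv_apply(1)[of h "b i"] b_Field[OF assms(3)] by simp
qed (use assms one_apply mult_apply b_Field \<rho>_closed \<rho>_b in auto)

lemma \<Gamma>_generated: "generate \<Gamma> (\<rho> ` {..<3}) = carrier \<Gamma>"
  using stabilizer_generated[of _ "{}"] \<Gamma>.generate_incl[of "\<rho> ` {..<3}"] \<rho>_closed by auto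

lemma flag_transitive:
  assumes "\<Psi> \<in> flags r"
  obtains \<gamma> where "\<gamma> \<in> carrier \<Gamma>" "\<Psi> = \<gamma> ` \<Phi>"
  using regular assms base_flag unfolding regular_polyhedron_def by metis

lemma face_cases:
  assumes "x \<in> Field r"
  obtains \<gamma> i where "\<gamma> \<in> carrier \<Gamma>" "i < 5" "x = \<gamma> (b i)" "level r x = i"
proof -
  obtain \<Psi> where "\<Psi> \<in> flags r" "x \<in> \<Psi>" by (rule face_in_flag[OF assms])
  moreover from this obtain \<gamma> where \<gamma>: "\<gamma> \<in> carrier \<Gamma>" "\<Psi> = \<gamma> ` \<Phi>" using flag_transitive by blast
  ultimately obtain y where "y \<in> \<Phi>" "x = \<gamma> y" by blast
  then have "x = \<gamma> (b (level r y))" "level r y < 5"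
    using face_at_level[OF base_flag] level_less_5 flag_Field[OF base_flag] by auto
  then show thesis using that[OF \<gamma>(1)] aut_b_level[OF \<gamma>(1)] by simp
qed

text \<open>Incident faces lie in a common flag, and flags are images of the base flag; incidence
  becomes having a common representative.\<close>

lemma le_iff:
  assumes "\<gamma> \<in> carrier \<Gamma>" "\<delta> \<in> carrier \<Gamma>" "i < 5" "j < 5"
  shows "(\<gamma> (b i), \<delta> (b j)) \<in> r \<longleftrightarrow>
    i \<le> j \<and> (\<exists>\<epsilon>\<in>carrier \<Gamma>. \<gamma> (b i) = \<epsilon> (b i) \<and> \<delta> (b j) = \<epsilon> (b j))"
proof
  assume le: "(\<gamma> (b i), \<delta> (b j)) \<in> r"
  obtain \<Psi> where \<Psi>: "\<Psi> \<in> flags r" "\<gamma> (b i) \<in> \<Psi>" "\<delta> (b j) \<in> \<Psi>" by (rule pair_in_flag[OF le])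
  obtain \<epsilon> where \<epsilon>: "\<epsilon> \<in> carrier \<Gamma>" "\<Psi> = \<epsilon> ` \<Phi>" by (rule flag_transitive[OF \<Psi>(1)])
  have "\<gamma> (b i) = \<epsilon> (b i)" "\<delta> (b j) = \<epsilon> (b j)"
    using face_at_level[OF \<Psi>(1,2)] face_at_level[OF \<Psi>(1,3)] aut_b_level assms
      face_at_aut[OF \<epsilon>(1) base_flag] \<epsilon>(2) by auto
  moreover have "i \<le> j" using level_mono[OF le] aut_b_level assms by simp
  ultimately show "i \<le> j \<and> (\<exists>\<epsilon>\<in>carrier \<Gamma>. \<gamma> (b i) = \<epsilon> (b i) \<and> \<delta> (b j) = \<epsilon> (b j))" using \<epsilon>(1) by blast
next
  assume "i \<le> j \<and> (\<exists>\<epsilon>\<in>carrier \<Gamma>. \<gamma> (b i) = \<epsilon> (b i) \<and> \<delta> (b j) = \<epsilon> (b j))"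
  then obtain \<epsilon> where "\<epsilon> \<in> carrier \<Gamma>" "\<gamma> (b i) = \<epsilon> (b i)" "\<delta> (b j) = \<epsilon> (b j)" "i \<le> j" by blast
  then show "(\<gamma> (b i), \<delta> (b j)) \<in> r"
    using aut_le_iff b_Field assms face_at_le[OF base_flag, of i j] by auto
qed

lemma vertices_orbit: "vertices r = (\<lambda>\<gamma>. \<gamma> (b 1)) ` carrier \<Gamma>"
  and facets_orbit: "facets r = (\<lambda>\<gamma>. \<gamma> (b 3)) ` carrier \<Gamma>"
proof -
  have "{x \<in> Field r. level r x = k} = (\<lambda>\<gamma>. \<gamma> (b k)) ` carrier \<Gamma>" if "k < 5" for k
  proof (intro equalityI subsetI)
    fix x assume "x \<in> {x \<in> Field r. level r x = k}"
    then show "x \<in> (\<lambda>\<gamma>. \<gamma> (b k)) ` carrier \<Gamma>" using face_cases[of x] by blast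
  next
    fix x assume "x \<in> (\<lambda>\<gamma>. \<gamma> (b k)) ` carrier \<Gamma>"
    then show "x \<in> {x \<in> Field r. level r x = k}" using aut_b_level that aut_Field b_Field by auto
  qed
  from this[of 1] this[of 3] show "vertices r = (\<lambda>\<gamma>. \<gamma> (b 1)) ` carrier \<Gamma>"
    "facets r = (\<lambda>\<gamma>. \<gamma> (b 3)) ` carrier \<Gamma>" by (simp_all add: vertices_eq facets_eq)
qed

end

text \<open>For each rank, exchange the base face for the other face of its diamond;
  flag-transitivity supplies an automorphism onto the flag so obtained.\<close>

lemma regular_polyhedron_has_base:
  assumes "regular_polyhedron r"
  obtains \<Phi> \<rho> where "regular_polyhedron_base r \<Phi> \<rho>"
proof -
  interpret polyhedron r using assms by (simp add: polyhedron_def regular_polyhedron_def)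
  have "{} \<in> Chains r" by (simp add: Chains_def)
  then obtain \<Phi> where \<Phi>: "\<Phi> \<in> flags r" using chain_in_flag by blast
  have F: "\<Phi> \<subseteq> Field r" using flag_Field[OF \<Phi>] by blast
  have "\<exists>\<gamma>. distinguished r \<Phi> i \<gamma>" if i: "i < 3" for i
  proof -
    define k where "k = Suc i"
    have k: "k \<in> {1, 2, 3}" "k < 5" using i by (auto simp: k_def)
    define x where "x = face_at \<Phi> k"
    define A where "A = {y. level r y = k \<and> (face_at \<Phi> (k - 1), y) \<in> r \<and> (y, face_at \<Phi> (k + 1)) \<in> r}"
    have "card A = 2"
      unfolding A_def
      by (rule diamond[OF k(1)]) (use face_at_le[OF \<Phi>, of "k - 1" "k + 1"] face_at[OF \<Phi>] k in auto)
    then obtain u v where uv: "A = {u, v}" "u \<noteq> v" by (auto simp: card_2_iff)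
    then obtain y where y: "y \<in> A" "y \<noteq> x" by blast
    then have yF: "y \<in> Field r" by (auto simp: A_def Field_def)
    have xk: "x \<in> \<Phi>" "level r x = k" using face_at[OF \<Phi> k(2)] by (simp_all add: x_def)
    have y_cmp: "(y, z) \<in> r \<or> (z, y) \<in> r" if z: "z \<in> \<Phi> - {x}" for z
    proof -
      have "level r z \<noteq> k" using flag_inj_level[OF \<Phi> _ xk(1)] z xk(2) by auto
      moreover have "(z, face_at \<Phi> (k - 1)) \<in> r" if "level r z < k"
        using face_at_le[OF \<Phi>, of "level r z" "k - 1"] face_at_level[OF \<Phi>, of z] that z k by auto
      moreover have "(face_at \<Phi> (k + 1), z) \<in> r" if "level r z > k"
        using face_at_le[OF \<Phi>, of "k + 1" "level r z"] face_at_level[OF \<Phi>, of z] that z F level_less_5 by auto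
      ultimately show ?thesis using y(1) trans by (auto simp: A_def neq_iff)
    qed
    define \<Psi> where "\<Psi> = insert y (\<Phi> - {x})"
    have "\<Phi> - {x} \<in> Chains r" using flag_chain[OF \<Phi>] by (auto simp: Chains_def)
    then have "\<Psi> \<in> Chains r" unfolding \<Psi>_def using chain_insert yF y_cmp by blast
    moreover have yn: "y \<notin> \<Phi>" using flag_inj_level[OF \<Phi> _ xk(1)] y xk(2) by (auto simp: A_def)
    then have "card \<Psi> = 5"
      using card_flag[OF \<Phi>] finite_flag[OF \<Phi>] xk(1) by (simp add: \<Psi>_def)
    ultimately have \<Psi>: "\<Psi> \<in> flags r" by (rule chain_card_5)
    then obtain \<gamma> where \<gamma>: "\<gamma> \<in> carrier \<Gamma>" "\<gamma> ` \<Phi> = \<Psi>"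
      using assms \<Phi> unfolding regular_polyhedron_def by blast
    have "\<gamma> z \<noteq> z \<longleftrightarrow> level r z = k" if z: "z \<in> \<Phi>" for z
    proof -
      have zl: "level r (\<gamma> z) = level r z" using aut_level[OF \<gamma>(1)] F z by blast
      have m: "\<gamma> z \<in> \<Psi>" using \<gamma>(2) z by blast
      show ?thesis
      proof
        assume "\<gamma> z \<noteq> z"
        then have "\<gamma> z = y" using m zl flag_inj_level[OF \<Phi> _ z] by (auto simp: \<Psi>_def)
        then show "level r z = k" using zl y(1) by (simp add: A_def)
      next
        assume "level r z = k"
        then have "z = x" using flag_inj_level[OF \<Phi> z xk(1)] xk(2) by simp
        then show "\<gamma> z \<noteq> z" using m y(2) yn by (auto simp: \<Psi>_def)
      qed
    qed
    then have "distinguished r \<Phi> i \<gamma>"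
      using \<gamma>(1) F by (auto simp: distinguished_def faces_of_rank_eq k_def)
    then show ?thesis by blast
  qed
  then have "\<forall>i\<in>{..<3}. \<exists>\<gamma>. distinguished r \<Phi> i \<gamma>" by blast
  then obtain \<rho> where "\<And>i. i < 3 \<Longrightarrow> distinguished r \<Phi> i (\<rho> i)" by (metis lessThan_iff)
  then have "regular_polyhedron_base r \<Phi> \<rho>"
    using assms \<Phi> polytope
    by (simp add: regular_polyhedron_base_def regular_polyhedron_base_axioms_def polyhedron_def)
  then show thesis by (rule that)
qed

section \<open>Groups generated by three involutions\<close>

context group
begin

lemma involution_cancel [simp]:
  "x \<in> carrier G \<Longrightarrow> y \<in> carrier G \<Longrightarrow> x \<otimes> x = \<one> \<Longrightarrow> x \<otimes> (x \<otimes> y) = y"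
  by (simp flip: m_assoc)

lemma involution_left_cancel:
  "x \<in> carrier G \<Longrightarrow> x \<otimes> x = \<one> \<Longrightarrow> y \<in> carrier G \<Longrightarrow> z \<in> carrier G \<Longrightarrow> x \<otimes> y = x \<otimes> z \<longleftrightarrow> y = z"
  by (metis involution_cancel)

lemma inv_involution: "x \<in> carrier G \<Longrightarrow> x \<otimes> x = \<one> \<Longrightarrow> inv x = x"
  by (rule inv_equality)

lemma conj_int_pow:
  assumes "y \<in> carrier G" "c \<in> carrier G" "d \<in> carrier G" "y \<otimes> c = d \<otimes> y"
  shows "y \<otimes> c [^] (i::int) = d [^] i \<otimes> y"
proof -
  have nat: "y \<otimes> c [^] n = d [^] n \<otimes> y" for n :: nat
  proof (induction n)
    case (Suc n)
    have "y \<otimes> c [^] Suc n = (y \<otimes> c [^] n) \<otimes> c" using assms by (simp add: m_assoc)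
    also have "\<dots> = d [^] n \<otimes> (y \<otimes> c)" using Suc assms by (simp add: m_assoc)
    finally show ?case using assms by (simp add: m_assoc)
  qed (use assms in simp)
  show ?thesis
  proof (cases i rule: int_cases2)
    case (nonneg n)
    then show ?thesis using nat by (simp add: int_pow_int)
  next
    case (nonpos n)
    have "inv (d [^] n) \<otimes> y = inv (d [^] n) \<otimes> (y \<otimes> c [^] n) \<otimes> inv (c [^] n)"
      using assms by (simp add: m_assoc)
    also have "\<dots> = y \<otimes> inv (c [^] n)"
    proof -
      have "inv (d [^] n) \<otimes> (d [^] n \<otimes> y) = y" using assms by (simp flip: m_assoc)
      then show ?thesis unfolding nat by simp
    qed
    finally have "inv (d [^] n) \<otimes> y = y \<otimes> inv (c [^] n)" .
    then show ?thesis using nonpos assms by (simp add: int_pow_neg_int)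
  qed
qed

lemma commute_int_pow:
  assumes "y \<in> carrier G" "c \<in> carrier G" "y \<otimes> c = c \<otimes> y"
  shows "y [^] (i::int) \<otimes> c = c \<otimes> y [^] i"
  using conj_int_pow[of c y y i] assms by simp

lemma reflection_inverts:
  assumes "x \<in> carrier G" "y \<in> carrier G" "x \<otimes> x = \<one>" "y \<otimes> y = \<one>"
  shows "y \<otimes> (x \<otimes> y) [^] (i::int) = (x \<otimes> y) [^] (- i) \<otimes> y"
proof -
  have "y \<otimes> (x \<otimes> y) = inv (x \<otimes> y) \<otimes> y"
    using assms by (simp add: inv_mult_group inv_involution m_assoc)
  from conj_int_pow[OF assms(2) _ _ this, of i] assms show ?thesis
    by (simp add: int_pow_neg int_pow_inv)
qed

lemma dihedral_elements:
  assumes "x \<in> carrier G" "y \<in> carrier G" "x \<otimes> x = \<one>" "y \<otimes> y = \<one>" "z \<in> generate G {x, y}"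
  obtains i :: int where "z = (x \<otimes> y) [^] i \<or> z = (x \<otimes> y) [^] i \<otimes> y"
proof -
  let ?c = "x \<otimes> y"
  define R where "R = {z. \<exists>i::int. z = ?c [^] i \<or> z = ?c [^] i \<otimes> y}"
  have c: "?c \<in> carrier G" using assms by simp
  have gen: "x \<in> R" "y \<in> R"
  proof -
    have "x = ?c [^] (1::int) \<otimes> y" "y = ?c [^] (0::int) \<otimes> y" using assms by (simp_all add: m_assoc)
    then show "x \<in> R" "y \<in> R" unfolding R_def by blast+
  qed
  have mult: "u \<otimes> v \<in> R" if uv: "u \<in> R" "v \<in> R" for u v
  proof -
    obtain i j :: int where i: "u = ?c [^] i \<or> u = ?c [^] i \<otimes> y" and j: "v = ?c [^] j \<or> v = ?c [^] j \<otimes> y"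
      using uv unfolding R_def by blast
    have y_pow: "?c [^] i \<otimes> (y \<otimes> z) = ?c [^] (i - j) \<otimes> y" if "z = ?c [^] j" for z
      using reflection_inverts[OF assms(1-4), of j] int_pow_mult[OF c, of i "- j"] c assms that
      by (simp flip: m_assoc)
    have "u \<otimes> v = ?c [^] (i + j) \<or> u \<otimes> v = ?c [^] (i + j) \<otimes> y \<or>
        u \<otimes> v = ?c [^] (i - j) \<otimes> y \<or> u \<otimes> v = ?c [^] (i - j)"
      using i j
    proof (elim disjE)
      assume "u = ?c [^] i \<otimes> y" "v = ?c [^] j \<otimes> y"
      then have "u \<otimes> v = (?c [^] i \<otimes> (y \<otimes> ?c [^] j)) \<otimes> y" using c assms by (simp add: m_assoc)
      also have "\<dots> = ?c [^] (i - j)" using y_pow[OF refl] c assms by (simp add: m_assoc)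
      finally show ?thesis by simp
    next
      assume "u = ?c [^] i \<otimes> y" "v = ?c [^] j"
      then have "u \<otimes> v = ?c [^] i \<otimes> (y \<otimes> ?c [^] j)" using c assms by (simp add: m_assoc)
      then show ?thesis using y_pow[OF refl] by simp
    qed (use c assms in \<open>auto simp: int_pow_mult m_assoc\<close>)
    then show ?thesis unfolding R_def by blast
  qed
  have one: "\<one> \<in> R" unfolding R_def by (intro CollectI exI[of _ 0]) simp
  have "z \<in> R"
    using assms(5)
    by (induction rule: generate.induct) (use one gen mult assms inv_involution in auto)
  then show thesis using that unfolding R_def by blast
qed

text \<open>If a power of \<open>x \<otimes> y\<close> were \<open>y\<close>, then \<open>y\<close>
  would commute with \<open>x \<otimes> y\<close>, whose square is therefore trivial. The power is
  then \<open>\<one>\<close> or \<open>x \<otimes> y\<close>, so \<open>y\<close> or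
  \<open>x\<close> is trivial.\<close>

lemma rotation_neq_reflection:
  assumes "x \<in> carrier G" "y \<in> carrier G" "x \<otimes> x = \<one>" "y \<otimes> y = \<one>" "x \<noteq> \<one>" "y \<noteq> \<one>"
  shows "(x \<otimes> y) [^] (i::int) \<noteq> y"
proof
  assume y: "(x \<otimes> y) [^] i = y"
  then have "y \<otimes> (x \<otimes> y) = (x \<otimes> y) \<otimes> y"
    using commute_int_pow[of "x \<otimes> y" "x \<otimes> y" i] assms by simp
  then have yx: "y \<otimes> (x \<otimes> y) = x" using assms by (simp add: m_assoc)
  have sq: "(x \<otimes> y) \<otimes> (x \<otimes> y) = \<one>" using yx assms by (simp add: m_assoc)
  define k where "k = i div 2"
  have "(x \<otimes> y) [^] (2 * k) = \<one>"
    using sq assms int_pow_pow[of "x \<otimes> y" 2 k] int_pow_mult[of "x \<otimes> y" 1 1] by simp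
  moreover have "i = 2 * k \<or> i = 2 * k + 1" unfolding k_def by presburger
  ultimately have "y = \<one> \<or> y = x \<otimes> y"
    using y assms int_pow_mult[of "x \<otimes> y" "2 * k" 1] by auto
  then show False using assms by (metis r_cancel_one)
qed

lemma generate_singleton_involution:
  assumes "y \<in> carrier G" "y \<otimes> y = \<one>" "z \<in> generate G {y}"
  shows "z = \<one> \<or> z = y"
  using assms(3) by (induction rule: generate.induct) (use assms inv_involution in auto)

text \<open>Only powers of the rotation need checking: a reflection in the kernel would make
  \<open>\<pi> y\<close> a power of the image rotation, which \<open>rotation_neq_reflection\<close>
  excludes.\<close>

lemma dihedral_hom_injective:
  assumes "group_hom G K \<pi>" and xy: "x \<in> carrier G" "y \<in> carrier G" "x \<otimes> x = \<one>" "y \<otimes> y = \<one>"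
    and ne: "\<pi> x \<noteq> \<one>\<^bsub>K\<^esub>" "\<pi> y \<noteq> \<one>\<^bsub>K\<^esub>"
    and ord: "\<And>n::nat. (\<pi> x \<otimes>\<^bsub>K\<^esub> \<pi> y) [^]\<^bsub>K\<^esub> n = \<one>\<^bsub>K\<^esub> \<Longrightarrow> (x \<otimes> y) [^] n = \<one>"
    and z: "z \<in> generate G {x, y}" "\<pi> z = \<one>\<^bsub>K\<^esub>"
  shows "z = \<one>"
proof -
  interpret \<pi>: group_hom G K \<pi> by fact
  have pow: "\<pi> ((x \<otimes> y) [^] (i::int)) = (\<pi> x \<otimes>\<^bsub>K\<^esub> \<pi> y) [^]\<^bsub>K\<^esub> i" for i
    using xy by (simp add: \<pi>.hom_int_pow)
  have sq: "\<pi> x \<otimes>\<^bsub>K\<^esub> \<pi> x = \<one>\<^bsub>K\<^esub>" "\<pi> y \<otimes>\<^bsub>K\<^esub> \<pi> y = \<one>\<^bsub>K\<^esub>"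
    using xy by (metis \<pi>.hom_mult \<pi>.hom_one)+
  have \<pi>c: "\<pi> x \<in> carrier K" "\<pi> y \<in> carrier K" using xy by auto
  obtain i :: int where "z = (x \<otimes> y) [^] i \<or> z = (x \<otimes> y) [^] i \<otimes> y"
    using dihedral_elements[OF xy z(1)] by blast
  then show ?thesis
  proof
    assume zi: "z = (x \<otimes> y) [^] i"
    then have i: "(\<pi> x \<otimes>\<^bsub>K\<^esub> \<pi> y) [^]\<^bsub>K\<^esub> i = \<one>\<^bsub>K\<^esub>" using z pow by simp
    have "(x \<otimes> y) [^] i = \<one>"
    proof (cases i rule: int_cases2)
      case (nonneg n)
      then show ?thesis using ord[of n] i by (simp add: int_pow_int)
    next
      case (nonpos n)
      then have "inv\<^bsub>K\<^esub> ((\<pi> x \<otimes>\<^bsub>K\<^esub> \<pi> y) [^]\<^bsub>K\<^esub> n) = \<one>\<^bsub>K\<^esub>"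
        using i \<pi>c by (simp add: \<pi>.H.int_pow_neg_int)
      then have "(\<pi> x \<otimes>\<^bsub>K\<^esub> \<pi> y) [^]\<^bsub>K\<^esub> n = \<one>\<^bsub>K\<^esub>"
        using \<pi>c by (simp add: \<pi>.H.inv_eq_1_iff)
      then show ?thesis using ord[of n] nonpos xy by (simp add: int_pow_neg_int)
    qed
    then show ?thesis using zi by simp
  next
    assume "z = (x \<otimes> y) [^] i \<otimes> y"
    then have "(\<pi> x \<otimes>\<^bsub>K\<^esub> \<pi> y) [^]\<^bsub>K\<^esub> i \<otimes>\<^bsub>K\<^esub> \<pi> y = \<one>\<^bsub>K\<^esub>" using z pow xy by simp
    then have "(\<pi> x \<otimes>\<^bsub>K\<^esub> \<pi> y) [^]\<^bsub>K\<^esub> i = \<pi> y"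
      using \<pi>c sq by (metis \<pi>.H.int_pow_closed \<pi>.H.inv_equality \<pi>.H.inv_involution \<pi>.H.m_closed \<pi>.H.inv_inv)
    then show ?thesis using \<pi>.H.rotation_neq_reflection[OF \<pi>c sq ne] by simp
  qed
qed

end

locale involution_triple = group G for G (structure) +
  fixes x0 x1 x2
  assumes closed [simp]: "x0 \<in> carrier G" "x1 \<in> carrier G" "x2 \<in> carrier G"
    and sq [simp]: "x0 \<otimes> x0 = \<one>" "x1 \<otimes> x1 = \<one>" "x2 \<otimes> x2 = \<one>"
    and comm: "x0 \<otimes> x2 = x2 \<otimes> x0"
begin

definition a where "a = x1 \<otimes> x2 \<otimes> x1"
text \<open>This is the square of \<open>x1 \<otimes> x2\<close>, written as a product of two
  conjugate reflections.\<close>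

definition w where "w = a \<otimes> x2"

lemma a_closed [simp]: "a \<in> carrier G" and w_closed [simp]: "w \<in> carrier G"
  by (simp_all add: a_def w_def)

lemma a_sq [simp]: "a \<otimes> a = \<one>"
  by (simp add: a_def m_assoc)

lemma comm': "y \<in> carrier G \<Longrightarrow> x0 \<otimes> (x2 \<otimes> y) = x2 \<otimes> (x0 \<otimes> y)"
  using comm by (simp flip: m_assoc)

lemma inv_gens [simp]: "inv x0 = x0" "inv x1 = x1" "inv x2 = x2" "inv a = a"
  by (simp_all add: inv_involution)

lemma x0_x2_x0: "x0 \<otimes> x2 \<otimes> x0 = x2"
  by (simp add: comm m_assoc)

lemma x1_a_x1: "x1 \<otimes> a \<otimes> x1 = x2"
  by (simp add: a_def m_assoc)

lemma conj_generate:
  assumes "t \<in> carrier G" "t \<otimes> t = \<one>" "S \<subseteq> carrier G" "H \<subseteq> carrier G" "subgroup H G"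
    and "\<And>s. s \<in> S \<Longrightarrow> t \<otimes> s \<otimes> t \<in> H" "n \<in> generate G S"
  shows "t \<otimes> n \<otimes> t \<in> H"
  using assms(7)
proof (induction rule: generate.induct)
  case one
  then show ?case using assms subgroup.one_closed by fastforce
next
  case (incl h)
  then show ?case by (rule assms(6))
next
  case (inv h)
  have "inv (t \<otimes> h \<otimes> t) = t \<otimes> inv h \<otimes> t"
    using assms inv by (simp add: inv_mult_group inv_involution m_assoc subsetD)
  then show ?case using assms(6)[OF inv] subgroup.m_inv_closed[OF assms(5)] by metis
next
  case (eng h k)
  have hk: "h \<in> carrier G" "k \<in> carrier G" using eng generate_in_carrier[OF assms(3)] by auto
  have "t \<otimes> (h \<otimes> k) \<otimes> t = (t \<otimes> h \<otimes> t) \<otimes> (t \<otimes> k \<otimes> t)"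
    using assms(1,2) hk by (simp add: m_assoc)
  then show ?case using eng subgroup.m_closed[OF assms(5)] by metis
qed

lemma generate_left_induct:
  assumes "z \<in> generate G S" "S \<subseteq> carrier G" "T \<subseteq> carrier G" "v \<in> T"
    and "\<And>s v. s \<in> S \<Longrightarrow> v \<in> T \<Longrightarrow> s \<otimes> v \<in> T" "\<And>s. s \<in> S \<Longrightarrow> s \<otimes> s = \<one>"
  shows "z \<otimes> v \<in> T"
  using assms(1,4)
proof (induction arbitrary: v rule: generate.induct)
  case (inv h)
  then have "inv h = h" using assms inv_involution by blast
  then show ?case using inv assms by simp
next
  case (eng h k)
  have "h \<in> carrier G" "k \<in> carrier G" using eng(1,2) generate_in_carrier[OF assms(2)] by auto
  then have "h \<otimes> k \<otimes> v = h \<otimes> (k \<otimes> v)" using eng assms(3) by (auto intro: m_assoc)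
  then show ?case using eng by simp
qed (use assms in auto)

text \<open>The premise makes the group \<open>N\<close> of \<open>x2\<close> and \<open>a\<close>
  invariant under conjugation by \<open>x0\<close> and \<open>x1\<close>. Moved to the right past
  any \<open>u\<close>, the generator \<open>x2\<close> therefore becomes an element of
  \<open>N\<close>, which lies in the second factor; the set of products absorbs all
  generators.\<close>

lemma factorization:
  assumes "generate G {x0, x1, x2} = carrier G" and a: "x0 \<otimes> a \<otimes> x0 \<in> generate G {x2, a}"
    and z: "z \<in> carrier G"
  obtains u v where "u \<in> generate G {x0, x1}" "v \<in> generate G {x1, x2}" "z = u \<otimes> v"
proof -
  define N where "N = generate G {x2, a}"
  have N: "subgroup N G" unfolding N_def by (rule generate_is_subgroup) simp
  have Nc: "N \<subseteq> carrier G" using subgroup.subset[OF N] .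
  have sub2: "subgroup (generate G {x0, x1}) G" and sub0: "subgroup (generate G {x1, x2}) G"
    by (rule generate_is_subgroup; simp)+
  have gens: "x2 \<in> N" "a \<in> N" unfolding N_def by (auto intro: generate.incl)
  have "x1 \<otimes> x2 \<otimes> x1 \<in> generate G {x1, x2}"
    by (intro generate.eng generate.incl) auto
  then have "N \<subseteq> generate G {x1, x2}"
    unfolding N_def by (intro generate_subgroup_incl sub0) (auto simp: a_def intro: generate.incl)
  have norm: "t \<otimes> n \<otimes> t \<in> N" if "t \<in> {x0, x1}" "n \<in> N" for t n
  proof (rule conj_generate[of t "{x2, a}"])
    show "n \<in> generate G {x2, a}" using that by (simp add: N_def)
    show "\<And>s. s \<in> {x2, a} \<Longrightarrow> t \<otimes> s \<otimes> t \<in> N"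
      using that(1) gens a x0_x2_x0 x1_a_x1 by (auto simp: N_def[symmetric] a_def[symmetric])
  qed (use that N Nc in auto)
  define T where "T = {u. u \<in> carrier G \<and> (\<forall>n\<in>N. \<exists>n'\<in>N. n \<otimes> u = u \<otimes> n')}"
  have T: "u \<otimes> \<one> \<in> T" if "u \<in> generate G {x0, x1}" for u
  proof (rule generate_left_induct[OF that])
    have "n \<otimes> \<one> = \<one> \<otimes> n" if "n \<in> N" for n using Nc that by (simp add: subsetD)
    then show "\<one> \<in> T" unfolding T_def by blast
    fix s v assume s: "s \<in> {x0, x1}" and v: "v \<in> T"
    then have sc: "s \<in> carrier G" "s \<otimes> s = \<one>" and vc: "v \<in> carrier G" by (auto simp: T_def)
    have "\<exists>n'\<in>N. n \<otimes> (s \<otimes> v) = s \<otimes> v \<otimes> n'" if n: "n \<in> N" for n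
    proof -
      have nc: "n \<in> carrier G" using n Nc by blast
      obtain n' where n': "n' \<in> N" "(s \<otimes> n \<otimes> s) \<otimes> v = v \<otimes> n'"
        using v norm[OF s n] by (auto simp: T_def)
      have "n \<otimes> (s \<otimes> v) = s \<otimes> ((s \<otimes> n \<otimes> s) \<otimes> v)" using sc vc nc by (simp add: m_assoc)
      also have "\<dots> = s \<otimes> v \<otimes> n'" unfolding n'(2) using sc vc n' Nc by (simp add: m_assoc subsetD)
      finally show ?thesis using n' by blast
    qed
    then show "s \<otimes> v \<in> T" using sc vc by (simp add: T_def)
  qed (auto simp: T_def)
  define U where "U = {u \<otimes> v | u v. u \<in> generate G {x0, x1} \<and> v \<in> generate G {x1, x2}}"
  have "z \<otimes> \<one> \<in> U"
  proof (rule generate_left_induct[of _ "{x0, x1, x2}"])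
    show "z \<in> generate G {x0, x1, x2}" using assms by simp
    show "U \<subseteq> carrier G"
      using subgroup.subset[OF sub2] subgroup.subset[OF sub0] unfolding U_def by blast
    have "\<one> \<otimes> \<one> \<in> U" unfolding U_def by (blast intro: generate.one)
    then show "\<one> \<in> U" by simp
    fix s v assume s: "s \<in> {x0, x1, x2}" and "v \<in> U"
    then obtain u v' where v: "u \<in> generate G {x0, x1}" "v' \<in> generate G {x1, x2}" "v = u \<otimes> v'"
      unfolding U_def by blast
    have c: "u \<in> carrier G" "v' \<in> carrier G" "s \<in> carrier G"
      using v s subgroup.subset[OF sub2] subgroup.subset[OF sub0] by auto
    show "s \<otimes> v \<in> U"
    proof (cases "s = x2")
      case True
      have uT: "u \<in> T" using T[OF v(1)] c by simp
      then obtain n' where n': "n' \<in> N" "x2 \<otimes> u = u \<otimes> n'" using gens(1) unfolding T_def by blast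
      have n'c: "n' \<in> carrier G" using n'(1) Nc by blast
      have "s \<otimes> v = (x2 \<otimes> u) \<otimes> v'" using c v True by (simp add: m_assoc)
      also have "\<dots> = u \<otimes> (n' \<otimes> v')" unfolding n'(2) using c n'c by (simp add: m_assoc)
      finally have "s \<otimes> v = u \<otimes> (n' \<otimes> v')" .
      moreover have "n' \<otimes> v' \<in> generate G {x1, x2}"
        using v n' \<open>N \<subseteq> generate G {x1, x2}\<close> by (blast intro: generate.eng)
      ultimately show ?thesis using v unfolding U_def by blast
    next
      case False
      then have "s \<otimes> u \<in> generate G {x0, x1}" using s v by (blast intro: generate.eng generate.incl)
      moreover have "s \<otimes> v = (s \<otimes> u) \<otimes> v'" using c v by (simp add: m_assoc)
      ultimately show ?thesis using v unfolding U_def by blast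
    qed
  qed auto
  then have "z \<in> U" using z by simp
  then show thesis using that unfolding U_def by blast
qed

section \<open>The listed relations as statements about the conjugate of \<open>a\<close> by
  \<open>x0\<close>\<close>

lemma x0_a_x0_of_comm_x0_x1:
  assumes "(x0 \<otimes> x1) [^] (2::nat) = \<one>"
  shows "x0 \<otimes> a \<otimes> x0 = a"
proof -
  have c: "x0 \<otimes> x1 = x1 \<otimes> x0" using involutions_commute[of x0 x1] assms by simp
  then have c': "y \<in> carrier G \<Longrightarrow> x0 \<otimes> (x1 \<otimes> y) = x1 \<otimes> (x0 \<otimes> y)" for y by (simp flip: m_assoc)
  have "x0 \<otimes> a \<otimes> x0 = x0 \<otimes> (x1 \<otimes> (x2 \<otimes> (x1 \<otimes> x0)))" by (simp add: a_def m_assoc)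
  also have "x1 \<otimes> x0 = x0 \<otimes> x1" using c by simp
  finally show ?thesis by (simp add: a_def m_assoc c' comm')
qed

lemma x0_a_x0_of_comm_x1_x2:
  assumes "(x1 \<otimes> x2) [^] (2::nat) = \<one>"
  shows "x0 \<otimes> a \<otimes> x0 = x2" "a = x2"
proof -
  have c: "x1 \<otimes> x2 = x2 \<otimes> x1" using involutions_commute[of x1 x2] assms by simp
  then show "a = x2" by (simp add: a_def m_assoc)
  then show "x0 \<otimes> a \<otimes> x0 = x2" using x0_x2_x0 by simp
qed

text \<open>The braid relation between \<open>x0\<close> and \<open>x1\<close>, together with the
  commutation of \<open>x0\<close> and \<open>x2\<close>, collects the cube around one conjugate of
  \<open>a\<close>.\<close>

lemma hemi_relation_iff:
  assumes "(x0 \<otimes> x1) [^] (3::nat) = \<one>"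
  shows "(x0 \<otimes> x1 \<otimes> x2) [^] (3::nat) = \<one> \<longleftrightarrow> x0 \<otimes> a \<otimes> x0 = a \<otimes> x2"
proof -
  have braid: "x0 \<otimes> (x1 \<otimes> (x0 \<otimes> y)) = x1 \<otimes> (x0 \<otimes> (x1 \<otimes> y))" if y: "y \<in> carrier G" for y
  proof -
    have "(x0 \<otimes> x1 \<otimes> x0) \<otimes> (x1 \<otimes> x0 \<otimes> x1) = \<one>"
      using assms by (simp add: numeral_3_eq_3 m_assoc)
    then have "x0 \<otimes> x1 \<otimes> x0 = inv (x1 \<otimes> x0 \<otimes> x1)" by (simp add: inv_equality)
    also have "\<dots> = x1 \<otimes> x0 \<otimes> x1" by (simp add: inv_mult_group m_assoc)
    finally have "(x0 \<otimes> x1 \<otimes> x0) \<otimes> y = (x1 \<otimes> x0 \<otimes> x1) \<otimes> y" by simp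
    then show ?thesis using y by (simp add: m_assoc)
  qed
  have "(x0 \<otimes> x1 \<otimes> x2) [^] (3::nat) = x0 \<otimes> (x1 \<otimes> (x2 \<otimes> (x0 \<otimes> (x1 \<otimes> (x2 \<otimes> (x0 \<otimes> (x1 \<otimes> x2)))))))"
    by (simp add: numeral_3_eq_3 m_assoc)
  also have "\<dots> = x0 \<otimes> (x1 \<otimes> (x0 \<otimes> (x2 \<otimes> (x1 \<otimes> (x0 \<otimes> (x2 \<otimes> (x1 \<otimes> x2)))))))"
    by (simp flip: comm')
  also have "\<dots> = x1 \<otimes> (x0 \<otimes> (x1 \<otimes> (x2 \<otimes> (x1 \<otimes> (x0 \<otimes> (x2 \<otimes> (x1 \<otimes> x2)))))))"
    by (rule braid) simp
  finally have *: "(x0 \<otimes> x1 \<otimes> x2) [^] (3::nat) = (x1 \<otimes> (x0 \<otimes> a \<otimes> x0)) \<otimes> (x2 \<otimes> x1 \<otimes> x2)"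
    by (simp add: a_def m_assoc)
  have inv: "inv (x2 \<otimes> x1 \<otimes> x2) = x2 \<otimes> x1 \<otimes> x2" by (simp add: inv_mult_group m_assoc)
  have "(x0 \<otimes> x1 \<otimes> x2) [^] (3::nat) = \<one> \<longleftrightarrow> x1 \<otimes> (x0 \<otimes> a \<otimes> x0) = x2 \<otimes> x1 \<otimes> x2"
    unfolding * using inv inv_solve_right[of "x1 \<otimes> (x0 \<otimes> a \<otimes> x0)" \<one> "x2 \<otimes> x1 \<otimes> x2"]
    by (metis closed(1,2,3) a_closed inv_equality inv_inv l_inv m_closed)
  also have "\<dots> \<longleftrightarrow> x1 \<otimes> (x1 \<otimes> (x0 \<otimes> a \<otimes> x0)) = x1 \<otimes> (x2 \<otimes> x1 \<otimes> x2)"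
    by (subst involution_left_cancel) simp_all
  also have "\<dots> \<longleftrightarrow> x0 \<otimes> a \<otimes> x0 = a \<otimes> x2" by (simp add: a_def m_assoc)
  finally show ?thesis .
qed

text \<open>Expanded into involutions, both sides of the relation are conjugated by
  \<open>x1\<close> and multiplied by \<open>x0\<close>; this brings out the conjugates of
  \<open>a\<close>.\<close>

lemma flat_relation_iff:
  shows "(inv (x1 \<otimes> x2) \<otimes> (x0 \<otimes> x1)) \<otimes> inv (inv (x0 \<otimes> x1) \<otimes> (x1 \<otimes> x2) [^] (-3::int)) = \<one>
    \<longleftrightarrow> x0 \<otimes> a \<otimes> x0 = x2 \<otimes> a \<otimes> x2"
proof -
  have pow: "(x1 \<otimes> x2) [^] (-3::int) = x2 \<otimes> x1 \<otimes> (x2 \<otimes> x1) \<otimes> (x2 \<otimes> x1)"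
    using int_pow_neg_int[of "x1 \<otimes> x2" 3] by (simp add: numeral_3_eq_3 inv_mult_group m_assoc)
  have "inv (x1 \<otimes> x2) \<otimes> (x0 \<otimes> x1) = x2 \<otimes> (x1 \<otimes> (x0 \<otimes> x1))" (is "?L = ?l") by (simp add: inv_mult_group m_assoc)
  moreover have "inv (x0 \<otimes> x1) \<otimes> (x1 \<otimes> x2) [^] (-3::int) = x1 \<otimes> (x0 \<otimes> (x2 \<otimes> (x1 \<otimes> (x2 \<otimes> (x1 \<otimes> (x2 \<otimes> x1))))))"
    (is "?R = ?r") unfolding pow by (simp add: inv_mult_group m_assoc)
  ultimately have "?L \<otimes> inv ?R = \<one> \<longleftrightarrow> ?l = ?r"
    using inv_solve_right[of \<one> ?l ?r] by (metis closed m_closed inv_closed inv_inv inv_equality r_inv)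
  also have "\<dots> \<longleftrightarrow> x0 \<otimes> (x1 \<otimes> ?l \<otimes> x1) = x0 \<otimes> (x1 \<otimes> ?r \<otimes> x1)"
  proof -
    have conj: "l = r \<longleftrightarrow> x0 \<otimes> (x1 \<otimes> l \<otimes> x1) = x0 \<otimes> (x1 \<otimes> r \<otimes> x1)"
      if "l \<in> carrier G" "r \<in> carrier G" for l r
      using that right_cancel[of x1 "x1 \<otimes> l" "x1 \<otimes> r"] involution_left_cancel[of x1 l r]
        involution_left_cancel[of x0 "x1 \<otimes> l \<otimes> x1" "x1 \<otimes> r \<otimes> x1"] by simp
    show ?thesis by (rule conj; simp)
  qed
  also have "\<dots> \<longleftrightarrow> x0 \<otimes> a \<otimes> x0 = x2 \<otimes> a \<otimes> x2" by (simp add: a_def m_assoc)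
  finally show ?thesis .
qed

section \<open>Conjugating the square of the second rotation by \<open>x0\<close>\<close>

lemma inv_w: "inv w = x2 \<otimes> a"
  by (simp add: w_def inv_mult_group)

lemma reflections_invert_w: "x1 \<otimes> w = inv w \<otimes> x1" "x2 \<otimes> w = inv w \<otimes> x2"
  by (simp_all add: inv_w, simp_all add: w_def a_def m_assoc)

lemma a_eq_w: "a = w \<otimes> x2"
  by (simp add: w_def m_assoc)

lemma a_eq_one_iff: "a = \<one> \<longleftrightarrow> x2 = \<one>"
proof
  assume "a = \<one>"
  then have "x1 \<otimes> a \<otimes> x1 = \<one>" by simp
  then show "x2 = \<one>" using x1_a_x1 by simp
next
  assume "x2 = \<one>"
  then show "a = \<one>" unfolding a_def by simp
qed

abbreviation "s \<equiv> x0 \<otimes> x1"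

lemma s_x2: "s \<otimes> x2 = (x0 \<otimes> a \<otimes> x0) \<otimes> s"
  by (simp add: a_def m_assoc)

text \<open>Conjugating twice gives \<open>w [^] (j * j) = w\<close>, and \<open>s\<close>
  conjugates \<open>w\<close> to its power with exponent \<open>- j\<close>; so the square of
  \<open>s\<close> commutes with \<open>w\<close>, and by odd order so does \<open>s\<close>. Hence
  \<open>x0\<close> inverts \<open>w\<close>. Moving \<open>x2\<close> past
  \<open>s [^] b = \<one>\<close> then collects a factor \<open>inv w\<close> at each of the
  \<open>b\<close> steps.\<close>

lemma relation_of_w_normalised:
  assumes x0w: "x0 \<otimes> w \<otimes> x0 = w [^] (j::int)" and sb: "s [^] b = \<one>" and odd: "odd (b::nat)"
  shows "x0 \<otimes> a \<otimes> x0 = x2 \<otimes> a \<otimes> x2" "w [^] b = \<one>"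
proof -
  have x0w': "x0 \<otimes> w = w [^] j \<otimes> x0"
    unfolding x0w[symmetric] by (simp add: m_assoc)
  have x0_pow: "x0 \<otimes> w [^] i = w [^] (j * i) \<otimes> x0" for i :: int
    using conj_int_pow[of x0 w "w [^] j" i, OF _ _ _ x0w'] by (simp add: int_pow_pow)
  have wjj: "w [^] (j * j) = w"
  proof -
    have "w = x0 \<otimes> (x0 \<otimes> w)" by simp
    also have "\<dots> = w [^] (j * j)" unfolding x0w' using x0_pow[of j] by (simp flip: m_assoc) (simp add: m_assoc)
    finally show ?thesis by simp
  qed
  have sw: "s \<otimes> w = w [^] (- j) \<otimes> s"
  proof -
    have "s \<otimes> w = x0 \<otimes> (x1 \<otimes> w)" by (simp add: m_assoc)
    also have "\<dots> = (x0 \<otimes> w [^] (- 1 :: int)) \<otimes> x1"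
      unfolding reflections_invert_w by (simp add: int_pow_neg m_assoc)
    also have "\<dots> = w [^] (- j) \<otimes> s" unfolding x0_pow by (simp add: m_assoc)
    finally show ?thesis .
  qed
  have "(s \<otimes> s) \<otimes> w = s \<otimes> (s \<otimes> w)" by (simp add: m_assoc)
  also have "\<dots> = (s \<otimes> w [^] (- j)) \<otimes> s" unfolding sw by (simp add: m_assoc)
  also have "s \<otimes> w [^] (- j) = w [^] (j * j) \<otimes> s"
    using conj_int_pow[of s w "w [^] (- j)" "- j", OF _ _ _ sw] by (simp add: int_pow_pow)
  finally have ssw: "(s \<otimes> s) \<otimes> w = w \<otimes> (s \<otimes> s)" unfolding wjj by (simp add: m_assoc)
  obtain k where k: "b = 2 * k + 1" using odd oddE by blast
  \<comment> \<open>\<open>u\<close> is the inverse of \<open>s\<close> expressed through its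
    square: \<open>s [^] (2 * k)\<close> times \<open>s\<close> is \<open>s [^] b\<close>.\<close>
  define u where "u = (s \<otimes> s) [^] int k"
  have u: "u \<in> carrier G" "u \<otimes> w = w \<otimes> u"
    using commute_int_pow[of "s \<otimes> s" w "int k"] ssw by (simp_all add: u_def)
  have "u = s [^] (2 * k)"
    using nat_pow_pow[of s 2 k] by (simp add: u_def int_pow_int numeral_2_eq_2)
  then have us: "u \<otimes> s = \<one>" using sb k by simp
  then have su: "s \<otimes> u = \<one>" using u by (metis closed(1,2) inv_comm m_closed)
  have "s \<otimes> w = s \<otimes> (w \<otimes> u) \<otimes> s" using us u by (simp add: m_assoc)
  also have "\<dots> = (s \<otimes> u) \<otimes> w \<otimes> s" unfolding u(2)[symmetric] using u by (simp add: m_assoc)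
  finally have comm_s: "s \<otimes> w = w \<otimes> s" using su by simp
  have "(x0 \<otimes> inv w) \<otimes> x1 = (w \<otimes> x0) \<otimes> x1"
    using comm_s reflections_invert_w(1) by (simp add: m_assoc)
  then have "x0 \<otimes> inv w = w \<otimes> x0" by (metis closed(1,2) inv_closed m_closed right_cancel w_closed)
  then have "x0 \<otimes> w \<otimes> x0 = x0 \<otimes> (x0 \<otimes> inv w)" by (simp add: m_assoc)
  then have x0wx0: "x0 \<otimes> w \<otimes> x0 = inv w" by simp
  have "x0 \<otimes> a \<otimes> x0 = (x0 \<otimes> w \<otimes> x0) \<otimes> x2"
    unfolding a_eq_w using comm by (simp add: m_assoc)
  then have x0ax0: "x0 \<otimes> a \<otimes> x0 = inv w \<otimes> x2" unfolding x0wx0 .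
  then show "x0 \<otimes> a \<otimes> x0 = x2 \<otimes> a \<otimes> x2" by (simp add: inv_w)
  have sx2: "s \<otimes> x2 = inv w \<otimes> x2 \<otimes> s" using s_x2 x0ax0 by simp
  have s_inv_w: "s [^] n \<otimes> inv w = inv w \<otimes> s [^] n" for n :: nat
  proof -
    have "s \<otimes> w [^] (- 1 :: int) = w [^] (- 1 :: int) \<otimes> s"
      using conj_int_pow[of s w w "-1"] comm_s by simp
    then have "s \<otimes> inv w = inv w \<otimes> s" by (simp add: int_pow_neg)
    from commute_int_pow[OF _ _ this, of "int n"] show ?thesis by (simp add: int_pow_int)
  qed
  have "s [^] n \<otimes> x2 = inv w [^] n \<otimes> (x2 \<otimes> s [^] n)" for n :: nat
  proof (induction n)
    case (Suc n)
    have "s [^] Suc n \<otimes> x2 = s [^] n \<otimes> (s \<otimes> x2)" by (simp add: m_assoc)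
    also have "\<dots> = (s [^] n \<otimes> inv w) \<otimes> (x2 \<otimes> s)" unfolding sx2 by (simp add: m_assoc)
    also have "\<dots> = inv w \<otimes> (s [^] n \<otimes> x2) \<otimes> s" unfolding s_inv_w by (simp add: m_assoc)
    also have "\<dots> = (inv w \<otimes> inv w [^] n) \<otimes> (x2 \<otimes> (s [^] n \<otimes> s))" unfolding Suc by (simp add: m_assoc)
    also have "inv w \<otimes> inv w [^] n = inv w [^] Suc n" by (rule nat_pow_Suc2[symmetric]) simp
    finally show ?case by simp
  qed simp
  from this[of b] have "x2 = inv w [^] b \<otimes> x2" unfolding sb by simp
  then have "\<one> \<otimes> x2 = inv w [^] b \<otimes> x2" by simp
  then have "inv w [^] b = \<one>" using right_cancel[of x2 "\<one>" "inv w [^] b"] by simp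
  then show "w [^] b = \<one>" using nat_pow_inv[of w b] inv_eq_1_iff[of "w [^] b"] by simp
qed

text \<open>A conjugate of \<open>w\<close> is a reflection, so \<open>w\<close> is an involution,
  and \<open>x2\<close>, \<open>w\<close>, \<open>a\<close> are the involutions of a Klein
  four-group that \<open>s\<close> permutes in a 3-cycle. The cube of \<open>s\<close> thus commutes
  with \<open>x2\<close>; for a prime \<open>b\<close> other than \<open>3\<close>, \<open>s\<close>
  is a power of its cube and would commute as well.\<close>

lemma relation_of_w_reflected:
  assumes x0w: "x0 \<otimes> w \<otimes> x0 = w [^] (j::int) \<otimes> x2" and sb: "s [^] b = \<one>" and b: "prime (b::nat)"
    and ne: "x2 \<noteq> \<one>"
  shows "b = 3" "w \<otimes> w = \<one>" "w \<noteq> \<one>" "x0 \<otimes> a \<otimes> x0 = a \<otimes> x2"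
proof -
  have "(w [^] j \<otimes> x2) \<otimes> (w [^] j \<otimes> x2) = w [^] j \<otimes> (x2 \<otimes> w [^] j) \<otimes> x2" by (simp add: m_assoc)
  also have "x2 \<otimes> w [^] j = w [^] (- j) \<otimes> x2"
    using conj_int_pow[of x2 w "inv w" j] reflections_invert_w by (simp add: int_pow_inv int_pow_neg)
  finally have "(w [^] j \<otimes> x2) \<otimes> (w [^] j \<otimes> x2) = \<one>" by (simp add: m_assoc int_pow_neg)
  then have "(x0 \<otimes> w \<otimes> x0) \<otimes> (x0 \<otimes> w \<otimes> x0) = \<one>" unfolding x0w .
  then have "x0 \<otimes> (w \<otimes> w) \<otimes> x0 = \<one>" by (simp add: m_assoc)
  then have "x0 \<otimes> (x0 \<otimes> (w \<otimes> w) \<otimes> x0) \<otimes> x0 = \<one>" by simp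
  then show ww: "w \<otimes> w = \<one>" by (simp add: m_assoc)
  then have inv_w_eq: "inv w = w" by (simp add: inv_involution)
  have w_x2: "w \<noteq> x2"
  proof
    assume "w = x2"
    then have "a = \<one>" unfolding a_eq_w by simp
    then show False using a_eq_one_iff ne by simp
  qed
  define k where "k = j div 2"
  have even: "w [^] (2 * k) = \<one>"
    using ww int_pow_pow[of w 2 k] int_pow_mult[of w 1 1] by simp
  have "j = 2 * k \<or> j = 2 * k + 1" unfolding k_def by presburger
  then have "w [^] j = \<one> \<or> w [^] j = w" using even int_pow_mult[of w "2 * k" 1] by auto
  moreover have "w [^] j \<noteq> \<one>"
  proof
    assume "w [^] j = \<one>"
    then have "x0 \<otimes> (x0 \<otimes> w \<otimes> x0) \<otimes> x0 = x0 \<otimes> x2 \<otimes> x0" using x0w by simp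
    then have "w = x2" using x0_x2_x0 by (simp add: m_assoc)
    then show False using w_x2 by simp
  qed
  ultimately have x0wx0: "x0 \<otimes> w \<otimes> x0 = a" using x0w a_eq_w by simp
  then have "x0 \<otimes> (x0 \<otimes> w \<otimes> x0) \<otimes> x0 = x0 \<otimes> a \<otimes> x0" by simp
  then have x0ax0: "x0 \<otimes> a \<otimes> x0 = w" by (simp add: m_assoc)
  then show "x0 \<otimes> a \<otimes> x0 = a \<otimes> x2" by (simp add: w_def)
  show "w \<noteq> \<one>"
  proof
    assume "w = \<one>"
    then have "a = \<one>" using x0wx0 by (simp add: m_assoc)
    then show False using a_eq_one_iff ne by simp
  qed
  have s1: "s \<otimes> x2 = w \<otimes> s" using s_x2 x0ax0 by simp
  have "x0 \<otimes> w = a \<otimes> x0" unfolding x0wx0[symmetric] by (simp add: m_assoc)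
  then have s2: "s \<otimes> w = a \<otimes> s"
    using reflections_invert_w(1) unfolding inv_w_eq by (simp add: m_assoc) (simp flip: m_assoc)
  have s3: "s \<otimes> a = x2 \<otimes> s" using comm' by (simp add: a_def m_assoc)
  have "(s \<otimes> (s \<otimes> s)) \<otimes> x2 = s \<otimes> (s \<otimes> (s \<otimes> x2))" by (simp add: m_assoc)
  also have "\<dots> = s \<otimes> (s \<otimes> w) \<otimes> s" unfolding s1 by (simp add: m_assoc)
  also have "\<dots> = (s \<otimes> a) \<otimes> (s \<otimes> s)" unfolding s2 by (simp add: m_assoc)
  also have "\<dots> = x2 \<otimes> (s \<otimes> (s \<otimes> s))" unfolding s3 by (simp add: m_assoc)
  finally have comm3: "(s \<otimes> (s \<otimes> s)) \<otimes> x2 = x2 \<otimes> (s \<otimes> (s \<otimes> s))" .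
  show "b = 3"
  proof (rule ccontr)
    assume "b \<noteq> 3"
    have "\<not> b dvd 3"
    proof
      assume "b dvd 3"
      moreover have "prime (3::nat)" by simp
      ultimately show False using b \<open>b \<noteq> 3\<close> primes_dvd_imp_eq by blast
    qed
    then have "gcd 3 b = 1"
      using prime_imp_coprime[OF b] coprime_iff_gcd_eq_1 gcd.commute by metis
    then obtain x y where xy: "3 * x = b * y + 1" using bezout_nat[of 3 b] by auto
    have "(s \<otimes> (s \<otimes> s)) [^] int x = s [^] (3 * x)"
      using nat_pow_pow[of s 3 x] by (simp add: int_pow_int numeral_3_eq_3 m_assoc)
    also have "\<dots> = (s [^] b) [^] y \<otimes> s" unfolding xy by (simp add: nat_pow_pow)
    also have "\<dots> = s" unfolding sb by simp
    finally have "s \<otimes> x2 = x2 \<otimes> s" using commute_int_pow[of "s \<otimes> (s \<otimes> s)" x2 "int x"] comm3 by simp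
    then have "w = x2" using s1 by (metis closed m_closed right_cancel w_closed)
    then show False using w_x2 by simp
  qed
qed

end

section \<open>The regular polyhedra with a prime number of vertices\<close>

declare One_nat_def [simp del]

context regular_polyhedron_base
begin

sublocale T: involution_triple \<Gamma> "\<rho> 0" "\<rho> 1" "\<rho> 2"
  by unfold_locales (use \<rho>_closed \<rho>_involution \<rho>_commute in auto)

abbreviation "s1 \<equiv> \<rho> 0 \<otimes>\<^bsub>\<Gamma>\<^esub> \<rho> 1"
abbreviation "s2 \<equiv> \<rho> 1 \<otimes>\<^bsub>\<Gamma>\<^esub> \<rho> 2"

lemma less_3_sets: "\<rho> ` {..<3} = {\<rho> 0, \<rho> 1, \<rho> 2}" "{..<3} - {0} = {1, 2::nat}" "{..<3} - {2} = {0, 1::nat}"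
    "{..<3} - {0, 2} = {1::nat}"
proof -
  have 3: "{..<3} = {0, 1, 2::nat}" by auto
  show "\<rho> ` {..<3} = {\<rho> 0, \<rho> 1, \<rho> 2}" unfolding 3 by simp
  show "{..<3} - {0} = {1, 2::nat}" "{..<3} - {2} = {0, 1::nat}" "{..<3} - {0, 2} = {1::nat}"
    unfolding 3 by auto
qed

lemma generated: "generate \<Gamma> {\<rho> 0, \<rho> 1, \<rho> 2} = carrier \<Gamma>"
  using \<Gamma>_generated less_3_sets(1) by simp

lemma stabilizer_iff:
  assumes "\<gamma> \<in> carrier \<Gamma>" "J \<subseteq> {..<3}"
  shows "(\<forall>j\<in>J. \<gamma> (b (Suc j)) = b (Suc j)) \<longleftrightarrow> \<gamma> \<in> generate \<Gamma> (\<rho> ` ({..<3} - J))"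
proof
  assume "\<forall>j\<in>J. \<gamma> (b (Suc j)) = b (Suc j)"
  then show "\<gamma> \<in> generate \<Gamma> (\<rho> ` ({..<3} - J))" using stabilizer_generated assms(1) by blast
next
  assume \<gamma>: "\<gamma> \<in> generate \<Gamma> (\<rho> ` ({..<3} - J))"
  show "\<forall>j\<in>J. \<gamma> (b (Suc j)) = b (Suc j)"
  proof
    fix j assume j: "j \<in> J"
    then have "Suc j < 5" using assms(2) by auto
    then show "\<gamma> (b (Suc j)) = b (Suc j)" using generate_fixes[OF \<gamma>, of "Suc j"] j by auto
  qed
qed

lemma vertex_stabilizer:
  assumes "\<gamma> \<in> carrier \<Gamma>"
  shows "\<gamma> (b 1) = b 1 \<longleftrightarrow> \<gamma> \<in> generate \<Gamma> {\<rho> 1, \<rho> 2}"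
  using stabilizer_iff[OF assms, of "{0}"] unfolding less_3_sets by (simp add: One_nat_def)

lemma facet_stabilizer:
  assumes "\<gamma> \<in> carrier \<Gamma>"
  shows "\<gamma> (b 3) = b 3 \<longleftrightarrow> \<gamma> \<in> generate \<Gamma> {\<rho> 0, \<rho> 1}"
  using stabilizer_iff[OF assms, of "{2}"] unfolding less_3_sets by simp

lemma vertex_facet_stabilizer:
  assumes "\<gamma> \<in> carrier \<Gamma>" "\<gamma> (b 1) = b 1" "\<gamma> (b 3) = b 3"
  shows "\<gamma> = \<one>\<^bsub>\<Gamma>\<^esub> \<or> \<gamma> = \<rho> 1"
proof -
  have "\<gamma> \<in> generate \<Gamma> {\<rho> 1}"
    using stabilizer_iff[OF assms(1), of "{0, 2}"] assms(2,3) unfolding less_3_sets by (simp add: One_nat_def)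
  then show ?thesis
    using \<Gamma>.generate_singleton_involution[of "\<rho> 1"] T.closed T.sq by blast
qed

lemma generators_ne: "\<rho> 0 \<noteq> \<one>\<^bsub>\<Gamma>\<^esub>" "\<rho> 1 \<noteq> \<one>\<^bsub>\<Gamma>\<^esub>" "\<rho> 2 \<noteq> \<one>\<^bsub>\<Gamma>\<^esub>" "s1 \<noteq> \<one>\<^bsub>\<Gamma>\<^esub>" "s2 \<noteq> \<one>\<^bsub>\<Gamma>\<^esub>"
proof -
  show ne: "\<rho> 0 \<noteq> \<one>\<^bsub>\<Gamma>\<^esub>" "\<rho> 1 \<noteq> \<one>\<^bsub>\<Gamma>\<^esub>" "\<rho> 2 \<noteq> \<one>\<^bsub>\<Gamma>\<^esub>" by (simp_all add: \<rho>_neq_one)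
  have "\<rho> 0 (b 1) \<noteq> b 1" "\<rho> 1 (b 1) = b 1" "\<rho> 2 (b 3) \<noteq> b 3" "\<rho> 1 (b 3) = b 3"
    using \<rho>_moves[of 0 1] \<rho>_moves[of 1 1] \<rho>_moves[of 2 3] \<rho>_moves[of 1 3] by auto
  \<comment> \<open>A trivial product would make the two involutions equal, but they differ on a
    base face.\<close>
  moreover have "x = y" if "x \<otimes>\<^bsub>\<Gamma>\<^esub> y = \<one>\<^bsub>\<Gamma>\<^esub>" "x \<in> carrier \<Gamma>" "y \<in> carrier \<Gamma>" "y \<otimes>\<^bsub>\<Gamma>\<^esub> y = \<one>\<^bsub>\<Gamma>\<^esub>" for x y
    using that \<Gamma>.right_cancel[of y x y] by simp
  ultimately show "s1 \<noteq> \<one>\<^bsub>\<Gamma>\<^esub>" "s2 \<noteq> \<one>\<^bsub>\<Gamma>\<^esub>"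
    using T.closed T.sq by metis+
qed

text \<open>Powers of \<open>s1\<close> fix the base facet; one that also fixes the base vertex is
  \<open>\<one>\<close> or \<open>\<rho> 1\<close>, and a rotation is not that reflection. So the
  order of \<open>s1\<close> can be read off at a single vertex.\<close>

lemma s1_pow_fixes_vertex:
  assumes "(s1 [^]\<^bsub>\<Gamma>\<^esub> (i::int)) (b 1) = b 1"
  shows "s1 [^]\<^bsub>\<Gamma>\<^esub> i = \<one>\<^bsub>\<Gamma>\<^esub>"
proof -
  have "s1 \<in> generate \<Gamma> {\<rho> 0, \<rho> 1}" by (intro generate.eng generate.incl) auto
  then have "s1 [^]\<^bsub>\<Gamma>\<^esub> i \<in> generate \<Gamma> {\<rho> 0, \<rho> 1}"
    by (intro \<Gamma>.subgroup_int_pow_closed \<Gamma>.generate_is_subgroup) auto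
  then have "s1 [^]\<^bsub>\<Gamma>\<^esub> i = \<one>\<^bsub>\<Gamma>\<^esub> \<or> s1 [^]\<^bsub>\<Gamma>\<^esub> i = \<rho> 1"
    using vertex_facet_stabilizer assms facet_stabilizer by simp
  then show ?thesis using \<Gamma>.rotation_neq_reflection[of "\<rho> 0" "\<rho> 1" i] generators_ne by simp
qed

lemma s2_pow_fixes_facet:
  assumes "((\<rho> 2 \<otimes>\<^bsub>\<Gamma>\<^esub> \<rho> 1) [^]\<^bsub>\<Gamma>\<^esub> (i::int)) (b 3) = b 3"
  shows "(\<rho> 2 \<otimes>\<^bsub>\<Gamma>\<^esub> \<rho> 1) [^]\<^bsub>\<Gamma>\<^esub> i = \<one>\<^bsub>\<Gamma>\<^esub>"
proof -
  let ?d = "\<rho> 2 \<otimes>\<^bsub>\<Gamma>\<^esub> \<rho> 1"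
  have "?d \<in> generate \<Gamma> {\<rho> 1, \<rho> 2}" by (intro generate.eng generate.incl) auto
  then have "?d [^]\<^bsub>\<Gamma>\<^esub> i \<in> generate \<Gamma> {\<rho> 1, \<rho> 2}"
    by (intro \<Gamma>.subgroup_int_pow_closed \<Gamma>.generate_is_subgroup) auto
  then have "?d [^]\<^bsub>\<Gamma>\<^esub> i = \<one>\<^bsub>\<Gamma>\<^esub> \<or> ?d [^]\<^bsub>\<Gamma>\<^esub> i = \<rho> 1"
    using vertex_facet_stabilizer assms vertex_stabilizer by simp
  then show ?thesis using \<Gamma>.rotation_neq_reflection[of "\<rho> 2" "\<rho> 1" i] generators_ne by simp
qed

lemma card_rotation_orbit:
  assumes "d \<in> carrier \<Gamma>" "\<Gamma>.ord d \<noteq> 0" "k < 5"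
    and "\<And>i::int. (d [^]\<^bsub>\<Gamma>\<^esub> i) (b k) = b k \<Longrightarrow> d [^]\<^bsub>\<Gamma>\<^esub> i = \<one>\<^bsub>\<Gamma>\<^esub>"
  shows "card {(d [^]\<^bsub>\<Gamma>\<^esub> i) (b k) | i::int. True} = \<Gamma>.ord d"
proof -
  let ?n = "int (\<Gamma>.ord d)" and ?f = "\<lambda>i::int. (d [^]\<^bsub>\<Gamma>\<^esub> i) (b k)"
  have F: "b k \<in> Field r" by (rule b_Field[OF assms(3)])
  have eq: "?f i = ?f j \<longleftrightarrow> i mod ?n = j mod ?n" for i j
  proof
    assume "?f i = ?f j"
    then have "(inv\<^bsub>\<Gamma>\<^esub> (d [^]\<^bsub>\<Gamma>\<^esub> j)) (?f i) = b k"
      using inv_apply(1)[of "d [^]\<^bsub>\<Gamma>\<^esub> j" "b k"] assms(1) F by simp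
    then have "(inv\<^bsub>\<Gamma>\<^esub> (d [^]\<^bsub>\<Gamma>\<^esub> j) \<otimes>\<^bsub>\<Gamma>\<^esub> d [^]\<^bsub>\<Gamma>\<^esub> i) (b k) = b k"
      using mult_apply assms(1) F by simp
    moreover have "inv\<^bsub>\<Gamma>\<^esub> (d [^]\<^bsub>\<Gamma>\<^esub> j) \<otimes>\<^bsub>\<Gamma>\<^esub> d [^]\<^bsub>\<Gamma>\<^esub> i = d [^]\<^bsub>\<Gamma>\<^esub> (- j + i)"
      using assms(1) \<Gamma>.int_pow_mult[of d "- j" i] by (simp add: \<Gamma>.int_pow_neg)
    ultimately have "d [^]\<^bsub>\<Gamma>\<^esub> (- j + i) = \<one>\<^bsub>\<Gamma>\<^esub>" using assms(4) by metis
    then have "?n dvd i - j" using \<Gamma>.int_pow_eq_id[OF assms(1), of "- j + i"] by simp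
    then show "i mod ?n = j mod ?n" by (simp add: mod_eq_dvd_iff)
  next
    assume "i mod ?n = j mod ?n"
    then have "?n dvd j - i" by (metis mod_eq_dvd_iff)
    then show "?f i = ?f j" using \<Gamma>.int_pow_eq[OF assms(1), of i j] by simp
  qed
  have "{?f i | i. True} = ?f ` {0..<?n}"
  proof (intro equalityI subsetI)
    fix x assume "x \<in> {?f i | i. True}"
    then obtain i where "x = ?f i" by blast
    then have "x = ?f (i mod ?n)" using eq by simp
    moreover have "i mod ?n \<in> {0..<?n}" using assms(2) by simp
    ultimately show "x \<in> ?f ` {0..<?n}" by blast
  qed blast
  moreover have "inj_on ?f {0..<?n}" using eq by (intro inj_onI) simp
  ultimately show ?thesis by (simp add: card_image)
qed

subsection \<open>Flatness and presentations\<close>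

lemma factor:
  assumes "\<rho> 0 \<otimes>\<^bsub>\<Gamma>\<^esub> T.a \<otimes>\<^bsub>\<Gamma>\<^esub> \<rho> 0 \<in> generate \<Gamma> {\<rho> 2, T.a}" "\<gamma> \<in> carrier \<Gamma>"
  obtains u v where "u \<in> carrier \<Gamma>" "v \<in> carrier \<Gamma>" "u (b 3) = b 3" "v (b 1) = b 1" "\<gamma> = u \<otimes>\<^bsub>\<Gamma>\<^esub> v"
    "u \<in> generate \<Gamma> {\<rho> 0, \<rho> 1}" "v \<in> generate \<Gamma> {\<rho> 1, \<rho> 2}"
proof -
  obtain u v where uv: "u \<in> generate \<Gamma> {\<rho> 0, \<rho> 1}" "v \<in> generate \<Gamma> {\<rho> 1, \<rho> 2}" "\<gamma> = u \<otimes>\<^bsub>\<Gamma>\<^esub> v"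
    using T.factorization[OF generated assms] by blast
  then have "u \<in> carrier \<Gamma>" "v \<in> carrier \<Gamma>"
    using \<Gamma>.generate_in_carrier[of "{\<rho> 0, \<rho> 1}" u] \<Gamma>.generate_in_carrier[of "{\<rho> 1, \<rho> 2}" v] by auto
  then show thesis using that uv vertex_stabilizer facet_stabilizer by metis
qed

text \<open>Splitting \<open>inv \<gamma> \<otimes> \<delta>\<close> into a facet stabiliser times a
  vertex stabiliser gives one automorphism carrying the base vertex to the given vertex and the base
  facet to the given facet.\<close>

lemma flatI:
  assumes "\<rho> 0 \<otimes>\<^bsub>\<Gamma>\<^esub> T.a \<otimes>\<^bsub>\<Gamma>\<^esub> \<rho> 0 \<in> generate \<Gamma> {\<rho> 2, T.a}"
  shows "flat r"
  unfolding flat_def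
proof (intro ballI)
  fix F v assume "F \<in> facets r" "v \<in> vertices r"
  then obtain \<gamma> \<delta> where \<gamma>: "\<gamma> \<in> carrier \<Gamma>" "F = \<gamma> (b 3)" and \<delta>: "\<delta> \<in> carrier \<Gamma>" "v = \<delta> (b 1)"
    unfolding facets_orbit vertices_orbit by blast
  then have \<gamma>\<delta>: "inv\<^bsub>\<Gamma>\<^esub> \<gamma> \<otimes>\<^bsub>\<Gamma>\<^esub> \<delta> \<in> carrier \<Gamma>" by simp
  obtain x y where xy: "x \<in> carrier \<Gamma>" "y \<in> carrier \<Gamma>" "x (b 3) = b 3" "y (b 1) = b 1"
      "inv\<^bsub>\<Gamma>\<^esub> \<gamma> \<otimes>\<^bsub>\<Gamma>\<^esub> \<delta> = x \<otimes>\<^bsub>\<Gamma>\<^esub> y"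
    using factor[OF assms \<gamma>\<delta>] by blast
  have b: "b 1 \<in> Field r" "b 3 \<in> Field r" using b_Field by auto
  have "\<delta> = \<gamma> \<otimes>\<^bsub>\<Gamma>\<^esub> (inv\<^bsub>\<Gamma>\<^esub> \<gamma> \<otimes>\<^bsub>\<Gamma>\<^esub> \<delta>)" using \<gamma> \<delta> by (simp flip: \<Gamma>.m_assoc)
  then have "\<delta> = (\<gamma> \<otimes>\<^bsub>\<Gamma>\<^esub> x) \<otimes>\<^bsub>\<Gamma>\<^esub> y" using xy \<gamma> by (simp add: \<Gamma>.m_assoc)
  then have "\<delta> (b 1) = (\<gamma> \<otimes>\<^bsub>\<Gamma>\<^esub> x) (b 1)" using mult_apply[of "\<gamma> \<otimes>\<^bsub>\<Gamma>\<^esub> x" y "b 1"] xy \<gamma> b by simp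
  moreover have "\<gamma> (b 3) = (\<gamma> \<otimes>\<^bsub>\<Gamma>\<^esub> x) (b 3)" using mult_apply[of \<gamma> x "b 3"] xy \<gamma> b by simp
  moreover have "\<gamma> \<otimes>\<^bsub>\<Gamma>\<^esub> x \<in> carrier \<Gamma>" using \<gamma> xy by simp
  ultimately show "(v, F) \<in> r" using le_iff[OF \<delta>(1) \<gamma>(1), of 1 3] \<gamma> \<delta> by auto
qed

text \<open>By the factorisation the stabiliser of the base facet is already transitive on vertices,
  so they form one orbit of \<open>s1\<close>, on which it acts freely.\<close>

lemma card_vertices_eq_ord:
  assumes "\<rho> 0 \<otimes>\<^bsub>\<Gamma>\<^esub> T.a \<otimes>\<^bsub>\<Gamma>\<^esub> \<rho> 0 \<in> generate \<Gamma> {\<rho> 2, T.a}" "\<Gamma>.ord s1 \<noteq> 0"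
  shows "card (vertices r) = \<Gamma>.ord s1"
proof -
  have F: "b 1 \<in> Field r" using b_Field by auto
  have "vertices r = {(s1 [^]\<^bsub>\<Gamma>\<^esub> i) (b 1) | i::int. True}"
  proof (intro equalityI subsetI)
    fix x assume "x \<in> vertices r"
    then obtain \<gamma> where \<gamma>: "\<gamma> \<in> carrier \<Gamma>" "x = \<gamma> (b 1)" unfolding vertices_orbit by blast
    obtain u v where uv: "u \<in> carrier \<Gamma>" "v \<in> carrier \<Gamma>" "v (b 1) = b 1" "\<gamma> = u \<otimes>\<^bsub>\<Gamma>\<^esub> v"
        "u \<in> generate \<Gamma> {\<rho> 0, \<rho> 1}"
      using factor[OF assms(1) \<gamma>(1)] by blast
    obtain i :: int where i: "u = s1 [^]\<^bsub>\<Gamma>\<^esub> i \<or> u = s1 [^]\<^bsub>\<Gamma>\<^esub> i \<otimes>\<^bsub>\<Gamma>\<^esub> \<rho> 1"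
      using \<Gamma>.dihedral_elements[of "\<rho> 0" "\<rho> 1" u] uv(5) by auto
    have "x = u (b 1)" using mult_apply[of u v "b 1"] uv \<gamma> F by simp
    also have "\<dots> = (s1 [^]\<^bsub>\<Gamma>\<^esub> i) (b 1)"
      using i mult_apply[of "s1 [^]\<^bsub>\<Gamma>\<^esub> i" "\<rho> 1" "b 1"] \<rho>_b[of 1 1] F by auto
    finally show "x \<in> {(s1 [^]\<^bsub>\<Gamma>\<^esub> i) (b 1) | i::int. True}" by blast
  qed (auto simp: vertices_orbit)
  then show ?thesis
    using card_rotation_orbit[of s1 1] assms(2) s1_pow_fixes_vertex by simp
qed

lemma card_facets_eq_ord:
  assumes "\<rho> 0 \<otimes>\<^bsub>\<Gamma>\<^esub> T.a \<otimes>\<^bsub>\<Gamma>\<^esub> \<rho> 0 \<in> generate \<Gamma> {\<rho> 2, T.a}" "\<Gamma>.ord s2 \<noteq> 0"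
  shows "card (facets r) = \<Gamma>.ord s2"
proof -
  let ?d = "\<rho> 2 \<otimes>\<^bsub>\<Gamma>\<^esub> \<rho> 1"
  have F: "b 3 \<in> Field r" using b_Field by auto
  \<comment> \<open>The reversed product is used so that the reflection in the normal form is
    \<open>\<rho> 1\<close>, which fixes the base facet.\<close>
  have "?d = inv\<^bsub>\<Gamma>\<^esub> s2" by (simp add: \<Gamma>.inv_mult_group)
  then have ord: "\<Gamma>.ord ?d = \<Gamma>.ord s2" using \<Gamma>.ord_inv[of s2] by simp
  have "facets r = {(?d [^]\<^bsub>\<Gamma>\<^esub> i) (b 3) | i::int. True}"
  proof (intro equalityI subsetI)
    fix x assume "x \<in> facets r"
    then obtain \<gamma> where \<gamma>: "\<gamma> \<in> carrier \<Gamma>" "x = \<gamma> (b 3)" unfolding facets_orbit by blast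
    then have inv\<gamma>: "inv\<^bsub>\<Gamma>\<^esub> \<gamma> \<in> carrier \<Gamma>" by simp
    obtain u v where uv: "u \<in> carrier \<Gamma>" "v \<in> carrier \<Gamma>" "u (b 3) = b 3" "inv\<^bsub>\<Gamma>\<^esub> \<gamma> = u \<otimes>\<^bsub>\<Gamma>\<^esub> v"
        "v \<in> generate \<Gamma> {\<rho> 1, \<rho> 2}"
      using factor[OF assms(1) inv\<gamma>] by blast
    have v': "inv\<^bsub>\<Gamma>\<^esub> v \<in> generate \<Gamma> {\<rho> 2, \<rho> 1}"
      using \<Gamma>.generate_m_inv_closed[OF _ uv(5)] by (simp add: insert_commute)
    obtain i :: int where i: "inv\<^bsub>\<Gamma>\<^esub> v = ?d [^]\<^bsub>\<Gamma>\<^esub> i \<or> inv\<^bsub>\<Gamma>\<^esub> v = ?d [^]\<^bsub>\<Gamma>\<^esub> i \<otimes>\<^bsub>\<Gamma>\<^esub> \<rho> 1"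
      using \<Gamma>.dihedral_elements[of "\<rho> 2" "\<rho> 1" "inv\<^bsub>\<Gamma>\<^esub> v"] v' by auto
    have "\<gamma> = inv\<^bsub>\<Gamma>\<^esub> (u \<otimes>\<^bsub>\<Gamma>\<^esub> v)" using uv(4) \<gamma>(1) by (metis \<Gamma>.inv_inv)
    then have "\<gamma> = inv\<^bsub>\<Gamma>\<^esub> v \<otimes>\<^bsub>\<Gamma>\<^esub> inv\<^bsub>\<Gamma>\<^esub> u" using uv by (simp add: \<Gamma>.inv_mult_group)
    moreover have "(inv\<^bsub>\<Gamma>\<^esub> u) (b 3) = b 3" using inv_apply(1)[OF uv(1) F] uv(3) by simp
    ultimately have "x = (inv\<^bsub>\<Gamma>\<^esub> v) (b 3)"
      using mult_apply[of "inv\<^bsub>\<Gamma>\<^esub> v" "inv\<^bsub>\<Gamma>\<^esub> u" "b 3"] uv \<gamma> F by simp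
    also have "\<dots> = (?d [^]\<^bsub>\<Gamma>\<^esub> i) (b 3)"
      using i mult_apply[of "?d [^]\<^bsub>\<Gamma>\<^esub> i" "\<rho> 1" "b 3"] \<rho>_b[of 1 3] F by auto
    finally show "x \<in> {(?d [^]\<^bsub>\<Gamma>\<^esub> i) (b 3) | i::int. True}" by blast
  qed (auto simp: facets_orbit)
  then show ?thesis
    using card_rotation_orbit[of ?d 3] assms(2) s2_pow_fixes_facet ord by simp
qed

lemma pow_eq_one_of_extended_ord:
  assumes "\<sigma> \<in> carrier \<Gamma>" "\<sigma> [^]\<^bsub>\<Gamma>\<^esub> n = \<one>\<^bsub>\<Gamma>\<^esub>" "group G" "x \<in> carrier G"
    and "\<And>m. extended_ord \<Gamma> \<sigma> = enat m \<Longrightarrow> x [^]\<^bsub>G\<^esub> m = \<one>\<^bsub>G\<^esub>"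
  shows "x [^]\<^bsub>G\<^esub> (n::nat) = \<one>\<^bsub>G\<^esub>"
proof -
  interpret G: group G by fact
  have dvd: "\<Gamma>.ord \<sigma> dvd n" using \<Gamma>.pow_eq_id assms by blast
  show ?thesis
  proof (cases "\<Gamma>.ord \<sigma> = 0")
    \<comment> \<open>Infinite order: \<open>ord\<close> is \<open>0\<close>, which divides
      \<open>n\<close> only if \<open>n = 0\<close>.\<close>
    case True
    then show ?thesis using dvd by simp
  next
    case False
    then have "x [^]\<^bsub>G\<^esub> \<Gamma>.ord \<sigma> = \<one>\<^bsub>G\<^esub>" using assms(5) by (simp add: extended_ord_def)
    then show ?thesis using dvd assms(4) G.nat_pow_pow by (metis G.nat_pow_one dvdE)
  qed
qed

lemma coxeter_system_aut: "coxeter_system \<Gamma> \<rho> (extended_ord \<Gamma> s1) (extended_ord \<Gamma> s2)"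
  by (rule coxeter_systemI)
     (use \<rho>_closed \<rho>_involution \<rho>_commute \<Gamma>_generated \<Gamma>.is_group T.closed in
       \<open>auto simp: extended_ord_def split: if_splits\<close>)

text \<open>An element of the kernel factors as \<open>u v\<close> by the relation on \<open>a\<close>; the images of \<open>u\<close> and
  \<open>v\<^sup>-\<^sup>1\<close> agree, hence lie in the stabiliser of a vertex and a facet, and \<open>u, v\<close> live in dihedral groups
  on which the homomorphism is injective.\<close>

lemma polyhedron_with_groupI:
  assumes G: "coxeter_system G g (extended_ord \<Gamma> s1) (extended_ord \<Gamma> s2)"
    and h: "h \<in> hom G \<Gamma>" "\<And>i. i < 3 \<Longrightarrow> h (g i) = \<rho> i"
    and a: "g 0 \<otimes>\<^bsub>G\<^esub> involution_triple.a G (g 1) (g 2) \<otimes>\<^bsub>G\<^esub> g 0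
        \<in> generate G {g 2, involution_triple.a G (g 1) (g 2)}"
  shows "polyhedron_with_group r (extended_ord \<Gamma> s1) (extended_ord \<Gamma> s2) G g"
proof -
  interpret G: involution_triple G "g 0" "g 1" "g 2"
    by (intro involution_triple.intro involution_triple_axioms.intro coxeter_systemD[OF G]) simp_all
  interpret h: group_hom G \<Gamma> h
    using h \<Gamma>.is_group G.is_group by (simp add: group_hom_def group_hom_axioms_def)
  have hg: "h (g 0) = \<rho> 0" "h (g 1) = \<rho> 1" "h (g 2) = \<rho> 2" using h(2) by auto
  have "{..<3::nat} = {0, 1, 2}" by auto
  then have gen3: "g ` {..<3} = {g 0, g 1, g 2}" by simp
  have gen: "generate G {g 0, g 1, g 2} = carrier G" using coxeter_systemD(7)[OF G] gen3 by simp
  have kernel: "z = \<one>\<^bsub>G\<^esub>" if z: "z \<in> carrier G" "h z = \<one>\<^bsub>\<Gamma>\<^esub>" for z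
  proof -
    obtain u v where uv: "u \<in> generate G {g 0, g 1}" "v \<in> generate G {g 1, g 2}" "z = u \<otimes>\<^bsub>G\<^esub> v"
      using G.factorization[OF gen a z(1)] by blast
    have c: "u \<in> carrier G" "v \<in> carrier G"
      using uv G.generate_in_carrier[of "{g 0, g 1}" u] G.generate_in_carrier[of "{g 1, g 2}" v] by auto
    have hu: "h u \<in> generate \<Gamma> {\<rho> 0, \<rho> 1}" and hv: "h v \<in> generate \<Gamma> {\<rho> 1, \<rho> 2}"
      using h.generate_img[of "{g 0, g 1}"] h.generate_img[of "{g 1, g 2}"] uv hg by auto
    have hu_hv: "h u \<otimes>\<^bsub>\<Gamma>\<^esub> h v = \<one>\<^bsub>\<Gamma>\<^esub>" using z uv c by simp
    then have hu_eq: "h u = inv\<^bsub>\<Gamma>\<^esub> h v" using c \<Gamma>.inv_equality[of "h u" "h v"] by simp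
    have F: "b 1 \<in> Field r" using b_Field by auto
    have "(h v) (b 1) = b 1" using vertex_stabilizer[of "h v"] hv c by simp
    then have "(h u) (b 1) = b 1"
      unfolding hu_eq using inv_apply(1)[of "h v" "b 1"] c F by simp
    moreover have "(h u) (b 3) = b 3" using facet_stabilizer hu c by simp
    ultimately have "h u = \<one>\<^bsub>\<Gamma>\<^esub> \<or> h u = \<rho> 1" using vertex_facet_stabilizer c by simp
    have inj2: "u' = \<one>\<^bsub>G\<^esub>" if "u' \<in> generate G {g 0, g 1}" "h u' = \<one>\<^bsub>\<Gamma>\<^esub>" for u'
    proof (rule G.dihedral_hom_injective[of \<Gamma> h "g 0" "g 1"])
      fix n :: nat assume "(h (g 0) \<otimes>\<^bsub>\<Gamma>\<^esub> h (g 1)) [^]\<^bsub>\<Gamma>\<^esub> n = \<one>\<^bsub>\<Gamma>\<^esub>"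
      then have "s1 [^]\<^bsub>\<Gamma>\<^esub> n = \<one>\<^bsub>\<Gamma>\<^esub>" unfolding hg .
      then show "(g 0 \<otimes>\<^bsub>G\<^esub> g 1) [^]\<^bsub>G\<^esub> n = \<one>\<^bsub>G\<^esub>"
        by (rule pow_eq_one_of_extended_ord[rotated])
           (use G.is_group coxeter_systemD(4)[OF G] in auto)
    qed (use that generators_ne hg h.group_hom_axioms in auto)
    have inj0: "v' = \<one>\<^bsub>G\<^esub>" if "v' \<in> generate G {g 1, g 2}" "h v' = \<one>\<^bsub>\<Gamma>\<^esub>" for v'
    proof (rule G.dihedral_hom_injective[of \<Gamma> h "g 1" "g 2"])
      fix n :: nat assume "(h (g 1) \<otimes>\<^bsub>\<Gamma>\<^esub> h (g 2)) [^]\<^bsub>\<Gamma>\<^esub> n = \<one>\<^bsub>\<Gamma>\<^esub>"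
      then have "s2 [^]\<^bsub>\<Gamma>\<^esub> n = \<one>\<^bsub>\<Gamma>\<^esub>" unfolding hg .
      then show "(g 1 \<otimes>\<^bsub>G\<^esub> g 2) [^]\<^bsub>G\<^esub> n = \<one>\<^bsub>G\<^esub>"
        by (rule pow_eq_one_of_extended_ord[rotated])
           (use G.is_group coxeter_systemD(5)[OF G] in auto)
    qed (use that generators_ne hg h.group_hom_axioms in auto)
    from \<open>h u = \<one>\<^bsub>\<Gamma>\<^esub> \<or> h u = \<rho> 1\<close> show ?thesis
    proof
      assume "h u = \<one>\<^bsub>\<Gamma>\<^esub>"
      moreover from this have "h v = \<one>\<^bsub>\<Gamma>\<^esub>" using hu_hv c by simp
      ultimately show ?thesis using inj2[OF uv(1)] inj0[OF uv(2)] uv(3) by simp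
    next
      assume hu1: "h u = \<rho> 1"
      then have "\<rho> 1 \<otimes>\<^bsub>\<Gamma>\<^esub> (\<rho> 1 \<otimes>\<^bsub>\<Gamma>\<^esub> h v) = \<rho> 1 \<otimes>\<^bsub>\<Gamma>\<^esub> \<one>\<^bsub>\<Gamma>\<^esub>" using hu_hv by simp
      then have hv1: "h v = \<rho> 1" using c by simp
      have "h (u \<otimes>\<^bsub>G\<^esub> g 1) = \<one>\<^bsub>\<Gamma>\<^esub>" "h (g 1 \<otimes>\<^bsub>G\<^esub> v) = \<one>\<^bsub>\<Gamma>\<^esub>"
        using c hu1 hv1 hg by simp_all
      moreover have "u \<otimes>\<^bsub>G\<^esub> g 1 \<in> generate G {g 0, g 1}" "g 1 \<otimes>\<^bsub>G\<^esub> v \<in> generate G {g 1, g 2}"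
        using uv by (blast intro: generate.eng generate.incl)+
      ultimately have "u \<otimes>\<^bsub>G\<^esub> g 1 = \<one>\<^bsub>G\<^esub>" "g 1 \<otimes>\<^bsub>G\<^esub> v = \<one>\<^bsub>G\<^esub>" using inj2 inj0 by auto
      then have "(u \<otimes>\<^bsub>G\<^esub> g 1) \<otimes>\<^bsub>G\<^esub> (g 1 \<otimes>\<^bsub>G\<^esub> v) = \<one>\<^bsub>G\<^esub>" by simp
      then show ?thesis using uv(3) c by (simp add: G.m_assoc)
    qed
  qed
  have "inj_on h (carrier G)" using kernel by (intro h.inj_on_one_iff[THEN iffD2]) auto
  moreover have "h ` carrier G = carrier \<Gamma>"
    using h.generate_img[of "{g 0, g 1, g 2}"] gen generated hg by simp
  ultimately have "h \<in> iso G \<Gamma>" using h(1) by (simp add: iso_def bij_betw_def)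
  then show ?thesis
    unfolding polyhedron_with_group_def using regular base_flag distinguished h(2) by blast
qed

lemma coxeter_quotient_polyhedronI:
  assumes "extended_ord \<Gamma> s1 = p" "extended_ord \<Gamma> s2 = q" "S \<subseteq> carrier (coxeter_group p q)"
    and "\<And>h s. h \<in> hom (coxeter_group p q) \<Gamma> \<Longrightarrow> (\<And>i. i < 3 \<Longrightarrow> h (coxeter_gen p q i) = \<rho> i) \<Longrightarrow>
           s \<in> S \<Longrightarrow> h s = \<one>\<^bsub>\<Gamma>\<^esub>"
    and "coxeter_quotient_gen p q S 0 \<otimes>\<^bsub>coxeter_quotient p q S\<^esub>
        involution_triple.a (coxeter_quotient p q S) (coxeter_quotient_gen p q S 1) (coxeter_quotient_gen p q S 2)
        \<otimes>\<^bsub>coxeter_quotient p q S\<^esub> coxeter_quotient_gen p q S 0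
      \<in> generate (coxeter_quotient p q S) {coxeter_quotient_gen p q S 2,
          involution_triple.a (coxeter_quotient p q S) (coxeter_quotient_gen p q S 1) (coxeter_quotient_gen p q S 2)}"
  shows "polyhedron_with_group r p q (coxeter_quotient p q S) (coxeter_quotient_gen p q S)"
proof -
  have cs: "coxeter_system \<Gamma> \<rho> p q" using coxeter_system_aut assms(1,2) by simp
  have "\<exists>h. h \<in> hom (coxeter_quotient p q S) \<Gamma> \<and> (\<forall>i<3. h (coxeter_quotient_gen p q S i) = \<rho> i)"
  proof (rule coxeter_quotient_universal[OF cs assms(3)])
    fix h s assume "h \<in> hom (coxeter_group p q) \<Gamma>" "\<And>i. i < 3 \<Longrightarrow> h (coxeter_gen p q i) = \<rho> i" "s \<in> S"
    then show "h s = \<one>\<^bsub>\<Gamma>\<^esub>" by (rule assms(4))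
  qed blast
  then obtain h where "h \<in> hom (coxeter_quotient p q S) \<Gamma>"
      "\<And>i. i < 3 \<Longrightarrow> h (coxeter_quotient_gen p q S i) = \<rho> i" by blast
  then show ?thesis
    using polyhedron_with_groupI[of "coxeter_quotient p q S" "coxeter_quotient_gen p q S" h]
      coxeter_system_coxeter_quotient(1)[OF assms(3)] assms(1,2,5) by simp
qed

end

lemma involution_triple_coxeter_system:
  "coxeter_system G g p q \<Longrightarrow> involution_triple G (g 0) (g 1) (g 2)"
  by (intro involution_triple.intro involution_triple_axioms.intro) (simp_all add: coxeter_systemD)

context regular_polyhedron_base
begin

text \<open>The type alone makes \<open>\<rho> 0\<close> commute with \<open>\<rho> 1\<close> and
  \<open>\<rho> 2\<close>, so the condition on \<open>a\<close> holds in the presented group without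
  an extra relator, also for infinite order of \<open>s2\<close>.\<close>

lemma hosohedronI:
  assumes "extended_ord \<Gamma> s1 = 2"
  shows "is_hosohedron (extended_ord \<Gamma> s2) r"
proof -
  define q where "q = extended_ord \<Gamma> s2"
  have cs: "coxeter_system \<Gamma> \<rho> 2 q" using coxeter_system_aut assms q_def by simp
  have csG: "coxeter_system (coxeter_group 2 q) (coxeter_gen 2 q) 2 q" by (rule coxeter_system_coxeter_group)
  interpret G: involution_triple "coxeter_group 2 q" "coxeter_gen 2 q 0" "coxeter_gen 2 q 1" "coxeter_gen 2 q 2"
    by (rule involution_triple_coxeter_system[OF csG])
  obtain h where h: "h \<in> hom (coxeter_group 2 q) \<Gamma>" "\<And>i. i < 3 \<Longrightarrow> h (coxeter_gen 2 q i) = \<rho> i"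
    using coxeter_group_universal[OF cs] by blast
  have "2 = enat 2" by (simp add: numeral_eq_enat)
  from G.x0_a_x0_of_comm_x0_x1[OF coxeter_systemD(4)[OF csG this]]
  show ?thesis
    using polyhedron_with_groupI[of "coxeter_group 2 q" "coxeter_gen 2 q" h] csG h assms
    by (simp add: is_hosohedron_def q_def generate.incl)
qed

lemma dihedronI:
  assumes "extended_ord \<Gamma> s1 = enat n" "extended_ord \<Gamma> s2 = 2"
  shows "is_dihedron n r"
proof -
  have cs: "coxeter_system \<Gamma> \<rho> (enat n) 2" using coxeter_system_aut assms by simp
  have csG: "coxeter_system (coxeter_group (enat n) 2) (coxeter_gen (enat n) 2) (enat n) 2"
    by (rule coxeter_system_coxeter_group)
  interpret G: involution_triple "coxeter_group (enat n) 2"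
      "coxeter_gen (enat n) 2 0" "coxeter_gen (enat n) 2 1" "coxeter_gen (enat n) 2 2"
    by (rule involution_triple_coxeter_system[OF csG])
  obtain h where h: "h \<in> hom (coxeter_group (enat n) 2) \<Gamma>" "\<And>i. i < 3 \<Longrightarrow> h (coxeter_gen (enat n) 2 i) = \<rho> i"
    using coxeter_group_universal[OF cs] by blast
  have "2 = enat 2" by (simp add: numeral_eq_enat)
  from G.x0_a_x0_of_comm_x1_x2(1)[OF coxeter_systemD(5)[OF csG this]]
  show ?thesis
    using polyhedron_with_groupI[of "coxeter_group (enat n) 2" "coxeter_gen (enat n) 2" h] csG h assms
    by (simp add: is_dihedron_def generate.incl)
qed

lemma hemi_octahedronI:
  assumes "extended_ord \<Gamma> s1 = 3" "extended_ord \<Gamma> s2 = 4"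
    and rel: "\<rho> 0 \<otimes>\<^bsub>\<Gamma>\<^esub> T.a \<otimes>\<^bsub>\<Gamma>\<^esub> \<rho> 0 = T.a \<otimes>\<^bsub>\<Gamma>\<^esub> \<rho> 2"
  shows "is_hemi_octahedron r"
  unfolding is_hemi_octahedron_def
proof (rule coxeter_quotient_polyhedronI[OF assms(1,2)])
  let ?G = "coxeter_group 3 4" and ?g = "coxeter_gen 3 4"
  let ?S = "{hemi_octahedron_relator}"
  let ?Q = "coxeter_quotient 3 4 ?S" and ?q = "coxeter_quotient_gen 3 4 ?S"
  have three: "3 = enat 3" by (simp add: numeral_eq_enat)
  have csG: "coxeter_system ?G ?g 3 4" by (rule coxeter_system_coxeter_group)
  interpret G: involution_triple ?G "?g 0" "?g 1" "?g 2"
    by (rule involution_triple_coxeter_system[OF csG])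
  have relator: "hemi_octahedron_relator = (?g 0 \<otimes>\<^bsub>?G\<^esub> ?g 1 \<otimes>\<^bsub>?G\<^esub> ?g 2) [^]\<^bsub>?G\<^esub> (3::nat)"
    by (simp add: hemi_octahedron_relator_def Let_def)
  show S: "?S \<subseteq> carrier ?G" by (simp add: relator)
  have s1_pow: "s1 [^]\<^bsub>\<Gamma>\<^esub> (3::nat) = \<one>\<^bsub>\<Gamma>\<^esub>"
    using coxeter_systemD(4)[OF coxeter_system_aut] assms(1) three by metis
  show "h s = \<one>\<^bsub>\<Gamma>\<^esub>"
    if h: "h \<in> hom ?G \<Gamma>" "\<And>i. i < 3 \<Longrightarrow> h (?g i) = \<rho> i" and s: "s \<in> ?S" for h s
  proof -
    interpret h: group_hom ?G \<Gamma> h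
      using h \<Gamma>.is_group G.is_group by (simp add: group_hom_def group_hom_axioms_def)
    have "h s = (\<rho> 0 \<otimes>\<^bsub>\<Gamma>\<^esub> \<rho> 1 \<otimes>\<^bsub>\<Gamma>\<^esub> \<rho> 2) [^]\<^bsub>\<Gamma>\<^esub> (3::nat)"
      using s h(2) by (simp add: relator h.hom_nat_pow)
    then show ?thesis using T.hemi_relation_iff[OF s1_pow] rel by simp
  qed
  have csQ: "coxeter_system ?Q ?q 3 4" by (rule coxeter_system_coxeter_quotient(1)[OF S])
  interpret Q: involution_triple ?Q "?q 0" "?q 1" "?q 2"
    by (rule involution_triple_coxeter_system[OF csQ])
  define \<pi> where "\<pi> = (\<lambda>x. normal_closure ?G ?S #>\<^bsub>?G\<^esub> x)"
  interpret \<pi>: group_hom ?G ?Q \<pi>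
    unfolding \<pi>_def by (rule coxeter_system_coxeter_quotient(2)[OF S])
  have "(?q 0 \<otimes>\<^bsub>?Q\<^esub> ?q 1 \<otimes>\<^bsub>?Q\<^esub> ?q 2) [^]\<^bsub>?Q\<^esub> (3::nat)
      = \<pi> ((?g 0 \<otimes>\<^bsub>?G\<^esub> ?g 1 \<otimes>\<^bsub>?G\<^esub> ?g 2) [^]\<^bsub>?G\<^esub> (3::nat))"
    by (simp add: coxeter_quotient_gen_def \<pi>.hom_nat_pow flip: \<pi>_def[unfolded fun_eq_iff, rule_format])
  also have "\<dots> = \<pi> hemi_octahedron_relator" using relator by (rule arg_cong[OF sym])
  also have "\<dots> = \<one>\<^bsub>?Q\<^esub>"
    unfolding \<pi>_def by (rule coxeter_system_coxeter_quotient(3)[OF S]) simp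
  finally have "?q 0 \<otimes>\<^bsub>?Q\<^esub> Q.a \<otimes>\<^bsub>?Q\<^esub> ?q 0 = Q.a \<otimes>\<^bsub>?Q\<^esub> ?q 2"
    using Q.hemi_relation_iff[OF coxeter_systemD(4)[OF csQ three]] by simp
  then show "?q 0 \<otimes>\<^bsub>?Q\<^esub> Q.a \<otimes>\<^bsub>?Q\<^esub> ?q 0 \<in> generate ?Q {?q 2, Q.a}"
    by (simp add: generate.eng generate.incl)
qed

lemma flat_b_2bI:
  assumes "extended_ord \<Gamma> s1 = enat n" "extended_ord \<Gamma> s2 = enat (2 * n)"
    and rel: "\<rho> 0 \<otimes>\<^bsub>\<Gamma>\<^esub> T.a \<otimes>\<^bsub>\<Gamma>\<^esub> \<rho> 0 = \<rho> 2 \<otimes>\<^bsub>\<Gamma>\<^esub> T.a \<otimes>\<^bsub>\<Gamma>\<^esub> \<rho> 2"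
  shows "is_flat_b_2b n r"
  unfolding is_flat_b_2b_def
proof (rule coxeter_quotient_polyhedronI[OF assms(1,2)])
  let ?p = "enat n" and ?q = "enat (2 * n)"
  let ?G = "coxeter_group ?p ?q" and ?g = "coxeter_gen ?p ?q"
  let ?S = "{flat_b_2b_relator n}"
  let ?Q = "coxeter_quotient ?p ?q ?S" and ?k = "coxeter_quotient_gen ?p ?q ?S"
  have csG: "coxeter_system ?G ?g ?p ?q" by (rule coxeter_system_coxeter_group)
  interpret G: involution_triple ?G "?g 0" "?g 1" "?g 2"
    by (rule involution_triple_coxeter_system[OF csG])
  have relator: "flat_b_2b_relator n = (inv\<^bsub>?G\<^esub> (?g 1 \<otimes>\<^bsub>?G\<^esub> ?g 2) \<otimes>\<^bsub>?G\<^esub> (?g 0 \<otimes>\<^bsub>?G\<^esub> ?g 1)) \<otimes>\<^bsub>?G\<^esub>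
      inv\<^bsub>?G\<^esub> (inv\<^bsub>?G\<^esub> (?g 0 \<otimes>\<^bsub>?G\<^esub> ?g 1) \<otimes>\<^bsub>?G\<^esub> (?g 1 \<otimes>\<^bsub>?G\<^esub> ?g 2) [^]\<^bsub>?G\<^esub> (-3::int))"
    by (simp add: flat_b_2b_relator_def Let_def)
  show S: "?S \<subseteq> carrier ?G" by (simp add: relator)
  show "h s = \<one>\<^bsub>\<Gamma>\<^esub>"
    if h: "h \<in> hom ?G \<Gamma>" "\<And>i. i < 3 \<Longrightarrow> h (?g i) = \<rho> i" and s: "s \<in> ?S" for h s
  proof -
    interpret h: group_hom ?G \<Gamma> h
      using h \<Gamma>.is_group G.is_group by (simp add: group_hom_def group_hom_axioms_def)
    have "h s = (inv\<^bsub>\<Gamma>\<^esub> s2 \<otimes>\<^bsub>\<Gamma>\<^esub> s1) \<otimes>\<^bsub>\<Gamma>\<^esub> inv\<^bsub>\<Gamma>\<^esub> (inv\<^bsub>\<Gamma>\<^esub> s1 \<otimes>\<^bsub>\<Gamma>\<^esub> s2 [^]\<^bsub>\<Gamma>\<^esub> (-3::int))"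
      using s h(2) by (simp add: relator h.hom_int_pow)
    then show ?thesis using T.flat_relation_iff rel by simp
  qed
  have csQ: "coxeter_system ?Q ?k ?p ?q" by (rule coxeter_system_coxeter_quotient(1)[OF S])
  interpret Q: involution_triple ?Q "?k 0" "?k 1" "?k 2"
    by (rule involution_triple_coxeter_system[OF csQ])
  define \<pi> where "\<pi> = (\<lambda>x. normal_closure ?G ?S #>\<^bsub>?G\<^esub> x)"
  interpret \<pi>: group_hom ?G ?Q \<pi>
    unfolding \<pi>_def by (rule coxeter_system_coxeter_quotient(2)[OF S])
  have "(inv\<^bsub>?Q\<^esub> (?k 1 \<otimes>\<^bsub>?Q\<^esub> ?k 2) \<otimes>\<^bsub>?Q\<^esub> (?k 0 \<otimes>\<^bsub>?Q\<^esub> ?k 1)) \<otimes>\<^bsub>?Q\<^esub>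
      inv\<^bsub>?Q\<^esub> (inv\<^bsub>?Q\<^esub> (?k 0 \<otimes>\<^bsub>?Q\<^esub> ?k 1) \<otimes>\<^bsub>?Q\<^esub> (?k 1 \<otimes>\<^bsub>?Q\<^esub> ?k 2) [^]\<^bsub>?Q\<^esub> (-3::int))
      = \<pi> ((inv\<^bsub>?G\<^esub> (?g 1 \<otimes>\<^bsub>?G\<^esub> ?g 2) \<otimes>\<^bsub>?G\<^esub> (?g 0 \<otimes>\<^bsub>?G\<^esub> ?g 1)) \<otimes>\<^bsub>?G\<^esub>
      inv\<^bsub>?G\<^esub> (inv\<^bsub>?G\<^esub> (?g 0 \<otimes>\<^bsub>?G\<^esub> ?g 1) \<otimes>\<^bsub>?G\<^esub> (?g 1 \<otimes>\<^bsub>?G\<^esub> ?g 2) [^]\<^bsub>?G\<^esub> (-3::int)))"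
    by (simp add: coxeter_quotient_gen_def \<pi>.hom_int_pow flip: \<pi>_def[unfolded fun_eq_iff, rule_format])
  also have "\<dots> = \<pi> (flat_b_2b_relator n)" using relator by (rule arg_cong[OF sym])
  also have "\<dots> = \<one>\<^bsub>?Q\<^esub>"
    unfolding \<pi>_def by (rule coxeter_system_coxeter_quotient(3)[OF S]) simp
  finally have "?k 0 \<otimes>\<^bsub>?Q\<^esub> Q.a \<otimes>\<^bsub>?Q\<^esub> ?k 0 = ?k 2 \<otimes>\<^bsub>?Q\<^esub> Q.a \<otimes>\<^bsub>?Q\<^esub> ?k 2"
    using Q.flat_relation_iff by simp
  then show "?k 0 \<otimes>\<^bsub>?Q\<^esub> Q.a \<otimes>\<^bsub>?Q\<^esub> ?k 0 \<in> generate ?Q {?k 2, Q.a}"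
    by (simp add: generate.eng generate.incl)
qed

end

lemma (in group) nat_pow_2: "x \<in> carrier G \<Longrightarrow> x [^] (2::nat) = x \<otimes> x"
  by (simp add: numeral_2_eq_2)

lemma dvd_double_prime:
  fixes d n :: nat
  assumes "d dvd 2 * n" "prime n" "\<not> d dvd n" "\<not> d dvd 2"
  shows "d = 2 * n"
proof -
  obtain e where e: "2 * n = d * e" using assms(1) by (auto simp: dvd_def)
  have n: "n > 0" using assms(2) prime_gt_0_nat by blast
  have "n dvd d * e" using e by (metis dvd_triv_right)
  then have "n dvd d \<or> n dvd e" using assms(2) prime_dvd_mult_iff by blast
  then show ?thesis
  proof
    assume "n dvd d"
    then obtain f where f: "d = n * f" by (auto simp: dvd_def)
    then have "2 = f * e" using e n by (simp add: mult.assoc)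
    then have "f dvd 2" by (metis dvd_triv_left)
    moreover from this have "f \<noteq> 0" by (intro notI) simp
    ultimately have "f \<le> 2" "f \<noteq> 0" by (auto dest: dvd_imp_le)
    then have "f = 1 \<or> f = 2" by linarith
    then show ?thesis using f assms(3) by auto
  next
    assume "n dvd e"
    then obtain f where f: "e = n * f" by (auto simp: dvd_def)
    then have "n * 2 = n * (d * f)" using e by (simp add: ac_simps)
    then have "2 = d * f" using n by simp
    then show ?thesis using assms(4) by (metis dvd_triv_left)
  qed
qed

context regular_polyhedron_base
begin

text \<open>\<open>\<rho> 1\<close> fixes the base vertex, hence also the only other one. So
  \<open>s1\<close> swaps the two, and its square fixes the base vertex.\<close>

lemma ord_s1_of_two_vertices:
  assumes "card (vertices r) = 2"
  shows "s1 [^]\<^bsub>\<Gamma>\<^esub> (2::nat) = \<one>\<^bsub>\<Gamma>\<^esub>"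
proof -
  have F: "b 1 \<in> Field r" using b_Field by auto
  have c: "\<rho> 0 \<in> carrier \<Gamma>" "\<rho> 1 \<in> carrier \<Gamma>" by auto
  have fin: "finite (vertices r)" using assms card.infinite by fastforce
  have ne: "\<rho> 0 (b 1) \<noteq> b 1" "\<rho> 1 (b 1) = b 1" using \<rho>_moves[of 0 1] \<rho>_moves[of 1 1] by auto
  have "{b 1, \<rho> 0 (b 1)} \<subseteq> vertices r"
    unfolding vertices_orbit using c one_apply[OF F] \<Gamma>.one_closed by (auto intro: rev_image_eqI)
  moreover have "card {b 1, \<rho> 0 (b 1)} = 2" using ne by auto
  ultimately have V: "{b 1, \<rho> 0 (b 1)} = vertices r" using assms fin by (intro card_subset_eq) auto
  have "\<rho> 1 (\<rho> 0 (b 1)) = (\<rho> 1 \<otimes>\<^bsub>\<Gamma>\<^esub> \<rho> 0) (b 1)" using mult_apply c F by simp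
  then have "\<rho> 1 (\<rho> 0 (b 1)) \<in> {b 1, \<rho> 0 (b 1)}" unfolding V vertices_orbit using c by blast
  moreover have "\<rho> 1 (\<rho> 0 (b 1)) \<noteq> b 1"
    using inv_apply(1)[OF c(2)] ne F aut_Field[OF c(1) F] by metis
  ultimately have "\<rho> 1 (\<rho> 0 (b 1)) = \<rho> 0 (b 1)" by blast
  moreover have "\<rho> 0 (\<rho> 0 (b 1)) = b 1"
    using mult_apply[OF c(1) c(1) F] \<rho>_involution[of 0] one_apply[OF F] by simp
  ultimately have "s1 (s1 (b 1)) = b 1" using mult_apply c F aut_Field ne by simp
  then have "(s1 [^]\<^bsub>\<Gamma>\<^esub> (2::int)) (b 1) = b 1"
    using mult_apply[of s1 s1 "b 1"] F \<Gamma>.int_pow_mult[of s1 1 1] by simp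
  then have "s1 [^]\<^bsub>\<Gamma>\<^esub> (2::int) = \<one>\<^bsub>\<Gamma>\<^esub>" by (rule s1_pow_fixes_vertex)
  then show ?thesis using int_pow_int[of \<Gamma> s1 2] by simp
qed

section \<open>The action on the vertices and its kernel\<close>

text \<open>Extended by the identity off the vertices, to give the functions on the whole type that
  \<open>prime_degree_action\<close> expects.\<close>

definition act :: "('a \<Rightarrow> 'a) \<Rightarrow> 'a \<Rightarrow> 'a" where
  "act \<gamma> = (\<lambda>v. if v \<in> vertices r then \<gamma> v else v)"

lemma vertices_Field: "v \<in> vertices r \<Longrightarrow> v \<in> Field r"
  by (simp add: vertices_eq)

lemma aut_vertices: "\<gamma> \<in> carrier \<Gamma> \<Longrightarrow> v \<in> vertices r \<Longrightarrow> \<gamma> v \<in> vertices r"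
  using aut_level aut_Field by (simp add: vertices_eq)

lemma act_mult: "\<gamma> \<in> carrier \<Gamma> \<Longrightarrow> \<delta> \<in> carrier \<Gamma> \<Longrightarrow> act (\<gamma> \<otimes>\<^bsub>\<Gamma>\<^esub> \<delta>) = act \<gamma> \<circ> act \<delta>"
  using mult_apply aut_vertices vertices_Field by (auto simp: act_def fun_eq_iff)

lemma act_one: "act \<one>\<^bsub>\<Gamma>\<^esub> = id"
  using one_apply vertices_Field by (auto simp: act_def fun_eq_iff)

lemma act_involution: "i < 3 \<Longrightarrow> act (\<rho> i) \<circ> act (\<rho> i) = id"
  using act_mult[of "\<rho> i" "\<rho> i"] act_one \<rho>_involution \<rho>_closed by simp

lemma act_span:
  assumes "K \<subseteq> \<rho> ` {..<3}" "\<gamma> \<in> generate \<Gamma> K"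
  shows "act \<gamma> \<in> involution_span (act ` K)"
  using assms(2)
proof (induction rule: generate.induct)
  case one
  show ?case using act_one involution_span.id by metis
next
  case (incl \<gamma>)
  then show ?case by (intro involution_span_incl) simp
next
  case (inv \<gamma>)
  then have "inv\<^bsub>\<Gamma>\<^esub> \<gamma> = \<gamma>" using assms(1) \<Gamma>.inv_involution \<rho>_closed \<rho>_involution by auto
  then show ?case using inv by (simp add: involution_span_incl)
next
  case (eng \<gamma> \<delta>)
  have K: "K \<subseteq> carrier \<Gamma>" using assms(1) \<rho>_closed by auto
  have "\<gamma> \<in> carrier \<Gamma>" "\<delta> \<in> carrier \<Gamma>" using eng(1,2) \<Gamma>.generate_in_carrier[OF K] by auto
  from act_mult[OF this] show ?case using involution_span_comp[OF eng(3,4)] by (simp only:)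
qed

lemma span_act:
  assumes "K \<subseteq> \<rho> ` {..<3}" "f \<in> involution_span (act ` K)"
  shows "\<exists>\<gamma> \<in> generate \<Gamma> K. f = act \<gamma>"
  using assms(2)
proof (induction rule: involution_span.induct)
  case id
  show ?case using act_one generate.one by metis
next
  case (step s f)
  then obtain \<gamma> \<delta> where \<gamma>: "\<gamma> \<in> K" "s = act \<gamma>" "\<delta> \<in> generate \<Gamma> K" "f = act \<delta>" by blast
  have K: "K \<subseteq> carrier \<Gamma>" using assms(1) \<rho>_closed by auto
  have "s \<circ> f = act (\<gamma> \<otimes>\<^bsub>\<Gamma>\<^esub> \<delta>)"
    using act_mult[OF subsetD[OF K \<gamma>(1)] \<Gamma>.generate_in_carrier[OF K \<gamma>(3)]] \<gamma> by (simp only:)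
  then show ?case using generate.eng[OF generate.incl[OF \<gamma>(1)] \<gamma>(3)] by blast
qed

lemma prime_degree_action_vertices:
  assumes "prime n" "odd n" "card (vertices r) = n"
  shows "prime_degree_action (vertices r) (b 1) (act (\<rho> 0)) (act (\<rho> 1)) (act (\<rho> 2)) n"
proof
  have F: "b 1 \<in> Field r" using b_Field by auto
  show b1: "b 1 \<in> vertices r" unfolding vertices_orbit using one_apply[OF F] \<Gamma>.one_closed by (metis imageI)
  show "act (\<rho> 0) \<circ> act (\<rho> 0) = id" "act (\<rho> 1) \<circ> act (\<rho> 1) = id" "act (\<rho> 2) \<circ> act (\<rho> 2) = id"
    using act_involution by auto
  show "act (\<rho> 0) \<circ> act (\<rho> 2) = act (\<rho> 2) \<circ> act (\<rho> 0)"
    using act_mult[of "\<rho> 0" "\<rho> 2"] act_mult[of "\<rho> 2" "\<rho> 0"] \<rho>_commute by simp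
  show "act (\<rho> 1) (b 1) = b 1" "act (\<rho> 2) (b 1) = b 1"
    using \<rho>_b[of 1 1] \<rho>_b[of 2 1] by (auto simp: act_def)
  have sub: "{\<rho> 0, \<rho> 1, \<rho> 2} \<subseteq> \<rho> ` {..<3}" "{\<rho> 1, \<rho> 2} \<subseteq> \<rho> ` {..<3}" by auto
  show "\<exists>g\<in>involution_span {act (\<rho> 0), act (\<rho> 1), act (\<rho> 2)}. g (b 1) = v" if v: "v \<in> vertices r" for v
  proof -
    obtain \<gamma> where \<gamma>: "\<gamma> \<in> carrier \<Gamma>" "v = \<gamma> (b 1)" using v unfolding vertices_orbit by blast
    then have "act \<gamma> \<in> involution_span {act (\<rho> 0), act (\<rho> 1), act (\<rho> 2)}"
      using act_span[OF sub(1)] generated by simp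
    moreover have "act \<gamma> (b 1) = v" using \<gamma> b1 by (simp add: act_def)
    ultimately show ?thesis by blast
  qed
  show "g \<in> involution_span {act (\<rho> 1), act (\<rho> 2)}"
    if g: "g \<in> involution_span {act (\<rho> 0), act (\<rho> 1), act (\<rho> 2)}" "g (b 1) = b 1" for g
  proof -
    obtain \<gamma> where \<gamma>: "\<gamma> \<in> carrier \<Gamma>" "g = act \<gamma>" using span_act[OF sub(1)] g(1) generated by auto
    then have "\<gamma> (b 1) = b 1" using g(2) b1 by (simp add: act_def)
    then have "\<gamma> \<in> generate \<Gamma> {\<rho> 1, \<rho> 2}" using vertex_stabilizer \<gamma> by simp
    then show ?thesis using act_span[OF sub(2)] \<gamma> by simp
  qed
qed (use assms in \<open>auto simp: act_def\<close>)

definition vertex_kernel :: "('a \<Rightarrow> 'a) set" where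
  "vertex_kernel = {\<gamma> \<in> carrier \<Gamma>. \<forall>v \<in> vertices r. \<gamma> v = v}"

lemma vertex_kernelI:
  "\<gamma> \<in> carrier \<Gamma> \<Longrightarrow> (\<And>v. v \<in> vertices r \<Longrightarrow> \<gamma> v = v) \<Longrightarrow> \<gamma> \<in> vertex_kernel"
  by (simp add: vertex_kernel_def)

lemma vertex_kernelD: "\<gamma> \<in> vertex_kernel \<Longrightarrow> v \<in> vertices r \<Longrightarrow> \<gamma> v = v"
  by (simp add: vertex_kernel_def)

lemma subgroup_vertex_kernel: "subgroup vertex_kernel \<Gamma>"
proof (rule \<Gamma>.subgroupI)
  show "vertex_kernel \<noteq> {}" using one_apply vertices_Field by (auto simp: vertex_kernel_def)
  fix \<gamma> assume \<gamma>: "\<gamma> \<in> vertex_kernel"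
  then have "(inv\<^bsub>\<Gamma>\<^esub> \<gamma>) v = v" if "v \<in> vertices r" for v
    using inv_apply(1)[of \<gamma> v] vertices_Field that by (simp add: vertex_kernel_def)
  then show "inv\<^bsub>\<Gamma>\<^esub> \<gamma> \<in> vertex_kernel" using \<gamma> by (simp add: vertex_kernel_def)
  fix \<delta> assume "\<delta> \<in> vertex_kernel"
  then show "\<gamma> \<otimes>\<^bsub>\<Gamma>\<^esub> \<delta> \<in> vertex_kernel"
    using \<gamma> mult_apply vertices_Field by (simp add: vertex_kernel_def)
qed (auto simp: vertex_kernel_def)

lemma conj_vertex_kernel:
  assumes "i < 3" "\<gamma> \<in> vertex_kernel"
  shows "\<rho> i \<otimes>\<^bsub>\<Gamma>\<^esub> \<gamma> \<otimes>\<^bsub>\<Gamma>\<^esub> \<rho> i \<in> vertex_kernel"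
proof -
  have c: "\<rho> i \<in> carrier \<Gamma>" "\<gamma> \<in> carrier \<Gamma>" using assms \<rho>_closed by (auto simp: vertex_kernel_def)
  have "(\<rho> i \<otimes>\<^bsub>\<Gamma>\<^esub> \<gamma> \<otimes>\<^bsub>\<Gamma>\<^esub> \<rho> i) v = v" if v: "v \<in> vertices r" for v
  proof -
    have F: "v \<in> Field r" "\<rho> i v \<in> vertices r" "\<rho> i v \<in> Field r"
      using v aut_vertices[OF c(1) v] vertices_Field by auto
    have "(\<rho> i \<otimes>\<^bsub>\<Gamma>\<^esub> \<gamma> \<otimes>\<^bsub>\<Gamma>\<^esub> \<rho> i) v = \<rho> i (\<gamma> (\<rho> i v))"
      using mult_apply[of "\<rho> i \<otimes>\<^bsub>\<Gamma>\<^esub> \<gamma>" "\<rho> i" v] mult_apply[of "\<rho> i" \<gamma> "\<rho> i v"] c F by simp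
    also have "\<dots> = \<rho> i (\<rho> i v)" using assms(2) F by (simp add: vertex_kernel_def)
    also have "\<dots> = v" using mult_apply[OF c(1) c(1) F(1)] \<rho>_involution[OF assms(1)] one_apply[OF F(1)] by simp
    finally show ?thesis .
  qed
  then show ?thesis using c by (simp add: vertex_kernel_def)
qed

text \<open>The vertex kernel contains \<open>\<rho> 2\<close> and \<open>T.w\<close> but no odd
  power of \<open>s2\<close>. It is normalised by \<open>\<rho> 0\<close>, so the conjugate of
  \<open>T.w\<close> is again in it; whether that conjugate is a rotation or a reflection separates
  the relations.\<close>

lemma odd_prime_vertices:
  assumes n: "prime n" "odd n" and card: "card (vertices r) = n"
  shows "\<Gamma>.ord s1 = n"
    and "(\<Gamma>.ord s2 = 2 \<and> \<rho> 0 \<otimes>\<^bsub>\<Gamma>\<^esub> T.a \<otimes>\<^bsub>\<Gamma>\<^esub> \<rho> 0 = \<rho> 2) \<or>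
      (n = 3 \<and> \<Gamma>.ord s2 = 4 \<and> \<rho> 0 \<otimes>\<^bsub>\<Gamma>\<^esub> T.a \<otimes>\<^bsub>\<Gamma>\<^esub> \<rho> 0 = T.a \<otimes>\<^bsub>\<Gamma>\<^esub> \<rho> 2) \<or>
      (\<Gamma>.ord s2 = 2 * n \<and> \<rho> 0 \<otimes>\<^bsub>\<Gamma>\<^esub> T.a \<otimes>\<^bsub>\<Gamma>\<^esub> \<rho> 0 = \<rho> 2 \<otimes>\<^bsub>\<Gamma>\<^esub> T.a \<otimes>\<^bsub>\<Gamma>\<^esub> \<rho> 2)"
proof -
  interpret P: prime_degree_action "vertices r" "b 1" "act (\<rho> 0)" "act (\<rho> 1)" "act (\<rho> 2)" n
    by (rule prime_degree_action_vertices[OF assms])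
  interpret K: subgroup vertex_kernel \<Gamma> by (rule subgroup_vertex_kernel)
  have F: "b 1 \<in> Field r" using b_Field by auto
  have b1: "b 1 \<in> vertices r" by (rule P.u0)
  have act_pow: "act (s1 [^]\<^bsub>\<Gamma>\<^esub> i) = (act (\<rho> 0) \<circ> act (\<rho> 1)) ^^ i" for i :: nat
  proof (induction i)
    case (Suc i)
    have "act (s1 [^]\<^bsub>\<Gamma>\<^esub> Suc i) = act (s1 [^]\<^bsub>\<Gamma>\<^esub> i) \<circ> act s1" using act_mult by simp
    also have "act s1 = act (\<rho> 0) \<circ> act (\<rho> 1)" using act_mult by simp
    finally show ?case unfolding Suc by (simp only: funpow_Suc_right)
  qed (simp add: act_one)
  have fix_iff: "(s1 [^]\<^bsub>\<Gamma>\<^esub> i) (b 1) = b 1 \<longleftrightarrow> n dvd i" for i :: nat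
  proof -
    have "act (s1 [^]\<^bsub>\<Gamma>\<^esub> i) (b 1) = (s1 [^]\<^bsub>\<Gamma>\<^esub> i) (b 1)" using b1 by (simp add: act_def)
    then show ?thesis using P.r0_r1_cycle[of i] unfolding act_pow by simp
  qed
  have "s1 [^]\<^bsub>\<Gamma>\<^esub> i = \<one>\<^bsub>\<Gamma>\<^esub> \<longleftrightarrow> n dvd i" for i :: nat
  proof
    assume "s1 [^]\<^bsub>\<Gamma>\<^esub> i = \<one>\<^bsub>\<Gamma>\<^esub>"
    then show "n dvd i" using fix_iff[of i] one_apply[OF F] by simp
  next
    assume "n dvd i"
    then show "s1 [^]\<^bsub>\<Gamma>\<^esub> i = \<one>\<^bsub>\<Gamma>\<^esub>"
      using fix_iff[of i] s1_pow_fixes_vertex[of "int i"] by (simp add: int_pow_int)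
  qed
  then show ord1: "\<Gamma>.ord s1 = n" using \<Gamma>.ord_unique[of s1 n] by simp
  then have s1n: "s1 [^]\<^bsub>\<Gamma>\<^esub> n = \<one>\<^bsub>\<Gamma>\<^esub>" using \<Gamma>.pow_ord_eq_1[of s1] by simp
  have \<rho>2K: "\<rho> 2 \<in> vertex_kernel"
  proof -
    have "\<rho> 2 v = v" if "v \<in> vertices r" for v
      using fun_cong[OF P.r2_trivial, of v] that by (simp add: act_def)
    then show ?thesis by (intro vertex_kernelI) auto
  qed
  \<comment> \<open>Otherwise \<open>s1\<close> would act on the vertices as the involution
    \<open>\<rho> 0\<close>, and \<open>n\<close> would divide \<open>2\<close>.\<close>
  have \<rho>1K: "\<rho> 1 \<notin> vertex_kernel"
  proof
    assume "\<rho> 1 \<in> vertex_kernel"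
    then have act1: "act (\<rho> 1) = id"
      by (intro ext) (simp add: vertex_kernelD act_def)
    have "act (s1 [^]\<^bsub>\<Gamma>\<^esub> (2::nat)) = act (\<rho> 0) \<circ> act (\<rho> 0)"
      unfolding act_pow act1 by (simp add: numeral_2_eq_2)
    also have "\<dots> = id" by (rule act_involution) simp
    finally have "act (s1 [^]\<^bsub>\<Gamma>\<^esub> (2::nat)) (b 1) = b 1" by simp
    then have "(s1 [^]\<^bsub>\<Gamma>\<^esub> (2::nat)) (b 1) = b 1" using b1 unfolding act_def by simp
    then have "n dvd 2" using fix_iff[of 2] by blast
    then show False using P.b_gt_2 by (auto dest: dvd_imp_le)
  qed
  have aK: "T.a \<in> vertex_kernel" using conj_vertex_kernel[OF _ \<rho>2K, of 1] by (simp add: T.a_def)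
  have wK: "T.w \<in> vertex_kernel" using aK \<rho>2K K.m_closed by (simp add: T.w_def)
  have s2K: "s2 \<notin> vertex_kernel"
  proof
    assume "s2 \<in> vertex_kernel"
    then have "s2 \<otimes>\<^bsub>\<Gamma>\<^esub> \<rho> 2 \<in> vertex_kernel" using \<rho>2K K.m_closed by blast
    then show False using \<rho>1K by (simp add: \<Gamma>.m_assoc)
  qed
  have s2_sq: "s2 \<otimes>\<^bsub>\<Gamma>\<^esub> s2 = T.w" by (simp add: T.w_def T.a_def \<Gamma>.m_assoc)
  have s2_even: "s2 [^]\<^bsub>\<Gamma>\<^esub> (2 * k) = T.w [^]\<^bsub>\<Gamma>\<^esub> k" for k :: int
    using \<Gamma>.int_pow_pow[of s2 2 k] \<Gamma>.int_pow_mult[of s2 1 1] s2_sq by simp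
  have wkK: "T.w [^]\<^bsub>\<Gamma>\<^esub> (k::int) \<in> vertex_kernel" for k
    using \<Gamma>.subgroup_int_pow_closed[OF subgroup_vertex_kernel wK] .
  have s2_odd: "s2 [^]\<^bsub>\<Gamma>\<^esub> (2 * k + 1) \<notin> vertex_kernel" for k :: int
  proof
    assume "s2 [^]\<^bsub>\<Gamma>\<^esub> (2 * k + 1) \<in> vertex_kernel"
    then have "T.w [^]\<^bsub>\<Gamma>\<^esub> (- k) \<otimes>\<^bsub>\<Gamma>\<^esub> (T.w [^]\<^bsub>\<Gamma>\<^esub> k \<otimes>\<^bsub>\<Gamma>\<^esub> s2) \<in> vertex_kernel"
      using \<Gamma>.int_pow_mult[of s2 "2 * k" 1] s2_even wkK K.m_closed by simp
    then show False using s2K by (simp add: \<Gamma>.int_pow_neg flip: \<Gamma>.m_assoc)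
  qed
  have kernel: "\<exists>k::int. \<gamma> = T.w [^]\<^bsub>\<Gamma>\<^esub> k \<or> \<gamma> = T.w [^]\<^bsub>\<Gamma>\<^esub> k \<otimes>\<^bsub>\<Gamma>\<^esub> \<rho> 2" if \<gamma>: "\<gamma> \<in> vertex_kernel" for \<gamma>
  proof -
    have "\<gamma> \<in> generate \<Gamma> {\<rho> 1, \<rho> 2}" 
      using vertex_stabilizer[of \<gamma>] vertex_kernelD[OF \<gamma> b1] K.mem_carrier[OF \<gamma>] by blast
    then obtain i :: int where i: "\<gamma> = s2 [^]\<^bsub>\<Gamma>\<^esub> i \<or> \<gamma> = s2 [^]\<^bsub>\<Gamma>\<^esub> i \<otimes>\<^bsub>\<Gamma>\<^esub> \<rho> 2"
      using \<Gamma>.dihedral_elements[of "\<rho> 1" "\<rho> 2" \<gamma>] by auto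
    have "s2 [^]\<^bsub>\<Gamma>\<^esub> i \<in> vertex_kernel"
      using i
    proof
      assume "\<gamma> = s2 [^]\<^bsub>\<Gamma>\<^esub> i \<otimes>\<^bsub>\<Gamma>\<^esub> \<rho> 2"
      then have "s2 [^]\<^bsub>\<Gamma>\<^esub> i = \<gamma> \<otimes>\<^bsub>\<Gamma>\<^esub> \<rho> 2" by (simp add: \<Gamma>.m_assoc)
      then show ?thesis using \<gamma> \<rho>2K K.m_closed by simp
    qed (use \<gamma> in simp)
    then have "i \<noteq> 2 * (i div 2) + 1" using s2_odd by metis
    then have "i = 2 * (i div 2)" by presburger
    then have "s2 [^]\<^bsub>\<Gamma>\<^esub> i = T.w [^]\<^bsub>\<Gamma>\<^esub> (i div 2)" using s2_even by metis
    then show ?thesis using i by auto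
  qed
  have s2_sq': "s2 [^]\<^bsub>\<Gamma>\<^esub> (2::nat) = T.w" using s2_sq by (simp add: \<Gamma>.nat_pow_2)
  have ord2_ne: "\<not> \<Gamma>.ord s2 dvd 1" using \<Gamma>.ord_eq_1[of s2] generators_ne(5) by simp
  obtain k :: int where "\<rho> 0 \<otimes>\<^bsub>\<Gamma>\<^esub> T.w \<otimes>\<^bsub>\<Gamma>\<^esub> \<rho> 0 = T.w [^]\<^bsub>\<Gamma>\<^esub> k \<or>
      \<rho> 0 \<otimes>\<^bsub>\<Gamma>\<^esub> T.w \<otimes>\<^bsub>\<Gamma>\<^esub> \<rho> 0 = T.w [^]\<^bsub>\<Gamma>\<^esub> k \<otimes>\<^bsub>\<Gamma>\<^esub> \<rho> 2"
    using kernel[OF conj_vertex_kernel[OF _ wK, of 0]] by auto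
  then show "(\<Gamma>.ord s2 = 2 \<and> \<rho> 0 \<otimes>\<^bsub>\<Gamma>\<^esub> T.a \<otimes>\<^bsub>\<Gamma>\<^esub> \<rho> 0 = \<rho> 2) \<or>
      (n = 3 \<and> \<Gamma>.ord s2 = 4 \<and> \<rho> 0 \<otimes>\<^bsub>\<Gamma>\<^esub> T.a \<otimes>\<^bsub>\<Gamma>\<^esub> \<rho> 0 = T.a \<otimes>\<^bsub>\<Gamma>\<^esub> \<rho> 2) \<or>
      (\<Gamma>.ord s2 = 2 * n \<and> \<rho> 0 \<otimes>\<^bsub>\<Gamma>\<^esub> T.a \<otimes>\<^bsub>\<Gamma>\<^esub> \<rho> 0 = \<rho> 2 \<otimes>\<^bsub>\<Gamma>\<^esub> T.a \<otimes>\<^bsub>\<Gamma>\<^esub> \<rho> 2)"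
  proof
    assume k: "\<rho> 0 \<otimes>\<^bsub>\<Gamma>\<^esub> T.w \<otimes>\<^bsub>\<Gamma>\<^esub> \<rho> 0 = T.w [^]\<^bsub>\<Gamma>\<^esub> k"
    note rel = T.relation_of_w_normalised[OF k s1n n(2)]
    show ?thesis
    proof (cases "T.w = \<one>\<^bsub>\<Gamma>\<^esub>")
      case True
      then have sq: "s2 [^]\<^bsub>\<Gamma>\<^esub> (2::nat) = \<one>\<^bsub>\<Gamma>\<^esub>" using s2_sq' by simp
      then have "\<Gamma>.ord s2 dvd 2" using \<Gamma>.pow_eq_id[of s2 2] by simp
      then have "\<Gamma>.ord s2 = 2" using ord2_ne two_is_prime_nat by (auto simp: prime_nat_iff)
      then show ?thesis using T.x0_a_x0_of_comm_x1_x2(1)[OF sq] by blast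
    next
      case False
      have "s2 [^]\<^bsub>\<Gamma>\<^esub> (2 * n) = \<one>\<^bsub>\<Gamma>\<^esub>"
        using \<Gamma>.nat_pow_pow[of s2 2 n] s2_sq' rel(2) by simp
      then have "\<Gamma>.ord s2 dvd 2 * n" using \<Gamma>.pow_eq_id[of s2 "2 * n"] by simp
      moreover have "\<not> \<Gamma>.ord s2 dvd 2" using \<Gamma>.pow_eq_id[of s2 2] s2_sq' False by simp
      \<comment> \<open>\<open>n\<close> is odd, and odd powers of \<open>s2\<close> lie outside the
        vertex kernel.\<close>
      moreover have "\<not> \<Gamma>.ord s2 dvd n"
      proof
        assume "\<Gamma>.ord s2 dvd n"
        then have "s2 [^]\<^bsub>\<Gamma>\<^esub> n = \<one>\<^bsub>\<Gamma>\<^esub>" using \<Gamma>.pow_eq_id[of s2 n] by simp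
        then have "s2 [^]\<^bsub>\<Gamma>\<^esub> int n \<in> vertex_kernel" using K.one_closed by (simp add: int_pow_int)
        moreover obtain l where "n = 2 * l + 1" using n(2) oddE by blast
        ultimately show False using s2_odd[of "int l"] by simp
      qed
      ultimately have "\<Gamma>.ord s2 = 2 * n" using dvd_double_prime n(1) by blast
      then show ?thesis using rel(1) by blast
    qed
  next
    assume k: "\<rho> 0 \<otimes>\<^bsub>\<Gamma>\<^esub> T.w \<otimes>\<^bsub>\<Gamma>\<^esub> \<rho> 0 = T.w [^]\<^bsub>\<Gamma>\<^esub> k \<otimes>\<^bsub>\<Gamma>\<^esub> \<rho> 2"
    note rel = T.relation_of_w_reflected[OF k s1n n(1) generators_ne(3)]
    have "s2 [^]\<^bsub>\<Gamma>\<^esub> (2 * 2 :: nat) = T.w [^]\<^bsub>\<Gamma>\<^esub> (2::nat)"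
      using \<Gamma>.nat_pow_pow[of s2 2 2] s2_sq' by simp
    also have "\<dots> = \<one>\<^bsub>\<Gamma>\<^esub>" using rel(2) by (simp add: \<Gamma>.nat_pow_2)
    finally have "\<Gamma>.ord s2 dvd 2 * 2" using \<Gamma>.pow_eq_id[of s2 "2 * 2"] by simp
    moreover have "\<not> \<Gamma>.ord s2 dvd 2" using \<Gamma>.pow_eq_id[of s2 2] s2_sq' rel(3) by simp
    ultimately have "\<Gamma>.ord s2 = 2 * 2" using dvd_double_prime two_is_prime_nat by blast
    then show ?thesis using rel(1,4) by simp
  qed
qed

theorem classification:
  assumes "prime n" "card (vertices r) = n"
  shows "flat r \<and> (n = 2 \<and> (\<exists>q \<ge> 2. is_hosohedron q r) \<or> n = 3 \<and> is_hemi_octahedron r \<or>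
    odd n \<and> is_dihedron n r \<or> odd n \<and> is_flat_b_2b n r)"
proof (cases "n = 2")
  case True
  have s1: "s1 [^]\<^bsub>\<Gamma>\<^esub> (2::nat) = \<one>\<^bsub>\<Gamma>\<^esub>" using ord_s1_of_two_vertices assms True by simp
  then have "\<Gamma>.ord s1 dvd 2" using \<Gamma>.pow_eq_id[of s1 2] by simp
  moreover have "\<Gamma>.ord s1 \<noteq> 1" using \<Gamma>.ord_eq_1[of s1] generators_ne(4) by simp
  ultimately have "\<Gamma>.ord s1 = 2" using two_is_prime_nat by (auto simp: prime_nat_iff)
  then have "is_hosohedron (extended_ord \<Gamma> s2) r"
    by (intro hosohedronI) (simp add: extended_ord_def numeral_eq_enat)
  moreover have "extended_ord \<Gamma> s2 \<ge> 2"
  proof (cases "\<Gamma>.ord s2 = 0")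
    case False
    then have "\<Gamma>.ord s2 \<ge> 2" using \<Gamma>.ord_eq_1[of s2] generators_ne(5) by simp
    then show ?thesis using False by (simp add: extended_ord_def numeral_eq_enat)
  qed (simp add: extended_ord_def)
  moreover have "flat r"
    by (rule flatI) (use T.x0_a_x0_of_comm_x0_x1[OF s1] in \<open>simp add: generate.incl\<close>)
  ultimately show ?thesis using True by blast
next
  case False
  then have odd: "odd n" using assms(1) primes_dvd_imp_eq two_is_prime_nat by blast
  have s1: "extended_ord \<Gamma> s1 = enat n"
    using odd_prime_vertices(1)[OF assms(1) odd assms(2)] prime_gt_0_nat[OF assms(1)]
    by (simp add: extended_ord_def)
  from odd_prime_vertices(2)[OF assms(1) odd assms(2)] show ?thesis
  proof (elim disjE conjE)
    assume *: "\<Gamma>.ord s2 = 2" "\<rho> 0 \<otimes>\<^bsub>\<Gamma>\<^esub> T.a \<otimes>\<^bsub>\<Gamma>\<^esub> \<rho> 0 = \<rho> 2"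
    then have "is_dihedron n r"
      using s1 by (intro dihedronI) (simp_all add: extended_ord_def numeral_eq_enat)
    moreover have "flat r" by (rule flatI) (use * in \<open>simp add: generate.incl\<close>)
    ultimately show ?thesis using odd by blast
  next
    assume *: "n = 3" "\<Gamma>.ord s2 = 4" "\<rho> 0 \<otimes>\<^bsub>\<Gamma>\<^esub> T.a \<otimes>\<^bsub>\<Gamma>\<^esub> \<rho> 0 = T.a \<otimes>\<^bsub>\<Gamma>\<^esub> \<rho> 2"
    then have "is_hemi_octahedron r"
      using s1 by (intro hemi_octahedronI) (simp_all add: extended_ord_def numeral_eq_enat)
    moreover have "flat r" by (rule flatI) (use * in \<open>simp add: generate.incl generate.eng\<close>)
    ultimately show ?thesis using * by blast
  next
    assume *: "\<Gamma>.ord s2 = 2 * n" "\<rho> 0 \<otimes>\<^bsub>\<Gamma>\<^esub> T.a \<otimes>\<^bsub>\<Gamma>\<^esub> \<rho> 0 = \<rho> 2 \<otimes>\<^bsub>\<Gamma>\<^esub> T.a \<otimes>\<^bsub>\<Gamma>\<^esub> \<rho> 2"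
    moreover have "n \<noteq> 0" using prime_gt_0_nat[OF assms(1)] by simp
    ultimately have "is_flat_b_2b n r"
      using s1 by (intro flat_b_2bI) (simp_all add: extended_ord_def)
    moreover have "flat r" by (rule flatI) (use * in \<open>simp add: generate.incl generate.eng\<close>)
    ultimately show ?thesis using odd by blast
  qed
qed

end

section \<open>A regular polyhedron is determined by its group with distinguished generators\<close>

text \<open>In both polyhedra the stabiliser of a proper base face is generated by the two other
  involutions, so a homomorphism matching generators maps stabiliser into stabiliser.\<close>

lemma stabilizer_hom:
  assumes R: "regular_polyhedron_base r \<Phi> \<rho>" and S: "regular_polyhedron_base s \<Psi> \<sigma>"
    and k: "k \<in> hom (aut_group r) (aut_group s)" "\<And>i. i < 3 \<Longrightarrow> k (\<rho> i) = \<sigma> i"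
    and \<gamma>: "\<gamma> \<in> carrier (aut_group r)" "\<delta> \<in> carrier (aut_group r)" "i < 5"
    and eq: "\<gamma> (polyhedron.face_at r \<Phi> i) = \<delta> (polyhedron.face_at r \<Phi> i)"
  shows "k \<gamma> (polyhedron.face_at s \<Psi> i) = k \<delta> (polyhedron.face_at s \<Psi> i)"
proof -
  interpret R: regular_polyhedron_base r \<Phi> \<rho> by fact
  interpret S: regular_polyhedron_base s \<Psi> \<sigma> by fact
  interpret k: group_hom R.\<Gamma> S.\<Gamma> k
    using k R.\<Gamma>.is_group S.\<Gamma>.is_group by (simp add: group_hom_def group_hom_axioms_def)
  have kc: "k \<gamma> \<in> carrier S.\<Gamma>" "k \<delta> \<in> carrier S.\<Gamma>" using \<gamma> by auto
  show ?thesis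
  proof (cases "i \<in> {0, 4}")
    case True
    then show ?thesis using S.extremes_fixed kc by metis
  next
    case False
    then obtain j where j: "i = Suc j" "j < 3" using \<gamma>(3) by (cases i) auto
    define \<epsilon> where "\<epsilon> = inv\<^bsub>R.\<Gamma>\<^esub> \<delta> \<otimes>\<^bsub>R.\<Gamma>\<^esub> \<gamma>"
    have \<epsilon>: "\<epsilon> \<in> carrier R.\<Gamma>" "\<epsilon> (R.b i) = R.b i"
      using \<gamma> eq R.mult_apply[of "inv\<^bsub>R.\<Gamma>\<^esub> \<delta>" \<gamma> "R.b i"] R.inv_apply(1)[of \<delta> "R.b i"] R.b_Field[of i]
      by (simp_all add: \<epsilon>_def)
    then have "\<epsilon> \<in> generate R.\<Gamma> (\<rho> ` ({..<3} - {j}))"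
      using R.stabilizer_iff[OF \<epsilon>(1), of "{j}"] j by simp
    moreover have sub: "\<rho> ` ({..<3} - {j}) \<subseteq> carrier R.\<Gamma>" using R.\<rho>_closed by auto
    ultimately have "k \<epsilon> \<in> generate S.\<Gamma> (k ` \<rho> ` ({..<3} - {j}))"
      using k.generate_img[OF sub] by blast
    also have "k ` \<rho> ` ({..<3} - {j}) = \<sigma> ` ({..<3} - {j})"
      using k(2) by (force simp: image_image)
    finally have "k \<epsilon> (S.b i) = S.b i"
      using S.stabilizer_iff[of "k \<epsilon>" "{j}"] j \<epsilon> by simp
    moreover have "k \<gamma> = k \<delta> \<otimes>\<^bsub>S.\<Gamma>\<^esub> k \<epsilon>"
      using \<gamma> by (simp add: \<epsilon>_def flip: S.\<Gamma>.m_assoc)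
    ultimately show ?thesis
      using S.mult_apply[of "k \<delta>" "k \<epsilon>" "S.b i"] kc \<epsilon> S.b_Field[OF \<gamma>(3)] by simp
  qed
qed

lemma poset_iso_of_aut_iso:
  assumes R: "regular_polyhedron_base r \<Phi> \<rho>" and S: "regular_polyhedron_base s \<Psi> \<sigma>"
    and k: "k \<in> iso (aut_group r) (aut_group s)" "\<And>i. i < 3 \<Longrightarrow> k (\<rho> i) = \<sigma> i"
  shows "poset_iso r s"
proof -
  interpret R: regular_polyhedron_base r \<Phi> \<rho> by fact
  interpret S: regular_polyhedron_base s \<Psi> \<sigma> by fact
  have khom: "k \<in> hom R.\<Gamma> S.\<Gamma>" using k(1) by (simp add: iso_def)
  have kb: "bij_betw k (carrier R.\<Gamma>) (carrier S.\<Gamma>)" using k(1) by (simp add: iso_def)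
  have kc: "k \<gamma> \<in> carrier S.\<Gamma>" if "\<gamma> \<in> carrier R.\<Gamma>" for \<gamma> using kb that by (auto simp: bij_betw_def)
  define l where "l = inv_into (carrier R.\<Gamma>) k"
  have l: "l \<in> hom S.\<Gamma> R.\<Gamma>"
    using R.\<Gamma>.iso_set_sym[OF k(1)] by (simp add: l_def iso_def)
  have lk: "l (k \<gamma>) = \<gamma>" if "\<gamma> \<in> carrier R.\<Gamma>" for \<gamma>
    using kb that by (simp add: l_def bij_betw_def inv_into_f_f)
  have l\<sigma>: "l (\<sigma> i) = \<rho> i" if "i < 3" for i using lk[OF R.\<rho>_closed[OF that]] k(2)[OF that] by simp
  have eq_iff: "\<gamma> (R.b i) = \<delta> (R.b i) \<longleftrightarrow> k \<gamma> (S.b i) = k \<delta> (S.b i)"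
    if "\<gamma> \<in> carrier R.\<Gamma>" "\<delta> \<in> carrier R.\<Gamma>" "i < 5" for \<gamma> \<delta> i
    using stabilizer_hom[OF R S khom k(2), of \<gamma> \<delta> i] stabilizer_hom[OF S R l l\<sigma>, of "k \<gamma>" "k \<delta>" i]
      that kc lk by metis
  \<comment> \<open>The choice is harmless: by \<open>eq_iff\<close> the value does not depend on
    how \<open>x\<close> is written as an image of a base face.\<close>
  define f where "f x = (SOME y. \<exists>\<gamma>\<in>carrier R.\<Gamma>. \<exists>i<5. x = \<gamma> (R.b i) \<and> y = k \<gamma> (S.b i))" for x
  have f: "f (\<gamma> (R.b i)) = k \<gamma> (S.b i)" if \<gamma>: "\<gamma> \<in> carrier R.\<Gamma>" "i < 5" for \<gamma> i
    unfolding f_def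
  proof (rule some_equality)
    show "\<exists>\<gamma>'\<in>carrier R.\<Gamma>. \<exists>j<5. \<gamma> (R.b i) = \<gamma>' (R.b j) \<and> k \<gamma> (S.b i) = k \<gamma>' (S.b j)" using \<gamma> by blast
    fix y assume "\<exists>\<gamma>'\<in>carrier R.\<Gamma>. \<exists>j<5. \<gamma> (R.b i) = \<gamma>' (R.b j) \<and> y = k \<gamma>' (S.b j)"
    then obtain \<gamma>' j where *: "\<gamma>' \<in> carrier R.\<Gamma>" "j < 5" "\<gamma> (R.b i) = \<gamma>' (R.b j)" "y = k \<gamma>' (S.b j)" by blast
    then have "i = j" using R.aut_b_inj[OF \<gamma>(1)] \<gamma> by blast
    then show "y = k \<gamma> (S.b i)" using * eq_iff[OF \<gamma>(1) *(1) \<gamma>(2)] by simp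
  qed
  have "bij_betw f (Field r) (Field s)"
  proof (rule bij_betwI')
    fix x y assume "x \<in> Field r" "y \<in> Field r"
    then obtain \<gamma> i \<delta> j where x: "\<gamma> \<in> carrier R.\<Gamma>" "i < 5" "x = \<gamma> (R.b i)"
        and y: "\<delta> \<in> carrier R.\<Gamma>" "j < 5" "y = \<delta> (R.b j)"
      using R.face_cases by metis
    show "f x = f y \<longleftrightarrow> x = y"
    proof
      assume "f x = f y"
      then have *: "k \<gamma> (S.b i) = k \<delta> (S.b j)" using f x y by simp
      then have "i = j" using S.aut_b_inj kc x y by blast
      then show "x = y" using * eq_iff x y by simp
    qed simp
  next
    fix x assume "x \<in> Field r"
    then obtain \<gamma> i where "\<gamma> \<in> carrier R.\<Gamma>" "i < 5" "x = \<gamma> (R.b i)" using R.face_cases by metis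
    then show "f x \<in> Field s" using f kc S.aut_Field S.b_Field by simp
  next
    fix y assume "y \<in> Field s"
    then obtain \<gamma>' i where y: "\<gamma>' \<in> carrier S.\<Gamma>" "i < 5" "y = \<gamma>' (S.b i)" using S.face_cases by metis
    then obtain \<gamma> where "\<gamma> \<in> carrier R.\<Gamma>" "\<gamma>' = k \<gamma>" using kb by (auto simp: bij_betw_def)
    then show "\<exists>x\<in>Field r. y = f x" using f y R.aut_Field R.b_Field by metis
  qed
  moreover have "(x, y) \<in> r \<longleftrightarrow> (f x, f y) \<in> s" if xy: "x \<in> Field r" "y \<in> Field r" for x y
  proof -
    obtain \<gamma> i where x: "\<gamma> \<in> carrier R.\<Gamma>" "i < 5" "x = \<gamma> (R.b i)"
      using R.face_cases[OF xy(1)] by blast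
    obtain \<delta> j where y: "\<delta> \<in> carrier R.\<Gamma>" "j < 5" "y = \<delta> (R.b j)"
      using R.face_cases[OF xy(2)] by blast
    have "(\<exists>\<epsilon>\<in>carrier R.\<Gamma>. \<gamma> (R.b i) = \<epsilon> (R.b i) \<and> \<delta> (R.b j) = \<epsilon> (R.b j)) \<longleftrightarrow>
        (\<exists>\<epsilon>\<in>carrier R.\<Gamma>. k \<gamma> (S.b i) = k \<epsilon> (S.b i) \<and> k \<delta> (S.b j) = k \<epsilon> (S.b j))"
      using eq_iff x y by blast
    also have "\<dots> \<longleftrightarrow> (\<exists>\<epsilon>\<in>carrier S.\<Gamma>. k \<gamma> (S.b i) = \<epsilon> (S.b i) \<and> k \<delta> (S.b j) = \<epsilon> (S.b j))"
    proof -
      have "carrier S.\<Gamma> = k ` carrier R.\<Gamma>" using kb by (simp add: bij_betw_def)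
      then show ?thesis by simp
    qed
    finally show ?thesis
      using R.le_iff[OF x(1) y(1) x(2) y(2)] S.le_iff[OF kc[OF x(1)] kc[OF y(1)] x(2) y(2)] x y f by simp
  qed
  ultimately show ?thesis unfolding poset_iso_def by blast
qed

lemma polyhedron_with_group_baseE:
  assumes "polyhedron_with_group r p q G g"
  obtains \<Phi> \<rho> h where "regular_polyhedron_base r \<Phi> \<rho>" "h \<in> iso G (aut_group r)" "\<And>i. i < 3 \<Longrightarrow> h (g i) = \<rho> i"
proof -
  obtain \<Phi> \<rho> h where *: "regular_polyhedron r" "\<Phi> \<in> flags r" "\<And>i. i < 3 \<Longrightarrow> distinguished r \<Phi> i (\<rho> i)"
      "h \<in> iso G (aut_group r)" "\<And>i. i < 3 \<Longrightarrow> h (g i) = \<rho> i"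
    using assms unfolding polyhedron_with_group_def by blast
  then have "regular_polyhedron_base r \<Phi> \<rho>"
    by (simp add: regular_polyhedron_base_def regular_polyhedron_base_axioms_def polyhedron_def regular_polyhedron_def)
  then show thesis using that * by blast
qed

lemma polyhedron_with_group_unique:
  assumes r: "polyhedron_with_group r p q G g" and s: "polyhedron_with_group s p' q' G g"
    and G: "group G" "\<And>i. i < 3 \<Longrightarrow> g i \<in> carrier G"
  shows "poset_iso r s"
proof -
  obtain \<Phi> \<rho> h where R: "regular_polyhedron_base r \<Phi> \<rho>" "h \<in> iso G (aut_group r)" "\<And>i. i < 3 \<Longrightarrow> h (g i) = \<rho> i"
    using polyhedron_with_group_baseE[OF r] by blast
  obtain \<Psi> \<sigma> k where S: "regular_polyhedron_base s \<Psi> \<sigma>" "k \<in> iso G (aut_group s)" "\<And>i. i < 3 \<Longrightarrow> k (g i) = \<sigma> i"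
    using polyhedron_with_group_baseE[OF s] by blast
  interpret G: group G by fact
  define l where "l = inv_into (carrier G) h"
  have "l \<in> iso (aut_group r) G" unfolding l_def by (rule G.iso_set_sym[OF R(2)])
  then have "k \<circ> l \<in> iso (aut_group r) (aut_group s)" using S(2) by (rule iso_set_trans)
  moreover have "(k \<circ> l) (\<rho> i) = \<sigma> i" if "i < 3" for i
  proof -
    have "l (h (g i)) = g i"
      using R(2) G(2)[OF that] by (simp add: l_def iso_def bij_betw_def inv_into_f_f)
    then show ?thesis using R(3)[OF that] S(3)[OF that] by simp
  qed
  ultimately show ?thesis using poset_iso_of_aut_iso[OF R(1) S(1)] by blast
qed

section \<open>Polyhedra from groups of functions\<close>

text \<open>Needed to number the cosets by naturals, including those of the infinite
  hosohedron.\<close>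

lemma countable_involution_span:
  assumes "countable S"
  shows "countable (involution_span S)"
proof -
  have "f \<in> (\<lambda>ws. foldr (\<circ>) ws id) ` lists S" if "f \<in> involution_span S" for f
    using that
  proof (induction rule: involution_span.induct)
    case id
    show ?case by (rule image_eqI[of _ _ "[]"]) auto
  next
    case (step s f)
    then obtain ws where "ws \<in> lists S" "f = foldr (\<circ>) ws id" by blast
    moreover have "s \<circ> foldr (\<circ>) ws id = foldr (\<circ>) (s # ws) id" by (simp only: foldr.simps comp_apply)
    ultimately show ?case using step(1) by (metis image_eqI lists.Cons)
  qed
  then have "involution_span S \<subseteq> (\<lambda>ws. foldr (\<circ>) ws id) ` lists S" by (rule subsetI)
  then show ?thesis by (rule countable_subset) (intro countable_image countable_lists assms)
qed

lemma comp_involution_cancel: "s \<circ> s = id \<Longrightarrow> s \<circ> (s \<circ> f) = f"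
  by (simp add: fun_eq_iff)

lemma involution_span_commuting:
  assumes "f \<in> involution_span {s, t}" "s \<circ> s = id" "t \<circ> t = id" "s \<circ> t = t \<circ> s"
  shows "f \<in> {id, s, t, s \<circ> t}"
  using assms(1)
proof (induction rule: involution_span.induct)
  case (step u f)
  have "t \<circ> (s \<circ> t) = t \<circ> (t \<circ> s)" by (simp only: assms(4))
  then have "s \<circ> (s \<circ> t) = t" "t \<circ> (s \<circ> t) = s"
    by (simp_all only: comp_involution_cancel[OF assms(2)] comp_involution_cancel[OF assms(3)])
  note eqs = this comp_id id_comp assms(2,3) assms(4)[symmetric]
  from step have "u = s \<or> u = t" "f = id \<or> f = s \<or> f = t \<or> f = s \<circ> t" by blast+
  then show ?case by (elim disjE; simp only: eqs insert_iff simp_thms)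
qed simp

text \<open>Powers of both products occur because \<open>funpow\<close> has natural exponents and
  the rotation may have infinite order.\<close>

lemma involution_span_dihedral:
  assumes "f \<in> involution_span {s, t}" "s \<circ> s = id" "t \<circ> t = id"
  obtains i where "f = (s \<circ> t) ^^ i \<or> f = (s \<circ> t) ^^ i \<circ> t \<or> f = (t \<circ> s) ^^ i \<or> f = (t \<circ> s) ^^ i \<circ> t"
proof -
  let ?c = "s \<circ> t" and ?d = "t \<circ> s"
  define R where "R f \<longleftrightarrow> (\<exists>i. f = ?c ^^ i \<or> f = ?c ^^ i \<circ> t \<or> f = ?d ^^ i \<or> f = ?d ^^ i \<circ> t)" for f
  have swap: "t \<circ> ?c ^^ i = ?d ^^ i \<circ> t" "t \<circ> ?d ^^ i = ?c ^^ i \<circ> t" for i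
  proof -
    have 1: "t \<circ> (s \<circ> t) = (t \<circ> s) \<circ> t" by (simp only: comp_assoc)
    have 2: "t \<circ> (t \<circ> s) = (s \<circ> t) \<circ> t"
      by (simp only: comp_assoc comp_involution_cancel[OF assms(3)] assms(3) comp_id)
    show "t \<circ> ?c ^^ i = ?d ^^ i \<circ> t" by (rule funpow_conj[OF 1])
    show "t \<circ> ?d ^^ i = ?c ^^ i \<circ> t" by (rule funpow_conj[OF 2])
  qed
  have cd: "?c \<circ> ?d = id"
    by (simp only: comp_assoc comp_involution_cancel[OF assms(3)] assms(2))
  have t: "R (t \<circ> f)" if f: "R f" for f
  proof -
    obtain i where i: "f = ?c ^^ i \<or> f = ?c ^^ i \<circ> t \<or> f = ?d ^^ i \<or> f = ?d ^^ i \<circ> t"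
      using f[unfolded R_def] by (elim exE)
    have "t \<circ> (?c ^^ i \<circ> t) = ?d ^^ i" "t \<circ> (?d ^^ i \<circ> t) = ?c ^^ i"
      using swap[of i] by (simp_all only: comp_assoc[symmetric]) (simp_all only: comp_assoc assms(3) comp_id)
    then have "\<exists>j. t \<circ> f = ?c ^^ j \<or> t \<circ> f = ?c ^^ j \<circ> t \<or> t \<circ> f = ?d ^^ j \<or> t \<circ> f = ?d ^^ j \<circ> t"
      using i swap[of i] by metis
    then show ?thesis by (simp only: R_def)
  qed
  have c: "R (?c \<circ> f)" if f: "R f" for f
  proof -
    obtain i where i: "f = ?c ^^ i \<or> f = ?c ^^ i \<circ> t \<or> f = ?d ^^ i \<or> f = ?d ^^ i \<circ> t"
      using f[unfolded R_def] by (elim exE)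
    have Suc_c: "?c \<circ> ?c ^^ i = ?c ^^ Suc i" "?c \<circ> (?c ^^ i \<circ> t) = ?c ^^ Suc i \<circ> t"
      by (simp_all only: funpow.simps comp_assoc)
    have "\<exists>j. ?c \<circ> ?d ^^ i = ?c ^^ j \<or> ?c \<circ> ?d ^^ i = ?d ^^ j"
    proof (cases i)
      case 0
      then have "?c \<circ> ?d ^^ i = ?c ^^ Suc 0" by simp
      then show ?thesis by blast
    next
      case (Suc j)
      then have "?c \<circ> ?d ^^ i = (?c \<circ> ?d) \<circ> ?d ^^ j" by (simp only: funpow.simps comp_assoc)
      then have "?c \<circ> ?d ^^ i = ?d ^^ j" by (simp only: cd id_comp)
      then show ?thesis by blast
    qed
    then obtain j where "?c \<circ> ?d ^^ i = ?c ^^ j \<or> ?c \<circ> ?d ^^ i = ?d ^^ j" by blast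
    moreover from this have "?c \<circ> (?d ^^ i \<circ> t) = ?c ^^ j \<circ> t \<or> ?c \<circ> (?d ^^ i \<circ> t) = ?d ^^ j \<circ> t"
      unfolding comp_assoc[symmetric] by (elim disjE) simp_all
    ultimately have "\<exists>j. ?c \<circ> f = ?c ^^ j \<or> ?c \<circ> f = ?c ^^ j \<circ> t \<or> ?c \<circ> f = ?d ^^ j \<or> ?c \<circ> f = ?d ^^ j \<circ> t"
      using i Suc_c by metis
    then show ?thesis by (simp only: R_def)
  qed
  have "R f"
    using assms(1)
  proof (induction rule: involution_span.induct)
    case id
    show ?case unfolding R_def by (intro exI[of _ 0]) simp
  next
    case (step u f)
    have "s \<circ> f = ?c \<circ> (t \<circ> f)" by (simp only: comp_assoc comp_involution_cancel[OF assms(3)])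
    then show ?case using step t c by (metis empty_iff insert_iff)
  qed
  then show thesis unfolding R_def using that by (elim exE)
qed

text \<open>The point \<open>x0\<close> stands for the base vertex and detects stabilisers by
  evaluation: \<open>rotation\<close> says that a rotation of the base facet fixing
  \<open>x0\<close> is trivial. With \<open>nontrivial\<close>, this suffices for the intersection
  property.\<close>

locale string_model =
  fixes g :: "nat \<Rightarrow> 'x \<Rightarrow> 'x" and x0 :: 'x
  assumes invol: "i < 3 \<Longrightarrow> g i \<circ> g i = id"
    and comm: "g 0 \<circ> g 2 = g 2 \<circ> g 0"
    and fixed: "g 1 x0 = x0" "g 2 x0 = x0" "g 0 x0 \<noteq> x0"
    and rotation: "((g 0 \<circ> g 1) ^^ i) x0 = x0 \<Longrightarrow> (g 0 \<circ> g 1) ^^ i = id"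
    and nontrivial: "g 1 \<noteq> id" "g 2 \<noteq> id" "g 1 \<noteq> g 2"
begin

definition Sp where "Sp J = involution_span (g ` J)"
definition M where "M = Sp {..<3}"
text \<open>The generator \<open>g j\<close> moves the base face of level \<open>Suc j\<close> only.
  At levels \<open>0\<close> and \<open>4\<close> no generator is excluded, which yields a single
  least and a single greatest face.\<close>

definition stab where "stab k = Sp {j. j < 3 \<and> Suc j \<noteq> k}"

lemma Sp_mono: "J \<subseteq> K \<Longrightarrow> f \<in> Sp J \<Longrightarrow> f \<in> Sp K"
  unfolding Sp_def by (rule involution_span_mono) auto

lemma Sp_inv:
  assumes "J \<subseteq> {..<3}" "f \<in> Sp J"
  shows "bij f" "finv f \<in> Sp J"
  using involution_span_bij[of f "g ` J"] assms invol unfolding Sp_def by blast+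

lemma stab_M: "f \<in> stab k \<Longrightarrow> f \<in> M"
  unfolding stab_def M_def by (rule Sp_mono[rotated]) auto

lemma M_bij: "f \<in> M \<Longrightarrow> bij f" and M_inv: "f \<in> M \<Longrightarrow> finv f \<in> M"
  unfolding M_def using Sp_inv[of "{..<3}" f] by auto

lemma stab_inv: "f \<in> stab k \<Longrightarrow> finv f \<in> stab k"
  unfolding stab_def by (rule Sp_inv(2)) auto

lemma M_comp: "f \<in> M \<Longrightarrow> h \<in> M \<Longrightarrow> f \<circ> h \<in> M"
  and stab_comp: "f \<in> stab k \<Longrightarrow> h \<in> stab k \<Longrightarrow> f \<circ> h \<in> stab k"
  unfolding M_def stab_def Sp_def by (rule involution_span_comp; assumption)+

lemma id_M: "id \<in> M" and id_stab: "id \<in> stab k"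
  unfolding M_def stab_def Sp_def by (rule involution_span.id)+

lemma g_M: "j < 3 \<Longrightarrow> g j \<in> M"
  unfolding M_def Sp_def by (intro involution_span_incl) auto

lemma g_stab: "j < 3 \<Longrightarrow> Suc j \<noteq> k \<Longrightarrow> g j \<in> stab k"
  unfolding stab_def Sp_def by (intro involution_span_incl) auto

lemma inv_comp: "f \<in> M \<Longrightarrow> finv f \<circ> f = id" "f \<in> M \<Longrightarrow> f \<circ> finv f = id"
  using M_bij by (simp_all add: bij_is_inj bij_is_surj surj_iff[symmetric])

lemma stab_extreme: "k = 0 \<or> k = 4 \<Longrightarrow> stab k = M"
proof -
  assume "k = 0 \<or> k = 4"
  then have "{j. j < 3 \<and> Suc j \<noteq> k} = {..<3}" by auto
  then show ?thesis by (simp add: stab_def M_def)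
qed

lemma stab_sets: "stab 1 = involution_span {g 1, g 2}" "stab 2 = involution_span {g 0, g 2}"
    "stab 3 = involution_span {g 0, g 1}"
proof -
  have "{j. j < 3 \<and> Suc j \<noteq> 1} = {1, 2}" "{j. j < 3 \<and> Suc j \<noteq> 2} = {0, 2}" "{j. j < 3 \<and> Suc j \<noteq> 3} = {0, 1}"
    by auto
  then show "stab 1 = involution_span {g 1, g 2}" "stab 2 = involution_span {g 0, g 2}"
    "stab 3 = involution_span {g 0, g 1}"
    unfolding stab_def Sp_def by simp_all
qed

lemma stab_1_fixes: "f \<in> stab 1 \<Longrightarrow> f x0 = x0"
  unfolding stab_sets by (induction rule: involution_span.induct) (use fixed in auto)

lemma stab_2_cases: "f \<in> stab 2 \<Longrightarrow> f \<in> {id, g 0, g 2, g 0 \<circ> g 2}"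
  by (rule involution_span_commuting[OF _ invol invol comm]) (simp_all add: stab_sets)

text \<open>A reflection is a rotation composed with \<open>g 1\<close>, and \<open>g 1\<close>
  fixes \<open>x0\<close>; so in either form the rotation part fixes \<open>x0\<close> and is
  trivial.\<close>

lemma stab_3_fixing:
  assumes "f \<in> stab 3" "f x0 = x0"
  shows "f = id \<or> f = g 1"
proof -
  let ?c = "g 0 \<circ> g 1" and ?d = "g 1 \<circ> g 0"
  have inv: "g 0 \<circ> g 0 = id" "g 1 \<circ> g 1 = id" using invol by auto
  obtain i where i: "f = ?c ^^ i \<or> f = ?c ^^ i \<circ> g 1 \<or> f = ?d ^^ i \<or> f = ?d ^^ i \<circ> g 1"
    using involution_span_dihedral[OF assms(1)[unfolded stab_sets] inv] by blast
  have dc: "(?d ^^ i) ((?c ^^ i) x) = x" "(?c ^^ i) ((?d ^^ i) x) = x" for x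
  proof -
    have cd: "?c (?d y) = y" "?d (?c y) = y" for y
      using inv by (simp_all add: fun_eq_iff)
    have *: "(?d ^^ i) ((?c ^^ i) x) = x \<and> (?c ^^ i) ((?d ^^ i) x) = x" for x
    proof (induction i arbitrary: x)
      case (Suc i)
      have "(?d ^^ Suc i) ((?c ^^ Suc i) x) = (?d ^^ i) (?d (?c ((?c ^^ i) x)))"
        "(?c ^^ Suc i) ((?d ^^ Suc i) x) = (?c ^^ i) (?c (?d ((?d ^^ i) x)))"
        by (simp_all only: funpow_Suc_right funpow.simps(2) comp_apply funpow_swap1)
      then show ?case unfolding cd using Suc by (simp only: simp_thms)
    qed simp
    then show "(?d ^^ i) ((?c ^^ i) x) = x" "(?c ^^ i) ((?d ^^ i) x) = x" by auto
  qed
  have "(?c ^^ i) x0 = x0 \<or> (?d ^^ i) x0 = x0"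
    using i assms(2) fixed(1) by (metis comp_apply)
  then have "(?c ^^ i) x0 = x0" using dc(2) by metis
  then have c: "?c ^^ i = id" by (rule rotation)
  then have "?d ^^ i = id" using dc(1) by (simp add: fun_eq_iff)
  then show ?thesis using i c by auto
qed

lemma g0_notin: "g 0 \<notin> stab 1" and g1_notin: "g 1 \<notin> stab 2" and g2_notin: "g 2 \<notin> stab 3"
proof -
  show "g 0 \<notin> stab 1" using stab_1_fixes fixed by blast
  show "g 1 \<notin> stab 2"
  proof
    assume "g 1 \<in> stab 2"
    then have "g 1 = g 0 \<or> g 1 = g 0 \<circ> g 2" using stab_2_cases nontrivial by blast
    then show False using fixed by (metis comp_apply)
  qed
  show "g 2 \<notin> stab 3"
  proof
    assume "g 2 \<in> stab 3"
    from stab_3_fixing[OF this fixed(2)] show False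
      using nontrivial(2) nontrivial(3)[symmetric] by (simp only: simp_thms)
  qed
qed

lemma g_notin: "j < 3 \<Longrightarrow> g j \<notin> stab (Suc j)"
proof -
  assume "j < 3"
  then have "j = 0 \<or> j = 1 \<or> j = 2" by linarith
  moreover have "Suc 0 = 1" "Suc 1 = 2" "Suc 2 = 3" by simp_all
  ultimately show ?thesis using g0_notin g1_notin g2_notin by (elim disjE) (simp_all only: simp_thms)
qed

lemma stab_1_2: "f \<in> stab 1 \<Longrightarrow> f \<in> stab 2 \<Longrightarrow> f = id \<or> f = g 2"
  using stab_1_fixes[of f] stab_2_cases[of f] fixed by auto

lemma stab_2_3:
  assumes "f \<in> stab 2" "f \<in> stab 3"
  shows "f = id \<or> f = g 0"
proof -
  have g0: "g 0 \<in> stab 3" by (rule g_stab) auto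
  have "g 0 \<circ> (g 0 \<circ> g 2) = g 2" using invol[of 0] by (metis comp_assoc id_comp zero_less_numeral)
  then have "f \<noteq> g 0 \<circ> g 2" using stab_comp[OF g0 assms(2)] g2_notin by metis
  then show ?thesis using stab_2_cases[OF assms(1)] assms(2) g2_notin by blast
qed

lemma stab_1_3: "f \<in> stab 1 \<Longrightarrow> f \<in> stab 3 \<Longrightarrow> f = id \<or> f = g 1"
  using stab_3_fixing stab_1_fixes by blast

text \<open>The intersection property of string C-groups.\<close>

lemma in_Sp_moved:
  assumes "f \<in> M"
  shows "f \<in> Sp {j. j < 3 \<and> f \<notin> stab (Suc j)}" (is "f \<in> Sp ?J")
proof -
  have Suc: "Suc 0 = 1" "Suc 1 = 2" "Suc 2 = 3" by simp_all
  have gJ: "g j \<in> Sp {j}" for j unfolding Sp_def by (intro involution_span_incl) simp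
  have idJ: "id \<in> Sp K" for K unfolding Sp_def by (rule involution_span.id)
  have three: "j < 3 \<Longrightarrow> j = 0 \<or> j = 1 \<or> j = 2" for j :: nat by linarith
  have S: "f \<in> stab (Suc j) \<longleftrightarrow> j = 0 \<and> f \<in> stab 1 \<or> j = 1 \<and> f \<in> stab 2 \<or> j = 2 \<and> f \<in> stab 3"
    if "j < 3" for j
    using three[OF that] by (elim disjE) (simp_all add: Suc)
  have stab_sub: "f \<in> Sp ?J" if "\<And>k. k < 3 \<Longrightarrow> k \<noteq> j \<Longrightarrow> f \<notin> stab (Suc k)" "f \<in> stab (Suc j)" for j
    using that(2) unfolding stab_def by (rule Sp_mono[rotated]) (use that(1) in \<open>auto simp: stab_def\<close>)
  have pair: "f \<in> Sp ?J" if "f = id \<or> f = g j" "j \<in> ?J \<or> f = id" for j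
    using that idJ gJ[of j] Sp_mono[of "{j}" ?J f] by auto
  show ?thesis
  proof (cases "f = id")
    case True
    then show ?thesis using idJ by simp
  next
    case False
    \<comment> \<open>If exactly one stabiliser contains \<open>f\<close>, membership in it is
      already the claim; if two do, \<open>f\<close> is a single generator, which
      \<open>g_notin\<close> allows.\<close>
    consider "f \<notin> stab 1" "f \<notin> stab 2" "f \<notin> stab 3" | "f \<in> stab 1" "f \<notin> stab 2" "f \<notin> stab 3"
      | "f \<notin> stab 1" "f \<in> stab 2" "f \<notin> stab 3" | "f \<notin> stab 1" "f \<notin> stab 2" "f \<in> stab 3"
      | "f \<in> stab 1" "f \<in> stab 2" | "f \<in> stab 2" "f \<in> stab 3" | "f \<in> stab 1" "f \<in> stab 3" by blast
    then show ?thesis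
    proof cases
      case 1
      then have "f \<notin> stab (Suc j)" if "j < 3" for j using S[OF that] by (simp only: simp_thms)
      then have "?J = {..<3}" by auto
      then show ?thesis using assms by (simp add: M_def)
    next
      case 2
      show ?thesis by (rule stab_sub[of 0]) (use 2 S Suc in \<open>simp_all only: simp_thms zero_less_numeral\<close>)
    next
      case 3
      show ?thesis by (rule stab_sub[of 1]) (use 3 S Suc in \<open>simp_all only: simp_thms zero_less_numeral\<close>)
    next
      case 4
      show ?thesis by (rule stab_sub[of 2]) (use 4 S Suc in \<open>simp_all only: simp_thms zero_less_numeral\<close>)
    next
      case 5
      then have "f = g 2" using stab_1_2 False by blast
      moreover have "2 \<in> ?J" using g_notin[of 2] calculation by simp
      ultimately show ?thesis using pair[of 2] by blast
    next
      case 6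
      then have "f = g 0" using stab_2_3 False by blast
      moreover have "0 \<in> ?J" using g_notin[of 0] calculation by simp
      ultimately show ?thesis using pair[of 0] by blast
    next
      case 7
      then have "f = g 1" using stab_1_3 False by blast
      moreover have "1 \<in> ?J" using g_notin[of 1] calculation by simp
      ultimately show ?thesis using pair[of 1] by blast
    qed
  qed
qed

subsection \<open>The poset of cosets\<close>

definition coset where "coset k m = {m \<circ> s | s. s \<in> stab k}"

lemma coset_eq_iff:
  assumes "m \<in> M" "n \<in> M"
  shows "coset k m = coset k n \<longleftrightarrow> (\<exists>s\<in>stab k. n = m \<circ> s)"
proof
  assume eq: "coset k m = coset k n"
  have "n \<circ> id \<in> coset k n" unfolding coset_def using id_stab by blast
  then show "\<exists>s\<in>stab k. n = m \<circ> s" unfolding eq[symmetric] by (auto simp: coset_def)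
next
  assume "\<exists>s\<in>stab k. n = m \<circ> s"
  then obtain s where s: "s \<in> stab k" "n = m \<circ> s" by blast
  then have m: "m = n \<circ> finv s"
    using inv_comp(2)[OF stab_M[OF s(1)]] by (simp add: comp_assoc)
  show "coset k m = coset k n"
  proof (intro equalityI subsetI)
    fix f assume "f \<in> coset k m"
    then obtain t where t: "t \<in> stab k" "f = m \<circ> t" by (auto simp: coset_def)
    then have "f = n \<circ> (finv s \<circ> t)" using m by (metis comp_assoc)
    then show "f \<in> coset k n" using stab_comp[OF stab_inv[OF s(1)] t(1)] by (auto simp: coset_def)
  next
    fix f assume "f \<in> coset k n"
    then obtain t where t: "t \<in> stab k" "f = n \<circ> t" by (auto simp: coset_def)
    then have "f = m \<circ> (s \<circ> t)" using s by (metis comp_assoc)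
    then show "f \<in> coset k m" using stab_comp[OF s(1) t(1)] by (auto simp: coset_def)
  qed
qed

text \<open>The level is part of the code because cosets alone do not determine it: levels
  \<open>0\<close> and \<open>4\<close> have the same stabiliser.\<close>

definition F :: "nat \<Rightarrow> ('x \<Rightarrow> 'x) \<Rightarrow> nat" where
  "F k m = to_nat_on {(k, coset k m) | k m. m \<in> M} (k, coset k m)"

lemma F_eq_iff:
  assumes "m \<in> M" "n \<in> M"
  shows "F k m = F l n \<longleftrightarrow> k = l \<and> (\<exists>s\<in>stab k. n = m \<circ> s)"
proof -
  have "countable M" unfolding M_def Sp_def by (intro countable_involution_span) simp
  then have "countable ((\<lambda>(k, m). (k, coset k m)) ` (UNIV \<times> M))" by (intro countable_image countable_SIGMA) auto
  moreover have "{(k, coset k m) | k m. m \<in> M} = (\<lambda>(k, m). (k, coset k m)) ` (UNIV \<times> M)" by auto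
  ultimately have "inj_on (to_nat_on {(k, coset k m) | k m. m \<in> M}) {(k, coset k m) | k m. m \<in> M}"
    by (simp add: inj_on_to_nat_on)
  then have "F k m = F l n \<longleftrightarrow> (k, coset k m) = (l, coset l n)"
    unfolding F_def using assms by (subst inj_on_eq_iff[of "to_nat_on {(k, coset k m) | k m. m \<in> M}"]) auto
  then show ?thesis using coset_eq_iff[OF assms] by auto
qed

lemma F_extreme: "m \<in> M \<Longrightarrow> n \<in> M \<Longrightarrow> k = 0 \<or> k = 4 \<Longrightarrow> F k m = F k n"
proof -
  assume *: "m \<in> M" "n \<in> M" "k = 0 \<or> k = 4"
  have "n = m \<circ> (finv m \<circ> n)" using inv_comp(2)[OF *(1)] by (simp flip: comp_assoc)
  moreover have "finv m \<circ> n \<in> stab k" using stab_extreme * M_comp M_inv by blast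
  ultimately show ?thesis using F_eq_iff * by blast
qed

lemma F_comp_stab: "m \<in> M \<Longrightarrow> s \<in> stab k \<Longrightarrow> F k (m \<circ> s) = F k m"
  using F_eq_iff[of m "m \<circ> s" k k] M_comp stab_M by auto

lemma F_left: "m \<in> M \<Longrightarrow> n \<in> M \<Longrightarrow> h \<in> M \<Longrightarrow> F k m = F k n \<Longrightarrow> F k (h \<circ> m) = F k (h \<circ> n)"
proof -
  assume *: "m \<in> M" "n \<in> M" "h \<in> M" "F k m = F k n"
  then obtain s where "s \<in> stab k" "n = m \<circ> s" using F_eq_iff by blast
  then show ?thesis using F_comp_stab[of "h \<circ> m" s k] * M_comp by (simp add: comp_assoc)
qed

text \<open>\<open>stab 2\<close> is the product of the groups of the commuting involutions
  \<open>g 2\<close> and \<open>g 0\<close>, so the part of one flag below a common edge fits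
  together with the part of another flag above it.\<close>

lemma amalgamate:
  assumes "m \<in> M" "n \<in> M" "F 2 m = F 2 n"
  obtains k where "k \<in> M" "F 1 k = F 1 m" "F 2 k = F 2 m" "F 3 k = F 3 n"
proof -
  obtain s where s: "s \<in> stab 2" "n = m \<circ> s" using F_eq_iff assms by blast
  have g: "g 2 \<in> stab 1" "g 2 \<in> stab 2" "g 0 \<in> stab 3" "g 0 \<in> stab 2" by (rule g_stab; simp)+
  have "\<exists>t u. s = t \<circ> u \<and> t \<in> {id, g 2} \<and> u \<in> {id, g 0}"
    using stab_2_cases[OF s(1)] comm by (metis comp_id id_comp insert_iff)
  then obtain t u where tu: "s = t \<circ> u" "t \<in> {id, g 2}" "u \<in> {id, g 0}" by blast
  then have st: "t \<in> stab 1" "t \<in> stab 2" "u \<in> stab 3" using g id_stab by auto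
  then have k: "m \<circ> t \<in> M" using assms M_comp stab_M by blast
  have "n = (m \<circ> t) \<circ> u" using s tu by (simp add: comp_assoc)
  then have "F 3 (m \<circ> t) = F 3 n" using F_comp_stab[OF k st(3)] by simp
  then show thesis using that[OF k] F_comp_stab[OF assms(1)] st by simp
qed

section \<open>Order, chains and flags of the coset poset\<close>

definition r where "r = {(F i m, F j m) | i j m. m \<in> M \<and> i \<le> j \<and> j < 5}"
definition Fl where "Fl m = (\<lambda>i. F i m) ` {..<5}"

lemma le_same: "m \<in> M \<Longrightarrow> i \<le> j \<Longrightarrow> j < 5 \<Longrightarrow> (F i m, F j m) \<in> r"
  unfolding r_def by blast

lemma le_iff:
  assumes "m \<in> M" "n \<in> M" "j < 5"
  shows "(F i m, F j n) \<in> r \<longleftrightarrow> i \<le> j \<and> (\<exists>k\<in>M. F i k = F i m \<and> F j k = F j n)"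
proof
  assume "(F i m, F j n) \<in> r"
  then obtain i' j' k where *: "F i m = F i' k" "F j n = F j' k" "k \<in> M" "i' \<le> j'" "j' < 5"
    unfolding r_def by blast
  then have "i' = i" "j' = j" using F_eq_iff assms by metis+
  then show "i \<le> j \<and> (\<exists>k\<in>M. F i k = F i m \<and> F j k = F j n)" using * by metis
next
  assume "i \<le> j \<and> (\<exists>k\<in>M. F i k = F i m \<and> F j k = F j n)"
  then obtain k where "i \<le> j" "k \<in> M" "F i k = F i m" "F j k = F j n" by blast
  then show "(F i m, F j n) \<in> r" using le_same[of k i j] assms(3) by simp
qed

lemma Field_r: "Field r = {F i m | i m. i < 5 \<and> m \<in> M}"
proof (intro equalityI subsetI)
  fix x assume "x \<in> {F i m | i m. i < 5 \<and> m \<in> M}"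
  then obtain i m where "i < 5" "m \<in> M" "x = F i m" by blast
  then have "(x, x) \<in> r" using le_same by blast
  then show "x \<in> Field r" by (auto simp: Field_def)
next
  fix x assume "x \<in> Field r"
  then obtain i j m where *: "m \<in> M" "i \<le> j" "j < 5" "x = F i m \<or> x = F j m"
    by (auto simp: r_def Field_def)
  then have "i < 5" by simp
  then show "x \<in> {F i m | i m. i < 5 \<and> m \<in> M}" using * by blast
qed

lemma Field_cases:
  assumes "x \<in> Field r"
  obtains i m where "i < 5" "m \<in> M" "x = F i m"
  using assms unfolding Field_r by blast

lemma trans_r: "(x, y) \<in> r \<Longrightarrow> (y, z) \<in> r \<Longrightarrow> (x, z) \<in> r"
proof -
  assume "(x, y) \<in> r" "(y, z) \<in> r"
  then obtain i j k j' h l where xy: "x = F i k" "y = F j k" "k \<in> M" "i \<le> j" "j < 5"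
      and yz: "y = F j' l" "z = F h l" "l \<in> M" "j' \<le> h" "h < 5" unfolding r_def by blast
  have "F j k = F j' l" using xy(2) yz(1) by simp
  moreover from this have "j = j'" by (simp only: F_eq_iff[OF xy(3) yz(3)])
  ultimately have j: "j' = j" "F j k = F j l" by simp_all
  \<comment> \<open>A repeated level or an extreme face lets one representative serve both pairs;
    only vertex, edge and facet need gluing.\<close>
  consider "i = j" | "j = h" | "i = 0" | "h = 4" | "i = 1" "j = 2" "h = 3"
    using xy yz j by linarith
  then show ?thesis
  proof cases
    case 1
    then have "x = F i l" using xy j by simp
    then show ?thesis using le_same[OF yz(3), of i h] yz j 1 by simp
  next
    case 2
    then have "z = F h k" using yz j by simp
    then show ?thesis using le_same[OF xy(3), of i h] xy 2 by simp
  next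
    case 3
    then have "x = F 0 l" using xy(1) F_extreme[OF xy(3) yz(3), of 0] 3 by simp
    then show ?thesis using le_same[OF yz(3), of 0 h] yz by simp
  next
    case 4
    then have "z = F 4 k" using yz(2) F_extreme[OF yz(3) xy(3), of 4] 4 by simp
    then show ?thesis using le_same[OF xy(3), of i 4] xy by simp
  next
    case 5
    then obtain e where "e \<in> M" "F 1 e = F 1 k" "F 3 e = F 3 l" using amalgamate[OF xy(3) yz(3)] j by metis
    then show ?thesis using le_same[of e 1 3] xy yz 5 by simp
  qed
qed

lemma partial_order_r: "Partial_order r"
proof -
  have "refl_on (Field r) r" by (auto simp: refl_on_def Field_r intro: le_same)
  moreover have "trans r" using trans_r by (auto simp: trans_def)
  moreover have "antisym r"
  proof (rule antisymI)
    fix x y assume "(x, y) \<in> r" "(y, x) \<in> r"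
    then obtain i j k j' h l where xy: "x = F i k" "y = F j k" "k \<in> M" "i \<le> j"
      and yx: "y = F j' l" "x = F h l" "l \<in> M" "j' \<le> h" unfolding r_def by blast
    have "F j k = F j' l" "F i k = F h l" using xy(1,2) yx(1,2) by simp_all
    then have "j = j'" "i = h" by (simp_all only: F_eq_iff[OF xy(3) yx(3)])
    then have "i = j" using xy(4) yx(4) by simp
    then show "x = y" using xy(1,2) by simp
  qed
  ultimately show ?thesis
    by (auto simp: partial_order_on_def preorder_on_def Field_def)
qed

lemma chain_Fl: "m \<in> M \<Longrightarrow> Fl m \<in> Chains r"
  unfolding Chains_def Fl_def by (auto intro: le_same) (meson le_same nat_le_linear)

lemma inj_on_F: "m \<in> M \<Longrightarrow> inj_on (\<lambda>i. F i m) A"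
  using F_eq_iff by (auto simp: inj_on_def)

lemma card_Fl: "m \<in> M \<Longrightarrow> card (Fl m) = 5"
  unfolding Fl_def using inj_on_F by (simp add: card_image)

text \<open>Comparable faces share a representative. These are glued at level \<open>2\<close> if
  the chain has a face there; otherwise only levels \<open>1\<close> and \<open>3\<close> can be
  proper, and one pair decides.\<close>

lemma chain_subset_Fl:
  assumes C: "C \<in> Chains r"
  obtains m where "m \<in> M" "C \<subseteq> Fl m"
proof -
  have cmp: "(x, y) \<in> r \<or> (y, x) \<in> r" if "x \<in> C" "y \<in> C" for x y using C that by (auto simp: Chains_def)
  have same: "F i m = F i n" if "F i m \<in> C" "F i n \<in> C" "m \<in> M" "n \<in> M" "i < 5" for i m n
    using cmp[OF that(1,2)] le_iff[of m n i i] le_iff[of n m i i] that(3-5) by metis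
  have common: "\<exists>k\<in>M. F i k = F i m \<and> F j k = F j n"
    if "F i m \<in> C" "F j n \<in> C" "m \<in> M" "n \<in> M" "i < 5" "j < 5" for i j m n
    using cmp[OF that(1,2)] le_iff[of m n j i] le_iff[of n m i j] that(3-6) by metis
  define P where "P i \<longleftrightarrow> (\<exists>n\<in>M. F i n \<in> C)" for i
  have "\<forall>i. \<exists>n. n \<in> M \<and> (P i \<longrightarrow> F i n \<in> C)" using id_M unfolding P_def by blast
  then obtain e where e: "\<And>i. e i \<in> M" "\<And>i. P i \<Longrightarrow> F i (e i) \<in> C" by metis
  have "\<exists>m\<in>M. \<forall>i\<in>{1, 2, 3}. P i \<longrightarrow> F i m = F i (e i)"
  proof (cases "P 2")
    case True
    have ex: "\<exists>k\<in>M. F 2 k = F 2 (e 2) \<and> (P i \<longrightarrow> F i k = F i (e i))" if "i < 5" for i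
      using common[of 2 "e 2" i "e i"] e True that by (cases "P i") auto
    obtain k where k: "k \<in> M" "F 2 k = F 2 (e 2)" "P 1 \<Longrightarrow> F 1 k = F 1 (e 1)" using ex[of 1] by auto
    obtain l where l: "l \<in> M" "F 2 l = F 2 (e 2)" "P 3 \<Longrightarrow> F 3 l = F 3 (e 3)" using ex[of 3] by auto
    have "F 2 k = F 2 l" using k l by simp
    then obtain m where "m \<in> M" "F 1 m = F 1 k" "F 2 m = F 2 k" "F 3 m = F 3 l"
      by (rule amalgamate[OF k(1) l(1)])
    then show ?thesis using k l by (intro bexI[of _ m]) auto
  next
    case False
    have "\<exists>m\<in>M. (P 1 \<longrightarrow> F 1 m = F 1 (e 1)) \<and> (P 3 \<longrightarrow> F 3 m = F 3 (e 3))"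
      using common[of 1 "e 1" 3 "e 3"] e by (cases "P 1"; cases "P 3") auto
    then show ?thesis using False by auto
  qed
  then obtain m where m: "m \<in> M" "\<And>i. i \<in> {1, 2, 3} \<Longrightarrow> P i \<Longrightarrow> F i m = F i (e i)" by blast
  have "C \<subseteq> Fl m"
  proof
    fix x assume x: "x \<in> C"
    then have "x \<in> Field r" using cmp by (auto simp: Field_def)
    then obtain i n where i: "i < 5" "n \<in> M" "x = F i n" by (rule Field_cases)
    have "x = F i m"
    proof (cases "i = 0 \<or> i = 4")
      case True
      then show ?thesis using F_extreme[OF i(2) m(1)] i(3) by simp
    next
      case False
      then have i123: "i \<in> {1, 2, 3}" using i(1) by auto
      have "P i" unfolding P_def using i x by blast
      then show ?thesis using m(2)[OF i123] same[OF _ _ i(2) e(1)[of i] i(1)] e(2)[of i] i x by simp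
    qed
    then show "x \<in> Fl m" using i by (auto simp: Fl_def)
  qed
  then show thesis using that m by blast
qed

lemma flags_eq: "flags r = Fl ` M"
proof (intro equalityI subsetI)
  fix \<Phi> assume \<Phi>: "\<Phi> \<in> flags r"
  then have "\<Phi> \<in> Chains r" by (simp add: flags_def)
  then obtain m where m: "m \<in> M" "\<Phi> \<subseteq> Fl m" by (rule chain_subset_Fl)
  then have "Fl m = \<Phi>" using \<Phi> chain_Fl unfolding flags_def by blast
  then show "\<Phi> \<in> Fl ` M" using m by blast
next
  fix \<Phi> assume "\<Phi> \<in> Fl ` M"
  then obtain m where m: "m \<in> M" "\<Phi> = Fl m" by blast
  have "D = Fl m" if D: "D \<in> Chains r" "Fl m \<subseteq> D" for D
  proof -
    obtain n where n: "n \<in> M" "D \<subseteq> Fl n" using chain_subset_Fl[OF D(1)] by blast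
    have "finite (Fl n)" by (simp add: Fl_def)
    moreover have "card (Fl m) = card (Fl n)" using card_Fl m n by simp
    ultimately have "Fl m = Fl n" using D n by (intro card_subset_eq) auto
    then show ?thesis using D n by blast
  qed
  then show "\<Phi> \<in> flags r" using m chain_Fl by (auto simp: flags_def)
qed

lemma faces_of_rank_r: "faces_of_rank r i = {F j m | j m. m \<in> M \<and> j < 5 \<and> int j = i + 1}"
proof -
  have card: "card {y \<in> Fl m. (y, F j m) \<in> r} = Suc j" if "m \<in> M" "j < 5" for m j
  proof -
    have "{y \<in> Fl m. (y, F j m) \<in> r} = (\<lambda>i. F i m) ` {..j}"
      using that le_iff[OF that(1) that(1) that(2)] by (auto simp: Fl_def)
    then show ?thesis using inj_on_F[OF that(1)] by (simp add: card_image)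
  qed
  show ?thesis
  proof (intro equalityI subsetI)
    fix x assume "x \<in> faces_of_rank r i"
    then obtain m where m: "m \<in> M" "x \<in> Fl m" "int (card {y \<in> Fl m. (y, x) \<in> r}) = i + 2"
      unfolding faces_of_rank_def flags_eq by blast
    then obtain j where j: "j < 5" "x = F j m" by (auto simp: Fl_def)
    then have "int j = i + 1" using m card[OF m(1) j(1)] by simp
    then show "x \<in> {F j m | j m. m \<in> M \<and> j < 5 \<and> int j = i + 1}" using m(1) j by blast
  next
    fix x assume "x \<in> {F j m | j m. m \<in> M \<and> j < 5 \<and> int j = i + 1}"
    then obtain j m where x: "m \<in> M" "j < 5" "int j = i + 1" "x = F j m" by blast
    then have "x \<in> Fl m" "int (card {y \<in> Fl m. (y, x) \<in> r}) = i + 2" using card by (auto simp: Fl_def)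
    then show "x \<in> faces_of_rank r i" unfolding faces_of_rank_def flags_eq using x(1) by blast
  qed
qed

lemma F_moved:
  assumes "m \<in> M" "j < 3"
  shows "F (Suc j) m \<noteq> F (Suc j) (m \<circ> g j)"
proof
  assume "F (Suc j) m = F (Suc j) (m \<circ> g j)"
  then obtain s where s: "s \<in> stab (Suc j)" "m \<circ> g j = m \<circ> s"
    using F_eq_iff[OF assms(1) M_comp[OF assms(1) g_M[OF assms(2)]]] by blast
  then have "(finv m \<circ> m) \<circ> g j = (finv m \<circ> m) \<circ> s" by (simp only: comp_assoc)
  then show False using g_notin[OF assms(2)] s(1) inv_comp(1)[OF assms(1)] by (simp only: id_comp) blast
qed

lemma Fl_comp_g:
  assumes "m \<in> M" "j < 3"
  shows "Fl m - Fl (m \<circ> g j) = {F (Suc j) m}"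
proof (intro equalityI subsetI)
  fix x assume x: "x \<in> Fl m - Fl (m \<circ> g j)"
  then obtain i where i: "i < 5" "x = F i m" by (auto simp: Fl_def)
  have "i = Suc j"
  proof (rule ccontr)
    assume "i \<noteq> Suc j"
    then have "x = F i (m \<circ> g j)" using F_comp_stab[OF assms(1) g_stab[OF assms(2)], of i] i(2) by simp
    then show False using x i(1) by (simp add: Fl_def)
  qed
  then show "x \<in> {F (Suc j) m}" using i(2) by simp
next
  fix x assume "x \<in> {F (Suc j) m}"
  then have x: "x = F (Suc j) m" by simp
  have mg: "m \<circ> g j \<in> M" using assms M_comp g_M by blast
  have "x \<notin> Fl (m \<circ> g j)"
  proof
    assume "x \<in> Fl (m \<circ> g j)"
    then obtain i where i: "F (Suc j) m = F i (m \<circ> g j)" unfolding x Fl_def by blast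
    then have "Suc j = i" by (simp only: F_eq_iff[OF assms(1) mg])
    then show False using i F_moved[OF assms] by simp
  qed
  moreover have "x \<in> Fl m" unfolding x Fl_def using assms(2) by (intro imageI) simp
  ultimately show "x \<in> Fl m - Fl (m \<circ> g j)" by blast
qed

lemma adjacent_Fl:
  assumes "m \<in> M" "j < 3"
  shows "(Fl m, Fl (m \<circ> g j)) \<in> adjacent_flags r"
proof -
  have mg: "m \<circ> g j \<in> M" using assms M_comp g_M by blast
  have "(m \<circ> g j) \<circ> g j = m" using invol[OF assms(2)] by (simp add: comp_assoc)
  then have "Fl (m \<circ> g j) - Fl m = {F (Suc j) (m \<circ> g j)}" using Fl_comp_g[OF mg assms(2)] by simp
  then show ?thesis
    unfolding adjacent_flags_def flags_eq using Fl_comp_g[OF assms] assms(1) mg by simp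
qed

text \<open>\<open>in_Sp_moved\<close> writes \<open>finv m \<circ> n\<close> in generators
  belonging to levels where the two flags differ, so every step of the resulting path keeps the
  common faces.\<close>

lemma strongly_connected:
  assumes "m \<in> M" "n \<in> M"
  shows "(Fl m, Fl n) \<in> {(A, B) \<in> adjacent_flags r. Fl m \<inter> Fl n \<subseteq> A \<and> Fl m \<inter> Fl n \<subseteq> B}\<^sup>*"
    (is "_ \<in> ?R\<^sup>*")
proof -
  define d where "d = finv m \<circ> n"
  have d: "d \<in> M" unfolding d_def using assms M_comp M_inv by blast
  have n: "m \<circ> d = n" unfolding d_def comp_assoc[symmetric] inv_comp(2)[OF assms(1)] by simp
  let ?J = "{j. j < 3 \<and> d \<notin> stab (Suc j)}"
  have keep: "Fl m \<inter> Fl n \<subseteq> Fl (k \<circ> g j)" if k: "k \<in> M" "Fl m \<inter> Fl n \<subseteq> Fl k" and j: "j \<in> ?J" for k j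
  proof
    fix x assume x: "x \<in> Fl m \<inter> Fl n"
    then obtain i i' i'' where i: "i < 5" "x = F i m" "x = F i' n" "x = F i'' k"
      using k(2) by (auto simp: Fl_def)
    have "F i m = F i' n" "F i m = F i'' k" using i by simp_all
    then have "i = i''" and "\<exists>s\<in>stab i. n = m \<circ> s"
      using F_eq_iff[OF assms] F_eq_iff[OF assms(1) k(1)] by metis+
    then obtain s where s: "s \<in> stab i" "n = m \<circ> s" by blast
    have "d = s" unfolding d_def s(2) comp_assoc[symmetric] inv_comp(1)[OF assms(1)] by simp
    then have "Suc j \<noteq> i" using s(1) j by blast
    then have "g j \<in> stab i" using j by (intro g_stab) auto
    then have "F i (k \<circ> g j) = x" using F_comp_stab[OF k(1)] i(4) \<open>i = i''\<close> by simp
    then show "x \<in> Fl (k \<circ> g j)" using i(1) unfolding Fl_def by blast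
  qed
  have "(Fl k, Fl (k \<circ> f)) \<in> ?R\<^sup>*"
    if "f \<in> involution_span (g ` ?J)" "k \<in> M" "Fl m \<inter> Fl n \<subseteq> Fl k" for f k
    using that
  proof (induction arbitrary: k rule: involution_span.induct)
    case id
    show ?case by (simp only: comp_id rtrancl.rtrancl_refl)
  next
    case (step s f)
    then obtain j where j: "j \<in> ?J" "s = g j" by blast
    then have j3: "j < 3" by simp
    have kj: "k \<circ> g j \<in> M" using step.prems(1) g_M[OF j3] M_comp by blast
    have sub: "Fl m \<inter> Fl n \<subseteq> Fl (k \<circ> g j)" by (rule keep[OF step.prems j(1)])
    have "(Fl k, Fl (k \<circ> g j)) \<in> ?R" using adjacent_Fl[OF step.prems(1) j3] sub step.prems(2) by simp
    moreover have "(Fl (k \<circ> g j), Fl ((k \<circ> g j) \<circ> f)) \<in> ?R\<^sup>*" by (rule step.IH[OF kj sub])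
    ultimately have "(Fl k, Fl ((k \<circ> g j) \<circ> f)) \<in> ?R\<^sup>*" by (rule converse_rtrancl_into_rtrancl)
    then show ?case by (simp only: j(2) comp_assoc)
  qed
  from this[of d m] show ?thesis
    using in_Sp_moved[OF d] assms(1) n unfolding Sp_def by simp
qed

text \<open>A face between the two shares with them a representative \<open>k \<circ> s\<close>,
  where \<open>s\<close> lies in both neighbouring stabilisers; modulo \<open>stab (Suc j)\<close>
  such an \<open>s\<close> is the identity or \<open>g j\<close>.\<close>

lemma diamond_r:
  assumes k: "k \<in> M" and j: "j < 3"
  shows "{H \<in> faces_of_rank r (int j). (F j k, H) \<in> r \<and> (H, F (j + 2) k) \<in> r}
    = {F (Suc j) k, F (Suc j) (k \<circ> g j)}" (is "?A = ?B")
proof (intro equalityI subsetI)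
  have kg: "k \<circ> g j \<in> M" using k j g_M M_comp by blast
  have st: "g j \<in> stab j" "g j \<in> stab (j + 2)" using j by (intro g_stab; simp)+
  fix H assume H: "H \<in> ?B"
  then obtain l where l: "l \<in> {k, k \<circ> g j}" "H = F (Suc j) l" by blast
  have lM: "l \<in> M" and "F j l = F j k" "F (j + 2) l = F (j + 2) k"
    using l(1) k kg F_comp_stab[OF k st(1)] F_comp_stab[OF k st(2)] by auto
  then have "(F j k, H) \<in> r" "(H, F (j + 2) k) \<in> r"
    using le_same[OF lM, of j "Suc j"] le_same[OF lM, of "Suc j" "j + 2"] l(2) j by auto
  moreover have "H \<in> faces_of_rank r (int j)" unfolding faces_of_rank_r l(2) using lM j by fastforce
  ultimately show "H \<in> ?A" by blast
next
  fix H assume "H \<in> ?A"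
  then obtain h l where "l \<in> M" "H = F h l" "int h = int j + 1"
    and H: "(F j k, H) \<in> r" "(H, F (j + 2) k) \<in> r"
    unfolding faces_of_rank_r by blast
  moreover from this have "h = Suc j" by linarith
  ultimately have l: "l \<in> M" "H = F (Suc j) l"
    and le: "(F j k, F (Suc j) l) \<in> r" "(F (Suc j) l, F (j + 2) k) \<in> r" by simp_all
  obtain a where a: "a \<in> M" "F j a = F j k" "F (Suc j) a = F (Suc j) l"
    using le(1) le_iff[OF k l(1), of "Suc j" j] j by auto
  obtain c where c: "c \<in> M" "F (Suc j) c = F (Suc j) l" "F (j + 2) c = F (j + 2) k"
    using le(2) le_iff[OF l(1) k, of "j + 2" "Suc j"] j by auto
  have three: "j = 0 \<or> j = 1 \<or> j = 2" using j by linarith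
  have "\<exists>e\<in>M. F j e = F j k \<and> F (Suc j) e = F (Suc j) l \<and> F (j + 2) e = F (j + 2) k"
    using three
  proof (elim disjE)
    assume "j = 0"
    then show ?thesis using c F_extreme[OF c(1) k, of 0] by auto
  next
    assume "j = 2"
    then show ?thesis using a F_extreme[OF a(1) k, of 4] by auto
  next
    assume j1: "j = 1"
    have nums: "Suc 1 = 2" "(1::nat) + 2 = 3" by simp_all
    have "F 2 a = F 2 c" using a(3) c(2) unfolding j1 nums by simp
    then obtain e where "e \<in> M" "F 1 e = F 1 a" "F 2 e = F 2 a" "F 3 e = F 3 c"
      by (rule amalgamate[OF a(1) c(1)])
    then show ?thesis using a c unfolding j1 nums by metis
  qed
  then obtain e where e: "e \<in> M" "F j k = F j e" "F (Suc j) e = F (Suc j) l" "F (j + 2) k = F (j + 2) e"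
    by metis
  note ex = F_eq_iff[OF k e(1), THEN iffD1, THEN conjunct2]
  obtain s where s: "s \<in> stab j" "e = k \<circ> s" using ex[OF e(2)] by (rule bexE)
  obtain t where t: "t \<in> stab (j + 2)" "e = k \<circ> t" using ex[OF e(4)] by (rule bexE)
  have "k \<circ> s = k \<circ> t" by (rule trans[OF sym[OF s(2)] t(2)])
  then have "(finv k \<circ> k) \<circ> s = (finv k \<circ> k) \<circ> t" by (simp only: comp_assoc)
  then have "s = t" unfolding inv_comp(1)[OF k] by (simp only: id_comp)
  then have st: "s \<in> stab j" "s \<in> stab (j + 2)" using s(1) t(1) by simp_all
  have gM: "g 0 \<in> M" "g 2 \<in> M" by (rule g_M; simp)+
  have kM: "k \<circ> g 0 \<in> M" "k \<circ> g 2 \<in> M" using gM M_comp[OF k] by blast+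
  have "F (Suc j) (k \<circ> s) = F (Suc j) k \<or> F (Suc j) (k \<circ> s) = F (Suc j) (k \<circ> g j)"
    using three
  proof (elim disjE)
    assume j0: "j = 0"
    have nums: "Suc 0 = 1" "(0::nat) + 2 = 2" by simp_all
    have "g 2 \<in> stab 1" by (rule g_stab) simp_all
    then have "F 1 (k \<circ> g 2) = F 1 k" "F 1 (k \<circ> (g 0 \<circ> g 2)) = F 1 (k \<circ> g 0)"
      using F_comp_stab[OF k] F_comp_stab[OF kM(1)] by (simp_all only: comp_assoc)
    moreover have "s \<in> {id, g 0, g 2, g 0 \<circ> g 2}" using st(2) stab_2_cases unfolding j0 nums by blast
    ultimately show ?thesis unfolding j0 nums by (elim insertE emptyE) (simp_all only: comp_id simp_thms)
  next
    assume j2: "j = 2"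
    have nums: "Suc 2 = 3" by simp
    have "g 0 \<in> stab 3" by (rule g_stab) simp_all
    then have "F 3 (k \<circ> g 0) = F 3 k" "F 3 (k \<circ> (g 0 \<circ> g 2)) = F 3 (k \<circ> g 2)"
      using F_comp_stab[OF k] F_comp_stab[OF kM(2)] by (simp_all only: comm comp_assoc)
    moreover have "s \<in> {id, g 0, g 2, g 0 \<circ> g 2}" using st(1) stab_2_cases unfolding j2 by blast
    ultimately show ?thesis unfolding j2 nums by (elim insertE emptyE) (simp_all only: comp_id simp_thms)
  next
    assume j1: "j = 1"
    have nums: "Suc 1 = 2" "(1::nat) + 2 = 3" by simp_all
    have "s = id \<or> s = g 1" using st unfolding j1 nums by (rule stab_1_3)
    then show ?thesis unfolding j1 nums by (elim disjE) (simp_all only: comp_id simp_thms)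
  qed
  then show "H \<in> ?B" using l(2) e(3) s(2) by auto
qed

lemma abstract_polytope_r: "abstract_polytope 3 r"
  unfolding abstract_polytope_def
proof (intro conjI)
  show "Partial_order r" by (rule partial_order_r)
  have least: "F 0 id \<in> Field r" "F 4 id \<in> Field r" unfolding Field_r using id_M by fastforce+
  have "(F 0 id, y) \<in> r \<and> (y, F 4 id) \<in> r" if yF: "y \<in> Field r" for y
  proof -
    obtain i m where y: "i < 5" "m \<in> M" "y = F i m" by (rule Field_cases[OF yF])
    have "F 0 id = F 0 m" "F 4 id = F 4 m" using F_extreme[OF id_M y(2)] by auto
    then show ?thesis using le_same[OF y(2), of 0 i] le_same[OF y(2), of i 4] y(1,3) by auto
  qed
  then show "\<exists>x\<in>Field r. \<forall>y\<in>Field r. (x, y) \<in> r" "\<exists>x\<in>Field r. \<forall>y\<in>Field r. (y, x) \<in> r"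
    using least by blast+
  show "\<forall>\<Phi>\<in>flags r. card \<Phi> = 3 + 2" unfolding flags_eq using card_Fl by simp
  show "\<forall>\<Phi>\<in>flags r. \<forall>\<Psi>\<in>flags r.
      (\<Phi>, \<Psi>) \<in> {(A, B) \<in> adjacent_flags r. \<Phi> \<inter> \<Psi> \<subseteq> A \<and> \<Phi> \<inter> \<Psi> \<subseteq> B}\<^sup>*"
  proof (intro ballI)
    fix \<Phi> \<Psi> assume "\<Phi> \<in> flags r" "\<Psi> \<in> flags r"
    then obtain m n where "m \<in> M" "\<Phi> = Fl m" "n \<in> M" "\<Psi> = Fl n" unfolding flags_eq by blast
    then show "(\<Phi>, \<Psi>) \<in> {(A, B) \<in> adjacent_flags r. \<Phi> \<inter> \<Psi> \<subseteq> A \<and> \<Phi> \<inter> \<Psi> \<subseteq> B}\<^sup>*"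
      using strongly_connected by simp
  qed
  show "\<forall>i::int. 0 \<le> i \<and> i < int 3 \<longrightarrow> (\<forall>A \<in> faces_of_rank r (i - 1). \<forall>B \<in> faces_of_rank r (i + 1).
    (A, B) \<in> r \<longrightarrow> card {H \<in> faces_of_rank r i. (A, H) \<in> r \<and> (H, B) \<in> r} = 2)"
  proof (intro allI ballI impI)
    fix i A B assume i: "0 \<le> i \<and> i < int 3" and A: "A \<in> faces_of_rank r (i - 1)"
      and B: "B \<in> faces_of_rank r (i + 1)" and le: "(A, B) \<in> r"
    define j where "j = nat i"
    have j: "j < 3" "i = int j" using i by (auto simp: j_def)
    obtain m where m: "m \<in> M" "A = F j m" using A unfolding faces_of_rank_r j(2) by auto
    obtain h n where n: "n \<in> M" "B = F h n" "int h = int j + 2" using B unfolding faces_of_rank_r j(2) by auto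
    have h: "h = j + 2" using n(3) by linarith
    obtain k where k: "k \<in> M" "F j k = A" "F (j + 2) k = B"
      using le le_iff[OF m(1) n(1), of "j + 2" j] j(1) unfolding m(2) n(2) h by auto
    have "F (Suc j) k \<noteq> F (Suc j) (k \<circ> g j)" by (rule F_moved[OF k(1) j(1)])
    then show "card {H \<in> faces_of_rank r i. (A, H) \<in> r \<and> (H, B) \<in> r} = 2"
      using diamond_r[OF k(1) j(1)] unfolding j(2) k(2,3) by simp
  qed
qed

subsection \<open>Automorphisms\<close>

text \<open>Left multiplication on cosets; \<open>THE\<close> is justified because the result is
  independent of the representative.\<close>

definition T where
  "T m = restrict (\<lambda>y. THE z. \<exists>i n. i < 5 \<and> n \<in> M \<and> y = F i n \<and> z = F i (m \<circ> n)) (Field r)"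

lemma F_Field: "m \<in> M \<Longrightarrow> i < 5 \<Longrightarrow> F i m \<in> Field r"
  unfolding Field_r by blast

lemma T_F:
  assumes "m \<in> M" "n \<in> M" "i < 5"
  shows "T m (F i n) = F i (m \<circ> n)"
proof -
  have "(THE z. \<exists>j k. j < 5 \<and> k \<in> M \<and> F i n = F j k \<and> z = F j (m \<circ> k)) = F i (m \<circ> n)"
  proof (rule the_equality)
    show "\<exists>j k. j < 5 \<and> k \<in> M \<and> F i n = F j k \<and> F i (m \<circ> n) = F j (m \<circ> k)" using assms by blast
    fix z assume "\<exists>j k. j < 5 \<and> k \<in> M \<and> F i n = F j k \<and> z = F j (m \<circ> k)"
    then obtain j k where k: "k \<in> M" "F i n = F j k" "z = F j (m \<circ> k)" by blast
    moreover from this have "i = j" by (simp only: F_eq_iff[OF assms(2) k(1)])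
    ultimately show "z = F i (m \<circ> n)" using F_left[OF assms(2) k(1) assms(1), of i] by simp
  qed
  then show ?thesis unfolding T_def using F_Field[OF assms(2,3)] by (simp only: restrict_apply' if_True)
qed

lemma T_inverse: "m \<in> M \<Longrightarrow> x \<in> Field r \<Longrightarrow> T (finv m) (T m x) = x"
  "m \<in> M \<Longrightarrow> x \<in> Field r \<Longrightarrow> T m (T (finv m) x) = x"
proof -
  assume m: "m \<in> M" and "x \<in> Field r"
  then obtain i n where x: "i < 5" "n \<in> M" "x = F i n" by (elim Field_cases)
  show "T (finv m) (T m x) = x" "T m (T (finv m) x) = x"
    by (simp_all only: x(3) T_F[OF _ _ x(1)] m x(2) M_inv M_comp comp_assoc[symmetric] inv_comp[OF m] id_comp)
qed

lemma T_Field: "m \<in> M \<Longrightarrow> x \<in> Field r \<Longrightarrow> T m x \<in> Field r"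
  using T_F F_Field M_comp by (elim Field_cases) simp

lemma T_mono: "m \<in> M \<Longrightarrow> (x, y) \<in> r \<Longrightarrow> (T m x, T m y) \<in> r"
proof -
  assume m: "m \<in> M" and "(x, y) \<in> r"
  then obtain i j k where k: "k \<in> M" "i \<le> j" "j < 5" "x = F i k" "y = F j k" unfolding r_def by blast
  then show ?thesis using le_same[OF M_comp[OF m k(1)] k(2,3)] T_F[OF m k(1)] by simp
qed

lemma T_aut: "m \<in> M \<Longrightarrow> T m \<in> carrier (aut_group r)"
proof -
  interpret polyhedron r by (rule polyhedron.intro[OF abstract_polytope_r])
  assume m: "m \<in> M"
  note m' = M_inv[OF m]
  have "bij_betw (T m) (Field r) (Field r)"
    by (rule bij_betw_byWitness[of _ "T (finv m)"]) (use T_inverse[OF m] T_Field[OF m] T_Field[OF m'] in auto)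
  moreover have "T m \<in> extensional (Field r)" unfolding T_def by (rule restrict_extensional)
  moreover have "(x, y) \<in> r \<longleftrightarrow> (T m x, T m y) \<in> r" if "x \<in> Field r" "y \<in> Field r" for x y
    using T_mono[OF m, of x y] T_mono[OF m', of "T m x" "T m y"] T_inverse(1)[OF m] that by auto
  ultimately show ?thesis by (simp add: aut_carrier Bij_def)
qed

lemma T_comp:
  assumes "m \<in> M" "n \<in> M"
  shows "T (m \<circ> n) = T m \<otimes>\<^bsub>aut_group r\<^esub> T n"
proof -
  interpret polyhedron r by (rule polyhedron.intro[OF abstract_polytope_r])
  note c = T_aut[OF assms(1)] T_aut[OF assms(2)] T_aut[OF M_comp[OF assms]]
  show ?thesis
  proof (rule aut_eqI[OF c(3)])
    show "T m \<otimes>\<^bsub>\<Gamma>\<^esub> T n \<in> carrier \<Gamma>" using c by simp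
    fix x assume x: "x \<in> Field r"
    obtain i l where l: "i < 5" "l \<in> M" "x = F i l" by (rule Field_cases[OF x])
    have "T (m \<circ> n) x = T m (T n x)"
      by (simp only: l(3) T_F[OF _ _ l(1)] assms l(2) M_comp comp_assoc)
    then show "T (m \<circ> n) x = (T m \<otimes>\<^bsub>\<Gamma>\<^esub> T n) x" using mult_apply[OF c(1,2) x] by simp
  qed
qed

text \<open>An element acting trivially fixes all base faces, and the stabilisers at levels
  \<open>1\<close>, \<open>2\<close> and \<open>3\<close> intersect trivially.\<close>

lemma T_eq_one_iff:
  assumes "m \<in> M"
  shows "T m = \<one>\<^bsub>aut_group r\<^esub> \<longleftrightarrow> m = id"
proof -
  interpret polyhedron r by (rule polyhedron.intro[OF abstract_polytope_r])
  have one: "\<one>\<^bsub>\<Gamma>\<^esub> (F i n) = F i n" if "i < 5" "n \<in> M" for i n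
    using one_apply F_Field that by blast
  show ?thesis
  proof
    assume T: "T m = \<one>\<^bsub>\<Gamma>\<^esub>"
    have "m \<in> stab i" if "i < 5" for i
    proof -
      have "F i id = F i m" using T_F[OF assms id_M that] one[OF that id_M] unfolding T by simp
      then have "\<exists>s\<in>stab i. m = id \<circ> s" using F_eq_iff[OF id_M assms, of i i] by blast
      then show ?thesis by (simp only: id_comp) blast
    qed
    from this[of 1] this[of 2] this[of 3] show "m = id"
      using stab_1_2 g2_notin by auto
  next
    assume m: "m = id"
    show "T m = \<one>\<^bsub>\<Gamma>\<^esub>"
    proof (rule aut_eqI[OF T_aut[OF assms] \<Gamma>.one_closed])
      fix x assume x: "x \<in> Field r"
      obtain i l where l: "i < 5" "l \<in> M" "x = F i l" by (rule Field_cases[OF x])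
      show "T m x = \<one>\<^bsub>\<Gamma>\<^esub> x" unfolding l(3) m one[OF l(1,2)] T_F[OF id_M l(2,1)] id_comp ..
    qed
  qed
qed

lemma T_image_Fl: "m \<in> M \<Longrightarrow> n \<in> M \<Longrightarrow> T m ` Fl n = Fl (m \<circ> n)"
  unfolding Fl_def image_image by (intro image_cong refl T_F) auto

lemma regular_polyhedron_base_r: "regular_polyhedron_base r (Fl id) (\<lambda>i. T (g i))"
proof
  show "abstract_polytope 3 r" by (rule abstract_polytope_r)
  show "regular_polyhedron r"
    unfolding regular_polyhedron_def
  proof (intro conjI abstract_polytope_r ballI)
    fix \<Phi> \<Psi> assume "\<Phi> \<in> flags r" "\<Psi> \<in> flags r"
    then obtain m n where mn: "m \<in> M" "\<Phi> = Fl m" "n \<in> M" "\<Psi> = Fl n" unfolding flags_eq by blast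
    have "(n \<circ> finv m) \<circ> m = n" by (simp only: comp_assoc inv_comp(1)[OF mn(1)] comp_id)
    moreover have nm: "n \<circ> finv m \<in> M" using mn M_comp M_inv by blast
    ultimately have "T (n \<circ> finv m) ` \<Phi> = \<Psi>" using T_image_Fl[OF nm mn(1)] mn by simp
    then show "\<exists>f\<in>carrier (aut_group r). f ` \<Phi> = \<Psi>" using T_aut[OF nm] by blast
  qed
  show "Fl id \<in> flags r" unfolding flags_eq using id_M by blast
  fix i :: nat assume i: "i < 3"
  have gi: "g i \<in> M" by (rule g_M[OF i])
  have "T (g i) x \<noteq> x \<longleftrightarrow> x \<in> faces_of_rank r (int i)" if "x \<in> Fl id" for x
  proof -
    obtain k where k: "k < 5" "x = F k id" using \<open>x \<in> Fl id\<close> by (auto simp: Fl_def)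
    have "T (g i) x = F k (id \<circ> g i)" unfolding k(2) T_F[OF gi id_M k(1)] comp_id id_comp ..
    moreover have "F k (id \<circ> g i) \<noteq> F k id \<longleftrightarrow> k = Suc i"
      using F_moved[OF id_M i] F_comp_stab[OF id_M g_stab[OF i], of k] by metis
    moreover have "x \<in> faces_of_rank r (int i) \<longleftrightarrow> k = Suc i"
    proof
      assume "x \<in> faces_of_rank r (int i)"
      then obtain j m where j: "F k id = F j m" "m \<in> M" "int j = int i + 1" unfolding faces_of_rank_r k(2) by blast
      have "k = j" using j(1) by (simp only: F_eq_iff[OF id_M j(2)])
      then show "k = Suc i" using j(3) by simp
    next
      assume "k = Suc i"
      then show "x \<in> faces_of_rank r (int i)" unfolding faces_of_rank_r k(2) using id_M k(1) by fastforce
    qed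
    ultimately show ?thesis using k(2) by simp
  qed
  then show "distinguished r (Fl id) i (T (g i))"
    using T_aut[OF gi] by (simp add: distinguished_def)
qed

text \<open>\<open>k = 0\<close> encodes infinite order, since \<open>0\<close> divides only
  \<open>0\<close>.\<close>

lemma extended_ord_T:
  assumes "m \<in> M" "\<And>n. m ^^ n = id \<longleftrightarrow> k dvd n"
  shows "extended_ord (aut_group r) (T m) = (if k = 0 then \<infinity> else enat k)"
proof -
  interpret polyhedron r by (rule polyhedron.intro[OF abstract_polytope_r])
  have pow: "m ^^ n \<in> M \<and> T (m ^^ n) = T m [^]\<^bsub>\<Gamma>\<^esub> n" for n
  proof (induction n)
    case 0
    show ?case unfolding funpow_0 using id_M T_eq_one_iff[OF id_M] by (simp add: id_def)
  next
    case (Suc n)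
    have "m ^^ Suc n = m ^^ n \<circ> m" by (rule funpow_Suc_right)
    then show ?case using Suc M_comp assms(1) T_comp[of "m ^^ n" m] by (simp only: \<Gamma>.nat_pow_Suc)
  qed
  have "\<Gamma>.ord (T m) dvd n \<longleftrightarrow> k dvd n" for n
    using \<Gamma>.pow_eq_id[OF T_aut[OF assms(1)], of n] T_eq_one_iff[of "m ^^ n"] pow[of n] assms(2)[of n] by metis
  then have "\<Gamma>.ord (T m) = k" by (metis dvd_antisym dvd_refl)
  then show ?thesis by (simp add: extended_ord_def)
qed

end

section \<open>Realisations of the groups in the classification\<close>

text \<open>For \<open>n = 0\<close> this is \<open>x \<mapsto> c - x\<close> on all integers, since \<open>x mod 0 = x\<close>.\<close>

definition reflect :: "nat \<Rightarrow> int \<Rightarrow> int \<Rightarrow> int" where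
  "reflect n c x = (if x mod int n = x then (c - x) mod int n else x)"

lemma reflect_reflect: "reflect n c (reflect n d x) = (if x mod int n = x then (x + (c - d)) mod int n else x)"
proof -
  have "(c - (d - x) mod int n) mod int n = (x + (c - d)) mod int n"
    by (simp add: mod_diff_right_eq algebra_simps)
  then show ?thesis by (simp add: reflect_def)
qed

lemma reflect_involution: "reflect n c \<circ> reflect n c = id"
  by (simp add: fun_eq_iff reflect_reflect)

lemma reflect_funpow:
  "((reflect n c \<circ> reflect n d) ^^ i) x = (if x mod int n = x then (x + int i * (c - d)) mod int n else x)"
proof (induction i)
  case (Suc i)
  have "x + int i * (c - d) + (c - d) = x + int (Suc i) * (c - d)" by (simp add: algebra_simps)
  then have "((x + int i * (c - d)) mod int n + (c - d)) mod int n = (x + int (Suc i) * (c - d)) mod int n"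
    by (simp only: mod_add_left_eq)
  then show ?case using Suc by (simp add: reflect_reflect)
qed simp

text \<open>The product of the two reflections translates by \<open>c - d\<close>, here a generator
  of the residues.\<close>

lemma reflect_funpow_eq_id:
  assumes "\<bar>c - d\<bar> = 1"
  shows "(reflect n c \<circ> reflect n d) ^^ i = id \<longleftrightarrow> n dvd i"
proof -
  have dvd: "int n dvd int i * (c - d) \<longleftrightarrow> n dvd i"
    using assms by (metis dvd_abs_iff abs_mult mult.right_neutral abs_of_nat int_dvd_int_iff)
  show ?thesis
  proof
    assume "(reflect n c \<circ> reflect n d) ^^ i = id"
    then have "((reflect n c \<circ> reflect n d) ^^ i) 0 = id 0" by (rule arg_cong)
    then have "(int i * (c - d)) mod int n = 0" unfolding reflect_funpow by simp
    then show "n dvd i" using dvd by (simp add: mod_eq_0_iff_dvd)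
  next
    assume "n dvd i"
    then have "(int i * (c - d)) mod int n = 0" using dvd by (simp add: mod_eq_0_iff_dvd)
    then have "(x + int i * (c - d)) mod int n = x mod int n" for x by (metis add.right_neutral mod_add_right_eq)
    then have "((reflect n c \<circ> reflect n d) ^^ i) x = id x" for x
      by (cases "x mod int n = x") (simp_all only: reflect_funpow id_apply if_True if_False if_cancel)
    then show "(reflect n c \<circ> reflect n d) ^^ i = id" by (rule ext)
  qed
qed

text \<open>Negation is trivial modulo \<open>2\<close>; hence the separate condition on
  \<open>y 1\<close> for two vertices in \<open>vertex_model\<close>.\<close>

lemma reflect_2_0: "reflect 2 0 = id"
proof
  fix x :: int
  have "x mod 2 = 0 \<or> x mod 2 = 1" by presburger
  then show "reflect 2 0 x = id x" by (auto simp: reflect_def)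
qed

lemma reflect_0_neq_id: "b > 2 \<Longrightarrow> reflect b 0 \<noteq> id"
proof
  assume b: "b > 2" and "reflect b 0 = id"
  then have "reflect b 0 1 = 1" by simp
  moreover have "(- 1) mod int b = int b - 1" using b by (simp add: zmod_minus1)
  ultimately show False using b by (simp add: reflect_def)
qed

lemma involution_funpow: "s \<circ> s = id \<Longrightarrow> s ^^ n = (if even n then id else s)"
proof (induction n)
  case (Suc n)
  then show ?case by (simp only: funpow.simps even_Suc split: if_split) auto
qed (simp add: id_def)

lemma map_sum_eq_iff: "map_sum f h = map_sum f' h' \<longleftrightarrow> f = f' \<and> h = h'"
proof
  assume eq: "map_sum f h = map_sum f' h'"
  have "Inl (f x) = Inl (f' x)" "Inr (h y) = Inr (h' y)" for x y
    using fun_cong[OF eq, of "Inl x"] fun_cong[OF eq, of "Inr y"] by simp_all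
  then show "f = f' \<and> h = h'" by auto
qed simp

lemma map_sum_eq_id_iff: "map_sum f h = id \<longleftrightarrow> f = id \<and> h = id"
  using map_sum_eq_iff[of f h id id] by (simp only: map_sum.id)

lemma map_sum_funpow:
  fixes f :: "'a \<Rightarrow> 'a" and h :: "'b \<Rightarrow> 'b"
  shows "map_sum f h ^^ n = map_sum (f ^^ n) (h ^^ n)"
  by (induction n) (simp_all only: funpow.simps map_sum.comp map_sum.id)

definition vertex_action :: "nat \<Rightarrow> nat \<Rightarrow> int \<Rightarrow> int" where
  "vertex_action b i = (if i = 0 then reflect b 1 else if i = 1 then reflect b 0 else id)"

lemma vertex_action_simps: "vertex_action b 0 = reflect b 1" "vertex_action b 1 = reflect b 0" "vertex_action b 2 = id"
  by (simp_all add: vertex_action_def)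

text \<open>The left summand is the action on the vertices, which form one orbit of the rotation of order
  \<open>b\<close>; the right summand makes the action faithful.\<close>

locale vertex_model =
  fixes b :: nat and y :: "nat \<Rightarrow> 'y \<Rightarrow> 'y"
  assumes b: "b \<ge> 2"
    and y_invol: "i < 3 \<Longrightarrow> y i \<circ> y i = id"
    and y_comm: "y 0 \<circ> y 2 = y 2 \<circ> y 0"
    and y_rotation: "(y 0 \<circ> y 1) ^^ b = id"
    and y_nontrivial: "y 2 \<noteq> id" "b > 2 \<or> y 1 \<noteq> id \<and> y 1 \<noteq> y 2"
begin

definition g where "g i = map_sum (vertex_action b i) (y i)"

lemma vertex_action_invol: "vertex_action b i \<circ> vertex_action b i = id"
  unfolding vertex_action_def by (simp only: reflect_involution comp_id split: if_split) simp

lemma g0_g1_funpow: "(g 0 \<circ> g 1) ^^ i = map_sum ((reflect b 1 \<circ> reflect b 0) ^^ i) ((y 0 \<circ> y 1) ^^ i)"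
  unfolding g_def by (simp only: map_sum.comp map_sum_funpow vertex_action_simps)

lemma g0_g1_order: "(g 0 \<circ> g 1) ^^ i = id \<longleftrightarrow> b dvd i"
proof -
  have "(y 0 \<circ> y 1) ^^ i = id" if "b dvd i"
  proof -
    obtain k where "i = b * k" using \<open>b dvd i\<close> by (elim dvdE)
    then have "(y 0 \<circ> y 1) ^^ i = ((y 0 \<circ> y 1) ^^ b) ^^ k" by (simp only: funpow_mult mult.commute)
    then show ?thesis by (simp only: y_rotation id_funpow)
  qed
  then show ?thesis
    unfolding g0_g1_funpow map_sum_eq_id_iff using reflect_funpow_eq_id[of 1 0 i b] by auto
qed

sublocale string_model g "Inl 0"
proof
  show "g i \<circ> g i = id" if "i < 3" for i
    unfolding g_def map_sum.comp map_sum_eq_id_iff using vertex_action_invol y_invol[OF that] by blast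
  show "g 0 \<circ> g 2 = g 2 \<circ> g 0"
    unfolding g_def map_sum.comp vertex_action_simps comp_id id_comp y_comm ..
  show "g 1 (Inl 0) = Inl 0" "g 2 (Inl 0) = Inl 0" "g 0 (Inl 0) \<noteq> Inl 0"
    using b by (simp_all add: g_def vertex_action_simps reflect_def)
  show "(g 0 \<circ> g 1) ^^ i = id" if "((g 0 \<circ> g 1) ^^ i) (Inl 0) = Inl 0" for i
  proof -
    have "int i mod int b = 0" using that unfolding g0_g1_funpow by (simp add: reflect_funpow)
    then show ?thesis unfolding g0_g1_order by (simp add: mod_eq_0_iff_dvd)
  qed
  show "g 1 \<noteq> id" "g 2 \<noteq> id" "g 1 \<noteq> g 2"
    unfolding g_def map_sum_eq_id_iff map_sum_eq_iff vertex_action_simps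
    using y_nontrivial reflect_0_neq_id[of b] by blast+
qed

sublocale P: regular_polyhedron_base r "Fl id" "\<lambda>i. T (g i)"
  by (rule regular_polyhedron_base_r)

lemma words_M: "g 0 \<in> M" "g 1 \<in> M" "g 2 \<in> M"
  by (rule g_M; simp)+

lemma s1_eq: "P.s1 = T (g 0 \<circ> g 1)" and s2_eq: "P.s2 = T (g 1 \<circ> g 2)"
  and a_eq: "P.T.a = T (g 1 \<circ> g 2 \<circ> g 1)"
  and conj_eq: "T (g 0) \<otimes>\<^bsub>aut_group r\<^esub> P.T.a \<otimes>\<^bsub>aut_group r\<^esub> T (g 0) = T (g 0 \<circ> (g 1 \<circ> g 2 \<circ> g 1) \<circ> g 0)"
  by (simp_all only: P.T.a_def T_comp M_comp words_M)

lemma extended_ord_s1: "extended_ord P.\<Gamma> P.s1 = enat b"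
  using extended_ord_T[OF M_comp[OF words_M(1,2)] g0_g1_order] b unfolding s1_eq by simp

lemma g1_g2_funpow: "(g 1 \<circ> g 2) ^^ i = map_sum (reflect b 0 ^^ i) ((y 1 \<circ> y 2) ^^ i)"
  unfolding g_def by (simp only: map_sum.comp map_sum_funpow vertex_action_simps comp_id)

lemma extended_ord_s2:
  assumes "\<And>n. reflect b 0 ^^ n = id \<and> (y 1 \<circ> y 2) ^^ n = id \<longleftrightarrow> k dvd n"
  shows "extended_ord P.\<Gamma> P.s2 = (if k = 0 then \<infinity> else enat k)"
  unfolding s2_eq
  by (rule extended_ord_T[OF M_comp[OF words_M(2,3)]]) (simp only: g1_g2_funpow map_sum_eq_id_iff assms)

lemma card_vertices:
  assumes "T (g 0 \<circ> (g 1 \<circ> g 2 \<circ> g 1) \<circ> g 0) \<in> generate P.\<Gamma> {T (g 2), P.T.a}"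
  shows "card (vertices r) = b"
proof -
  have "P.\<Gamma>.ord P.s1 = b" using extended_ord_s1 by (simp add: extended_ord_def split: if_splits)
  then show ?thesis using P.card_vertices_eq_ord assms b unfolding conj_eq by simp
qed

lemma card_facets:
  assumes "T (g 0 \<circ> (g 1 \<circ> g 2 \<circ> g 1) \<circ> g 0) \<in> generate P.\<Gamma> {T (g 2), P.T.a}"
    and "extended_ord P.\<Gamma> P.s2 = enat k"
  shows "card (facets r) = k"
proof -
  have "P.\<Gamma>.ord P.s2 = k" "k \<noteq> 0" using assms(2) by (simp_all add: extended_ord_def split: if_splits)
  then show ?thesis using P.card_facets_eq_ord assms(1) unfolding conj_eq by simp
qed

lemma conjugate_g2: "g 1 \<circ> g 2 \<circ> g 1 = map_sum id (y 1 \<circ> y 2 \<circ> y 1)"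
    "g 0 \<circ> (g 1 \<circ> g 2 \<circ> g 1) \<circ> g 0 = map_sum id (y 0 \<circ> (y 1 \<circ> y 2 \<circ> y 1) \<circ> y 0)"
    "g 2 = map_sum id (y 2)"
  unfolding g_def map_sum.comp vertex_action_simps comp_id id_comp reflect_involution by (rule refl)+

end

lemma hosohedron_exists:
  fixes q :: enat
  assumes "q \<ge> 2"
  shows "\<exists>P :: nat rel. is_hosohedron q P \<and> card (vertices P) = 2"
proof -
  \<comment> \<open>\<open>0\<close> stands for infinite order, in agreement with
    \<open>reflect 0\<close> acting on all integers.\<close>
  define n where "n = (case q of enat m \<Rightarrow> m | \<infinity> \<Rightarrow> 0)"
  have n: "n \<noteq> 1" "q = (if n = 0 then \<infinity> else enat n)"
    using assms by (auto simp: n_def numeral_eq_enat split: enat.splits)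
  \<comment> \<open>The factor \<open>Not\<close> keeps \<open>y 2\<close> nontrivial even for
    \<open>n = 2\<close>, where \<open>reflect 2 0\<close> is the identity; it cancels in
    \<open>y 1 \<circ> y 2\<close>.\<close>
  define y where "y i = (if i = 0 then id else map_prod (reflect n (if i = 1 then 1 else 0)) Not)" for i :: nat
  have y: "y 0 = id" "y 1 = map_prod (reflect n 1) Not" "y 2 = map_prod (reflect n 0) Not"
    by (simp_all add: y_def)
  have Not: "Not \<circ> Not = id" by auto
  have inv: "y i \<circ> y i = id" for i
    unfolding y_def by (simp only: map_prod.comp reflect_involution Not map_prod.id comp_id split: if_split) simp
  have "reflect n 1 0 \<noteq> reflect n 0 0" using n(1) by (cases "n = 0") (auto simp: reflect_def zmod_trivial_iff)
  then have "y 1 (0, False) \<noteq> y 2 (0, False)" unfolding y by simp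
  moreover have "y 1 (0, False) \<noteq> id (0, False)" "y 2 (0, False) \<noteq> id (0, False)" unfolding y by simp_all
  ultimately have neq: "y 1 \<noteq> y 2" "y 1 \<noteq> id" "y 2 \<noteq> id" by metis+
  interpret vertex_model 2 y
  proof
    show "y 0 \<circ> y 2 = y 2 \<circ> y 0" by (simp only: y(1) comp_id id_comp)
    show "(y 0 \<circ> y 1) ^^ 2 = id"
      using inv[of 1] by (simp only: y(1) id_comp numeral_2_eq_2 funpow.simps comp_id)
  qed (use inv neq in auto)
  have pow: "(y 1 \<circ> y 2) ^^ k = map_prod ((reflect n 1 \<circ> reflect n 0) ^^ k) id" for k
    by (induction k) (simp_all only: funpow.simps y map_prod.comp map_prod.id Not comp_id)
  have "map_prod h id = (id :: int \<times> bool \<Rightarrow> _) \<longleftrightarrow> h = id" for h :: "int \<Rightarrow> int"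
  proof
    assume eq: "map_prod h id = (id :: int \<times> bool \<Rightarrow> _)"
    have "h x = x" for x using fun_cong[OF eq, of "(x, True)"] by simp
    then show "h = id" by auto
  qed (simp add: map_prod.id)
  then have "reflect 2 0 ^^ k = id \<and> (y 1 \<circ> y 2) ^^ k = id \<longleftrightarrow> n dvd k" for k
    using reflect_funpow_eq_id[of 1 0 k n] by (simp only: pow reflect_2_0 id_funpow) simp
  then have ord: "extended_ord P.\<Gamma> P.s2 = q" using extended_ord_s2 n(2) by metis
  have "g 0 \<circ> (g 1 \<circ> g 2 \<circ> g 1) \<circ> g 0 = g 1 \<circ> g 2 \<circ> g 1"
    unfolding conjugate_g2(2) unfolding conjugate_g2(1) y(1) comp_id id_comp ..
  then have "T (g 0 \<circ> (g 1 \<circ> g 2 \<circ> g 1) \<circ> g 0) \<in> generate P.\<Gamma> {T (g 2), P.T.a}"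
    unfolding a_eq by (simp add: generate.incl)
  then have "card (vertices r) = 2" by (rule card_vertices)
  moreover have "is_hosohedron q r"
    using P.hosohedronI extended_ord_s1 unfolding ord by (simp add: numeral_eq_enat)
  ultimately show ?thesis by blast
qed

lemma hemi_octahedron_exists: "\<exists>P :: nat rel. is_hemi_octahedron P \<and> card (vertices P) = 3"
proof -
  \<comment> \<open>The action on the four facets of the hemi-octahedron: \<open>y 0\<close> and
    \<open>y 1\<close> fix the base facet \<open>3\<close>, and \<open>y 1 \<circ> y 2\<close> is a
    4-cycle.\<close>
  define y :: "nat \<Rightarrow> nat \<Rightarrow> nat" where "y i = (if i = 0 then transpose 0 1
    else if i = 1 then transpose 1 2 else transpose 0 1 \<circ> transpose 2 3)" for i
  have y: "y 0 = transpose 0 1" "y 1 = transpose 1 2" "y 2 = transpose 0 1 \<circ> transpose 2 3"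
    by (simp_all add: y_def)
  have val: "y 0 0 = 1" "y 0 1 = 0" "y 0 2 = 2" "y 0 3 = 3" "y 1 0 = 0" "y 1 1 = 2" "y 1 2 = 1" "y 1 3 = 3"
      "y 2 0 = 1" "y 2 1 = 0" "y 2 2 = 3" "y 2 3 = 2"
    by (simp_all add: y transpose_def)
  have fixed_pt: "y 0 x = x" "y 1 x = x" "y 2 x = x" if "x > 3" for x
    using that by (simp_all add: y transpose_def)
  have ext4: "f = h" if "f 0 = h 0" "f 1 = h 1" "f 2 = h 2" "f 3 = h 3" "\<And>x. x > 3 \<Longrightarrow> f x = h x"
    for f h :: "nat \<Rightarrow> nat"
  proof
    fix x :: nat
    have "x = 0 \<or> x = 1 \<or> x = 2 \<or> x = 3 \<or> x > 3" by linarith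
    then show "f x = h x" using that by blast
  qed
  have four: "(4::nat) = Suc (Suc (Suc (Suc 0)))" by simp
  have pow: "(f ^^ 3) x = f (f (f x))" "(f ^^ 4) x = f (f (f (f x)))" for f :: "nat \<Rightarrow> nat" and x
    unfolding numeral_3_eq_3 four by (simp_all only: funpow.simps comp_apply id_apply)
  interpret vertex_model 3 y
  proof
    show "y i \<circ> y i = id" if "i < 3" for i
    proof -
      have "i = 0 \<or> i = 1 \<or> i = 2" using that by linarith
      then show ?thesis by (elim disjE; intro ext4; simp add: val fixed_pt)
    qed
    show "y 0 \<circ> y 2 = y 2 \<circ> y 0" by (rule ext4) (simp_all add: val fixed_pt)
    show "(y 0 \<circ> y 1) ^^ 3 = id" by (rule ext4) (simp_all add: val fixed_pt pow)
    have "y 2 0 \<noteq> id 0" by (simp add: val)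
    then show "y 2 \<noteq> id" by metis
  qed simp_all
  have f4: "(y 1 \<circ> y 2) ^^ 4 = id"
    by (rule ext4) (simp_all add: val fixed_pt pow)
  have orbit: "(y 1 \<circ> y 2) 0 = 2" "(y 1 \<circ> y 2) 2 = 3" "(y 1 \<circ> y 2) 3 = 1"
    by (simp_all add: val)
  have "(y 1 \<circ> y 2) ^^ n = id \<longleftrightarrow> 4 dvd n" for n
  proof
    assume "(y 1 \<circ> y 2) ^^ n = id"
    then have 0: "((y 1 \<circ> y 2) ^^ (n mod 4)) 0 = 0"
      using funpow_mod_eq[of 4 "y 1 \<circ> y 2" 0 n] f4 by simp
    have pows: "((y 1 \<circ> y 2) ^^ Suc 0) 0 = 2" "((y 1 \<circ> y 2) ^^ Suc (Suc 0)) 0 = 3" "((y 1 \<circ> y 2) ^^ Suc (Suc (Suc 0))) 0 = 1"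
      using orbit by (simp_all only: funpow.simps comp_apply id_apply)
    have "n mod 4 < 4" by simp
    then consider "n mod 4 = 0" | "n mod 4 = Suc 0" | "n mod 4 = Suc (Suc 0)" | "n mod 4 = Suc (Suc (Suc 0))"
      by linarith
    then show "4 dvd n"
    proof cases
      case 1
      then show ?thesis by (rule iffD1[OF mod_eq_0_iff_dvd])
    next
      case 2
      have "(2::nat) = 0" using trans[OF sym[OF pows(1)] 0[unfolded 2]] .
      then show ?thesis by simp
    next
      case 3
      have "(3::nat) = 0" using trans[OF sym[OF pows(2)] 0[unfolded 3]] .
      then show ?thesis by simp
    next
      case 4
      have "(1::nat) = 0" using trans[OF sym[OF pows(3)] 0[unfolded 4]] .
      then show ?thesis by simp
    qed
  next
    assume "4 dvd n"
    then obtain k where "n = 4 * k" by (elim dvdE)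
    then have "(y 1 \<circ> y 2) ^^ n = ((y 1 \<circ> y 2) ^^ 4) ^^ k" by (simp only: funpow_mult mult.commute)
    then show "(y 1 \<circ> y 2) ^^ n = id" by (simp only: f4 id_funpow)
  qed
  moreover have "reflect 3 0 ^^ n = id" if "4 dvd n" for n
  proof -
    have "even n" using that by presburger
    then show ?thesis using involution_funpow[OF reflect_involution[of 3 0], of n] by simp
  qed
  ultimately have "reflect 3 0 ^^ n = id \<and> (y 1 \<circ> y 2) ^^ n = id \<longleftrightarrow> 4 dvd n" for n by blast
  then have ord: "extended_ord P.\<Gamma> P.s2 = enat 4" using extended_ord_s2[of 4] by simp
  have "g 0 \<circ> (g 1 \<circ> g 2 \<circ> g 1) \<circ> g 0 = g 1 \<circ> g 2 \<circ> g 1 \<circ> g 2"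
    unfolding conjugate_g2(2) unfolding conjugate_g2(1) unfolding conjugate_g2(3) map_sum.comp map_sum_eq_iff
    by (intro conjI refl ext4) (simp_all add: val fixed_pt)
  then have rel: "T (g 0 \<circ> (g 1 \<circ> g 2 \<circ> g 1) \<circ> g 0) = P.T.a \<otimes>\<^bsub>P.\<Gamma>\<^esub> T (g 2)"
    unfolding a_eq by (simp only: T_comp M_comp words_M)
  then have "T (g 0 \<circ> (g 1 \<circ> g 2 \<circ> g 1) \<circ> g 0) \<in> generate P.\<Gamma> {T (g 2), P.T.a}"
    by (simp only: generate.eng generate.incl insert_iff simp_thms)
  then have "card (vertices r) = 3" by (rule card_vertices)
  moreover have "is_hemi_octahedron r"
    using P.hemi_octahedronI rel extended_ord_s1 ord unfolding conj_eq by (simp add: numeral_eq_enat)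
  ultimately show ?thesis by blast
qed

lemma dihedron_exists:
  assumes "odd b" "b \<ge> 3"
  shows "\<exists>P :: nat rel. is_dihedron b P \<and> card (vertices P) = b \<and> card (facets P) = 2"
proof -
  \<comment> \<open>\<open>Not\<close> exchanges the two facets, which the other generators
    fix.\<close>
  define y :: "nat \<Rightarrow> bool \<Rightarrow> bool" where "y i = (if i < 2 then id else Not)" for i
  have y: "y 0 = id" "y 1 = id" "y 2 = Not" by (simp_all add: y_def)
  have Not: "Not \<circ> Not = id" "Not \<noteq> id" by (auto simp: fun_eq_iff)
  interpret vertex_model b y
  proof
    show "y i \<circ> y i = id" for i unfolding y_def by (simp only: Not comp_id split: if_split) simp
    show "y 0 \<circ> y 2 = y 2 \<circ> y 0" unfolding y comp_id id_comp ..
    show "(y 0 \<circ> y 1) ^^ b = id" unfolding y comp_id id_funpow ..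
  qed (use assms Not y in simp_all)
  have "reflect b 0 ^^ n = id \<and> (y 1 \<circ> y 2) ^^ n = id \<longleftrightarrow> 2 dvd n" for n
    using involution_funpow[OF reflect_involution[of b 0], of n] involution_funpow[OF Not(1), of n] Not(2)
    unfolding y id_comp by (cases "even n") simp_all
  then have ord: "extended_ord P.\<Gamma> P.s2 = enat 2" using extended_ord_s2[of 2] by simp
  have "g 0 \<circ> (g 1 \<circ> g 2 \<circ> g 1) \<circ> g 0 = g 2"
    unfolding conjugate_g2(2) unfolding conjugate_g2(3) map_sum_eq_iff y comp_id id_comp by (intro conjI refl)
  then have "T (g 0 \<circ> (g 1 \<circ> g 2 \<circ> g 1) \<circ> g 0) \<in> generate P.\<Gamma> {T (g 2), P.T.a}"
    by (simp only: generate.incl insert_iff simp_thms)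
  then have "card (vertices r) = b" "card (facets r) = 2" using card_vertices card_facets ord by blast+
  moreover have "is_dihedron b r"
    using P.dihedronI[OF extended_ord_s1] ord by (simp add: numeral_eq_enat)
  ultimately show ?thesis by blast
qed

lemma flat_b_2b_exists:
  assumes "odd b" "b \<ge> 3"
  shows "\<exists>P :: nat rel. is_flat_b_2b b P \<and> card (vertices P) = b \<and> card (facets P) = 2 * b"
proof -
  \<comment> \<open>A second polygon on which \<open>y 0\<close> and \<open>y 2\<close> coincide, so
    both conjugate \<open>a\<close> in the same way; on the left summand \<open>a\<close> is
    trivial. The order \<open>2 * b\<close> arises from a reflection on the left and a rotation of
    odd order \<open>b\<close> on the right.\<close>
  define y :: "nat \<Rightarrow> int \<Rightarrow> int" where "y i = (if i = 1 then reflect b 0 else reflect b 1)" for i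
  have y: "y 0 = reflect b 1" "y 1 = reflect b 0" "y 2 = reflect b 1" by (simp_all add: y_def)
  have "reflect b 1 0 \<noteq> id 0" using assms(2) by (simp add: reflect_def)
  then have neq: "reflect b 1 \<noteq> id" by metis
  interpret vertex_model b y
  proof
    show "y i \<circ> y i = id" for i unfolding y_def by (simp only: reflect_involution if_cancel split: if_split) simp
    show "y 0 \<circ> y 2 = y 2 \<circ> y 0" unfolding y ..
    show "(y 0 \<circ> y 1) ^^ b = id" unfolding y using reflect_funpow_eq_id[of 1 0 b b] by simp
  qed (use assms neq y in simp_all)
  have "reflect b 0 ^^ n = id \<longleftrightarrow> even n" for n
    using involution_funpow[OF reflect_involution[of b 0], of n] reflect_0_neq_id[of b] assms(2) by simp
  moreover have "(y 1 \<circ> y 2) ^^ n = id \<longleftrightarrow> b dvd n" for n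
    unfolding y using reflect_funpow_eq_id[of 0 1 n b] by simp
  moreover have "even n \<and> b dvd n \<longleftrightarrow> 2 * b dvd n" for n
    using assms(1) by (metis coprime_left_2_iff_odd divides_mult dvd_mult_left dvd_mult_right)
  ultimately have "reflect b 0 ^^ n = id \<and> (y 1 \<circ> y 2) ^^ n = id \<longleftrightarrow> 2 * b dvd n" for n by simp
  then have ord: "extended_ord P.\<Gamma> P.s2 = enat (2 * b)" using extended_ord_s2[of "2 * b"] assms(2) by simp
  have "g 0 \<circ> (g 1 \<circ> g 2 \<circ> g 1) \<circ> g 0 = g 2 \<circ> (g 1 \<circ> g 2 \<circ> g 1) \<circ> g 2"
    unfolding conjugate_g2(2) unfolding conjugate_g2(1) unfolding conjugate_g2(3) map_sum.comp map_sum_eq_iff y comp_id id_comp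
    by (intro conjI refl)
  then have rel: "T (g 0 \<circ> (g 1 \<circ> g 2 \<circ> g 1) \<circ> g 0) = T (g 2) \<otimes>\<^bsub>P.\<Gamma>\<^esub> P.T.a \<otimes>\<^bsub>P.\<Gamma>\<^esub> T (g 2)"
    unfolding a_eq by (simp only: T_comp M_comp words_M)
  then have "T (g 0 \<circ> (g 1 \<circ> g 2 \<circ> g 1) \<circ> g 0) \<in> generate P.\<Gamma> {T (g 2), P.T.a}"
    by (simp only: generate.eng generate.incl insert_iff simp_thms)
  then have "card (vertices r) = b" "card (facets r) = 2 * b" using card_vertices card_facets ord by blast+
  moreover have "is_flat_b_2b b r"
    using P.flat_b_2bI[OF extended_ord_s1 ord] rel unfolding conj_eq by simp
  ultimately show ?thesis by blast
qed

section \<open>The number of facets as an isomorphism invariant\<close>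

lemma isomorphism_flags:
  assumes f: "bij_betw f (Field r) (Field s)"
    and iso: "\<And>x y. x \<in> Field r \<Longrightarrow> y \<in> Field r \<Longrightarrow> (x, y) \<in> r \<longleftrightarrow> (f x, f y) \<in> s"
    and \<Phi>: "\<Phi> \<in> flags r"
  shows "f ` \<Phi> \<in> flags s"
proof -
  define h where "h = inv_into (Field r) f"
  have h: "h y \<in> Field r" "f (h y) = y" if "y \<in> Field s" for y
    using that f by (auto simp: h_def bij_betw_def inv_into_into f_inv_into_f)
  have hf: "h (f x) = x" if "x \<in> Field r" for x using that f by (simp add: h_def bij_betw_def)
  have chain: "f ` C \<in> Chains s" if "C \<in> Chains r" for C
  proof -
    have "C \<subseteq> Field r" using that by (fastforce simp: Chains_def Field_def)
    then show ?thesis using that iso by (auto simp: Chains_def) (meson subsetD)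
  qed
  have chain': "h ` C \<in> Chains r" if "C \<in> Chains s" for C
  proof -
    have "C \<subseteq> Field s" using that by (fastforce simp: Chains_def Field_def)
    then have "(h x, h y) \<in> r \<longleftrightarrow> (x, y) \<in> s" if "x \<in> C" "y \<in> C" for x y
      using iso[of "h x" "h y"] h that by (metis subsetD)
    then show ?thesis using that by (auto simp: Chains_def)
  qed
  have \<Phi>F: "\<Phi> \<subseteq> Field r" using \<Phi> by (fastforce simp: flags_def Chains_def Field_def)
  have "\<Psi> = f ` \<Phi>" if \<Psi>: "\<Psi> \<in> Chains s" "f ` \<Phi> \<subseteq> \<Psi>" for \<Psi>
  proof -
    have \<Psi>F: "\<Psi> \<subseteq> Field s" using \<Psi>(1) by (fastforce simp: Chains_def Field_def)
    have "\<Phi> \<subseteq> h ` \<Psi>"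
    proof
      fix x assume "x \<in> \<Phi>"
      then have "x = h (f x)" "f x \<in> \<Psi>" using hf \<Phi>F \<Psi>(2) by auto
      then show "x \<in> h ` \<Psi>" by (rule image_eqI)
    qed
    then have "h ` \<Psi> = \<Phi>" using \<Phi> chain'[OF \<Psi>(1)] by (simp add: flags_def)
    then have "f ` \<Phi> = f ` h ` \<Psi>" by simp
    also have "\<dots> = \<Psi>" using h(2) \<Psi>F by (force simp: image_image)
    finally show ?thesis ..
  qed
  then show ?thesis using chain \<Phi> by (simp add: flags_def)
qed

lemma isomorphism_faces_of_rank:
  assumes f: "bij_betw f (Field r) (Field s)"
    and iso: "\<And>x y. x \<in> Field r \<Longrightarrow> y \<in> Field r \<Longrightarrow> (x, y) \<in> r \<longleftrightarrow> (f x, f y) \<in> s"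
    and x: "x \<in> faces_of_rank r i"
  shows "f x \<in> faces_of_rank s i"
proof -
  obtain \<Phi> where \<Phi>: "\<Phi> \<in> flags r" "x \<in> \<Phi>" "int (card {y \<in> \<Phi>. (y, x) \<in> r}) = i + 2"
    using x unfolding faces_of_rank_def by blast
  have F: "\<Phi> \<subseteq> Field r" using \<Phi>(1) by (fastforce simp: flags_def Chains_def Field_def)
  have inj: "inj_on f (Field r)" using f by (simp add: bij_betw_def)
  have "{y \<in> f ` \<Phi>. (y, f x) \<in> s} = f ` {y \<in> \<Phi>. (y, x) \<in> r}"
    using iso F \<Phi>(2) by auto
  then have "card {y \<in> f ` \<Phi>. (y, f x) \<in> s} = card {y \<in> \<Phi>. (y, x) \<in> r}"
    using card_image[OF inj_on_subset[OF inj, of "{y \<in> \<Phi>. (y, x) \<in> r}"]] F by auto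
  then show ?thesis
    unfolding faces_of_rank_def using isomorphism_flags[OF f iso \<Phi>(1)] \<Phi>(2,3) by auto
qed

lemma poset_iso_card_facets:
  assumes "poset_iso r s"
  shows "card (facets r) = card (facets s)"
proof -
  obtain f where f: "bij_betw f (Field r) (Field s)"
    and iso: "\<And>x y. x \<in> Field r \<Longrightarrow> y \<in> Field r \<Longrightarrow> (x, y) \<in> r \<longleftrightarrow> (f x, f y) \<in> s"
    using assms unfolding poset_iso_def by blast
  define h where "h = inv_into (Field r) f"
  have h: "bij_betw h (Field s) (Field r)" unfolding h_def by (rule bij_betw_inv_into[OF f])
  have fh: "f (h y) = y" if "y \<in> Field s" for y using that f by (simp add: h_def bij_betw_def f_inv_into_f)
  have hf: "h (f x) = x" if "x \<in> Field r" for x using that f by (simp add: h_def bij_betw_def)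
  have iso': "(x, y) \<in> s \<longleftrightarrow> (h x, h y) \<in> r" if "x \<in> Field s" "y \<in> Field s" for x y
    using iso[of "h x" "h y"] fh that bij_betwE[OF h] by auto
  have F: "facets t \<subseteq> Field t" for t :: "'c rel"
    by (fastforce simp: facets_def faces_of_rank_def flags_def Chains_def Field_def)
  have "bij_betw f (facets r) (facets s)"
    by (rule bij_betw_byWitness[of _ h])
      (use F[of r] F[of s] hf fh isomorphism_faces_of_rank[OF f iso] isomorphism_faces_of_rank[OF h iso'] in
        \<open>auto simp: facets_def\<close>)
  then show ?thesis by (rule bij_betw_same_card)
qed

section \<open>Uniqueness within each family\<close>

lemma hemi_octahedron_relator_closed: "hemi_octahedron_relator \<in> carrier (coxeter_group 3 4)"
proof -
  interpret G: involution_triple "coxeter_group 3 4" "coxeter_gen 3 4 0" "coxeter_gen 3 4 1" "coxeter_gen 3 4 2"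
    by (rule involution_triple_coxeter_system[OF coxeter_system_coxeter_group])
  show ?thesis by (simp add: hemi_octahedron_relator_def Let_def)
qed

lemma flat_b_2b_relator_closed: "flat_b_2b_relator b \<in> carrier (coxeter_group (enat b) (enat (2 * b)))"
proof -
  let ?g = "coxeter_gen (enat b) (enat (2 * b))"
  interpret G: involution_triple "coxeter_group (enat b) (enat (2 * b))" "?g 0" "?g 1" "?g 2"
    by (rule involution_triple_coxeter_system[OF coxeter_system_coxeter_group])
  show ?thesis by (simp add: flat_b_2b_relator_def Let_def)
qed

lemma hosohedron_unique: "is_hosohedron q Q \<Longrightarrow> is_hosohedron q P \<Longrightarrow> poset_iso Q P"
  unfolding is_hosohedron_def
  by (erule (1) polyhedron_with_group_unique) (rule coxeter_systemD(1,2)[OF coxeter_system_coxeter_group]; assumption?)+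

lemma dihedron_unique: "is_dihedron b Q \<Longrightarrow> is_dihedron b P \<Longrightarrow> poset_iso Q P"
  unfolding is_dihedron_def
  by (erule (1) polyhedron_with_group_unique) (rule coxeter_systemD(1,2)[OF coxeter_system_coxeter_group]; assumption?)+

lemma coxeter_quotient_unique:
  assumes "s \<in> carrier (coxeter_group p q)"
    and "polyhedron_with_group Q p q (coxeter_quotient p q {s}) (coxeter_quotient_gen p q {s})"
    and "polyhedron_with_group P p q (coxeter_quotient p q {s}) (coxeter_quotient_gen p q {s})"
  shows "poset_iso Q P"
proof -
  have cs: "coxeter_system (coxeter_quotient p q {s}) (coxeter_quotient_gen p q {s}) p q"
    using assms(1) by (intro coxeter_system_coxeter_quotient(1)) simp
  show ?thesis by (rule polyhedron_with_group_unique[OF assms(2,3) coxeter_systemD(1,2)[OF cs]])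
qed

lemma hemi_octahedron_unique: "is_hemi_octahedron Q \<Longrightarrow> is_hemi_octahedron P \<Longrightarrow> poset_iso Q P"
  unfolding is_hemi_octahedron_def by (rule coxeter_quotient_unique[OF hemi_octahedron_relator_closed])

lemma flat_b_2b_unique: "is_flat_b_2b b Q \<Longrightarrow> is_flat_b_2b b P \<Longrightarrow> poset_iso Q P"
  unfolding is_flat_b_2b_def by (rule coxeter_quotient_unique[OF flat_b_2b_relator_closed])

text \<open>Existence is stated over \<open>nat\<close>, since a given type of faces may be too
  small to carry any polyhedron; the classification ranges over faces of arbitrary type.\<close>

theorem theorem4p3:
  fixes b :: nat
  assumes "prime b"
  shows
    "(\<forall>P :: 'a rel. regular_polyhedron P \<and> card (vertices P) = b \<longrightarrow>
        flat P \<and>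
        (b = 2 \<and> (\<exists>q \<ge> 2. is_hosohedron q P) \<or>
         b = 3 \<and> is_hemi_octahedron P \<or>
         odd b \<and> is_dihedron b P \<or>
         odd b \<and> is_flat_b_2b b P)) \<and>
     (b = 2 \<longrightarrow> (\<forall>q \<ge> 2. \<exists>P :: nat rel. is_hosohedron q P \<and> card (vertices P) = b \<and>
        (\<forall>Q :: 'a rel. is_hosohedron q Q \<longrightarrow> poset_iso Q P))) \<and>
     (b = 3 \<longrightarrow> (\<exists>P :: nat rel. is_hemi_octahedron P \<and> card (vertices P) = b \<and>
        (\<forall>Q :: 'a rel. is_hemi_octahedron Q \<longrightarrow> poset_iso Q P))) \<and>
     (odd b \<longrightarrow> (\<exists>P :: nat rel. is_dihedron b P \<and> card (vertices P) = b \<and>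
        (\<forall>Q :: 'a rel. is_dihedron b Q \<longrightarrow> poset_iso Q P))) \<and>
     (odd b \<longrightarrow> (\<exists>P :: nat rel. is_flat_b_2b b P \<and> card (vertices P) = b \<and>
        (\<forall>Q :: 'a rel. is_flat_b_2b b Q \<longrightarrow> poset_iso Q P))) \<and>
     (b \<ge> 5 \<longrightarrow> (\<exists>(P :: nat rel) (Q :: nat rel).
        regular_polyhedron P \<and> card (vertices P) = b \<and>
        regular_polyhedron Q \<and> card (vertices Q) = b \<and>
        \<not> poset_iso P Q \<and>
        (\<forall>R :: 'a rel. regular_polyhedron R \<and> card (vertices R) = b \<longrightarrow>
           poset_iso R P \<or> poset_iso R Q)))"
proof -
  have cases: "flat P \<and> (b = 2 \<and> (\<exists>q \<ge> 2. is_hosohedron q P) \<or> b = 3 \<and> is_hemi_octahedron P \<or>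
      odd b \<and> is_dihedron b P \<or> odd b \<and> is_flat_b_2b b P)"
    if P: "regular_polyhedron P" "card (vertices P) = b" for P :: "'a rel"
  proof -
    obtain \<Phi> \<rho> where "regular_polyhedron_base P \<Phi> \<rho>" by (rule regular_polyhedron_has_base[OF P(1)])
    from regular_polyhedron_base.classification[OF this assms P(2)] show ?thesis .
  qed
  have ge3: "b \<ge> 3" if "odd b" using that prime_ge_2_nat[OF assms] by (cases "b = 2") auto
  have odd: "odd b" if "b \<ge> 5" using that primes_dvd_imp_eq[OF two_is_prime_nat assms] by auto
  obtain D :: "nat rel" where D: "is_dihedron b D" "card (vertices D) = b" "card (facets D) = 2" if "odd b"
    using dihedron_exists ge3 by metis
  obtain E :: "nat rel" where E: "is_flat_b_2b b E" "card (vertices E) = b" "card (facets E) = 2 * b" if "odd b"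
    using flat_b_2b_exists ge3 by metis
  show ?thesis
  proof (intro conjI allI impI)
    fix P :: "'a rel" assume "regular_polyhedron P \<and> card (vertices P) = b"
    then show "flat P" "b = 2 \<and> (\<exists>q \<ge> 2. is_hosohedron q P) \<or> b = 3 \<and> is_hemi_octahedron P \<or>
      odd b \<and> is_dihedron b P \<or> odd b \<and> is_flat_b_2b b P" using cases by blast+
  next
    fix q :: enat assume b: "b = 2" and q: "q \<ge> 2"
    obtain P :: "nat rel" where "is_hosohedron q P" "card (vertices P) = 2" using hosohedron_exists[OF q] by blast
    then show "\<exists>P :: nat rel. is_hosohedron q P \<and> card (vertices P) = b \<and>
        (\<forall>Q :: 'a rel. is_hosohedron q Q \<longrightarrow> poset_iso Q P)" using hosohedron_unique b by blast
  next
    assume b: "b = 3"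
    obtain P :: "nat rel" where "is_hemi_octahedron P" "card (vertices P) = 3" using hemi_octahedron_exists by blast
    then show "\<exists>P :: nat rel. is_hemi_octahedron P \<and> card (vertices P) = b \<and>
        (\<forall>Q :: 'a rel. is_hemi_octahedron Q \<longrightarrow> poset_iso Q P)" using hemi_octahedron_unique b by blast
  next
    assume "odd b"
    then show "\<exists>P :: nat rel. is_dihedron b P \<and> card (vertices P) = b \<and>
        (\<forall>Q :: 'a rel. is_dihedron b Q \<longrightarrow> poset_iso Q P)" using D dihedron_unique by blast
  next
    assume "odd b"
    then show "\<exists>P :: nat rel. is_flat_b_2b b P \<and> card (vertices P) = b \<and>
        (\<forall>Q :: 'a rel. is_flat_b_2b b Q \<longrightarrow> poset_iso Q P)" using E flat_b_2b_unique by blast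
  next
    assume b: "b \<ge> 5"
    note D = D[OF odd[OF b]] and E = E[OF odd[OF b]]
    have "regular_polyhedron D" "regular_polyhedron E"
      using D(1) E(1) by (simp_all add: is_dihedron_def is_flat_b_2b_def polyhedron_with_group_def)
    \<comment> \<open>The facet counts \<open>2\<close> and \<open>2 * b\<close> differ.\<close>
    moreover have "\<not> poset_iso D E" using poset_iso_card_facets[of D E] D(3) E(3) b by auto
    moreover have "poset_iso R D \<or> poset_iso R E" if R: "regular_polyhedron R \<and> card (vertices R) = b" for R :: "'a rel"
    proof -
      have "is_dihedron b R \<or> is_flat_b_2b b R" using cases[of R] R b by auto
      then show ?thesis using dihedron_unique[OF _ D(1)] flat_b_2b_unique[OF _ E(1)] by blast
    qed
    ultimately show "\<exists>(P :: nat rel) (Q :: nat rel).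
        regular_polyhedron P \<and> card (vertices P) = b \<and> regular_polyhedron Q \<and> card (vertices Q) = b \<and>
        \<not> poset_iso P Q \<and> (\<forall>R :: 'a rel. regular_polyhedron R \<and> card (vertices R) = b \<longrightarrow>
           poset_iso R P \<or> poset_iso R Q)" using D(2) E(2) by blast
  qed
qed

end
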